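(* Let $n\ge 5$. Let $F_p$, $p=(p_1,p_2)$ in a neighbourhood of $0\in\mathbb R^2$, be a family of real-analytic area-preserving and orientation-preserving maps of a neighbourhood of the origin in $\mathbb R^2$, depending analytically on $p$, such that $F_p(0)=0$ and $DF_p(0)=R_{\alpha_p}$ for all small $p$, where $\alpha_p$ is an analytic function of $p$ and $\lambda_0=e^{i\alpha_0}$ satisfies $\lambda_0^n=1$, $\lambda_0^k\ne1$ for $1\le k<n$. Suppose that in the complex coordinate $z=x+iy$ $$f_p=a_p(z\bar z)\,z+b_p(z\bar z)\,\bar z^{\,n-1}+O(|z|^{n+1}),$$ where $a_p,b_p$ are polynomials in $z\bar z$ with coefficients depending analytically on $p$ and $a_p(0)=\lambda_p=e^{i\alpha_p}$. Put $$\delta=\alpha_0-\alpha_p,\qquad \nu=\frac{i\,a_p'(0)}{\lambda_p}$$ (these are real). Suppose that $a_0'(0)=0$, $a_0''(0)\neq0$, $b_0(0)\ne 0$ (the values at $p=0$), and that $F_p$ is a generic unfolding of $F_0$, i.e. the Jacobian of the map $(p_1,p_2)\mapsto(\delta,\nu)$ does not vanish at $p=0$, and use $p=(\delta,\nu)$ as the parameter. Then there is a formal canonical change of variables which conjugates $F_p$ with $R_{\alpha_0}\circ\Phi^1_{H_p}$, where the formal Hamiltonian $H_p$ has the form $$H_{\delta,\nu}(I,\varphi)=\delta I+\nu I^2+I^3A(I;\delta,\nu)+I^{n/2}B(I;\delta,\nu)\cos n\varphi,$$ where $$A(I;\delta,\nu)=\sum_{k,m,j\ge0}a_{kmj}I^k\delta^m\nu^j,\qquad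 B(I;\delta,\nu)=\sum_{k,m,j\ge0}b_{kmj}I^k\delta^m\nu^j$$ are formal series with real coefficients, and - if $n=5$, then $a_{kmj}=0$ for $k\equiv1\pmod5$ and $b_{kmj}=0$ for $k\equiv4\pmod5$; - if $n\ge6$, then $b_{kmj}=0$ for $k\equiv2\pmod3$. Moreover, the coefficients of the series $A(I;\delta,\nu)$ and $B(I;\delta,\nu)$ are defined uniquely, provided the leading order is normalised to ensure $b_{000}>0$.
   Context: $R_\alpha$ is the rotation of the plane by the angle $\alpha$, $R_\alpha=\begin{pmatrix}\cos\alpha&-\sin\alpha\\ \sin\alpha&\cos\alpha\end{pmatrix}$. The plane with coordinates $(x,y)$ is identified with the complex plane via $z=x+iy$, $\bar z=x-iy$. Symplectic polar coordinates $(I,\varphi)$ are defined by $x=\sqrt{2I}\cos\varphi$, $y=\sqrt{2I}\sin\varphi$, so $z=\sqrt{2I}e^{i\varphi}$, $z\bar z=2I$, and $I^{n/2}\cos n\varphi=2^{-n/2}\,\mathrm{Re}(z^n)$. Thus a Hamiltonian of the stated form is a real formal power series in $(x,y,\delta,\nu)$. For a formal power series $H$, $\Phi^t_H$ is the formal Hamiltonian flow generated by $H$ with respect to the area form in $(x,y)$ (parameters being constant), with the convention $\dot x=\partial H/\partial y$, $\dot y=-\partial H/\partial x$; $\Phi_H^1$ is the time-one map. All maps, changes of variables and Hamiltonians in the conclusion are formal power series in $(z,\bar z,\delta,\nu)$ (equivalently $(x,y,\delta,\nu)$). A formal canonical change of variables is an invertible change of $(x,y)$, given by real formal power series in $(x,y,\delta,\nu)$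 that vanish at $x=y=0$ and whose Jacobian determinant with respect to $(x,y)$ is identically $1$. Conjugation is understood at the level of formal Taylor series in $(x,y,\delta,\nu)$. Any such family can be brought to the displayed form of $f_p$ for small $p$ by an analytic area-preserving change of variables; the theorem assumes that this has been done. The parameters $\delta,\nu$ do not depend on the choice of that change. *)

theory Defs
  imports
    "HOL-Analysis.Analysis"
    "HOL-Computational_Algebra.Computational_Algebra"
    "HOL-Library.Landau_Symbols"
begin

unbundle no vec_syntax
unbundle fps_syntax

text \<open>
  Multivariate formal power series are nested univariate ones. A \<open>par_series\<close> is an element of
  \<open>\<real>[[\<delta>,\<nu>]]\<close>; \<open>T $ m $ l\<close> is the coefficient of \<open>\<delta>^m \<nu>^l\<close>. A \<open>plane_series\<close> is an element of
  \<open>\<real>[[\<delta>,\<nu>]][[x,y]] = \<real>[[x,y,\<delta>,\<nu>]]\<close>; \<open>T $ i $ j $ m $ l\<close> is the coefficient of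
  \<open>x^i y^j \<delta>^m \<nu>^l\<close>. The same types serve for series in the original parameters \<open>(p1,p2)\<close>.
\<close>

type_synonym par_series = "real fps fps"
type_synonym plane_series = "par_series fps fps"

text \<open>A pair \<open>(X, Y)\<close> is the formal family of maps \<open>(x,y) \<mapsto> (X,Y)\<close> of the plane.\<close>
type_synonym formal_map = "plane_series \<times> plane_series"

definition par_const :: "par_series \<Rightarrow> plane_series" where
  "par_const c = fps_const (fps_const c)"

definition real_const :: "real \<Rightarrow> plane_series" where
  "real_const c = par_const (fps_const (fps_const c))"

definition x_var :: plane_series where "x_var = fps_X"
definition y_var :: plane_series where "y_var = fps_const fps_X"
definition delta_var :: plane_series where "delta_var = par_const fps_X"
definition nu_var :: plane_series where "nu_var = par_const (fps_const fps_X)"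

definition d_x :: "plane_series \<Rightarrow> plane_series" where
  "d_x G = fps_deriv G"

definition d_y :: "plane_series \<Rightarrow> plane_series" where
  "d_y G = Abs_fps (\<lambda>i. fps_deriv (G $ i))"

text \<open>
  Substitution \<open>G(X,Y)\<close> into a series \<open>G\<close> in two variables. It is meaningful only if \<open>X\<close> and \<open>Y\<close>
  have zero constant term; then \<open>X^i Y^j\<close> has no terms of degree below \<open>i + j\<close>, so the finite sum
  below is the full coefficient of the substituted series.
\<close>
definition subst2 ::
  "'a::comm_ring_1 fps fps \<Rightarrow> 'a fps fps \<Rightarrow> 'a fps fps \<Rightarrow> 'a fps fps" where
  "subst2 G X Y = Abs_fps (\<lambda>a. Abs_fps (\<lambda>b.
     \<Sum>i\<le>a + b. \<Sum>j\<le>a + b. G $ i $ j * (X ^ i * Y ^ j) $ a $ b))"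

definition vanishes_at_origin :: "formal_map \<Rightarrow> bool" where
  "vanishes_at_origin f \<longleftrightarrow> fst f $ 0 $ 0 = 0 \<and> snd f $ 0 $ 0 = 0"

definition fid :: formal_map where
  "fid = (x_var, y_var)"

text \<open>\<open>f \<circ> g\<close>, where the parameters \<open>\<delta>,\<nu>\<close> are left fixed.\<close>
definition fcompose :: "formal_map \<Rightarrow> formal_map \<Rightarrow> formal_map" where
  "fcompose f g = (subst2 (fst f) (fst g) (snd g), subst2 (snd f) (fst g) (snd g))"

definition formal_rotation :: "real \<Rightarrow> formal_map" where
  "formal_rotation \<alpha> =
     (real_const (cos \<alpha>) * x_var - real_const (sin \<alpha>) * y_var,
      real_const (sin \<alpha>) * x_var + real_const (cos \<alpha>) * y_var)"

definition formal_jacobian :: "formal_map \<Rightarrow> plane_series" where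
  "formal_jacobian f = d_x (fst f) * d_y (snd f) - d_y (fst f) * d_x (snd f)"

definition formal_invertible :: "formal_map \<Rightarrow> bool" where
  "formal_invertible f \<longleftrightarrow>
     (\<exists>g. vanishes_at_origin g \<and> fcompose f g = fid \<and> fcompose g f = fid)"

definition formal_canonical :: "formal_map \<Rightarrow> bool" where
  "formal_canonical f \<longleftrightarrow>
     vanishes_at_origin f \<and> formal_invertible f \<and> formal_jacobian f = 1"

text \<open>
  \<open>\<Phi> t\<close> is the formal Hamiltonian flow of \<open>H\<close>: the equations \<open>x' = \<partial>H/\<partial>y\<close>, \<open>y' = - \<partial>H/\<partial>x\<close> hold
  for every coefficient of \<open>\<Phi> t\<close> as a real function of the time \<open>t\<close>. The origin is assumed to
  be an equilibrium, so that composition with \<open>\<Phi> t\<close> makes sense.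
\<close>
definition formal_ham_flow :: "plane_series \<Rightarrow> (real \<Rightarrow> formal_map) \<Rightarrow> bool" where
  "formal_ham_flow H \<Phi> \<longleftrightarrow>
     \<Phi> 0 = fid \<and>
     (\<forall>t. vanishes_at_origin (\<Phi> t)) \<and>
     (\<forall>t i j m l.
        ((\<lambda>s. fst (\<Phi> s) $ i $ j $ m $ l) has_real_derivative
           subst2 (d_y H) (fst (\<Phi> t)) (snd (\<Phi> t)) $ i $ j $ m $ l) (at t) \<and>
        ((\<lambda>s. snd (\<Phi> s) $ i $ j $ m $ l) has_real_derivative
           subst2 (- d_x H) (fst (\<Phi> t)) (snd (\<Phi> t)) $ i $ j $ m $ l) (at t))"

definition action :: plane_series where
  "action = real_const (1/2) * (x_var ^ 2 + y_var ^ 2)"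

text \<open>
  A series \<open>A(I;\<delta>,\<nu>)\<close> is given by its coefficients \<open>A $ k $ m $ j\<close> at \<open>I^k \<delta>^m \<nu>^j\<close>;
  here \<open>I = (x^2 + y^2)/2\<close> is substituted (as the first variable of \<open>subst2\<close>, the second is unused).
\<close>
definition in_action :: "par_series fps \<Rightarrow> plane_series" where
  "in_action A = subst2 (Abs_fps (\<lambda>k. fps_const (A $ k))) action 0"

text \<open>\<open>Re ((x + i y)^n)\<close>, by the binomial theorem.\<close>
definition Re_z_power :: "nat \<Rightarrow> plane_series" where
  "Re_z_power n =
     (\<Sum>j\<le>n. real_const (of_nat (n choose j) * Re (\<i> ^ j)) * x_var ^ (n - j) * y_var ^ j)"

text \<open>\<open>I^(n/2) cos (n\<phi>) = 2^(-n/2) Re (z^n)\<close>\<close>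
definition resonant_term :: "nat \<Rightarrow> plane_series" where
  "resonant_term n = real_const (2 powr (- real n / 2)) * Re_z_power n"

text \<open>\<open>\<delta> I + \<nu> I^2 + I^3 A(I;\<delta>,\<nu>) + I^(n/2) B(I;\<delta>,\<nu>) cos (n\<phi>)\<close>\<close>
definition normal_form_ham :: "nat \<Rightarrow> par_series fps \<Rightarrow> par_series fps \<Rightarrow> plane_series" where
  "normal_form_ham n A B =
     delta_var * action + nu_var * action ^ 2 + action ^ 3 * in_action A
     + resonant_term n * in_action B"

definition normal_form_coeffs :: "nat \<Rightarrow> par_series fps \<Rightarrow> par_series fps \<Rightarrow> bool" where
  "normal_form_coeffs n A B \<longleftrightarrow>
     (n = 5 \<longrightarrow> (\<forall>k m j. (k mod 5 = 1 \<longrightarrow> A $ k $ m $ j = 0) \<and> (k mod 5 = 4 \<longrightarrow> B $ k $ m $ j = 0))) \<and>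
     (n \<ge> 6 \<longrightarrow> (\<forall>k m j. k mod 3 = 2 \<longrightarrow> B $ k $ m $ j = 0))"

definition formally_conjugate :: "formal_map \<Rightarrow> formal_map \<Rightarrow> bool" where
  "formally_conjugate f g \<longleftrightarrow> (\<exists>\<psi>. formal_canonical \<psi> \<and> fcompose \<psi> f = fcompose g \<psi>)"

text \<open>
  Convergent Taylor expansions at the origin. For functions of several real variables, being
  analytic near the origin means being the sum of such a series on a small polydisc; \<open>has_sum\<close>
  for reals is absolute convergence.
\<close>
definition has_taylor_par :: "(real \<times> real \<Rightarrow> real) \<Rightarrow> par_series \<Rightarrow> bool" where
  "has_taylor_par f T \<longleftrightarrow> (\<exists>r>0. \<forall>p. norm p < r \<longrightarrow>
     ((\<lambda>(m, l). T $ m $ l * fst p ^ m * snd p ^ l) has_sum f p) UNIV)"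

definition has_taylor_plane :: "(real \<times> real \<Rightarrow> complex \<Rightarrow> real) \<Rightarrow> plane_series \<Rightarrow> bool" where
  "has_taylor_plane f T \<longleftrightarrow> (\<exists>r>0. \<forall>p z. norm p < r \<longrightarrow> norm z < r \<longrightarrow>
     ((\<lambda>(i, j, m, l). T $ i $ j $ m $ l * Re z ^ i * Im z ^ j * fst p ^ m * snd p ^ l)
        has_sum f p z) UNIV)"

definition has_taylor_family :: "(real \<times> real \<Rightarrow> complex \<Rightarrow> complex) \<Rightarrow> formal_map \<Rightarrow> bool" where
  "has_taylor_family F T \<longleftrightarrow>
     has_taylor_plane (\<lambda>p z. Re (F p z)) (fst T) \<and> has_taylor_plane (\<lambda>p z. Im (F p z)) (snd T)"

definition analytic_par :: "(real \<times> real \<Rightarrow> real) \<Rightarrow> bool" where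
  "analytic_par f \<longleftrightarrow> (\<exists>T. has_taylor_par f T)"

definition analytic_par_complex :: "(real \<times> real \<Rightarrow> complex) \<Rightarrow> bool" where
  "analytic_par_complex f \<longleftrightarrow> analytic_par (\<lambda>p. Re (f p)) \<and> analytic_par (\<lambda>p. Im (f p))"

definition analytic_family :: "(real \<times> real \<Rightarrow> complex \<Rightarrow> complex) \<Rightarrow> bool" where
  "analytic_family F \<longleftrightarrow> (\<exists>T. has_taylor_family F T)"

text \<open>
  \<open>S\<close> is the Taylor series of the family \<open>F\<close> in \<open>(x,y,\<delta>,\<nu>)\<close> when the functions \<open>\<delta>,\<nu>\<close> of \<open>p\<close> are
  used as parameters: substituting the Taylor series of \<open>\<delta>(p)\<close> and \<open>\<nu>(p)\<close> for the parameters
  of \<open>S\<close> gives the Taylor series of \<open>F\<close> in \<open>(x,y,p1,p2)\<close>. Here \<open>\<delta>(0) = \<nu>(0) = 0\<close>.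
\<close>
definition taylor_in_parameters ::
  "(real \<times> real \<Rightarrow> complex \<Rightarrow> complex) \<Rightarrow> (real \<times> real \<Rightarrow> real) \<Rightarrow> (real \<times> real \<Rightarrow> real)
     \<Rightarrow> formal_map \<Rightarrow> bool" where
  "taylor_in_parameters F \<delta> \<nu> S \<longleftrightarrow>
     (\<exists>T D N. has_taylor_family F T \<and> has_taylor_par \<delta> D \<and> has_taylor_par \<nu> N \<and>
        D $ 0 $ 0 = 0 \<and> N $ 0 $ 0 = 0 \<and>
        (\<forall>i j. subst2 (fst S $ i $ j) D N = fst T $ i $ j \<and>
               subst2 (snd S $ i $ j) D N = snd T $ i $ j))"

text \<open>The determinant of a real-linear \<open>L\<close>, with \<open>\<complex>\<close> identified with \<open>\<real>^2\<close> by \<open>z = x + i y\<close>.\<close>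
definition det_complex :: "(complex \<Rightarrow> complex) \<Rightarrow> real" where
  "det_complex L = Re (L 1) * Im (L \<i>) - Re (L \<i>) * Im (L 1)"

definition det_pair :: "(real \<times> real \<Rightarrow> real \<times> real) \<Rightarrow> real" where
  "det_pair L = fst (L (1, 0)) * snd (L (0, 1)) - fst (L (0, 1)) * snd (L (1, 0))"

end

theory Submission imports Defs begin

text \<open>
  A formal canonical map that is tangent to the rotation \<open>R\<close> of order \<open>n\<close> can be averaged: up to
  conjugation it is \<open>R\<close> followed by the time-one map of an \<open>R\<close>-invariant Hamiltonian \<open>H\<close>, and the
  coefficients of \<open>H\<close> up to degree \<open>n\<close> are read off from the logarithm. In complex coordinates only the
  resonant monomials \<open>z^k w^l\<close>, \<open>n\<close> dividing \<open>k - l\<close>, occur. With the weight \<open>2 min(k, l) + \<mu> |k - l| / n\<close>,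
  \<open>\<mu> = min n 6\<close>, and weight 6 for both parameters, the leading part of \<open>H\<close> is \<open>a (z w)^3 + b (z^n + w^n)\<close>. The
  homological operator of this leading part is a two-step recursion along each row of resonant
  monomials of the same weight. Its image complements exactly the normal form, and its kernel is
  spanned by the powers of the leading part, which lift to powers of \<open>H\<close> commuting with \<open>H\<close>;
  this gives existence and uniqueness.
\<close>

section \<open>Formal power series in two variables\<close>

text \<open>Maps act on series by pullback, so a conjugacy is an identity between algebra
  automorphisms, and the time-t map of H is the Lie series \<open>ex t H\<close>. The rotation part
  of the map is not close to the identity; it is kept as a separate factor of finite order n, over
  which one averages, and it disappears in n-th iterates, which is how two normal forms are
  compared. Ordinary degree cannot organise the normalisation: the bracket with I^3 alone
  annihilates every series in I, while z^n has another degree once n > 6. The weight puts both terms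
  on one level, and the kernel shrinks, for each monomial in the parameters, to real multiples of
  one power of the leading part, present only in weights divisible by \<mu>. In exactly these
  weights the recursion leaves an imaginary constant free, which removes one further coefficient.
  Expressed through the exponent of I this gives the residues modulo 5 and 3. For n = 5 the term I^3
  is heavier than z^5 and drops out of the leading part; the recursion then splits by parity, which
  is why both A and B lose coefficients.\<close>

definition dge :: "nat \<Rightarrow> 'a::zero fps fps \<Rightarrow> bool" where
  "dge k T \<longleftrightarrow> (\<forall>i j. i + j < k \<longrightarrow> T $ i $ j = 0)"

definition dY :: "'a::comm_ring_1 fps fps \<Rightarrow> 'a fps fps" where
  "dY G = Abs_fps (\<lambda>i. fps_deriv (G $ i))"

text \<open>The Poisson bracket of the area form. With x' = dH/dy and y' = -dH/dx the derivative of
  G along the flow of H is \<open>br G H\<close>.\<close>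

definition br :: "'a::comm_ring_1 fps fps \<Rightarrow> 'a fps fps \<Rightarrow> 'a fps fps" where
  "br G H = fps_deriv G * dY H - dY G * fps_deriv H"

definition cc :: "'a::zero \<Rightarrow> 'a fps fps" where
  "cc c = fps_const (fps_const c)"

definition yy :: "'a::comm_ring_1 fps fps" where
  "yy = fps_const fps_X"

definition mono2 :: "'a::comm_ring_1 \<Rightarrow> nat \<Rightarrow> nat \<Rightarrow> 'a fps fps" where
  "mono2 c i j = cc c * fps_X ^ i * yy ^ j"

lemma fps2_eqI: "(\<And>a b. S $ a $ b = T $ a $ b) \<Longrightarrow> S = T"
  by (simp add: fps_eq_iff)

lemma mult2_nth:
  "((S::'a::comm_ring_1 fps fps) * T) $ a $ b = (\<Sum>i\<le>a. \<Sum>j\<le>b. S $ i $ j * T $ (a - i) $ (b - j))"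
  by (simp add: fps_mult_nth fps_sum_nth atLeast0AtMost)

lemma cc_mult_nth [simp]: "(cc c * T) $ a $ b = c * (T::'a::comm_ring_1 fps fps) $ a $ b"
  by (simp add: cc_def)

lemma fps_deriv_nth2: "fps_deriv G $ a $ b = of_nat (a + 1) * (G::'a::comm_ring_1 fps fps) $ (a + 1) $ b"
proof -
  have *: "(of_nat n :: 'a fps) = fps_const (of_nat n)" for n
    by (simp add: fps_of_nat)
  show ?thesis unfolding fps_deriv_nth *  by (simp del: of_nat_add of_nat_Suc)
qed

lemma dY_nth: "dY G $ a $ b = of_nat (b + 1) * G $ a $ (b + 1)"
  by (simp add: dY_def)

declare fps_deriv_nth [simp del]

lemma cc_hom [simp]: "cc 0 = 0" "cc 1 = (1::'a::comm_ring_1 fps fps)"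
  by (simp_all add: cc_def)

lemma cc_add: "cc (c + d) = cc c + cc (d::'a::comm_ring_1)"
  by (simp add: cc_def)

lemma cc_diff: "cc (c - d) = cc c - cc (d::'a::comm_ring_1)"
  by (simp add: cc_def)

lemma cc_minus: "cc (- d) = - cc (d::'a::comm_ring_1)"
  by (simp add: cc_def)

lemma cc_mult: "cc (c * d) = cc c * cc (d::'a::comm_ring_1)"
  by (simp add: cc_def)

lemma cc_nth: "cc c $ a $ b = (if a = 0 \<and> b = 0 then c else (0::'a::comm_ring_1))"
  by (simp add: cc_def)

lemma yy_power: "(yy::'a::comm_ring_1 fps fps) ^ j = fps_const (fps_X ^ j)"
  by (simp add: yy_def fps_const_power)

lemma mono2_nth: "mono2 c i j $ a $ b = (if a = i \<and> b = j then c else 0)"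
proof -
  have "mono2 c i j = cc c * (fps_const (fps_X ^ j) * fps_X ^ i)"
    by (simp add: mono2_def yy_power mult_ac)
  then show ?thesis
    by (simp add: fps_X_power_nth)
qed

lemma dge_0 [simp]: "dge k 0" "dge 0 T"
  by (simp_all add: dge_def)

lemma dge_add: "dge k S \<Longrightarrow> dge k T \<Longrightarrow> dge k (S + T :: 'a::comm_ring_1 fps fps)"
  by (simp add: dge_def)

lemma dge_diff: "dge k S \<Longrightarrow> dge k T \<Longrightarrow> dge k (S - T :: 'a::comm_ring_1 fps fps)"
  by (simp add: dge_def)

lemma dge_mono: "dge k S \<Longrightarrow> l \<le> k \<Longrightarrow> dge l S"
  by (simp add: dge_def)

lemma dge_mult: "dge k S \<Longrightarrow> dge l T \<Longrightarrow> dge (k + l) (S * T :: 'a::comm_ring_1 fps fps)"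
  unfolding dge_def mult2_nth
proof (intro allI impI sum.neutral ballI)
  fix i j a b
  assume A: "\<forall>i j. i + j < k \<longrightarrow> S $ i $ j = 0" "\<forall>i j. i + j < l \<longrightarrow> T $ i $ j = 0"
    and "i + j < k + l" "a \<in> {..i}" "b \<in> {..j}"
  then have "a + b < k \<or> (i - a) + (j - b) < l" by auto
  with A show "S $ a $ b * T $ (i - a) $ (j - b) = 0" by auto
qed

lemma dge_power: "dge 1 X \<Longrightarrow> dge i (X ^ i :: 'a::comm_ring_1 fps fps)"
  by (induction i) (use dge_mult[of 1 X] in auto)

lemma dge_powers: "dge 1 X \<Longrightarrow> dge 1 Y \<Longrightarrow> dge (i + j) (X ^ i * Y ^ j :: 'a::comm_ring_1 fps fps)"
  by (intro dge_mult dge_power)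

lemma dge_1_iff: "dge (Suc 0) X \<longleftrightarrow> X $ 0 $ 0 = 0"
  by (auto simp: dge_def)

lemma additive_sum:
  assumes "\<And>S T. f (S + T) = f S + (f T :: 'c::ab_group_add)"
  shows "f (\<Sum>i\<in>A. g i) = (\<Sum>i\<in>A. f (g i :: 'b::ab_group_add))"
proof -
  have z: "f 0 = 0" using assms[of 0 0] by simp
  show ?thesis by (induction A rule: infinite_finite_induct) (auto simp: assms z)
qed

text \<open>A functional that only sees finitely many coefficients is determined on monomials.\<close>

lemma coef_ext:
  fixes f g :: "'a::comm_ring_1 fps fps \<Rightarrow> 'c::ab_group_add"
  assumes fa: "\<And>S T. f (S + T) = f S + f T" and ga: "\<And>S T. g (S + T) = g S + g T"
    and fc: "\<And>T. dge k T \<Longrightarrow> f T = 0" and gc: "\<And>T. dge k T \<Longrightarrow> g T = 0"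
    and m: "\<And>c i j. f (mono2 c i j) = g (mono2 c i j)"
  shows "f T = g T"
proof -
  define P where "P = (\<Sum>i<k. \<Sum>j<k. mono2 (T $ i $ j) i j)"
  have "P $ a $ b = (if a < k \<and> b < k then T $ a $ b else 0)" for a b
  proof -
    have "P $ a $ b = (\<Sum>i<k. \<Sum>j<k. if a = i \<and> b = j then T $ i $ j else 0)"
      unfolding P_def by (simp add: fps_sum_nth mono2_nth)
    also have "\<dots> = (\<Sum>i<k. if a = i then (\<Sum>j<k. if b = j then T $ i $ j else 0) else 0)"
      by (intro sum.cong) auto
    finally show ?thesis by (simp add: sum.delta')
  qed
  then have "dge k (T - P)" by (simp add: dge_def)
  then have "f (T - P) = g (T - P)" using fc gc by simp
  moreover have "f P = g P" unfolding P_def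
    by (simp add: additive_sum[of f, OF fa] additive_sum[of g, OF ga] m)
  ultimately have "f (T - P) + f P = g (T - P) + g P" by simp
  then show ?thesis by (simp flip: fa ga)
qed

section \<open>Substitution as a ring homomorphism\<close>

lemma subst2_nth: "subst2 G X Y $ a $ b = (\<Sum>i\<le>a + b. \<Sum>j\<le>a + b. G $ i $ j * (X ^ i * Y ^ j) $ a $ b)"
  by (simp add: subst2_def)

lemma subst2_add: "subst2 (G + H) X Y = subst2 G X Y + subst2 H X Y"
  by (rule fps2_eqI) (simp add: subst2_nth ring_distribs sum.distrib)

lemma subst2_diff: "subst2 (G - H) X Y = subst2 G X Y - subst2 H X Y"
  by (rule fps2_eqI) (simp add: subst2_nth ring_distribs sum_subtractf)

lemma subst2_uminus: "subst2 (- G) X Y = - subst2 G X Y"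
  by (rule fps2_eqI) (simp add: subst2_nth sum_negf)

lemma subst2_0 [simp]: "subst2 0 X Y = 0"
  by (rule fps2_eqI) (simp add: subst2_nth)

lemma subst2_dge:
  assumes "dge 1 X" "dge 1 Y" "dge k G"
  shows "dge k (subst2 G X Y)"
  unfolding dge_def subst2_nth
proof (intro allI impI sum.neutral ballI)
  fix a b i j assume ab: "a + b < k" "i \<in> {..a+b}" "j \<in> {..a+b}"
  show "G $ i $ j * (X ^ i * Y ^ j) $ a $ b = 0"
  proof (cases "i + j < k")
    case True with assms(3) show ?thesis by (simp add: dge_def)
  next
    case False
    with ab dge_powers[OF assms(1,2), of i j] show ?thesis by (simp add: dge_def)
  qed
qed

lemma subst2_mono2:
  assumes "dge 1 X" "dge 1 Y"
  shows "subst2 (mono2 c i j) X Y = cc c * X ^ i * Y ^ j"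
proof (rule fps2_eqI)
  fix a b
  have "subst2 (mono2 c i j) X Y $ a $ b
     = (\<Sum>i'\<le>a + b. \<Sum>j'\<le>a + b. if i = i' \<and> j = j' then c * (X ^ i * Y ^ j) $ a $ b else 0)"
    unfolding subst2_nth by (intro sum.cong) (auto simp: mono2_nth)
  also have "\<dots> = (\<Sum>i'\<le>a + b. if i = i' then (\<Sum>j'\<le>a + b. if j = j' then c * (X ^ i * Y ^ j) $ a $ b else 0) else 0)"
    by (intro sum.cong) auto
  also have "\<dots> = (if i \<le> a + b \<and> j \<le> a + b then c * (X ^ i * Y ^ j) $ a $ b else 0)"
    by (simp add: sum.delta')
  also have "\<dots> = c * (X ^ i * Y ^ j) $ a $ b"
    using dge_powers[OF assms, of i j] by (auto simp: dge_def)
  also have "\<dots> = (cc c * X ^ i * Y ^ j) $ a $ b"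
    by (simp add: mult.assoc)
  finally show "subst2 (mono2 c i j) X Y $ a $ b = \<dots>" .
qed

lemma mono2_mult: "mono2 c i j * mono2 d k l = mono2 (c * d) (i + k) (j + l)"
  by (simp add: mono2_def cc_mult power_add mult_ac)

text \<open>Both sides are additive in each factor and their coefficient at (a,b) ignores factors of
  order above a + b. So \<open>coef_ext\<close> applies, for H while G is a monomial and then for G,
  and only products of monomials remain.\<close>

lemma subst2_mult:
  fixes X Y :: "'a::comm_ring_1 fps fps"
  assumes XY: "dge 1 X" "dge 1 Y"
  shows "subst2 (G * H) X Y = subst2 G X Y * subst2 H X Y"
proof (rule fps2_eqI)
  fix a b
  have nz: "dge (Suc (a + b)) T \<Longrightarrow> T $ a $ b = 0" for T :: "'a fps fps" by (simp add: dge_def)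
  have 1: "subst2 (mono2 c i j * H) X Y $ a $ b = (subst2 (mono2 c i j) X Y * subst2 H X Y) $ a $ b" for c i j
  proof (rule coef_ext[where T = H and k = "Suc (a + b)"])
    show "subst2 (mono2 c i j * T) X Y $ a $ b = 0" if "dge (Suc (a + b)) T" for T
      using nz[OF subst2_dge[OF XY dge_mult[OF dge_0(2) that], simplified]] .
    show "(subst2 (mono2 c i j) X Y * subst2 T X Y) $ a $ b = 0" if "dge (Suc (a + b)) T" for T
      using nz[OF dge_mult[OF dge_0(2) subst2_dge[OF XY that], simplified]] .
  qed (simp_all add: subst2_add ring_distribs mono2_mult subst2_mono2[OF XY] cc_mult power_add mult_ac)
  show "subst2 (G * H) X Y $ a $ b = (subst2 G X Y * subst2 H X Y) $ a $ b"
  proof (rule coef_ext[where T = G and k = "Suc (a + b)"])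
    show "subst2 (T * H) X Y $ a $ b = 0" if "dge (Suc (a + b)) T" for T
      using nz[OF subst2_dge[OF XY dge_mult[OF that dge_0(2)], simplified]] .
    show "(subst2 T X Y * subst2 H X Y) $ a $ b = 0" if "dge (Suc (a + b)) T" for T
      using nz[OF dge_mult[OF subst2_dge[OF XY that] dge_0(2), simplified]] .
  qed (simp_all add: subst2_add ring_distribs 1)
qed

lemma subst2_cc:
  assumes "dge 1 X" "dge 1 Y"
  shows "subst2 (cc c) X Y = cc c"
  using subst2_mono2[OF assms, of c 0 0] by (simp add: mono2_def)

lemma subst2_1:
  assumes "dge 1 X" "dge 1 Y"
  shows "subst2 1 X Y = 1"
  using subst2_cc[OF assms, of 1] by simp

lemma subst2_X:
  assumes "dge 1 X" "dge 1 Y"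
  shows "subst2 fps_X X Y = X"
  using subst2_mono2[OF assms, of 1 1 0] by (simp add: mono2_def)

lemma subst2_Y:
  assumes "dge 1 X" "dge 1 Y"
  shows "subst2 yy X Y = Y"
  using subst2_mono2[OF assms, of 1 0 1] by (simp add: mono2_def)

lemma subst2_power:
  assumes "dge 1 X" "dge 1 Y"
  shows "subst2 (G ^ k) X Y = subst2 G X Y ^ k"
  by (induction k) (simp_all add: subst2_1[OF assms] subst2_mult[OF assms])

lemma subst2_id: "subst2 G fps_X yy = G"
proof (rule fps2_eqI)
  fix a b
  have XY: "dge 1 (fps_X :: 'a fps fps)" "dge 1 (yy :: 'a fps fps)"
    by (simp_all add: dge_1_iff yy_def)
  have m: "subst2 (mono2 c i j) fps_X yy = mono2 c i j" for c :: 'a and i j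
    unfolding subst2_mono2[OF XY, simplified] by (simp add: mono2_def)
  show "subst2 G fps_X yy $ a $ b = G $ a $ b"
    by (rule coef_ext[where T = G and k = "Suc (a + b)"])
       (use subst2_dge[OF XY] in \<open>auto simp: subst2_add m dge_def\<close>)
qed

lemma subst2_assoc:
  fixes X Y X' Y' :: "'a::comm_ring_1 fps fps"
  assumes XY: "dge 1 X" "dge 1 Y" and XY': "dge 1 X'" "dge 1 Y'"
  shows "subst2 (subst2 G X Y) X' Y' = subst2 G (subst2 X X' Y') (subst2 Y X' Y')"
proof (rule fps2_eqI)
  fix a b
  have nz: "dge (Suc (a + b)) T \<Longrightarrow> T $ a $ b = 0" for T :: "'a fps fps" by (simp add: dge_def)
  note XY'' = subst2_dge[OF XY' XY(1)] subst2_dge[OF XY' XY(2)]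
  show "subst2 (subst2 G X Y) X' Y' $ a $ b = subst2 G (subst2 X X' Y') (subst2 Y X' Y') $ a $ b"
    by (rule coef_ext[where T = G and k = "Suc (a + b)"])
       (simp_all add: subst2_add subst2_mono2[OF XY] subst2_mono2[OF XY''] subst2_mult[OF XY']
         subst2_power[OF XY'] subst2_cc[OF XY'] nz[OF subst2_dge[OF XY'' ]] nz[OF subst2_dge[OF XY' subst2_dge[OF XY]]])
qed

section \<open>Derivatives, the chain rule and the Poisson bracket\<close>

lemma dY_mult: "dY (G * H) = dY G * H + G * dY H"
proof (rule fps_ext)
  fix a
  show "dY (G * H) $ a = (dY G * H + G * dY H) $ a"
    by (simp add: dY_def fps_mult_nth fps_deriv_sum sum.distrib add.commute)
qed

lemma dY_add: "dY (G + H) = dY G + dY H"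
  by (rule fps2_eqI) (simp add: dY_nth ring_distribs)

lemma dY_diff: "dY (G - H) = dY G - dY H"
  by (rule fps2_eqI) (simp add: dY_nth ring_distribs)

lemma dY_minus: "dY (- G) = - dY G"
  by (rule fps2_eqI) (simp add: dY_nth ring_distribs)

lemma dY_basic [simp]: "dY (cc c) = 0" "dY 0 = 0" "dY 1 = 0" "dY fps_X = 0" "dY yy = 1"
  by (rule fps2_eqI; auto simp: dY_nth cc_nth yy_def)+

lemma dX_basic [simp]: "fps_deriv (cc c) = 0" "fps_deriv yy = 0"
  by (simp_all add: cc_def yy_def)

lemma dXY: "fps_deriv (dY G) = dY (fps_deriv (G::'a::comm_ring_1 fps fps))"
  by (rule fps2_eqI) (simp add: dY_nth fps_deriv_nth2 mult_ac)

lemma dY_power: "dY (G ^ n) = of_nat n * dY G * G ^ (n - 1)"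
proof (induction n)
  case (Suc n)
  show ?case
    by (cases n) (use Suc in \<open>auto simp: dY_mult algebra_simps\<close>)
qed simp

lemma dge_dX: "dge (Suc k) G \<Longrightarrow> dge k (fps_deriv (G::'a::comm_ring_1 fps fps))"
  by (simp add: dge_def fps_deriv_nth2)

lemma dge_dY: "dge (Suc k) G \<Longrightarrow> dge k (dY G)"
  by (simp add: dge_def dY_nth)

lemma chain_rule:
  fixes X Y :: "'a::comm_ring_1 fps fps"
  assumes XY: "dge 1 X" "dge 1 Y"
  shows "fps_deriv (subst2 G X Y) = subst2 (fps_deriv G) X Y * fps_deriv X + subst2 (dY G) X Y * fps_deriv Y" (is ?A)
    and "dY (subst2 G X Y) = subst2 (fps_deriv G) X Y * dY X + subst2 (dY G) X Y * dY Y" (is ?B)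
proof -
  have nz: "dge (Suc (a + b)) T \<Longrightarrow> T $ a $ b = 0" for T :: "'a fps fps" and a b by (simp add: dge_def)
  \<comment> \<open>Differentiation lowers the order by one, so the coefficient at (a,b) still sees
    terms of G of order a + b + 1; hence the cut-off two above a + b.\<close>
  have r: "(subst2 (fps_deriv T) X Y * U) $ a $ b = 0" "(U * subst2 (fps_deriv T) X Y) $ a $ b = 0"
    "(subst2 (dY T) X Y * U) $ a $ b = 0" "(U * subst2 (dY T) X Y) $ a $ b = 0"
    if "dge (Suc (Suc (a + b))) T" for T U :: "'a fps fps" and a b
    using nz[OF dge_mult[OF subst2_dge[OF XY dge_dX[OF that]] dge_0(2)[of U], simplified]]
      nz[OF dge_mult[OF subst2_dge[OF XY dge_dY[OF that]] dge_0(2)[of U], simplified]]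
    by (simp_all add: mult.commute)
  have m: "fps_deriv (mono2 c i j) = mono2 (c * of_nat i) (i - 1) j" "dY (mono2 c i j) = mono2 (c * of_nat j) i (j - 1)"
    for c :: 'a and i j
    by (rule fps2_eqI; cases i; cases j; auto simp: fps_deriv_nth2 dY_nth mono2_nth)+
  have cm: "cc (c * of_nat i) = cc c * of_nat i" for c :: 'a and i
    unfolding cc_mult by (simp add: cc_def fps_of_nat)
  show ?A
  proof (rule fps2_eqI)
    fix a b
    show "fps_deriv (subst2 G X Y) $ a $ b = (subst2 (fps_deriv G) X Y * fps_deriv X + subst2 (dY G) X Y * fps_deriv Y) $ a $ b"
    proof (rule coef_ext[where T = G and k = "Suc (Suc (a + b))"])
      fix T :: "'a fps fps" assume T: "dge (Suc (Suc (a + b))) T"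
      show "fps_deriv (subst2 T X Y) $ a $ b = 0"
        by (rule nz[OF dge_dX[OF subst2_dge[OF XY T]]])
      show "(subst2 (fps_deriv T) X Y * fps_deriv X + subst2 (dY T) X Y * fps_deriv Y) $ a $ b = 0"
        using r[OF T] by (simp only: fps_add_nth add_0)
    next
      fix c :: 'a and i j
      show "fps_deriv (subst2 (mono2 c i j) X Y) $ a $ b
        = (subst2 (fps_deriv (mono2 c i j)) X Y * fps_deriv X + subst2 (dY (mono2 c i j)) X Y * fps_deriv Y) $ a $ b"
        by (rule arg_cong[where f = "\<lambda>u. u $ a $ b"])
          (simp only: m subst2_mono2[OF XY] fps_deriv_mult fps_deriv_power' cm dX_basic, simp add: algebra_simps)
    qed (simp_all add: subst2_add dY_add ring_distribs)
  qed
  show ?B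
  proof (rule fps2_eqI)
    fix a b
    show "dY (subst2 G X Y) $ a $ b = (subst2 (fps_deriv G) X Y * dY X + subst2 (dY G) X Y * dY Y) $ a $ b"
    proof (rule coef_ext[where T = G and k = "Suc (Suc (a + b))"])
      fix T :: "'a fps fps" assume T: "dge (Suc (Suc (a + b))) T"
      show "dY (subst2 T X Y) $ a $ b = 0"
        by (rule nz[OF dge_dY[OF subst2_dge[OF XY T]]])
      show "(subst2 (fps_deriv T) X Y * dY X + subst2 (dY T) X Y * dY Y) $ a $ b = 0"
        using r[OF T] by (simp only: fps_add_nth add_0)
    next
      fix c :: 'a and i j
      show "dY (subst2 (mono2 c i j) X Y) $ a $ b
        = (subst2 (fps_deriv (mono2 c i j)) X Y * dY X + subst2 (dY (mono2 c i j)) X Y * dY Y) $ a $ b"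
        by (rule arg_cong[where f = "\<lambda>u. u $ a $ b"])
          (simp only: m subst2_mono2[OF XY] dY_mult dY_power cm dY_basic, simp add: algebra_simps)
    qed (simp_all add: subst2_add dY_add ring_distribs)
  qed
qed

text \<open>The bracket is a 2 by 2 determinant, so the chain rule multiplies it by the Jacobian
  determinant \<open>br X Y\<close>; substitutions with Jacobian 1 respect it.\<close>

lemma br_subst2:
  assumes XY: "dge 1 X" "dge 1 Y"
  shows "br (subst2 G X Y) (subst2 H X Y) = subst2 (br G H) X Y * br X Y"
  unfolding br_def chain_rule[OF XY] subst2_diff subst2_mult[OF XY] by (simp add: algebra_simps)

lemma br_add_left: "br (G + G') H = br G H + br G' H"
  by (simp add: br_def dY_add algebra_simps)

lemma br_add_right: "br G (H + H') = br G H + br G H'"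
  by (simp add: br_def dY_add algebra_simps)

lemma br_diff_left: "br (G - G') H = br G H - br G' H"
  by (simp add: br_def dY_diff algebra_simps)

lemma br_diff_right: "br G (H - H') = br G H - br G H'"
  by (simp add: br_def dY_diff algebra_simps)

lemma br_minus_right: "br G (- H) = - br G H"
  by (simp add: br_def dY_minus algebra_simps)

lemma br_zero [simp]: "br 0 H = 0" "br G 0 = 0" "br (cc c) H = 0" "br G (cc c) = 0" "br 1 H = 0"
  by (simp_all add: br_def)

lemma br_antisym: "br G H = - br H G"
  by (simp add: br_def algebra_simps)

lemma br_self [simp]: "br G G = 0"
  by (simp add: br_def algebra_simps)

lemma br_mult_left: "br (F * G) H = br F H * G + F * br G H"
  by (simp add: br_def dY_mult algebra_simps)

lemma br_mult_right: "br H (F * G) = br H F * G + F * br H G"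
  by (simp add: br_def dY_mult algebra_simps)

lemma br_cc_left: "br (cc c * G) H = cc c * br G H"
  by (simp add: br_mult_left)

lemma br_cc_right: "br G (cc c * H) = cc c * br G H"
  by (simp add: br_mult_right)

text \<open>The Jacobi identity in derivation form: bracketing with H is a derivation of the
  bracket. This is what makes \<open>ex t H\<close> preserve brackets.\<close>

lemma br_jacobi: "br (br F G) H = br (br F H) G + br F (br G H)"
  by (simp add: br_def dY_diff dY_mult dXY algebra_simps)

lemma br_power_0: "br K H = 0 \<Longrightarrow> br (K ^ q) H = 0"
  by (induction q) (simp_all add: br_mult_left)

lemma sum_drop_first: fixes f :: "nat \<Rightarrow> 'a::comm_monoid_add" shows "f 0 = 0 \<Longrightarrow> (\<Sum>i\<le>a + 1. f i) = (\<Sum>i\<le>a. f (i + 1))"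
  using sum.atMost_Suc_shift[of f a] by simp

lemma sum_drop_last: fixes f :: "nat \<Rightarrow> 'a::comm_monoid_add" shows "f (a + 1) = 0 \<Longrightarrow> (\<Sum>i\<le>a + 1. f i) = (\<Sum>i\<le>a. f i)"
  by simp

text \<open>Both products of the bracket are rearranged over the same index set; the boundary terms have coefficient 0.\<close>

lemma br_nth:
  fixes S T :: "'a::comm_ring_1 fps fps"
  shows "br S T $ a $ b = (\<Sum>i\<le>a + 1. \<Sum>j\<le>b + 1.
    (of_nat (i * (b + 1 - j)) - of_nat (j * (a + 1 - i))) * (S $ i $ j * T $ (a + 1 - i) $ (b + 1 - j)))"
proof -
  define f where "f i j = S $ i $ j * T $ (a + 1 - i) $ (b + 1 - j)" for i j
  have "(\<Sum>i\<le>a + 1. \<Sum>j\<le>b + 1. of_nat (i * (b + 1 - j)) * f i j)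
     = (\<Sum>i\<le>a. \<Sum>j\<le>b + 1. of_nat ((i + 1) * (b + 1 - j)) * f (i + 1) j)"
    by (rule sum_drop_first) simp
  also have "\<dots> = (\<Sum>i\<le>a. \<Sum>j\<le>b. of_nat ((i + 1) * (b + 1 - j)) * f (i + 1) j)"
    by (intro sum.cong refl sum_drop_last) simp
  also have "\<dots> = (fps_deriv S * dY T) $ a $ b"
    unfolding mult2_nth fps_deriv_nth2 dY_nth f_def
    by (intro sum.cong refl) (simp only: of_nat_mult Suc_diff_le Suc_eq_plus1[symmetric] atMost_iff mult_ac diff_Suc_Suc)
  finally have 1: "(fps_deriv S * dY T) $ a $ b = (\<Sum>i\<le>a + 1. \<Sum>j\<le>b + 1. of_nat (i * (b + 1 - j)) * f i j)" ..
  have "(\<Sum>i\<le>a + 1. \<Sum>j\<le>b + 1. of_nat (j * (a + 1 - i)) * f i j)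
     = (\<Sum>i\<le>a. \<Sum>j\<le>b + 1. of_nat (j * (a + 1 - i)) * f i j)"
    by (rule sum_drop_last) simp
  also have "\<dots> = (\<Sum>i\<le>a. \<Sum>j\<le>b. of_nat ((j + 1) * (a + 1 - i)) * f i (j + 1))"
    by (intro sum.cong refl sum_drop_first) simp
  also have "\<dots> = (dY S * fps_deriv T) $ a $ b"
    unfolding mult2_nth fps_deriv_nth2 dY_nth f_def
    by (intro sum.cong refl) (simp only: of_nat_mult Suc_diff_le Suc_eq_plus1[symmetric] atMost_iff mult_ac diff_Suc_Suc)
  finally have 2: "(dY S * fps_deriv T) $ a $ b = (\<Sum>i\<le>a + 1. \<Sum>j\<le>b + 1. of_nat (j * (a + 1 - i)) * f i j)" ..
  show ?thesis
    unfolding br_def fps_sub_nth 1 2 f_def by (simp only: left_diff_distrib sum_subtractf)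
qed

lemma dge_br: "dge (Suc k) S \<Longrightarrow> dge (Suc l) T \<Longrightarrow> dge (k + l) (br S T)"
  unfolding br_def by (intro dge_diff dge_mult dge_dX dge_dY)

text \<open>Support conditions for series in four variables.\<close>

definition spt :: "(nat \<Rightarrow> nat \<Rightarrow> nat \<Rightarrow> nat \<Rightarrow> bool) \<Rightarrow> 'a::zero fps fps fps fps \<Rightarrow> bool" where
  "spt A T \<longleftrightarrow> (\<forall>i j m l. T $ i $ j $ m $ l \<noteq> 0 \<longrightarrow> A i j m l)"

lemma sptD: "spt A T \<Longrightarrow> \<not> A i j m l \<Longrightarrow> T $ i $ j $ m $ l = 0"
  by (auto simp: spt_def)

lemma spt_0 [simp]: "spt A 0"
  by (simp add: spt_def)

lemma spt_add: "spt A S \<Longrightarrow> spt A T \<Longrightarrow> spt A (S + T :: 'a::comm_ring_1 fps fps fps fps)"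
proof -
  assume "spt A S" "spt A T"
  moreover have "S $ i $ j $ m $ l \<noteq> 0 \<or> T $ i $ j $ m $ l \<noteq> 0" if "(S + T) $ i $ j $ m $ l \<noteq> 0" for i j m l
    using that by auto
  ultimately show ?thesis unfolding spt_def by blast
qed

lemma spt_minus: "spt A S \<Longrightarrow> spt A (- S :: 'a::comm_ring_1 fps fps fps fps)"
  by (fastforce simp: spt_def)

lemma spt_diff: "spt A S \<Longrightarrow> spt A T \<Longrightarrow> spt A (S - T :: 'a::comm_ring_1 fps fps fps fps)"
  using spt_add[of A S "- T"] spt_minus[of A T] by simp

lemma spt_sum: "(\<And>x. x \<in> X \<Longrightarrow> spt A (f x)) \<Longrightarrow> spt A (\<Sum>x\<in>X. f x :: 'a::comm_ring_1 fps fps fps fps)"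
  by (induction X rule: infinite_finite_induct) (auto intro: spt_add)

lemma spt_mono: "spt A S \<Longrightarrow> (\<And>i j m l. A i j m l \<Longrightarrow> B i j m l) \<Longrightarrow> spt B S"
  by (auto simp: spt_def)

lemma sum2_nzE:
  assumes "(\<Sum>i\<in>A. \<Sum>j\<in>B. f i j) \<noteq> (0::'a::comm_monoid_add)"
  obtains i j where "i \<in> A" "j \<in> B" "f i j \<noteq> 0"
proof -
  from assms obtain i where i: "i \<in> A" "(\<Sum>j\<in>B. f i j) \<noteq> 0"
    using sum.not_neutral_contains_not_neutral by blast
  from i(2) obtain j where "j \<in> B" "f i j \<noteq> 0"
    using sum.not_neutral_contains_not_neutral by blast
  with i(1) that show thesis by blast
qed

lemma spt_mult:
  fixes S T :: "'a::comm_ring_1 fps fps fps fps"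
  assumes "spt A S" "spt B T"
    and C: "\<And>i j m l i' j' m' l'. A i j m l \<Longrightarrow> B i' j' m' l' \<Longrightarrow> C (i + i') (j + j') (m + m') (l + l')"
  shows "spt C (S * T)"
  unfolding spt_def
proof (intro allI impI)
  fix a b m l assume "(S * T) $ a $ b $ m $ l \<noteq> 0"
  then have "(\<Sum>i\<le>a. \<Sum>j\<le>b. (S $ i $ j * T $ (a - i) $ (b - j)) $ m $ l) \<noteq> 0"
    unfolding mult2_nth[of S T] by (simp add: fps_sum_nth)
  then obtain i j where ij: "i \<le> a" "j \<le> b" "(S $ i $ j * T $ (a - i) $ (b - j)) $ m $ l \<noteq> 0"
    by (rule sum2_nzE) auto
  from ij(3) obtain u v where uv: "u \<le> m" "v \<le> l"
    and "S $ i $ j $ u $ v * T $ (a - i) $ (b - j) $ (m - u) $ (l - v) \<noteq> 0"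
    unfolding mult2_nth by (rule sum2_nzE) auto
  then have "S $ i $ j $ u $ v \<noteq> 0" "T $ (a - i) $ (b - j) $ (m - u) $ (l - v) \<noteq> 0" by auto
  then have "A i j u v" "B (a - i) (b - j) (m - u) (l - v)" using assms(1,2) by (auto simp: spt_def)
  from C[OF this] ij uv show "C a b m l" by simp
qed

text \<open>The bracket of monomials with exponents (i,j) and (i',j') is (i j' - j i') times the
  monomial with exponents (i + i' - 1, j + j' - 1), while parameter exponents just add.\<close>

lemma spt_br:
  fixes S T :: "'a::comm_ring_1 fps fps fps fps"
  assumes "spt A S" "spt B T"
    and C: "\<And>i j m l i' j' m' l' a b. A i j m l \<Longrightarrow> B i' j' m' l' \<Longrightarrow> i + i' = Suc a \<Longrightarrow> j + j' = Suc b \<Longrightarrow>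
       i * j' \<noteq> j * i' \<Longrightarrow> C a b (m + m') (l + l')"
  shows "spt C (br S T)"
  unfolding spt_def
proof (intro allI impI)
  fix a b m l assume nz: "br S T $ a $ b $ m $ l \<noteq> 0"
  have "br S T $ a $ b $ m $ l = (\<Sum>i\<le>a+1. \<Sum>j\<le>b+1.
     ((of_nat (i * (b + 1 - j)) - of_nat (j * (a + 1 - i))) * (S $ i $ j * T $ (a + 1 - i) $ (b + 1 - j))) $ m $ l)"
    unfolding br_nth by (simp only: fps_sum_nth)
  with nz have "(\<Sum>i\<le>a+1. \<Sum>j\<le>b+1.
     ((of_nat (i * (b + 1 - j)) - of_nat (j * (a + 1 - i))) * (S $ i $ j * T $ (a + 1 - i) $ (b + 1 - j))) $ m $ l) \<noteq> 0"
    by (simp only: not_False_eq_True)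
  then obtain i j where ij: "i \<in> {..a + 1}" "j \<in> {..b + 1}"
    and nz2: "((of_nat (i * (b + 1 - j)) - of_nat (j * (a + 1 - i))) * (S $ i $ j * T $ (a + 1 - i) $ (b + 1 - j))) $ m $ l \<noteq> 0"
    by (rule sum2_nzE)
  have d: "i * (b + 1 - j) \<noteq> j * (a + 1 - i)" using nz2 by (auto simp del: of_nat_mult)
  have "(of_nat (i * (b + 1 - j)) - of_nat (j * (a + 1 - i)) :: 'a fps fps) = cc (of_nat (i * (b + 1 - j)) - of_nat (j * (a + 1 - i)))"
  proof -
    have "of_nat k = (cc (of_nat k) :: 'a fps fps)" for k by (simp add: cc_def fps_of_nat)
    then show ?thesis by (metis cc_diff)
  qed
  from nz2[unfolded this cc_mult_nth] have "(S $ i $ j * T $ (a + 1 - i) $ (b + 1 - j)) $ m $ l \<noteq> 0"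
    by (metis cc_mult_nth fps_mult_right_const_nth fps_zero_nth mult_zero_right)
  then obtain u v where uv: "u \<in> {..m}" "v \<in> {..l}" and "S $ i $ j $ u $ v * T $ (a + 1 - i) $ (b + 1 - j) $ (m - u) $ (l - v) \<noteq> 0"
    unfolding mult2_nth by (rule sum2_nzE)
  then have "S $ i $ j $ u $ v \<noteq> 0" "T $ (a + 1 - i) $ (b + 1 - j) $ (m - u) $ (l - v) \<noteq> 0" by auto
  then have "A i j u v" "B (a + 1 - i) (b + 1 - j) (m - u) (l - v)" using assms(1,2) by (auto simp: spt_def)
  from C[OF this _ _ d, of a b] ij uv show "C a b m l" by auto
qed

section \<open>Real plane series: pullback, total degree, admissible Hamiltonians, Lie
  series\<close>

lemma defs_eq: "x_var = fps_X" "y_var = yy" "d_x = fps_deriv" "d_y = dY" "par_const = cc"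
  "real_const c = cc (fps_const (fps_const c))"
  by (auto simp: x_var_def y_var_def yy_def d_x_def d_y_def dY_def cc_def par_const_def real_const_def)

lemma rc_nth [simp]: "(real_const c * T) $ i $ j $ m $ l = c * T $ i $ j $ m $ l"
  by (simp add: defs_eq)

lemma rc_hom: "real_const (a + b) = real_const a + real_const b" "real_const (a * b) = real_const a * real_const b"
  "real_const 0 = 0" "real_const 1 = 1" "real_const (- a) = - real_const a" "real_const (a - b) = real_const a - real_const b"
  by (simp_all add: defs_eq cc_def)

lemma fps4_eqI: "(\<And>i j m l. S $ i $ j $ m $ l = T $ i $ j $ m $ l) \<Longrightarrow> S = T"
  by (simp add: fps_eq_iff)

lemma of_nat_mult_nth2: "(of_nat k * P) $ m $ l = of_nat k * (P::'a::comm_ring_1 fps fps) $ m $ l"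
proof -
  have "(of_nat k :: 'a fps fps) = cc (of_nat k)" by (simp add: cc_def fps_of_nat)
  then show ?thesis by simp
qed

text \<open>A map acts on functions. Composition of maps becomes composition of operators in reverse
  order, and conjugacy becomes an identity between automorphisms.\<close>

definition pb :: "formal_map \<Rightarrow> plane_series \<Rightarrow> plane_series" where
  "pb f G = subst2 G (fst f) (snd f)"

text \<open>Unlike in \<open>dge\<close>, the parameters count here. All formal limits are taken in
  this filtration.\<close>

definition vge :: "nat \<Rightarrow> plane_series \<Rightarrow> bool" where
  "vge k = spt (\<lambda>i j m l. k \<le> i + j + m + l)"

text \<open>Order 2 in (x,y) keeps the origin an equilibrium and prevents brackets from lowering the
  (x,y)-order. Total order 3 makes every bracket raise the total order, so that Lie series converge.
  Since parameters count, delta I qualifies although it is quadratic in (x,y).\<close>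

definition Ham :: "plane_series \<Rightarrow> bool" where
  "Ham = spt (\<lambda>i j m l. 2 \<le> i + j \<and> 3 \<le> i + j + m + l)"

lemma dge_spt: "dge k T \<longleftrightarrow> spt (\<lambda>i j m l. k \<le> i + j) (T::'a::comm_ring_1 fps fps fps fps)"
proof
  assume "dge k T"
  then show "spt (\<lambda>i j m l. k \<le> i + j) T" by (force simp: dge_def spt_def not_less[symmetric])
next
  assume "spt (\<lambda>i j m l. k \<le> i + j) T"
  then show "dge k T" unfolding dge_def spt_def fps_eq_iff by (metis fps_zero_nth not_le)
qed

lemma Ham_iff: "Ham H \<longleftrightarrow> dge 2 H \<and> vge 3 H"
  by (auto simp: Ham_def dge_spt vge_def spt_def)

lemma vge_0 [simp]: "vge k 0" "vge 0 T"
  by (simp_all add: vge_def spt_def)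

lemma vge_nth: "vge k T \<Longrightarrow> i + j + m + l < k \<Longrightarrow> T $ i $ j $ m $ l = 0"
  by (auto simp: vge_def intro: sptD)

lemma vge_mono: "vge k T \<Longrightarrow> l \<le> k \<Longrightarrow> vge l T"
  by (auto simp: vge_def elim: spt_mono)

lemma vge_add: "vge k S \<Longrightarrow> vge k T \<Longrightarrow> vge k (S + T)"
  and vge_diff: "vge k S \<Longrightarrow> vge k T \<Longrightarrow> vge k (S - T)"
  and vge_minus: "vge k S \<Longrightarrow> vge k (- S)"
  by (simp_all add: vge_def spt_add spt_diff spt_minus)

lemma vge_mult: "vge k S \<Longrightarrow> vge l T \<Longrightarrow> vge (k + l) (S * T)"
  unfolding vge_def by (rule spt_mult, assumption, assumption, simp)

lemma vge_power: "vge 1 X \<Longrightarrow> vge i (X ^ i)"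
  by (induction i) (use vge_mult[of 1 X] in auto)

lemma vge_eqI: "(\<And>k. vge k (S - T)) \<Longrightarrow> S = T"
proof (rule fps4_eqI)
  fix i j m l assume "\<And>k. vge k (S - T)"
  from vge_nth[OF this[of "Suc (i + j + m + l)"], of i j m l] show "S $ i $ j $ m $ l = T $ i $ j $ m $ l"
    by simp
qed

lemma vge_br: "vge (Suc k) S \<Longrightarrow> vge (Suc l) T \<Longrightarrow> vge (k + l) (br S T)"
  unfolding vge_def by (rule spt_br, assumption, assumption, linarith)

lemma vge_br_Ham: "Ham H \<Longrightarrow> vge k G \<Longrightarrow> vge (Suc k) (br G H)"
  unfolding vge_def Ham_def by (rule spt_br, assumption, assumption, linarith)

lemma dge_1_vge: "dge (Suc 0) X \<Longrightarrow> vge (Suc 0) X"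
  unfolding dge_spt vge_def by (erule spt_mono) auto

lemma spt_rc: "spt A T \<Longrightarrow> spt A (real_const c * T)"
  by (auto simp: spt_def)

lemma Ham_add: "Ham G \<Longrightarrow> Ham H \<Longrightarrow> Ham (G + H)"
  and Ham_diff: "Ham G \<Longrightarrow> Ham H \<Longrightarrow> Ham (G - H)"
  and Ham_minus: "Ham G \<Longrightarrow> Ham (- G)"
  and Ham_0 [simp]: "Ham 0"
  and Ham_rc: "Ham G \<Longrightarrow> Ham (real_const c * G)"
  by (simp_all add: Ham_def spt_add spt_diff spt_minus spt_rc)

abbreviation Lp :: "nat \<Rightarrow> plane_series \<Rightarrow> plane_series \<Rightarrow> plane_series" where
  "Lp q H G \<equiv> ((\<lambda>G. br G H) ^^ q) G"

text \<open>The Lie series of the bracket with H. The sum for a coefficient stops at its total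
  degree because for admissible H the q-fold bracket has total order at least q.\<close>

definition ex :: "real \<Rightarrow> plane_series \<Rightarrow> plane_series \<Rightarrow> plane_series" where
  "ex t H G = Abs_fps (\<lambda>i. Abs_fps (\<lambda>j. Abs_fps (\<lambda>m. Abs_fps (\<lambda>l.
     \<Sum>q\<le>i + j + m + l. t ^ q / fact q * Lp q H G $ i $ j $ m $ l))))"

lemma vge_Lp: "Ham H \<Longrightarrow> vge k G \<Longrightarrow> vge (k + q) (Lp q H G)"
  by (induction q) (auto dest: vge_br_Ham)

lemma Lp_br: "Lp q H (br G H) = br (Lp q H G) H"
  by (induction q) simp_all

lemma ex_nth:
  assumes "Ham H" "i + j + m + l \<le> N"
  shows "ex t H G $ i $ j $ m $ l = (\<Sum>q\<le>N. t ^ q / fact q * Lp q H G $ i $ j $ m $ l)"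
proof -
  have "ex t H G $ i $ j $ m $ l = (\<Sum>q\<le>i + j + m + l. t ^ q / fact q * Lp q H G $ i $ j $ m $ l)"
    by (simp add: ex_def)
  also have "\<dots> = (\<Sum>q\<le>N. t ^ q / fact q * Lp q H G $ i $ j $ m $ l)"
  proof (rule sum.mono_neutral_left)
    show "\<forall>q\<in>{..N} - {..i + j + m + l}. t ^ q / fact q * Lp q H G $ i $ j $ m $ l = 0"
      using vge_nth[OF vge_Lp[OF assms(1), of 0 G]] by simp
  qed (use assms in auto)
  finally show ?thesis .
qed

lemma ex_partial:
  assumes "Ham H"
  shows "vge (Suc N) (ex t H G - (\<Sum>q\<le>N. real_const (t ^ q / fact q) * Lp q H G))"
proof -
  have "(ex t H G - (\<Sum>q\<le>N. real_const (t ^ q / fact q) * Lp q H G)) $ i $ j $ m $ l = 0"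
    if "i + j + m + l \<le> N" for i j m l
    using ex_nth[OF assms that, of t G] by (simp add: fps_sum_nth)
  then show ?thesis unfolding vge_def spt_def by (meson not_less_eq_eq)
qed

lemma ex_0 [simp]: "ex 0 H G = G"
proof (rule fps4_eqI)
  fix i j m l
  have "ex 0 H G $ i $ j $ m $ l = (\<Sum>q\<le>i + j + m + l. if q = 0 then Lp q H G $ i $ j $ m $ l else 0)"
    unfolding ex_def fps_nth_Abs_fps by (intro sum.cong) (auto simp: power_0_left)
  then show "ex 0 H G $ i $ j $ m $ l = G $ i $ j $ m $ l" by (simp add: sum.delta)
qed

lemma Lp_add: "Lp q H (F + G) = Lp q H F + Lp q H G"
  by (induction q) (auto simp: br_add_left)

lemma Lp_diff: "Lp q H (F - G) = Lp q H F - Lp q H G"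
  by (induction q) (auto simp: br_diff_left)

lemma ex_add: "ex t H (F + G) = ex t H F + ex t H G"
  by (rule fps4_eqI) (simp add: ex_def Lp_add ring_distribs sum.distrib)

lemma ex_diff: "ex t H (F - G) = ex t H F - ex t H G"
  by (rule fps4_eqI) (simp add: ex_def Lp_diff ring_distribs sum_subtractf)

lemma br_rc_left: "br (real_const c * G) H = real_const c * br G H"
  by (simp add: defs_eq br_cc_left)

lemma br_rc_right: "br G (real_const c * H) = real_const c * br G H"
  by (simp add: defs_eq br_cc_right)

lemma br_sum_left: "br (\<Sum>i\<in>I. f i) H = (\<Sum>i\<in>I. br (f i) H)"
  by (rule additive_sum[of "\<lambda>G. br G H"]) (simp add: br_add_left)

lemma br_ex:
  assumes H: "Ham H"
  shows "br (ex t H G) H = ex t H (br G H)"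
proof (rule vge_eqI)
  fix k
  let ?P = "\<lambda>G. \<Sum>q\<le>k. real_const (t ^ q / fact q) * Lp q H G"
  have "br (?P G) H = ?P (br G H)"
    by (simp add: br_sum_left br_rc_left Lp_br)
  then have "br (ex t H G) H - ex t H (br G H) = br (ex t H G - ?P G) H - (ex t H (br G H) - ?P (br G H))"
    by (simp add: br_diff_left)
  moreover have "vge k \<dots>"
    by (intro vge_diff vge_mono[OF vge_br_Ham[OF H ex_partial[OF H]]] vge_mono[OF ex_partial[OF H]]) auto
  ultimately show "vge k (br (ex t H G) H - ex t H (br G H))" by (simp only:)
qed

section \<open>Coefficientwise differentiation in time and the laws of Lie series\<close>

definition hcd :: "(real \<Rightarrow> plane_series) \<Rightarrow> plane_series \<Rightarrow> real \<Rightarrow> bool" where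
  "hcd u u' t \<longleftrightarrow> (\<forall>i j m l. ((\<lambda>s. u s $ i $ j $ m $ l) has_real_derivative u' $ i $ j $ m $ l) (at t))"

lemma hcd_const [simp]: "hcd (\<lambda>s. c) 0 t"
  by (simp add: hcd_def)

lemma hcd_add: "hcd u u' t \<Longrightarrow> hcd v v' t \<Longrightarrow> hcd (\<lambda>s. u s + v s) (u' + v') t"
  by (simp add: hcd_def DERIV_add)

lemma hcd_diff: "hcd u u' t \<Longrightarrow> hcd v v' t \<Longrightarrow> hcd (\<lambda>s. u s - v s) (u' - v') t"
  by (simp add: hcd_def DERIV_diff)

lemma hcd_sum: "(\<And>i. i \<in> I \<Longrightarrow> hcd (u i) (u' i) t) \<Longrightarrow> hcd (\<lambda>s. \<Sum>i\<in>I. u i s) (\<Sum>i\<in>I. u' i) t"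
  by (induction I rule: infinite_finite_induct) (auto intro: hcd_add)

lemma mult4_nth: "((S::'a::comm_ring_1 fps fps fps fps) * T) $ a $ b $ m $ l =
   (\<Sum>i\<le>a. \<Sum>j\<le>b. \<Sum>p\<le>m. \<Sum>q\<le>l. S $ i $ j $ p $ q * T $ (a - i) $ (b - j) $ (m - p) $ (l - q))"
  unfolding mult2_nth[of S T] fps_sum_nth by (simp add: mult2_nth)

lemma hcd_mult:
  assumes "hcd u u' t" "hcd v v' t"
  shows "hcd (\<lambda>s. u s * v s) (u' * v t + u t * v') t"
  unfolding hcd_def
proof (intro allI)
  fix a b m l
  have "((\<lambda>s. \<Sum>i\<le>a. \<Sum>j\<le>b. \<Sum>p\<le>m. \<Sum>q\<le>l. u s $ i $ j $ p $ q * v s $ (a - i) $ (b - j) $ (m - p) $ (l - q))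
    has_real_derivative (\<Sum>i\<le>a. \<Sum>j\<le>b. \<Sum>p\<le>m. \<Sum>q\<le>l.
      u' $ i $ j $ p $ q * v t $ (a - i) $ (b - j) $ (m - p) $ (l - q)
      + v' $ (a - i) $ (b - j) $ (m - p) $ (l - q) * u t $ i $ j $ p $ q)) (at t)"
    using assms unfolding hcd_def by (intro DERIV_sum DERIV_mult) auto
  then show "((\<lambda>s. (u s * v s) $ a $ b $ m $ l) has_real_derivative (u' * v t + u t * v') $ a $ b $ m $ l) (at t)"
    unfolding fps_add_nth mult4_nth by (simp add: sum.distrib mult.commute)
qed

lemma hcd_power: "hcd u u' t \<Longrightarrow> hcd (\<lambda>s. u s ^ n) (of_nat n * u t ^ (n - 1) * u') t"
proof (induction n)
  case (Suc n)
  have "u' * u t ^ n + u t * (of_nat n * u t ^ (n - 1) * u') = of_nat (Suc n) * u t ^ (Suc n - 1) * u'"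
    by (cases n) (auto simp: algebra_simps)
  with hcd_mult[OF Suc.prems Suc.IH[OF Suc.prems]] show ?case by simp
qed simp

lemma hcd_dX: "hcd u u' t \<Longrightarrow> hcd (\<lambda>s. fps_deriv (u s)) (fps_deriv u') t"
  unfolding hcd_def fps_deriv_nth2 of_nat_mult_nth2 by (auto intro!: DERIV_cmult)

lemma hcd_dY: "hcd u u' t \<Longrightarrow> hcd (\<lambda>s. dY (u s)) (dY u') t"
  unfolding hcd_def dY_nth of_nat_mult_nth2 by (auto intro!: DERIV_cmult)

lemma hcd_br: "hcd u u' t \<Longrightarrow> hcd v v' t \<Longrightarrow> hcd (\<lambda>s. br (u s) (v s)) (br u' (v t) + br (u t) v') t"
proof -
  assume a: "hcd u u' t" "hcd v v' t"
  have "hcd (\<lambda>s. br (u s) (v s)) ((fps_deriv u' * dY (v t) + fps_deriv (u t) * dY v') - (dY u' * fps_deriv (v t) + dY (u t) * fps_deriv v')) t"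
    unfolding br_def by (intro hcd_diff hcd_mult hcd_dX hcd_dY a)
  then show ?thesis by (simp add: br_def algebra_simps)
qed

text \<open>At a fixed coefficient all time derivatives of order above its total degree vanish
  identically, so Maclaurin's formula has no remainder and the coefficient is a polynomial in
  t.\<close>

lemma taylor_hcd:
  assumes D: "\<And>q t. hcd (D q) (D (Suc q) t) t" and v: "\<And>q t. vge q (D q t)"
  shows "D 0 t $ i $ j $ m $ l = (\<Sum>q\<le>i + j + m + l. t ^ q / fact q * D q 0 $ i $ j $ m $ l)"
proof -
  let ?d = "\<lambda>q t. D q t $ i $ j $ m $ l" and ?N = "i + j + m + l"
  have "\<forall>q x. DERIV (?d q) x :> ?d (Suc q) x" using D by (simp add: hcd_def)
  from Maclaurin_all_le[OF refl this, of t "Suc ?N"]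
  obtain r where "?d 0 t = (\<Sum>q<Suc ?N. ?d q 0 / fact q * t ^ q) + ?d (Suc ?N) r / fact (Suc ?N) * t ^ Suc ?N"
    by blast
  moreover have "?d (Suc ?N) r = 0" using vge_nth[OF v] by simp
  ultimately show ?thesis by (simp add: lessThan_Suc_atMost mult.commute)
qed

lemma hcd_Lp: "hcd u u' t \<Longrightarrow> hcd (\<lambda>s. Lp q H (u s)) (Lp q H u') t"
proof (induction q)
  case (Suc q)
  from hcd_br[OF Suc.IH[OF Suc.prems] hcd_const[of H]] show ?case by simp
qed simp

text \<open>Uniqueness for the linear equation u' = {u, H}. The laws of \<open>ex\<close> below
  (products, brackets, the group law, transport by canonical maps) are proved by checking that a
  candidate solves it.\<close>

lemma flow_lemma:
  assumes H: "Ham H" and u: "\<And>t. hcd u (br (u t) H) t"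
  shows "u t = ex t H (u 0)"
proof (rule fps4_eqI)
  fix i j m l
  have "Lp 0 H (u t) $ i $ j $ m $ l = (\<Sum>q\<le>i + j + m + l. t ^ q / fact q * Lp q H (u 0) $ i $ j $ m $ l)"
  proof (rule taylor_hcd[where D = "\<lambda>q s. Lp q H (u s)"])
    show "hcd (\<lambda>s. Lp q H (u s)) (Lp (Suc q) H (u t)) t" for q t
      using hcd_Lp[OF u, of q H t] by (simp add: Lp_br)
    show "vge q (Lp q H (u t))" for q t
      using vge_Lp[OF H, of 0] by simp
  qed
  then show "u t $ i $ j $ m $ l = ex t H (u 0) $ i $ j $ m $ l"
    by (simp add: ex_def)
qed

lemma hcd_ex:
  assumes H: "Ham H"
  shows "hcd (\<lambda>s. ex s H G) (br (ex t H G) H) t"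
  unfolding hcd_def
proof (intro allI)
  fix i j m l
  let ?N = "i + j + m + l" and ?c = "\<lambda>q. Lp q H G $ i $ j $ m $ l"
  have 1: "(\<lambda>s. ex s H G $ i $ j $ m $ l) = (\<lambda>s. \<Sum>q\<le>Suc ?N. s ^ q / fact q * ?c q)"
    by (rule ext) (rule ex_nth[OF H], simp)
  have 2: "br (ex t H G) H $ i $ j $ m $ l = (\<Sum>q\<le>?N. t ^ q / fact q * ?c (Suc q))"
    unfolding br_ex[OF H] ex_nth[OF H order_refl] by (simp add: Lp_br)
  have "((\<lambda>s. \<Sum>q\<le>Suc ?N. s ^ q / fact q * ?c q) has_real_derivative (\<Sum>q\<le>Suc ?N. of_nat q * t ^ (q - 1) / fact q * ?c q)) (at t)"
    by (intro DERIV_sum) (auto intro!: derivative_eq_intros)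
  also have "(\<Sum>q\<le>Suc ?N. of_nat q * t ^ (q - 1) / fact q * ?c q) = (\<Sum>q\<le>?N. t ^ q / fact q * ?c (Suc q))"
  proof -
    have "of_nat (Suc q) * t ^ (Suc q - 1) / fact (Suc q) = t ^ q / fact q" for q
      by (simp add: fact_Suc del: of_nat_Suc)
    then show ?thesis
      unfolding sum.atMost_Suc_shift[of _ ?N] by (simp only: of_nat_0 mult_zero_left div_0 add_0)
  qed
  finally show "((\<lambda>s. ex s H G $ i $ j $ m $ l) has_real_derivative br (ex t H G) H $ i $ j $ m $ l) (at t)"
    unfolding 1 2 .
qed

lemma ex_kernel: "Ham H \<Longrightarrow> br K H = 0 \<Longrightarrow> ex t H K = K"
  using flow_lemma[of H "\<lambda>_. K" t] by simp

lemma ex_mult: "Ham H \<Longrightarrow> ex t H (F * G) = ex t H F * ex t H G"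
  using flow_lemma[of H "\<lambda>t. ex t H F * ex t H G" t] hcd_mult[OF hcd_ex[of H F] hcd_ex[of H G]]
  by (simp add: br_mult_left)

lemma ex_power: "Ham H \<Longrightarrow> ex t H (F ^ k) = ex t H F ^ k"
  by (induction k) (simp_all add: ex_mult ex_kernel)

lemma ex_br: "Ham H \<Longrightarrow> ex t H (br F G) = br (ex t H F) (ex t H G)"
  using flow_lemma[of H "\<lambda>t. br (ex t H F) (ex t H G)" t] hcd_br[OF hcd_ex[of H F] hcd_ex[of H G]]
  by (simp add: br_jacobi[of _ _ H])

lemma ex_group: "Ham H \<Longrightarrow> ex s H (ex t H G) = ex (s + t) H G"
proof -
  assume H: "Ham H"
  have "hcd (\<lambda>s. ex (s + t) H G) (br (ex (r + t) H G) H) r" for r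
    unfolding hcd_def
  proof (intro allI)
    fix i j m l
    have "((\<lambda>s. ex s H G $ i $ j $ m $ l) has_real_derivative br (ex (r + t) H G) H $ i $ j $ m $ l) (at (r + t))"
      using hcd_ex[OF H, of G "r + t"] by (simp add: hcd_def)
    then show "((\<lambda>s. ex (s + t) H G $ i $ j $ m $ l) has_real_derivative br (ex (r + t) H G) H $ i $ j $ m $ l) (at r)"
      by (simp add: DERIV_shift)
  qed
  from flow_lemma[OF H this, of s] show ?thesis by simp
qed

lemma ex_scale: "Ham H \<Longrightarrow> ex t (real_const c * H) G = ex (c * t) H G"
proof -
  assume H: "Ham H"
  have "Lp q (real_const c * H) G = real_const (c ^ q) * Lp q H G" for q
    by (induction q) (simp_all add: rc_hom br_rc_left br_rc_right mult.assoc mult.left_commute)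
  then show ?thesis
    by (intro fps4_eqI) (simp add: ex_def power_mult_distrib mult_ac)
qed

lemma ex_inverse: "Ham H \<Longrightarrow> ex 1 H (ex 1 (- H) G) = G" "Ham H \<Longrightarrow> ex 1 (- H) (ex 1 H G) = G"
  using ex_scale[of H 1 "-1"] by (simp_all add: rc_hom ex_group)

lemma ex_spt:
  assumes "Ham H" "\<And>G. spt A G \<Longrightarrow> spt A (br G H)" "spt A G"
  shows "spt A (ex t H G)"
proof -
  have "spt A (Lp q H G)" for q by (induction q) (auto intro: assms)
  then have "ex t H G $ i $ j $ m $ l = 0" if "\<not> A i j m l" for i j m l
  proof -
    have "Lp q H G $ i $ j $ m $ l = 0" for q
      by (rule sptD[of A]) (use that \<open>\<And>q. spt A (Lp q H G)\<close> in auto)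
    then show ?thesis by (simp add: ex_def)
  qed
  then show ?thesis unfolding spt_def by blast
qed

section \<open>Canonical maps and Hamiltonian flows\<close>

lemma vanishes_iff: "vanishes_at_origin f \<longleftrightarrow> dge 1 (fst f) \<and> dge 1 (snd f)"
  by (auto simp: vanishes_at_origin_def dge_1_iff)

lemma subst2_nth_ge:
  assumes "dge 1 X" "dge 1 Y" "a + b \<le> N"
  shows "subst2 G X Y $ a $ b = (\<Sum>i\<le>N. \<Sum>j\<le>N. G $ i $ j * (X ^ i * Y ^ j) $ a $ b)"
proof -
  have z: "(X ^ i * Y ^ j) $ a $ b = 0" if "a + b < i \<or> a + b < j" for i j
    using dge_powers[OF assms(1,2), of i j] that by (auto simp: dge_def)
  have "(\<Sum>i\<le>N. \<Sum>j\<le>N. G $ i $ j * (X ^ i * Y ^ j) $ a $ b)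
    = (\<Sum>i\<le>a + b. \<Sum>j\<le>N. G $ i $ j * (X ^ i * Y ^ j) $ a $ b)"
    by (rule sum.mono_neutral_right) (use assms(3) z in auto)
  also have "\<dots> = (\<Sum>i\<le>a + b. \<Sum>j\<le>a + b. G $ i $ j * (X ^ i * Y ^ j) $ a $ b)"
    by (rule sum.cong[OF refl], rule sum.mono_neutral_right) (use assms(3) z in auto)
  finally show ?thesis by (simp add: subst2_nth)
qed

lemma hcd_cc: "hcd (\<lambda>s. cc (v s $ i $ j)) (cc (v' $ i $ j)) t" if "hcd v v' t"
  using that unfolding hcd_def by (auto simp: cc_nth)

text \<open>The chain rule in time with both the outer series and the inserted ones moving. A
  coefficient involves finitely many monomials only, so a finite sum is differentiated and then
  compared with the two partial derivatives by \<open>coef_ext\<close>.\<close>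

lemma hcd_subst2:
  assumes u: "hcd u u' t" and XY: "\<And>s. dge 1 (X s)" "\<And>s. dge 1 (Y s)" and X: "hcd X X' t" and Y: "hcd Y Y' t"
  shows "hcd (\<lambda>s. subst2 (u s) (X s) (Y s)) (subst2 u' (X t) (Y t)
    + (subst2 (fps_deriv (u t)) (X t) (Y t) * X' + subst2 (dY (u t)) (X t) (Y t) * Y')) t"
  unfolding hcd_def
proof (intro allI)
  fix a b m l
  \<comment> \<open>One more than a + b, because the derivative of X^i Y^j is only of order i + j -
    1.\<close>
  define N where "N = Suc (a + b)"
  define P where "P s = (\<Sum>i\<le>N. \<Sum>j\<le>N. cc (u s $ i $ j) * (X s ^ i * Y s ^ j))" for s
  define D where "D i j = (of_nat i * X t ^ (i - 1) * X') * Y t ^ j + X t ^ i * (of_nat j * Y t ^ (j - 1) * Y')" for i j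
  define Q where "Q T = (\<Sum>i\<le>N. \<Sum>j\<le>N. cc (T $ i $ j) * D i j)" for T :: plane_series
  have "hcd P (\<Sum>i\<le>N. \<Sum>j\<le>N. cc (u' $ i $ j) * (X t ^ i * Y t ^ j) + cc (u t $ i $ j) * D i j) t"
    unfolding P_def D_def by (intro hcd_sum hcd_mult hcd_cc hcd_power u X Y)
  then have "((\<lambda>s. P s $ a $ b $ m $ l) has_real_derivative
      (\<Sum>i\<le>N. \<Sum>j\<le>N. cc (u' $ i $ j) * (X t ^ i * Y t ^ j) + cc (u t $ i $ j) * D i j) $ a $ b $ m $ l) (at t)"
    by (simp add: hcd_def)
  moreover have P: "P s $ a $ b = subst2 (u s) (X s) (Y s) $ a $ b" for s
    by (subst subst2_nth_ge[of _ _ _ _ N]) (use XY in \<open>auto simp: P_def fps_sum_nth N_def\<close>)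
  moreover have "(\<Sum>i\<le>N. \<Sum>j\<le>N. cc (u' $ i $ j) * (X t ^ i * Y t ^ j)) $ a $ b = subst2 u' (X t) (Y t) $ a $ b"
    by (subst subst2_nth_ge[of _ _ _ _ N]) (use XY in \<open>auto simp: fps_sum_nth N_def\<close>)
  moreover have "Q (u t) $ a $ b = (subst2 (fps_deriv (u t)) (X t) (Y t) * X' + subst2 (dY (u t)) (X t) (Y t) * Y') $ a $ b"
  proof (rule coef_ext[where T = "u t" and k = "Suc (Suc (a + b))"])
    fix T :: plane_series assume T: "dge (Suc (Suc (a + b))) T"
    have D: "D i j $ a $ b = 0" if "Suc (a + b) < i + j" for i j
    proof -
      have "dge (i - 1 + j) (X t ^ (i - 1) * Y t ^ j)" "dge (i + (j - 1)) (X t ^ i * Y t ^ (j - 1))"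
        using XY by (auto intro!: dge_powers)
      from dge_mult[OF this(1) dge_0(2), of "of_nat i * X'"] dge_mult[OF this(2) dge_0(2), of "of_nat j * Y'"]
      have "dge (i + j - 1) (of_nat i * X t ^ (i - 1) * X' * Y t ^ j)" "dge (i + j - 1) (X t ^ i * (of_nat j * Y t ^ (j - 1) * Y'))"
        by (auto simp: mult_ac elim: dge_mono)
      then have "dge (i + j - 1) (D i j)" unfolding D_def by (rule dge_add)
      with that show ?thesis by (auto simp: dge_def)
    qed
    have "T $ i $ j * D i j $ a $ b = 0" for i j
      using T D[of i j] by (cases "i + j < Suc (Suc (a + b))") (auto simp: dge_def)
    then show "Q T $ a $ b = 0" unfolding Q_def fps_sum_nth cc_mult_nth by (intro sum.neutral ballI)
    have "(subst2 (fps_deriv T) (X t) (Y t) * X') $ a $ b = 0" "(subst2 (dY T) (X t) (Y t) * Y') $ a $ b = 0"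
      using dge_mult[OF subst2_dge[OF XY(1) XY(2) dge_dX[OF T]] dge_0(2)[of X'], of t t]
        dge_mult[OF subst2_dge[OF XY(1) XY(2) dge_dY[OF T]] dge_0(2)[of Y'], of t t]
      by (simp_all add: dge_def)
    then show "(subst2 (fps_deriv T) (X t) (Y t) * X' + subst2 (dY T) (X t) (Y t) * Y') $ a $ b = 0" by simp
  next
    fix c :: par_series and i j
    have m: "fps_deriv (mono2 c i j) = mono2 (c * of_nat i) (i - 1) j" "dY (mono2 c i j) = mono2 (c * of_nat j) i (j - 1)"
      by (rule fps2_eqI; cases i; cases j; auto simp: fps_deriv_nth2 dY_nth mono2_nth)+
    have cm: "cc (c * of_nat i) = cc c * of_nat i" for i
      unfolding cc_mult by (simp add: cc_def fps_of_nat)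
    have "subst2 (fps_deriv (mono2 c i j)) (X t) (Y t) * X' + subst2 (dY (mono2 c i j)) (X t) (Y t) * Y' = cc c * D i j"
      unfolding m subst2_mono2[OF XY] cm D_def by (simp add: algebra_simps)
    moreover have "Q (mono2 c i j) $ a $ b = (cc c * D i j) $ a $ b"
    proof -
      have "Q (mono2 c i j) = (\<Sum>i'\<le>N. \<Sum>j'\<le>N. if i' = i then if j' = j then cc c * D i j else 0 else 0)"
        unfolding Q_def by (intro sum.cong) (auto simp: mono2_nth)
      also have "\<dots> = (\<Sum>i'\<le>N. if i' = i then (\<Sum>j'\<le>N. if j' = j then cc c * D i j else 0) else 0)"
        by (intro sum.cong) auto
      also have "\<dots> = (if i \<le> N \<and> j \<le> N then cc c * D i j else 0)" by simp
      finally have 1: "Q (mono2 c i j) = (if i \<le> N \<and> j \<le> N then cc c * D i j else 0)" .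
      show ?thesis
      proof (cases "i \<le> N \<and> j \<le> N")
        case False
        then have "Suc (a + b) < i + j \<or> (i = 0 \<or> j = 0) \<and> Suc (a + b) < i + j" by (auto simp: N_def)
        then have ij: "Suc (a + b) < i + j" by auto
        have "dge (i - 1 + j) (X t ^ (i - 1) * Y t ^ j)" "dge (i + (j - 1)) (X t ^ i * Y t ^ (j - 1))"
          using XY by (auto intro!: dge_powers)
        from dge_mult[OF this(1) dge_0(2), of "of_nat i * X'"] dge_mult[OF this(2) dge_0(2), of "of_nat j * Y'"]
        have "dge (i + j - 1) (of_nat i * X t ^ (i - 1) * X' * Y t ^ j)" "dge (i + j - 1) (X t ^ i * (of_nat j * Y t ^ (j - 1) * Y'))"
          by (auto simp: mult_ac elim: dge_mono)
        then have "dge (i + j - 1) (D i j)" unfolding D_def by (rule dge_add)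
        with ij have "D i j $ a $ b = 0" by (auto simp: dge_def)
        with 1 False show ?thesis by simp
      qed (simp add: 1)
    qed
    ultimately show "Q (mono2 c i j) $ a $ b = (subst2 (fps_deriv (mono2 c i j)) (X t) (Y t) * X'
        + subst2 (dY (mono2 c i j)) (X t) (Y t) * Y') $ a $ b" by simp
  qed (simp_all add: Q_def subst2_add dY_add ring_distribs cc_add sum.distrib)
  ultimately show "((\<lambda>s. subst2 (u s) (X s) (Y s) $ a $ b $ m $ l) has_real_derivative
     (subst2 u' (X t) (Y t) + (subst2 (fps_deriv (u t)) (X t) (Y t) * X' + subst2 (dY (u t)) (X t) (Y t) * Y')) $ a $ b $ m $ l) (at t)"
    by (simp add: sum.distrib Q_def)
qed

text \<open>Invertibility is left out, since it plays no part in transporting brackets;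
  \<open>formal_canonical_iff\<close> adds it in terms of pullbacks.\<close>

definition canon :: "formal_map \<Rightarrow> bool" where
  "canon f \<longleftrightarrow> vanishes_at_origin f \<and> br (fst f) (snd f) = 1"

lemma formal_jacobian_eq: "formal_jacobian f = br (fst f) (snd f)"
  by (simp add: formal_jacobian_def br_def defs_eq)

lemma canonD: "canon f \<Longrightarrow> dge 1 (fst f)" "canon f \<Longrightarrow> dge 1 (snd f)" "canon f \<Longrightarrow> br (fst f) (snd f) = 1"
  by (auto simp: canon_def vanishes_iff)

lemma pb_ring:
  assumes "vanishes_at_origin f"
  shows "pb f (F + G) = pb f F + pb f G" "pb f (F - G) = pb f F - pb f G" "pb f (- G) = - pb f G"
    "pb f (F * G) = pb f F * pb f G" "pb f (cc c) = cc c" "pb f 0 = 0" "pb f 1 = 1" "pb f (F ^ k) = pb f F ^ k"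
    "pb f fps_X = fst f" "pb f yy = snd f" "pb f (real_const r) = real_const r"
  using assms unfolding vanishes_iff
  by (auto simp: pb_def subst2_add subst2_diff subst2_uminus subst2_mult subst2_cc subst2_1 subst2_power subst2_X subst2_Y defs_eq)

lemma pb_br: "canon f \<Longrightarrow> pb f (br F G) = br (pb f F) (pb f G)"
  using br_subst2[of "fst f" "snd f" F G] canonD[of f] by (simp add: pb_def)

lemma pb_dge: "vanishes_at_origin f \<Longrightarrow> dge k G \<Longrightarrow> dge k (pb f G)"
  unfolding pb_def vanishes_iff by (auto intro: subst2_dge)

lemma spt_subst2:
  assumes "\<And>i j. spt C (cc (G $ i $ j) * (X ^ i * Y ^ j))"
  shows "spt C (subst2 G X Y)"
  unfolding spt_def
proof (intro allI impI)
  fix a b m l assume "subst2 G X Y $ a $ b $ m $ l \<noteq> 0"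
  then have "(\<Sum>i\<le>a+b. \<Sum>j\<le>a+b. (cc (G $ i $ j) * (X ^ i * Y ^ j)) $ a $ b $ m $ l) \<noteq> 0"
    by (simp add: subst2_nth fps_sum_nth)
  then obtain i j where "(cc (G $ i $ j) * (X ^ i * Y ^ j)) $ a $ b $ m $ l \<noteq> 0"
    by (rule sum2_nzE)
  with assms[of i j] show "C a b m l" by (auto simp: spt_def)
qed

lemma vge_coef:
  assumes "vge k G" shows "vge (k - (i + j)) (cc (G $ i $ j))"
  unfolding vge_def spt_def
proof (intro allI impI)
  fix a b m l assume "cc (G $ i $ j) $ a $ b $ m $ l \<noteq> 0"
  then have "a = 0" "b = 0" "G $ i $ j $ m $ l \<noteq> 0" by (auto simp: cc_nth split: if_splits)
  with assms have "k \<le> i + j + m + l" by (auto simp: vge_def spt_def)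
  then show "k - (i + j) \<le> a + b + m + l" by simp
qed

lemma pb_vge:
  assumes f: "vanishes_at_origin f" and G: "vge k G"
  shows "vge k (pb f G)"
  unfolding pb_def vge_def
proof (rule spt_subst2, fold vge_def)
  fix i j
  have "vge 1 (fst f)" "vge 1 (snd f)" using f by (auto simp: vanishes_iff dest: dge_1_vge)
  then have "vge ((k - (i + j)) + (i + j)) (cc (G $ i $ j) * (fst f ^ i * snd f ^ j))"
    by (intro vge_mult vge_power vge_coef G)
  then show "vge k (cc (G $ i $ j) * (fst f ^ i * snd f ^ j))" by (rule vge_mono) simp
qed

lemma pb_Ham: "vanishes_at_origin f \<Longrightarrow> Ham H \<Longrightarrow> Ham (pb f H)"
  by (simp add: Ham_iff pb_dge pb_vge)

lemma pb_fcompose: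
  "vanishes_at_origin f \<Longrightarrow> vanishes_at_origin g \<Longrightarrow> pb (fcompose f g) G = pb g (pb f G)"
  unfolding pb_def fcompose_def vanishes_iff by (simp add: subst2_assoc)

lemma fcompose_eq: "fcompose f g = (pb g (fst f), pb g (snd f))"
  by (simp add: fcompose_def pb_def)

lemma vanishes_fcompose: "vanishes_at_origin f \<Longrightarrow> vanishes_at_origin g \<Longrightarrow> vanishes_at_origin (fcompose f g)"
  unfolding fcompose_eq by (simp add: vanishes_iff pb_dge[unfolded vanishes_iff])

lemma canon_fcompose: "canon f \<Longrightarrow> canon g \<Longrightarrow> canon (fcompose f g)"
  unfolding canon_def by (simp add: vanishes_fcompose) (simp add: fcompose_eq pb_br[unfolded canon_def, symmetric] pb_ring)

lemma fid_eq: "fid = (fps_X, yy)"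
  by (simp add: fid_def defs_eq)

lemma dge_vars: "dge 1 (fps_X :: 'a::comm_ring_1 fps fps)" "dge 1 (yy :: 'a::comm_ring_1 fps fps)"
  by (simp_all add: dge_1_iff yy_def)

lemma br_vars: "br fps_X H = dY H" "br yy H = - fps_deriv H"
  by (simp_all add: br_def)

lemma fid_canon: "canon fid" "vanishes_at_origin fid"
  using dge_vars by (auto simp: canon_def fid_eq vanishes_iff br_vars)

lemma pb_fid [simp]: "pb fid G = G"
  by (simp add: pb_def fid_eq subst2_id)

lemma pb_cong: "fst f = fst g \<Longrightarrow> snd f = snd g \<Longrightarrow> pb f G = pb g G"
  by (simp add: pb_def)

text \<open>An automorphism of the series ring is the pullback by the map formed by its values on
  the coordinates.\<close>

definition E :: "real \<Rightarrow> plane_series \<Rightarrow> formal_map" where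
  "E t H = (ex t H fps_X, ex t H yy)"

lemma dge_br_Ham: "Ham H \<Longrightarrow> dge k G \<Longrightarrow> dge k (br G H)"
  unfolding dge_spt Ham_def by (rule spt_br, assumption, assumption, linarith)

lemma dge_ex: "Ham H \<Longrightarrow> dge k G \<Longrightarrow> dge k (ex t H G)"
  unfolding dge_spt by (rule ex_spt) (auto simp: dge_br_Ham[unfolded dge_spt])

lemma vge_ex: "Ham H \<Longrightarrow> vge k G \<Longrightarrow> vge k (ex t H G)"
  unfolding vge_def by (rule ex_spt) (auto intro: vge_mono[unfolded vge_def] vge_br_Ham[unfolded vge_def])

lemma E_vanishes: "Ham H \<Longrightarrow> vanishes_at_origin (E t H)"
  unfolding vanishes_iff E_def by (simp add: dge_ex dge_vars del: One_nat_def)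

lemma E_canon: "Ham H \<Longrightarrow> canon (E t H)"
  using ex_br[of H t fps_X yy] ex_kernel[of H 1 t] by (simp add: canon_def E_vanishes) (simp add: E_def br_vars)

lemma ex_cc: "Ham H \<Longrightarrow> ex t H (cc c) = cc c"
  by (simp add: ex_kernel)

text \<open>Both sides are additive, multiplicative and respect the order in (x,y), and they agree
  on coordinates and constants. This turns the Lie series into an actual substitution.\<close>

lemma ex_pb:
  assumes H: "Ham H"
  shows "ex t H G = pb (E t H) G"
proof (rule fps2_eqI)
  fix a b
  note XY = E_vanishes[OF H, of t, unfolded vanishes_iff]
  have nz: "dge (Suc (a + b)) T \<Longrightarrow> T $ a $ b = 0" for T :: plane_series by (simp add: dge_def)
  show "ex t H G $ a $ b = pb (E t H) G $ a $ b"
  proof (rule coef_ext[where T = G and k = "Suc (a + b)"])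
    show "ex t H (mono2 c i j) $ a $ b = pb (E t H) (mono2 c i j) $ a $ b" for c i j
      using XY by (simp add: pb_def subst2_mono2) (simp add: mono2_def ex_mult[OF H] ex_power[OF H] ex_cc[OF H] E_def)
  qed (use XY in \<open>auto simp: ex_add pb_def subst2_add intro!: nz dge_ex[OF H] subst2_dge\<close>)
qed

lemma E_flow:
  assumes H: "Ham H"
  shows "formal_ham_flow H (\<lambda>t. E t H)"
proof -
  have "hcd (\<lambda>s. fst (E s H)) (subst2 (dY H) (fst (E t H)) (snd (E t H))) t" for t
    using hcd_ex[OF H, of fps_X t] by (simp add: E_def br_ex[OF H] br_vars ex_pb[OF H, of t "dY H"] pb_def)
  moreover have "hcd (\<lambda>s. snd (E s H)) (subst2 (- fps_deriv H) (fst (E t H)) (snd (E t H))) t" for t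
    using hcd_ex[OF H, of yy t] by (simp add: E_def br_ex[OF H] br_vars ex_pb[OF H, of t "- fps_deriv H"] pb_def)
  moreover have "E 0 H = fid" by (simp add: E_def fid_eq)
  ultimately show ?thesis
    using E_vanishes[OF H] by (simp add: formal_ham_flow_def hcd_def defs_eq)
qed

text \<open>\<open>flow_lemma\<close> does not apply directly: for an arbitrary flow the bracket
  with H appears inside the pullback, not outside. Iterating d/ds of the pullback of G as the
  pullback of {G, H} still yields every time derivative, and Taylor's formula at time 0, where the
  map is the identity, gives the Lie series.\<close>

lemma flow_unique:
  assumes H: "Ham H" and \<Phi>: "formal_ham_flow H \<Phi>"
  shows "\<Phi> t = E t H"
proof -
  have v: "vanishes_at_origin (\<Phi> s)" and 0: "\<Phi> 0 = fid" for s using \<Phi> by (auto simp: formal_ham_flow_def)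
  have X: "hcd (\<lambda>s. fst (\<Phi> s)) (pb (\<Phi> s) (dY H)) s" and Y: "hcd (\<lambda>s. snd (\<Phi> s)) (pb (\<Phi> s) (- fps_deriv H)) s" for s
    using \<Phi> by (auto simp: formal_ham_flow_def hcd_def pb_def defs_eq)
  have XY: "dge 1 (fst (\<Phi> s))" "dge 1 (snd (\<Phi> s))" for s using v[of s] by (auto simp: vanishes_iff)
  have d: "hcd (\<lambda>s. pb (\<Phi> s) G) (pb (\<Phi> s) (br G H)) s" for G s
    using hcd_subst2[OF hcd_const XY X Y, of G s]
    by (simp add: pb_def br_def subst2_mult[OF XY] subst2_diff subst2_uminus)
  have *: "pb (\<Phi> t) G = ex t H G" for G
  proof (rule fps4_eqI)
    fix i j m l
    have "pb (\<Phi> t) (Lp 0 H G) $ i $ j $ m $ l = (\<Sum>q\<le>i + j + m + l. t ^ q / fact q * pb (\<Phi> 0) (Lp q H G) $ i $ j $ m $ l)"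
    proof (rule taylor_hcd[where D = "\<lambda>q s. pb (\<Phi> s) (Lp q H G)"])
      show "hcd (\<lambda>s. pb (\<Phi> s) (Lp q H G)) (pb (\<Phi> t) (Lp (Suc q) H G)) t" for q t
        using d[of "Lp q H G"] by simp
      show "vge q (pb (\<Phi> t) (Lp q H G))" for q t
        using pb_vge[OF v vge_Lp[OF H, of 0]] by simp
    qed
    then show "pb (\<Phi> t) G $ i $ j $ m $ l = ex t H G $ i $ j $ m $ l"
      by (simp add: ex_def 0)
  qed
  from *[of fps_X] *[of yy] show ?thesis
    by (simp add: pb_ring[OF v] E_def prod_eq_iff)
qed

lemma hcd_pb: "vanishes_at_origin f \<Longrightarrow> hcd u u' t \<Longrightarrow> hcd (\<lambda>s. pb f (u s)) (pb f u') t"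
  using hcd_subst2[of u u' t "\<lambda>_. fst f" "\<lambda>_. snd f", OF _ _ _ hcd_const hcd_const]
  by (simp add: pb_def vanishes_iff)

text \<open>Canonical maps transport flows: the left side solves the linear equation of the
  transported Hamiltonian.\<close>

lemma pb_ex:
  assumes f: "canon f" and H: "Ham H"
  shows "pb f (ex t H G) = ex t (pb f H) (pb f G)"
proof -
  have v: "vanishes_at_origin f" using f by (simp add: canon_def)
  have "hcd (\<lambda>t. pb f (ex t H G)) (br (pb f (ex s H G)) (pb f H)) s" for s
    unfolding pb_br[OF f, symmetric] by (rule hcd_pb[OF v hcd_ex[OF H]])
  from flow_lemma[OF pb_Ham[OF v H] this, of t] show ?thesis by simp
qed

lemma spt_nz: "spt A T \<Longrightarrow> T $ i $ j $ m $ l \<noteq> 0 \<Longrightarrow> A i j m l"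
  by (simp add: spt_def)

lemma spt_conj: "spt A T \<Longrightarrow> spt B T \<Longrightarrow> spt (\<lambda>i j m l. A i j m l \<and> B i j m l) T"
  by (simp add: spt_def)

lemma spt_br':
  fixes S T :: "'a::comm_ring_1 fps fps fps fps"
  assumes "spt A S" "spt B T"
    and "\<And>i j m l i' j' m' l' a b. A i j m l \<Longrightarrow> B i' j' m' l' \<Longrightarrow> i + i' = Suc a \<Longrightarrow> j + j' = Suc b \<Longrightarrow>
       C a b (m + m') (l + l')"
  shows "spt C (br S T)"
  by (rule spt_br[OF assms(1,2)]) (rule assms(3))

lemma diff_rearrange:
  "a = b + S \<Longrightarrow> a = P - Q \<Longrightarrow> X - Y - b - S = (X - P) - (Y - Q)" for a b :: "'a::ab_group_add"
proof -
  assume "a = b + S" "a = P - Q"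
  then have "X - Y - (b + S) = X - Y - (P - Q)" by simp
  then show ?thesis by (simp add: algebra_simps)
qed

text \<open>Abstract decreasing filtrations, closed under limits in the total degree.\<close>

section \<open>Filtrations\<close>

definition filtr :: "(nat \<Rightarrow> plane_series \<Rightarrow> bool) \<Rightarrow> bool" where
  "filtr F \<longleftrightarrow> (\<forall>k S T. F k S \<longrightarrow> F k T \<longrightarrow> F k (S + T)) \<and> (\<forall>k c T. F k T \<longrightarrow> F k (real_const c * T)) \<and>
     (\<forall>k l T. F l T \<longrightarrow> k \<le> l \<longrightarrow> F k T) \<and> (\<forall>k T. (\<forall>N. \<exists>S. F k S \<and> vge N (T - S)) \<longrightarrow> F k T)"

lemma filtrD:
  assumes "filtr F"
  shows "F k S \<Longrightarrow> F k T \<Longrightarrow> F k (S + T)" "F k T \<Longrightarrow> F k (real_const c * T)" "F l T \<Longrightarrow> k \<le> l \<Longrightarrow> F k T"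
    "(\<And>N. \<exists>S. F k S \<and> vge N (T - S)) \<Longrightarrow> F k T" "F k S \<Longrightarrow> F k T \<Longrightarrow> F k (S - T)" "F k S \<Longrightarrow> F k (- S)"
proof -
  show a: "F k S \<Longrightarrow> F k T \<Longrightarrow> F k (S + T)" and b: "F k T \<Longrightarrow> F k (real_const c * T)" and "F l T \<Longrightarrow> k \<le> l \<Longrightarrow> F k T"
    and "(\<And>N. \<exists>S. F k S \<and> vge N (T - S)) \<Longrightarrow> F k T" for k S T c
    using assms unfolding filtr_def by meson+
  show m: "F k S \<Longrightarrow> F k (- S)" for S using b[of k S "-1"] by (simp add: rc_hom)
  show "F k S \<Longrightarrow> F k T \<Longrightarrow> F k (S - T)" using a[of k S "- T"] m[of T] by simp
qed

text \<open>The index set is nonempty because a filtration step is not assumed to contain 0.\<close>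

lemma filtr_sum:
  assumes "filtr F" "\<And>i. i \<in> I \<Longrightarrow> F k (f i)" "finite I" "I \<noteq> {}"
  shows "F k (\<Sum>i\<in>I. f i)"
  using assms(3,4,2) by (induction rule: finite_ne_induct) (auto intro: filtrD[OF assms(1)])

lemma filtr_spt:
  assumes "\<And>k l a b c d. l \<ge> k \<Longrightarrow> A l a b c d \<Longrightarrow> A k a b c d"
  shows "filtr (\<lambda>k. spt (A k))"
  unfolding filtr_def
proof (intro conjI allI impI)
  fix k T assume *: "\<forall>N. \<exists>S. spt (A k) S \<and> vge N (T - S)"
  show "spt (A k) T" unfolding spt_def
  proof (intro allI impI)
    fix a b c d assume nz: "T $ a $ b $ c $ d \<noteq> 0"
    from * obtain S where "spt (A k) S" "vge (Suc (a + b + c + d)) (T - S)" by blast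
    then have "spt (A k) S" "S $ a $ b $ c $ d = T $ a $ b $ c $ d"
      using vge_nth[of _ "T - S" a b c d] by auto
    with nz show "A k a b c d" by (auto simp: spt_def)
  qed
qed (auto simp: spt_add spt_rc intro: assms spt_mono)

text \<open>The tail of the exponential series lies in a filtration step as soon as its terms do.\<close>

lemma ex_tail:
  assumes F: "filtr F" and H: "Ham H" and c: "\<And>q. m \<le> q \<Longrightarrow> F k (Lp q H G)"
  shows "F k (ex 1 H G - (\<Sum>q<m. real_const (1 / fact q) * Lp q H G))"
proof (rule filtrD(4)[OF F])
  fix N
  let ?f = "\<lambda>q. real_const (1 / fact q) * Lp q H G"
  have "F k (sum ?f {m..m + N})"
    by (rule filtr_sum[OF F]) (auto intro: filtrD(2)[OF F] c)
  moreover have "vge N (ex 1 H G - (\<Sum>q<m. ?f q) - sum ?f {m..m + N})"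
  proof -
    have "{..m + N} = {..<m} \<union> {m..m + N}" by auto
    then have "sum ?f {..m + N} = (\<Sum>q<m. ?f q) + sum ?f {m..m + N}"
      by (simp add: sum.union_disjoint ivl_disj_int)
    with ex_partial[OF H, of "m + N" 1 G] show ?thesis
      by (auto simp: algebra_simps elim: vge_mono)
  qed
  ultimately show "\<exists>S. F k S \<and> vge N (ex 1 H G - (\<Sum>q<m. ?f q) - S)" by blast
qed

lemma ex_filtr_step:
  assumes F: "filtr F" and H: "Ham H" and L: "\<And>k T. F k T \<Longrightarrow> F (k + 1) (br T H)" and G: "F k G"
  shows "F (k + 1) (ex 1 H G - G)" "F k (ex 1 H G)"
proof -
  have Lp: "F (k + q) (Lp q H G)" for q
    by (induction q) (use L[of "k + _"] G in auto)
  have "F (k + 1) (Lp q H G)" if "1 \<le> q" for q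
    using filtrD(3)[OF F Lp[of q], of "k + 1"] that by simp
  from ex_tail[OF F H this, of 1] show 1: "F (k + 1) (ex 1 H G - G)" by (simp add: rc_hom)
  show "F k (ex 1 H G)" using filtrD(1)[OF F filtrD(3)[OF F 1, of k] G] by simp
qed

text \<open>Nothing is known about G itself, only about its first bracket; the terms of the Lie
  series from q = 2 on then gain one step over that bracket.\<close>

lemma ex_filtr_step2:
  assumes F: "filtr F" and H: "Ham H" and L: "\<And>k T. F k T \<Longrightarrow> F (k + 1) (br T H)" and G: "F k (br G H)"
  shows "F (k + 1) (ex 1 H G - G - br G H)"
proof -
  have Lp: "F (k + q) (Lp (Suc q) H G)" for q
    by (induction q) (use L[of "k + _"] G in auto)
  have "F (k + 1) (Lp q H G)" if "2 \<le> q" for q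
  proof -
    have "Suc (q - 1) = q" "k + 1 \<le> k + (q - 1)" using that by auto
    with filtrD(3)[OF F Lp[of "q - 1"], of "k + 1"] show ?thesis by simp
  qed
  from ex_tail[OF F H this, of 2] show ?thesis by (simp add: rc_hom numeral_2_eq_2 lessThan_Suc diff_diff_eq add.commute)
qed

text \<open>First-order variation of the exponential in its generator.\<close>

lemma ex_variation:
  assumes F: "filtr F" and H: "Ham H" and h: "Ham h"
    and L: "\<And>k T. F k T \<Longrightarrow> F (k + 1) (br T H)" and l: "\<And>k T. F k T \<Longrightarrow> F (k + s) (br T h)" and s: "1 \<le> s"
    and G: "F k G"
  shows "F (k + s + 1) (ex 1 (H + h) G - ex 1 H G - br G h)"
proof -
  have L': "F (k + 1) (br T (H + h))" if "F k T" for k T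
    unfolding br_add_right using L[OF that] filtrD(3)[OF F l[OF that], of "k + 1"] s by (auto intro: filtrD[OF F])
  have Lp: "F (k + q) (Lp q H G)" for q
    by (induction q) (use L[of "k + _"] G in auto)
  have Lp': "F (k + q) (Lp q (H + h) G)" for q
    by (induction q) (use L'[of "k + _"] G in auto)
  \<comment> \<open>Two iterated brackets differ by terms containing h at least once; one bracket
    with h gains s, each of the others at least 1.\<close>
  have D: "F (k + q + s) (Lp (Suc q) (H + h) G - Lp (Suc q) H G)" for q
  proof (induction q)
    case 0
    show ?case using l[OF G] by (simp add: br_add_right)
  next
    case (Suc q)
    have "Lp (Suc (Suc q)) (H + h) G - Lp (Suc (Suc q)) H G
      = br (Lp (Suc q) (H + h) G - Lp (Suc q) H G) (H + h) + br (Lp (Suc q) H G) h"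
      by (simp add: br_diff_left br_add_right)
    moreover have "F (k + Suc q + s) \<dots>"
      using L'[OF Suc.IH] l[OF Lp[of "Suc q"]] by (intro filtrD(1)[OF F]) auto
    ultimately show ?case by (simp only:)
  qed
  show ?thesis
  proof (rule filtrD(4)[OF F])
    fix N
    let ?f = "\<lambda>H q. real_const (1 / fact q) * Lp q H G"
    let ?d = "\<lambda>q. real_const (1 / fact q) * (Lp q (H + h) G - Lp q H G)"
    have "F (k + s + 1) (sum ?d {2..2 + N})"
    proof (rule filtr_sum[OF F])
      fix q assume "q \<in> {2..2 + N}"
      then have "Suc (q - 1) = q" "k + s + 1 \<le> k + (q - 1) + s" by auto
      with filtrD(3)[OF F D[of "q - 1"], of "k + s + 1"] show "F (k + s + 1) (?d q)"
        by (auto intro: filtrD(2)[OF F])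
    qed auto
    moreover have "vge N (ex 1 (H + h) G - ex 1 H G - br G h - sum ?d {2..2 + N})"
    proof -
      have "{..2 + N} = insert 0 (insert 1 {2..2 + N})" by auto
      then have "sum ?d {..2 + N} = br G h + sum ?d {2..2 + N}"
        by (simp add: br_add_right rc_hom)
      moreover have "sum ?d {..2 + N} = sum (?f (H + h)) {..2 + N} - sum (?f H) {..2 + N}"
        by (simp add: right_diff_distrib sum_subtractf)
      ultimately have "ex 1 (H + h) G - ex 1 H G - br G h - sum ?d {2..2 + N}
         = (ex 1 (H + h) G - sum (?f (H + h)) {..2 + N}) - (ex 1 H G - sum (?f H) {..2 + N})"
        by (rule diff_rearrange)
      moreover have "vge N (ex 1 K G - sum (?f K) {..2 + N})" if "Ham K" for K
        using vge_mono[OF ex_partial[OF that, of "2 + N" 1 G], of N] by (simp only: power_one le_SucI le_add2)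
      from vge_diff[OF this[OF Ham_add[OF H h]] this[OF H]]
      have "vge N ((ex 1 (H + h) G - sum (?f (H + h)) {..2 + N}) - (ex 1 H G - sum (?f H) {..2 + N}))" .
      ultimately show ?thesis by (simp only:)
    qed
    ultimately show "\<exists>S. F (k + s + 1) S \<and> vge N (ex 1 (H + h) G - ex 1 H G - br G h - S)" by blast
  qed
qed

lemma filtr_vge: "filtr vge"
  unfolding vge_def by (rule filtr_spt) simp

lemma vge_L: "Ham H \<Longrightarrow> vge k T \<Longrightarrow> vge (k + 1) (br T H)"
  using vge_br_Ham by simp

lemma vge_l: "vge (s + 2) h \<Longrightarrow> vge k T \<Longrightarrow> vge (k + s) (br T h)"
  unfolding vge_def by (rule spt_br, assumption, assumption, linarith)

lemma vge_variation:
  assumes "Ham H" "Ham h" "vge (s + 2) h" "1 \<le> s" "vge k G"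
  shows "vge (k + s + 1) (ex 1 (H + h) G - ex 1 H G - br G h)"
  by (rule ex_variation[OF filtr_vge assms(1,2) vge_L[OF assms(1)] vge_l[OF assms(3)] assms(4,5)])

text \<open>A Hamiltonian is determined by its time-one map, also up to a given degree in \<open>(x,y)\<close>.\<close>

lemma ex_inj_step:
  assumes H: "Ham H" and h: "Ham h" and s: "1 \<le> s"
    and hs: "spt (\<lambda>i j m l. N \<le> i + j \<or> s + 2 \<le> i + j + m + l) h" and N: "2 \<le> N"
    and X: "dge (N - 1) (ex 1 (H + h) fps_X - ex 1 H fps_X)" and Y: "dge (N - 1) (ex 1 (H + h) yy - ex 1 H yy)"
  shows "spt (\<lambda>i j m l. N \<le> i + j \<or> s + 3 \<le> i + j + m + l) h"
proof -
  define A where "A k i j m l \<longleftrightarrow> 1 \<le> i + j \<and> (N \<le> i + j + 1 \<or> k \<le> i + j + m + l)" for k i j m l :: nat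
  have F: "filtr (\<lambda>k. spt (A k))" by (rule filtr_spt) (auto simp: A_def)
  have L: "spt (A (k + 1)) (br T H)" if "spt (A k) T" for k T
    using that H unfolding Ham_def A_def by (rule spt_br') (elim conjE disjE; intro conjI; (linarith | (rule disjI1, linarith) | (rule disjI2, linarith)))
  have l: "spt (A (k + s)) (br T h)" if "spt (A k) T" for k T
  proof -
    have "spt (\<lambda>i j m l. (2 \<le> i + j \<and> 3 \<le> i + j + m + l) \<and> (N \<le> i + j \<or> s + 2 \<le> i + j + m + l)) h"
      by (rule spt_conj[OF h[unfolded Ham_def] hs])
    from that[unfolded A_def] this show ?thesis unfolding A_def by (rule spt_br') (elim conjE disjE; intro conjI; (linarith | (rule disjI1, linarith) | (rule disjI2, linarith)))
  qed
  have *: "spt (A (s + 2)) (br G h)" if "dge (N - 1) (ex 1 (H + h) G - ex 1 H G)" "spt (A 1) G" for G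
  proof -
    have e: "1 + s + 1 = s + 2" by simp
    have diff_diff_cancel: "X - (X - Y) = Y" for X Y :: plane_series by simp
    have v: "spt (A (1 + s + 1)) (ex 1 (H + h) G - ex 1 H G - br G h)"
      by (rule ex_variation[OF F H h L l s that(2)])
    have "spt (A (s + 2)) (ex 1 (H + h) G - ex 1 H G)"
      by (rule spt_mono[OF that(1)[unfolded dge_spt]]) (use N in \<open>auto simp: A_def\<close>)
    from spt_diff[OF this v[unfolded e]] show ?thesis unfolding diff_diff_cancel .
  qed
  have "spt (A 1) T" if "dge 1 T" for T :: plane_series
    by (rule spt_mono[OF that[unfolded dge_spt]]) (simp add: A_def)
  note vars = this[OF dge_vars(1)] this[OF dge_vars(2)]
  show ?thesis unfolding spt_def
  proof (intro allI impI)
    fix i j m l' assume nz: "h $ i $ j $ m $ l' \<noteq> 0"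
    from spt_nz[OF h[unfolded Ham_def] nz] have ij: "2 \<le> i + j" by simp
    show "N \<le> i + j \<or> s + 3 \<le> i + j + m + l'"
    \<comment> \<open>The brackets of h with the coordinates are its partial derivatives up to sign,
      and a monomial of positive degree in (x,y) survives in at least one of them.\<close>
    proof (cases j)
      case (Suc j')
      have "dY h $ i $ j' $ m $ l' \<noteq> 0" using nz Suc by (simp add: dY_nth of_nat_mult_nth2 del: of_nat_Suc)
      then have "A (s + 2) i j' m l'" by (rule spt_nz[OF *[OF X vars(1), unfolded br_vars]])
      then show ?thesis using Suc by (auto simp: A_def)
    next
      case 0
      with ij obtain i' where i: "i = Suc i'" by (cases i) auto
      have "fps_deriv h $ i' $ j $ m $ l' \<noteq> 0" using nz i by (simp add: fps_deriv_nth2 of_nat_mult_nth2 del: of_nat_Suc)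
      then have "(- fps_deriv h) $ i' $ j $ m $ l' \<noteq> 0" by simp
      then have "A (s + 2) i' j m l'" by (rule spt_nz[OF *[OF Y vars(2), unfolded br_vars]])
      then show ?thesis using i by (auto simp: A_def)
    qed
  qed
qed

text \<open>Induction over the total degree: each round of \<open>ex_inj_step\<close> pushes the
  part of K - H of (x,y)-order below N one degree higher, so it vanishes.\<close>

lemma ex_inj_dge:
  assumes H: "Ham H" and K: "Ham K" and N: "2 \<le> N"
    and X: "dge (N - 1) (ex 1 K fps_X - ex 1 H fps_X)" and Y: "dge (N - 1) (ex 1 K yy - ex 1 H yy)"
  shows "dge N (K - H)"
proof -
  have h: "Ham (K - H)" by (rule Ham_diff[OF K H])
  have "spt (\<lambda>i j m l. N \<le> i + j \<or> s + 3 \<le> i + j + m + l) (K - H)" for s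
  proof (induction s)
    case 0
    show ?case using h unfolding Ham_def by (rule spt_mono) auto
  next
    case (Suc s)
    have e: "Suc s + 2 = s + 3" by simp
    show ?case by (rule ex_inj_step[OF H h, of "Suc s" N, unfolded e]) (use X Y N Suc in auto)
  qed
  note * = this
  show ?thesis unfolding dge_spt spt_def
  proof (intro allI impI)
    fix i j m l assume "(K - H) $ i $ j $ m $ l \<noteq> 0"
    then have "N \<le> i + j \<or> (i + j + m + l) + 3 \<le> i + j + m + l"
      using *[of "i + j + m + l"] unfolding spt_def by blast
    then show "N \<le> i + j" by simp
  qed
qed

lemma ex_inj:
  assumes H: "Ham H" and K: "Ham K" and e: "ex 1 K fps_X = ex 1 H fps_X" "ex 1 K yy = ex 1 H yy"
  shows "K = H"
proof -
  have d: "dge N (K - H)" for N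
    using dge_mono[OF ex_inj_dge[OF H K, of "N + 2"], of N] e by simp
  show ?thesis
  proof (rule fps2_eqI)
    fix a b show "K $ a $ b = H $ a $ b" using d[of "Suc (a + b)"] by (simp add: dge_def)
  qed
qed

text \<open>Completeness of formal series: each coefficient is taken from a stage beyond which it no
  longer changes.\<close>

lemma vge_limit:
  assumes step: "\<And>k. vge (f k) (G (Suc k) - G k)" and f: "mono f" "\<And>N. \<exists>k. N \<le> f k"
  obtains L where "\<And>k. vge (f k) (L - G k)"
proof -
  have cauchy: "vge (f k) (G k' - G k)" if "k \<le> k'" for k k'
    using that
  proof (induction k' rule: dec_induct)
    case (step k')
    have "vge (f k) (G (Suc k') - G k')" by (rule vge_mono[OF assms(1) monoD[OF f(1) step(1)]])
    from vge_add[OF this step.IH] show ?case by simp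
  qed simp
  define g where "g N = (SOME k. N \<le> f k)" for N
  have g: "N \<le> f (g N)" for N unfolding g_def using f(2) by (rule someI_ex)
  define L where "L = Abs_fps (\<lambda>i. Abs_fps (\<lambda>j. Abs_fps (\<lambda>m. Abs_fps (\<lambda>l. G (g (Suc (i + j + m + l))) $ i $ j $ m $ l))))"
  have "vge (f k) (L - G k)" for k
    unfolding vge_def spt_def
  proof (intro allI impI, rule ccontr)
    fix i j m l assume nz: "(L - G k) $ i $ j $ m $ l \<noteq> 0" and lt: "\<not> f k \<le> i + j + m + l"
    let ?k = "g (Suc (i + j + m + l))"
    have "G ?k $ i $ j $ m $ l = G k $ i $ j $ m $ l"
    proof (cases "k \<le> ?k")
      case True
      have "(G ?k - G k) $ i $ j $ m $ l = 0" by (rule vge_nth[OF cauchy[OF True]]) (use lt in simp)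
      then show ?thesis by simp
    next
      case False
      then have "vge (f ?k) (G k - G ?k)" by (intro cauchy) simp
      from vge_nth[OF this] g[of "Suc (i + j + m + l)"] have "(G k - G ?k) $ i $ j $ m $ l = 0" by simp
      then show ?thesis by simp
    qed
    with nz show False by (simp add: L_def)
  qed
  with that show thesis by blast
qed

lemma vgeI: "(\<And>i j m l. i + j + m + l < k \<Longrightarrow> T $ i $ j $ m $ l = 0) \<Longrightarrow> vge k T"
  unfolding vge_def spt_def by (metis not_le)

lemma power_diff_vge:
  assumes "vge 1 a" "vge 1 b" "vge 2 (a - b)"
  shows "vge (i + 1) (a ^ i - b ^ i)"
proof (induction i)
  case (Suc i)
  have "a ^ Suc i - b ^ Suc i = a * (a ^ i - b ^ i) + (a - b) * b ^ i" by (simp add: algebra_simps)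
  moreover have "vge (Suc i + 1) (a * (a ^ i - b ^ i))" using vge_mult[OF assms(1) Suc] by simp
  moreover have "vge (Suc i + 1) ((a - b) * b ^ i)" using vge_mult[OF assms(3) vge_power[OF assms(2), of i]] by simp
  ultimately show ?case by (simp only: vge_add)
qed simp

lemma vanishes_vge: "vanishes_at_origin f \<Longrightarrow> vge 1 (fst f) \<and> vge 1 (snd f)"
  by (auto simp: vanishes_iff dest: dge_1_vge)

text \<open>Maps that agree up to total order 2 act alike to leading order, one factor of a monomial
  at a time. This lets R replace S in error terms.\<close>

lemma pb_diff_vge:
  assumes f: "vanishes_at_origin f" and g: "vanishes_at_origin g"
    and d: "vge 2 (fst f - fst g)" "vge 2 (snd f - snd g)" and Y: "vge k Y"
  shows "vge (k + 1) (pb f Y - pb g Y)"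
  unfolding vge_def spt_def
proof (intro allI impI)
  fix a b m l
  define M where "M i j = fst f ^ i * snd f ^ j - fst g ^ i * snd g ^ j" for i j
  assume nz: "(pb f Y - pb g Y) $ a $ b $ m $ l \<noteq> 0"
  have "(pb f Y - pb g Y) $ a $ b $ m $ l = (\<Sum>i\<le>a+b. \<Sum>j\<le>a+b. (cc (Y $ i $ j) * M i j) $ a $ b $ m $ l)"
    by (simp add: pb_def subst2_nth fps_sum_nth sum_subtractf M_def right_diff_distrib)
  with nz obtain i j where nz2: "(cc (Y $ i $ j) * M i j) $ a $ b $ m $ l \<noteq> 0"
  proof -
    from nz \<open>(pb f Y - pb g Y) $ a $ b $ m $ l = _\<close>
    have "(\<Sum>i\<le>a+b. \<Sum>j\<le>a+b. (cc (Y $ i $ j) * M i j) $ a $ b $ m $ l) \<noteq> 0" by simp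
    then show ?thesis by (rule sum2_nzE) (rule that)
  qed
  have v: "vge 1 (fst f)" "vge 1 (snd f)" "vge 1 (fst g)" "vge 1 (snd g)" using f g vanishes_vge by blast+
  have "M i j = (fst f ^ i - fst g ^ i) * snd f ^ j + fst g ^ i * (snd f ^ j - snd g ^ j)"
    by (simp add: M_def algebra_simps)
  moreover have "vge (i + j + 1) ((fst f ^ i - fst g ^ i) * snd f ^ j)"
    using vge_mult[OF power_diff_vge[OF v(1,3) d(1), of i] vge_power[OF v(2), of j]] by (simp add: algebra_simps)
  moreover have "vge (i + j + 1) (fst g ^ i * (snd f ^ j - snd g ^ j))"
    using vge_mult[OF vge_power[OF v(3), of i] power_diff_vge[OF v(2,4) d(2), of j]] by (simp add: algebra_simps)
  ultimately have "vge (i + j + 1) (M i j)" by (simp only: vge_add)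
  from vge_mult[OF vge_coef[OF Y, of i j] this] have "vge (k + 1) (cc (Y $ i $ j) * M i j)"
    by (rule vge_mono) simp
  from spt_nz[OF this[unfolded vge_def] nz2] show "k + 1 \<le> a + b + m + l" .
qed

lemma vge_U: "Ham H \<Longrightarrow> vge k G \<Longrightarrow> vge (k + 1) (ex 1 H G - G)"
  by (rule ex_filtr_step(1)[OF filtr_vge _ vge_L])

text \<open>The converse of \<open>ex_inj_dge\<close>: changing H in order N of (x,y) and above
  affects the time-one map only from order N - 1 on, one derivative being spent.\<close>

lemma dge_U_diff:
  assumes H: "Ham H" and K: "Ham K" and d: "dge N (K - H)" and N: "2 \<le> N" and Y: "dge 1 Y"
  shows "dge (N - 1) (ex 1 K Y - ex 1 H Y)"
proof -
  have Lp1: "dge 1 (Lp q H Y)" for q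
    by (induction q) (use Y dge_br_Ham[OF H] in auto)
  have D: "dge (N - 1) (Lp q K Y - Lp q H Y)" for q
  proof (induction q)
    case (Suc q)
    have "Suc (N - 1) = N" using N by simp
    then have "dge (N - 1) (br (Lp q H Y) (K - H))"
      using dge_br[of 0 "Lp q H Y" "N - 1" "K - H"] Lp1[of q] d by simp
    moreover have "Lp (Suc q) K Y - Lp (Suc q) H Y = br (Lp q K Y - Lp q H Y) K + br (Lp q H Y) (K - H)"
      by (simp add: br_diff_left br_diff_right)
    ultimately show ?case using dge_br_Ham[OF K Suc] by (simp only: dge_add)
  qed simp
  show ?thesis unfolding dge_def
  proof (intro allI impI)
    fix i j assume ij: "i + j < N - 1"
    have "(Lp q K Y - Lp q H Y) $ i $ j = 0" for q using D[of q] ij by (simp add: dge_def)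
    then have e: "Lp q K Y $ i $ j = Lp q H Y $ i $ j" for q by simp
    show "(ex 1 K Y - ex 1 H Y) $ i $ j = 0"
      by (rule fps2_eqI) (simp add: ex_def e)
  qed
qed

lemma ex_zero [simp]: "ex t 0 G = G"
proof -
  have "ex t (real_const 0 * 0) G = ex (0 * t) 0 G" by (rule ex_scale) simp
  then show ?thesis by (simp add: rc_hom)
qed

text \<open>Euler's homotopy formula: a vector field \<open>(u,v)\<close> of zero divergence is Hamiltonian with Hamiltonian
  \<open>(y u - x v) / degree\<close>.\<close>

section \<open>Logarithms and averaging\<close>

definition Pot :: "plane_series \<Rightarrow> plane_series \<Rightarrow> plane_series" where
  "Pot u v = Abs_fps (\<lambda>a. Abs_fps (\<lambda>b. fps_const (fps_const (1 / real (a + b))) *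
     ((if b = 0 then 0 else u $ a $ (b - 1)) - (if a = 0 then 0 else v $ (a - 1) $ b))))"

lemma Pot_nth: "Pot u v $ a $ b $ m $ l = ((if b = 0 then 0 else u $ a $ (b - 1) $ m $ l) -
    (if a = 0 then 0 else v $ (a - 1) $ b $ m $ l)) / real (a + b)"
  by (simp add: Pot_def)

lemma Pot_vge:
  assumes "vge k u" "vge k v" shows "vge (k + 1) (Pot u v)"
  unfolding vge_def spt_def
proof (intro allI impI, rule ccontr)
  fix a b m l assume nz: "Pot u v $ a $ b $ m $ l \<noteq> 0" and lt: "\<not> k + 1 \<le> a + b + m + l"
  have "(if b = 0 then 0 else u $ a $ (b - 1) $ m $ l) = 0"
    using vge_nth[OF assms(1), of a "b - 1" m l] lt by (cases b) auto
  moreover have "(if a = 0 then 0 else v $ (a - 1) $ b $ m $ l) = 0"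
    using vge_nth[OF assms(2), of "a - 1" b m l] lt by (cases a) auto
  ultimately show False using nz unfolding Pot_nth by simp
qed

lemma Pot_dge:
  assumes "dge k u" "dge k v" shows "dge (k + 1) (Pot u v)"
  unfolding dge_def
proof (intro allI impI, rule fps2_eqI)
  fix a b m l assume lt: "a + b < k + 1"
  have "(if b = 0 then 0 else u $ a $ (b - 1) $ m $ l) = 0"
    using assms(1) lt by (cases b) (auto simp: dge_def)
  moreover have "(if a = 0 then 0 else v $ (a - 1) $ b $ m $ l) = 0"
    using assms(2) lt by (cases a) (auto simp: dge_def)
  ultimately show "Pot u v $ a $ b $ m $ l = 0 $ m $ l" unfolding Pot_nth by simp
qed

text \<open>Euler's identity coefficientwise: the divergence equation turns the other component's
  coefficient into a multiple of the wanted one, and the two factors add up to the degree in the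
  denominator. If the divergence vanishes only below order k, the formula still holds below k +
  1.\<close>

lemma Pot_deriv:
  assumes div: "vge k (dY v + fps_deriv u)"
  shows "vge (k + 1) (dY (Pot u v) - u)" "vge (k + 1) (- fps_deriv (Pot u v) - v)"
proof -
  have d: "real (b + 1) * v $ a $ (b + 1) $ m $ l + real (a + 1) * u $ (a + 1) $ b $ m $ l = 0"
    if "a + b + m + l < k" for a b m l
    using vge_nth[OF div that] by (simp add: dY_nth fps_deriv_nth2 of_nat_mult_nth2 del: of_nat_Suc)
  have 1: "(dY (Pot u v) - u) $ a $ b $ m $ l = 0" if lt: "a + b + m + l < k + 1" for a b m l
  proof (cases a)
    case 0
    then show ?thesis by (simp add: dY_nth of_nat_mult_nth2 Pot_nth del: of_nat_Suc)
  next
    case (Suc a')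
    have "dY (Pot u v) $ a $ b $ m $ l = (real (b + 1) * u $ a $ b $ m $ l - real (b + 1) * v $ a' $ (b + 1) $ m $ l) / real (a + b + 1)"
      by (simp add: dY_nth of_nat_mult_nth2 Pot_nth Suc right_diff_distrib diff_divide_distrib del: of_nat_Suc)
    also have "real (b + 1) * v $ a' $ (b + 1) $ m $ l = - (real a * u $ a $ b $ m $ l)"
      using d[of a' b m l] lt Suc by (simp add: eq_neg_iff_add_eq_0)
    also have "(real (b + 1) * u $ a $ b $ m $ l - - (real a * u $ a $ b $ m $ l)) / real (a + b + 1) = u $ a $ b $ m $ l"
      by (simp add: field_simps)
    finally show ?thesis by simp
  qed
  have 2: "(- fps_deriv (Pot u v) - v) $ a $ b $ m $ l = 0" if lt: "a + b + m + l < k + 1" for a b m l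
  proof (cases b)
    case 0
    then show ?thesis by (simp add: fps_deriv_nth2 of_nat_mult_nth2 Pot_nth del: of_nat_Suc)
  next
    case (Suc b')
    have "fps_deriv (Pot u v) $ a $ b $ m $ l = (real (a + 1) * u $ (a + 1) $ b' $ m $ l - real (a + 1) * v $ a $ b $ m $ l) / real (a + b + 1)"
      by (simp add: fps_deriv_nth2 of_nat_mult_nth2 Pot_nth Suc right_diff_distrib diff_divide_distrib del: of_nat_Suc)
    also have "real (a + 1) * u $ (a + 1) $ b' $ m $ l = - (real b * v $ a $ b $ m $ l)"
      using d[of a b' m l] lt Suc by (simp add: eq_neg_iff_add_eq_0 add.commute)
    also have "(- (real b * v $ a $ b $ m $ l) - real (a + 1) * v $ a $ b $ m $ l) / real (a + b + 1) = - v $ a $ b $ m $ l"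
      by (simp add: field_simps)
    finally show ?thesis by simp
  qed
  show "vge (k + 1) (dY (Pot u v) - u)" "vge (k + 1) (- fps_deriv (Pot u v) - v)"
    by (rule vgeI, rule 1, assumption) (rule vgeI, rule 2, assumption)
qed

text \<open>R is the linear part, R' its inverse, n a period. Besides the rotation, the identity
  with n = 1 is an instance; it yields plain logarithms.\<close>

locale periodic_map =
  fixes R R' :: formal_map and n :: nat
  assumes R: "canon R" "canon R'" and inv: "\<And>X. pb R (pb R' X) = X" "\<And>X. pb R' (pb R X) = X"
    and per: "\<And>X. (pb R ^^ n) X = X" and n: "0 < n"
begin

lemma Rv: "vanishes_at_origin R" "vanishes_at_origin R'"
  using R by (auto simp: canon_def)

lemma pow_pres:
  shows "vge k e \<Longrightarrow> vge k ((pb R ^^ q) e)" "dge k e \<Longrightarrow> dge k ((pb R ^^ q) e)"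
  by (induction q) (auto intro: pb_vge pb_dge Rv)

text \<open>\<eta> is the mean of e over the cyclic group. The weights q in \<gamma> make R\<gamma>
  - \<gamma> collapse by Abel summation to the mean minus e.\<close>

lemma averaging:
  assumes e: "vge k e" "dge N e"
  obtains \<gamma> \<eta> where "vge k \<gamma>" "dge N \<gamma>" "vge k \<eta>" "dge N \<eta>" "pb R \<eta> = \<eta>" "pb R \<gamma> - \<gamma> - \<eta> = - e"
proof -
  define s where "s q = (pb R ^^ q) e" for q
  define \<eta> where "\<eta> = real_const (1 / n) * (\<Sum>q<n. s q)"
  define \<gamma> where "\<gamma> = - (real_const (1 / n) * (\<Sum>q<n. real_const q * s q))"
  have sR: "pb R (s q) = s (Suc q)" for q by (simp add: s_def)
  have sn: "s n = s 0" by (simp add: s_def per)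
  have pbsum: "pb R (\<Sum>q\<in>A. g q) = (\<Sum>q\<in>A. pb R (g q))" for A :: "nat set" and g
    by (rule additive_sum) (simp add: pb_ring[OF Rv(1)])
  have shift: "(\<Sum>q<n. s (Suc q)) = (\<Sum>q<n. s q)"
    using sum_lessThan_telescope[of s n] sn by (simp add: sum_subtractf)
  have 1: "pb R \<eta> = \<eta>" unfolding \<eta>_def by (simp add: pb_ring[OF Rv(1)] pbsum sR shift)
  have tel: "(\<Sum>q<n. real_const q * s (Suc q)) - (\<Sum>q<n. real_const q * s q) = real_const n * e - (\<Sum>q<n. s q)"
  proof -
    have "(\<Sum>q<n. real_const (Suc q) * s (Suc q) - real_const q * s q) = real_const n * e"
      unfolding sum_lessThan_telescope[of "\<lambda>q. real_const q * s q"] by (simp add: sn rc_hom) (simp add: s_def)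
    moreover have "real_const (Suc q) * s (Suc q) = real_const q * s (Suc q) + s (Suc q)" for q
      by (simp add: rc_hom ring_distribs add.commute)
    ultimately show ?thesis by (simp add: sum_subtractf sum.distrib shift algebra_simps)
  qed
  have "pb R \<gamma> - \<gamma> = - (real_const (1 / n) * ((\<Sum>q<n. real_const q * s (Suc q)) - (\<Sum>q<n. real_const q * s q)))"
    unfolding \<gamma>_def by (simp add: pb_ring[OF Rv(1)] pbsum sR algebra_simps)
  also have "\<dots> = - (real_const (1 / n) * real_const n) * e + \<eta>"
    unfolding tel by (simp add: \<eta>_def algebra_simps)
  also have "real_const (1 / n) * real_const n = 1"
    using n by (simp flip: rc_hom)
  finally have 2: "pb R \<gamma> - \<gamma> - \<eta> = - e" by simp
  have sv: "vge k (s q)" "dge N (s q)" for q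
    unfolding s_def by (rule pow_pres(1)[OF e(1)], rule pow_pres(2)[OF e(2)])
  have v: "vge k \<gamma>" "vge k \<eta>"
    unfolding \<gamma>_def \<eta>_def vge_def by (intro spt_minus spt_rc spt_sum sv[unfolded vge_def])+
  have d: "dge N \<gamma>" "dge N \<eta>"
    unfolding \<gamma>_def \<eta>_def dge_spt by (intro spt_minus spt_rc spt_sum sv[unfolded dge_spt])+
  from that v d 1 2 show thesis by blast
qed

text \<open>To leading order the defect of the conjugacy reacts linearly to the corrections: it
  changes by the bracket of R X with R\<gamma> - \<gamma> - \<eta>, that is, with -e. The remainders
  r1 to r6 are all of higher order.\<close>

lemma step_variation:
  assumes S: "canon S" "vge 2 (fst S - fst R)" "vge 2 (snd S - snd R)"
    and G: "Ham G" and H: "Ham H" and g: "Ham \<gamma>" "vge (k + 1) \<gamma>" and h: "Ham \<eta>" "vge (k + 1) \<eta>"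
    and k: "2 \<le> k" and X: "vge 1 X" and e: "pb R \<gamma> - \<gamma> - \<eta> = - e"
  shows "vge (k + 1) ((pb S (ex 1 (G + \<gamma>) X) - ex 1 (G + \<gamma>) (ex 1 (H + \<eta>) (pb R X)))
    - (pb S (ex 1 G X) - ex 1 G (ex 1 H (pb R X))) + br (pb R X) e)"
proof -
  have Sv: "vanishes_at_origin S" using S(1) by (simp add: canon_def)
  have kk: "k - 1 + 2 = k + 1" "1 \<le> k - 1" "1 + (k - 1) = k" "1 + (k - 1) + 1 = k + 1" using k by auto
  define rX where "rX = pb R X"
  have rX: "vge 1 rX" unfolding rX_def by (rule pb_vge[OF Rv(1) X])
  define Z where "Z = ex 1 H rX"
  have Z: "vge 1 Z" unfolding Z_def by (rule vge_ex[OF H rX])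
  have Zr: "vge 2 (Z - rX)" using vge_U[OF H rX] by (simp add: Z_def numeral_2_eq_2)
  have Gg: "Ham (G + \<gamma>)" by (rule Ham_add[OF G g(1)])
  note g' = g(2)[folded kk(1)] and h' = h(2)[folded kk(1)]
  define r1 where "r1 = ex 1 (G + \<gamma>) X - ex 1 G X - br X \<gamma>"
  have r1: "vge (k + 1) r1" unfolding r1_def using vge_variation[OF G g(1) g' kk(2) X] by (simp only: kk)
  define r2 where "r2 = ex 1 (H + \<eta>) rX - Z - br rX \<eta>"
  have r2: "vge (k + 1) r2" unfolding r2_def Z_def using vge_variation[OF H h(1) h' kk(2) rX] by (simp only: kk)
  define r3 where "r3 = ex 1 (G + \<gamma>) Z - ex 1 G Z - br Z \<gamma>"
  have r3: "vge (k + 1) r3" unfolding r3_def using vge_variation[OF G g(1) g' kk(2) Z] by (simp only: kk)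
  define r4 where "r4 = pb S (br X \<gamma>) - pb R (br X \<gamma>)"
  have b: "vge k (br X \<gamma>)" "vge k (br rX \<eta>)"
    using vge_l[OF g' X] vge_l[OF h' rX] by (simp_all only: kk)
  have r4: "vge (k + 1) r4"
    unfolding r4_def by (rule pb_diff_vge[OF Sv Rv(1) S(2,3) b(1)])
  have r5: "vge (k + 1) (ex 1 (G + \<gamma>) (br rX \<eta>) - br rX \<eta>)"
    by (rule vge_U[OF Gg b(2)])
  have r6: "vge (k + 1) (br (Z - rX) \<gamma>)"
    using vge_l[OF g' Zr] by (rule vge_mono) simp
  have eq1: "pb S (ex 1 (G + \<gamma>) X) = pb S (ex 1 G X) + br rX (pb R \<gamma>) + r4 + pb S r1"
    by (simp add: r4_def r1_def pb_ring[OF Sv] rX_def pb_br[OF R(1)])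
  have eq2: "ex 1 (G + \<gamma>) (ex 1 (H + \<eta>) rX) = ex 1 G Z + r3 + br rX \<gamma> + br (Z - rX) \<gamma>
     + (ex 1 (G + \<gamma>) (br rX \<eta>) - br rX \<eta>) + br rX \<eta> + ex 1 (G + \<gamma>) r2"
  proof -
    have "ex 1 (H + \<eta>) rX = Z + br rX \<eta> + r2" by (simp add: r2_def)
    then have "ex 1 (G + \<gamma>) (ex 1 (H + \<eta>) rX) = ex 1 (G + \<gamma>) Z + ex 1 (G + \<gamma>) (br rX \<eta>) + ex 1 (G + \<gamma>) r2"
      by (simp add: ex_add)
    then show ?thesis by (simp add: r3_def br_diff_left)
  qed
  have "br rX (pb R \<gamma>) - br rX \<gamma> - br rX \<eta> + br rX e = 0"
    using arg_cong[OF e, of "br rX"] by (simp add: br_diff_right br_minus_right)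
  then have "(pb S (ex 1 (G + \<gamma>) X) - ex 1 (G + \<gamma>) (ex 1 (H + \<eta>) rX)) - (pb S (ex 1 G X) - ex 1 G Z) + br rX e
    = r4 + pb S r1 - r3 - br (Z - rX) \<gamma> - (ex 1 (G + \<gamma>) (br rX \<eta>) - br rX \<eta>) - ex 1 (G + \<gamma>) r2"
    unfolding eq1 eq2 by (simp add: algebra_simps)
  moreover have "vge (k + 1) \<dots>"
    by (intro vge_add vge_diff r4 r3 r6 r5 pb_vge[OF Sv r1] vge_ex[OF Gg r2])
  ultimately show ?thesis unfolding Z_def rX_def by (simp only:)
qed

text \<open>Both sides of the conjugacy have Jacobian 1, so their difference (u,v) is divergence
  free to leading order and has a potential. Pulling back by R' moves this to the coordinates x and
  y, where \<open>Pot\<close> applies.\<close>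

lemma step_potential:
  assumes S: "canon S" and G: "Ham G" and H: "Ham H" and k: "2 \<le> k"
    and u: "u = pb S (ex 1 G fps_X) - ex 1 G (ex 1 H (pb R fps_X))" "vge k u"
    and v: "v = pb S (ex 1 G yy) - ex 1 G (ex 1 H (pb R yy))" "vge k v"
    and N: "2 \<le> N" "dge (N - 1) u" "dge (N - 1) v"
  obtains e where "vge (k + 1) e" "dge N e" "vge (k + 1) (u - br (pb R fps_X) e)" "vge (k + 1) (v - br (pb R yy) e)"
proof -
  define qx where "qx = ex 1 G (ex 1 H (pb R fps_X))"
  define qy where "qy = ex 1 G (ex 1 H (pb R yy))"
  define rx where "rx = pb R fps_X"
  define ry where "ry = pb R yy"
  have vv: "vge 1 (fps_X :: plane_series)" "vge 1 (yy :: plane_series)"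
    using dge_vars dge_1_vge by auto
  have r: "vge 1 rx" "vge 1 ry" unfolding rx_def ry_def by (auto intro: pb_vge Rv vv simp del: One_nat_def)
  have Q: "vge 2 (ex 1 G (ex 1 H Y) - Y)" if "vge 1 Y" for Y
  proof -
    have "vge 2 (ex 1 G (ex 1 H Y) - ex 1 H Y)" "vge 2 (ex 1 H Y - Y)"
      using vge_U[OF G vge_ex[OF H that]] vge_U[OF H that] by (simp_all add: numeral_2_eq_2)
    from vge_add[OF this] show ?thesis by simp
  qed
  have qr: "vge 2 (qx - rx)" "vge 2 (qy - ry)"
    unfolding qx_def qy_def rx_def[symmetric] ry_def[symmetric] using Q r by auto
  have b1: "br fps_X yy = (1 :: plane_series)" by (simp add: br_vars)
  have "br qx qy = ex 1 G (ex 1 H (pb R (br fps_X yy)))"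
    unfolding qx_def qy_def ex_br[OF G] ex_br[OF H] pb_br[OF R(1)] ..
  then have one: "br qx qy = 1"
    by (simp add: b1 pb_ring[OF Rv(1)] ex_kernel[OF H] ex_kernel[OF G])
  have Sv: "vanishes_at_origin S" using S by (simp add: canon_def)
  have "qx + u = pb S (ex 1 G fps_X)" "qy + v = pb S (ex 1 G yy)" by (simp_all add: qx_def qy_def u(1) v(1))
  then have "br (qx + u) (qy + v) = pb S (ex 1 G (br fps_X yy))"
    unfolding ex_br[OF G] pb_br[OF S] by simp
  then have two: "br (qx + u) (qy + v) = 1"
    by (simp add: b1 pb_ring[OF Sv] ex_kernel[OF G])
  \<comment> \<open>The difference of two determinants equal to 1, with the terms of higher order
    moved to the right.\<close>
  have "br rx v + br u ry = - (br (qx - rx) v + br u (qy - ry) + br u v)"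
    using one two by (simp add: br_add_left br_add_right br_diff_left br_diff_right algebra_simps)
  moreover have w: "vge k (br (qx - rx) v + br u (qy - ry) + br u v)"
  proof -
    have kk: "Suc (k - 1) = k" "Suc 1 = 2" "1 + (k - 1) = k" "k - 1 + 1 = k" using k by auto
    have "vge k (br (qx - rx) v)" using vge_br[of 1 "qx - rx" "k - 1" v] qr(1) v(2) by (simp only: kk)
    moreover have "vge k (br u (qy - ry))" using vge_br[of "k - 1" u 1 "qy - ry"] qr(2) u(2) by (simp only: kk)
    moreover have "vge k (br u v)"
      by (rule vge_mono[OF vge_br[of "k - 1" u "k - 1" v]]) (use u(2) v(2) k kk in auto)
    ultimately show ?thesis by (intro vge_add)
  qed
  ultimately have "vge k (br rx v + br u ry)" using vge_minus[OF w] by simp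
  from pb_vge[OF Rv(2) this] have "vge k (br fps_X (pb R' v) + br (pb R' u) yy)"
    by (simp add: pb_ring[OF Rv(2)] pb_br[OF R(2)] rx_def ry_def inv)
  moreover have "br (pb R' u) yy = fps_deriv (pb R' u)" by (simp add: br_def)
  ultimately have div: "vge k (dY (pb R' v) + fps_deriv (pb R' u))" by (simp add: br_vars)
  define e' where "e' = Pot (pb R' u) (pb R' v)"
  define e where "e = pb R e'"
  have NN: "N - 1 + 1 = N" using N by simp
  have "vge (k + 1) e'" unfolding e'_def by (intro Pot_vge pb_vge Rv u v)
  then have 1: "vge (k + 1) e" unfolding e_def by (rule pb_vge[OF Rv(1)])
  have "dge N e'" using Pot_dge[of "N - 1" "pb R' u" "pb R' v"] N NN by (simp add: e'_def pb_dge[OF Rv(2)])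
  then have 2: "dge N e" unfolding e_def by (rule pb_dge[OF Rv(1)])
  note P = Pot_deriv[OF div, folded e'_def]
  have eX: "br (pb R fps_X) e = pb R (dY e')" and eY: "br (pb R yy) e = pb R (- fps_deriv e')"
    by (simp_all only: e_def pb_br[OF R(1), symmetric] br_vars)
  have 3: "vge (k + 1) (u - br (pb R fps_X) e)"
    using vge_minus[OF pb_vge[OF Rv(1) P(1)]] unfolding eX by (simp add: pb_ring[OF Rv(1)] inv)
  have 4: "vge (k + 1) (v - br (pb R yy) e)"
    using vge_minus[OF pb_vge[OF Rv(1) P(2)]] unfolding eY pb_ring(2)[OF Rv(1)] inv by simp
  from that[OF 1 2 3 4] show thesis .
qed

text \<open>Order by order the potential of the defect is split by averaging into a part removed by
  the conjugation G and an invariant part absorbed by H. N and H0 keep track of low orders: if S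
  already agrees with R followed by the flow of H0 up to order N - 1 in (x,y), then G and H - H0
  start at order N, so known coefficients survive.\<close>

theorem log_birkhoff:
  assumes S: "canon S" and H0: "Ham H0" "pb R H0 = H0" and N: "2 \<le> N"
    and base: "dge (N - 1) (pb S fps_X - ex 1 H0 (pb R fps_X))" "dge (N - 1) (pb S yy - ex 1 H0 (pb R yy))"
      "vge 2 (pb S fps_X - pb R fps_X)" "vge 2 (pb S yy - pb R yy)"
  obtains G H where "Ham G" "Ham H" "pb R H = H" "dge N G" "dge N (H - H0)"
    "\<And>X. pb S (ex 1 G X) = ex 1 G (ex 1 H (pb R X))"
proof -
  have Sv: "vanishes_at_origin S" using S by (simp add: canon_def)
  have vv: "vge 1 (fps_X :: plane_series)" "vge 1 (yy :: plane_series)"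
    using dge_vars dge_1_vge by auto
  have S2: "vge 2 (fst S - fst R)" "vge 2 (snd S - snd R)"
    using base(3,4) by (simp_all add: pb_ring[OF Sv] pb_ring[OF Rv(1)])
  define D where "D G H X = pb S (ex 1 G X) - ex 1 G (ex 1 H (pb R X))" for G H X
  \<comment> \<open>At stage k the defect has total order at least k + 2; by Q the next correction
    has order at least k + 3, so the stages converge.\<close>
  define P where "P k GH \<longleftrightarrow> (case GH of (G, H) \<Rightarrow> Ham G \<and> Ham H \<and> pb R H = H \<and> dge N G \<and> dge N (H - H0)
     \<and> vge (k + 2) (D G H fps_X) \<and> vge (k + 2) (D G H yy))" for k GH
  define Q where "Q k GH GH' \<longleftrightarrow> vge (k + 3) (fst GH' - fst GH) \<and> vge (k + 3) (snd GH' - snd GH)" for k and GH GH' :: "plane_series \<times> plane_series"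
  have dgeD: "dge (N - 1) (D G H X)"
    if "Ham G" "Ham H" "dge N G" "dge N (H - H0)" "dge (N - 1) (pb S X - ex 1 H0 (pb R X))" "dge 1 X" for G H X
  proof -
    have 1: "dge 1 (pb R X)" by (rule pb_dge[OF Rv(1) that(6)])
    have 2: "dge (N - 1) (ex 1 G Y - Y)" if "dge 1 Y" for Y
      using dge_U_diff[of 0 G N Y] \<open>Ham G\<close> \<open>dge N G\<close> N that by simp
    have "dge (N - 1) (pb S (ex 1 G X - X))" by (rule pb_dge[OF Sv 2[OF that(6)]])
    then have a: "dge (N - 1) (pb S (ex 1 G X) - pb S X)" by (simp add: pb_ring[OF Sv])
    have b: "dge (N - 1) (ex 1 G (ex 1 H (pb R X)) - ex 1 H (pb R X))"
      by (rule 2[OF dge_ex[OF that(2) 1]])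
    have c: "dge (N - 1) (ex 1 H (pb R X) - ex 1 H0 (pb R X))"
      by (rule dge_U_diff[OF H0(1) that(2,4) N 1])
    have "D G H X = (pb S (ex 1 G X) - pb S X) - (ex 1 G (ex 1 H (pb R X)) - ex 1 H (pb R X))
      - (ex 1 H (pb R X) - ex 1 H0 (pb R X)) + (pb S X - ex 1 H0 (pb R X))"
      by (simp add: D_def)
    also have "dge (N - 1) \<dots>" by (intro dge_add dge_diff a b c that(5))
    finally show ?thesis .
  qed
  have start: "P 0 (0, H0)"
  proof -
    have "vge 2 (D 0 H0 X)" if "vge 2 (pb S X - pb R X)" "vge 1 X" for X
    proof -
      have "vge 2 (ex 1 H0 (pb R X) - pb R X)"
        using vge_U[OF H0(1) pb_vge[OF Rv(1) that(2)]] by (simp add: numeral_2_eq_2)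
      from vge_diff[OF that(1) this] show ?thesis by (simp add: D_def)
    qed
    then have "vge 2 (D 0 H0 fps_X)" "vge 2 (D 0 H0 yy)" using base vv by blast+
    then show ?thesis using H0 by (simp add: P_def numeral_2_eq_2)
  qed
  have step: "\<exists>GH'. P (Suc k) GH' \<and> Q k GH GH'" if PP: "P k GH" for k GH
  proof -
    obtain G H where GH: "GH = (G, H)" by (cases GH)
    from PP have G: "Ham G" "dge N G" and H: "Ham H" "pb R H = H" "dge N (H - H0)"
      and v: "vge (k + 2) (D G H fps_X)" "vge (k + 2) (D G H yy)" by (auto simp: P_def GH)
    have k2: "2 \<le> k + 2" by simp
    obtain e where e: "vge (k + 3) e" "dge N e" "vge (k + 3) (D G H fps_X - br (pb R fps_X) e)"
        "vge (k + 3) (D G H yy - br (pb R yy) e)"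
      using step_potential[OF S G(1) H(1) k2 D_def v(1) D_def v(2) N dgeD[OF G(1) H(1) G(2) H(3) base(1) dge_vars(1)]
        dgeD[OF G(1) H(1) G(2) H(3) base(2) dge_vars(2)]] by (auto simp: numeral_eq_Suc)
    obtain \<gamma> \<eta> where ge: "vge (k + 3) \<gamma>" "dge N \<gamma>" "vge (k + 3) \<eta>" "dge N \<eta>" "pb R \<eta> = \<eta>" "pb R \<gamma> - \<gamma> - \<eta> = - e"
      by (rule averaging[OF e(1,2)])
    have Hg: "Ham \<gamma>" "Ham \<eta>" using ge N by (auto simp: Ham_iff elim: vge_mono dge_mono)
    have "vge (k + 3) (D (G + \<gamma>) (H + \<eta>) X)" if X: "vge 1 X" "vge (k + 3) (D G H X - br (pb R X) e)" for X
    proof -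
      have "vge (k + 3) (D (G + \<gamma>) (H + \<eta>) X - D G H X + br (pb R X) e)"
        using step_variation[OF S S2 G(1) H(1) Hg(1) _ Hg(2) _ k2 X(1) ge(6)] ge(1,3)
        by (simp add: D_def numeral_eq_Suc)
      from vge_add[OF this X(2)] show ?thesis by simp
    qed
    then have "vge (k + 3) (D (G + \<gamma>) (H + \<eta>) fps_X)" "vge (k + 3) (D (G + \<gamma>) (H + \<eta>) yy)"
      using vv e by blast+
    moreover have "dge N (H + \<eta> - H0)" using dge_add[OF H(3) ge(4)] by (simp add: algebra_simps)
    ultimately have "P (Suc k) (G + \<gamma>, H + \<eta>)"
      using G H Hg ge by (simp add: P_def Ham_add dge_add pb_ring[OF Rv(1)] numeral_eq_Suc)
    moreover have "Q k GH (G + \<gamma>, H + \<eta>)" using ge by (simp add: Q_def GH)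
    ultimately show ?thesis by blast
  qed
  obtain f where f: "\<And>k. P k (f k)" "\<And>k. Q k (f k) (f (Suc k))"
    using dependent_nat_choice[of P Q] start step by metis
  have m: "mono (\<lambda>k::nat. k + 3)" by (simp add: mono_def)
  have ub: "\<exists>k. M \<le> k + 3" for M :: nat by (rule exI[of _ M]) simp
  obtain G where G: "\<And>k. vge (k + 3) (G - fst (f k))"
    using vge_limit[of "\<lambda>k. k + 3" "\<lambda>k. fst (f k)", OF _ m ub] f(2) by (auto simp: Q_def)
  obtain H where H: "\<And>k. vge (k + 3) (H - snd (f k))"
    using vge_limit[of "\<lambda>k. k + 3" "\<lambda>k. snd (f k)", OF _ m ub] f(2) by (auto simp: Q_def)
  have fk: "Ham (fst (f k))" "Ham (snd (f k))" "pb R (snd (f k)) = snd (f k)" "dge N (fst (f k))" "dge N (snd (f k) - H0)"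
     "vge (k + 2) (D (fst (f k)) (snd (f k)) fps_X)" "vge (k + 2) (D (fst (f k)) (snd (f k)) yy)" for k
    using f(1)[of k] by (auto simp: P_def split: prod.splits)
  have clsd: "spt A T" if "\<And>k. spt A (s k)" "\<And>k. vge (k + 3) (T - s k)" for A T and s :: "nat \<Rightarrow> plane_series"
  proof -
    have "filtr (\<lambda>k. spt A)" by (rule filtr_spt)
    from filtrD(4)[OF this, of T] show ?thesis using that by (meson vge_mono le_add1)
  qed
  have GH: "Ham G" "Ham H" "dge N G"
    using clsd[OF fk(1)[unfolded Ham_def] G] clsd[OF fk(2)[unfolded Ham_def] H] clsd[OF fk(4)[unfolded dge_spt] G]
    by (simp_all add: Ham_def dge_spt)
  have dH: "dge N (H - H0)"
    unfolding dge_spt by (rule clsd[OF fk(5)[unfolded dge_spt]]) (use H in simp)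
  have RH: "pb R H = H"
  proof (rule vge_eqI)
    fix k
    have "vge (k + 3) (pb R (H - snd (f k)) - (H - snd (f k)))"
      by (intro vge_diff pb_vge[OF Rv(1)] H)
    then show "vge k (pb R H - H)" by (auto simp: pb_ring[OF Rv(1)] fk(3) elim: vge_mono)
  qed
  have ediff: "vge k (ex 1 T X - ex 1 T' X)" if "Ham T" "Ham T'" "vge (k + 3) (T - T')" for k T T' X
  proof -
    have "vge (0 + Suc k + 1) (ex 1 (T' + (T - T')) X - ex 1 T' X - br X (T - T'))"
      by (rule vge_variation) (use that in \<open>auto intro: Ham_diff simp: numeral_eq_Suc\<close>)
    moreover have "vge (0 + Suc k) (br X (T - T'))" by (rule vge_l) (use that in \<open>auto simp: numeral_eq_Suc\<close>)
    ultimately have "vge k (ex 1 T X - ex 1 T' X - br X (T - T') + br X (T - T'))"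
      by (intro vge_add) (auto elim: vge_mono)
    then show ?thesis by simp
  qed
  have D0: "D G H X = 0" if X: "\<And>k. vge (k + 2) (D (fst (f k)) (snd (f k)) X)" for X
  proof (rule vge_eqI)
    fix k
    let ?g = "fst (f k)" and ?h = "snd (f k)"
    have a: "vge k (pb S (ex 1 G X - ex 1 ?g X))" by (intro pb_vge[OF Sv] ediff GH fk G)
    have b: "vge k (ex 1 G (ex 1 H (pb R X) - ex 1 ?h (pb R X)))" by (intro vge_ex ediff GH fk H)
    have c: "vge k (ex 1 G (ex 1 ?h (pb R X)) - ex 1 ?g (ex 1 ?h (pb R X)))" by (intro ediff GH fk G)
    have d: "vge k (D ?g ?h X)" using X[of k] by (rule vge_mono) simp
    have "vge k (pb S (ex 1 G X - ex 1 ?g X) - ex 1 G (ex 1 H (pb R X) - ex 1 ?h (pb R X))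
       - (ex 1 G (ex 1 ?h (pb R X)) - ex 1 ?g (ex 1 ?h (pb R X))) + D ?g ?h X)"
      by (rule vge_add[OF vge_diff[OF vge_diff[OF a b] c] d])
    then show "vge k (D G H X - 0)" by (simp add: D_def pb_ring[OF Sv] ex_diff)
  qed
  \<comment> \<open>Equality is known on the two coordinates only; it extends to every series
    because both sides are pullbacks by formal maps.\<close>
  have gen: "pb S (ex 1 G X) = ex 1 G (ex 1 H (pb R X))" for X
  proof -
    let ?f = "fcompose (E 1 G) S" and ?g = "fcompose (fcompose R (E 1 H)) (E 1 G)"
    note va = E_vanishes[OF GH(1), of 1] E_vanishes[OF GH(2), of 1] Sv Rv(1)
    have 1: "pb ?f X = pb S (ex 1 G X)" "pb ?g X = ex 1 G (ex 1 H (pb R X))" for X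
      by (simp_all add: pb_fcompose va vanishes_fcompose ex_pb[OF GH(1)] ex_pb[OF GH(2)])
    have v: "vanishes_at_origin ?f" "vanishes_at_origin ?g" by (simp_all add: vanishes_fcompose va)
    have "pb ?f fps_X = pb ?g fps_X" "pb ?f yy = pb ?g yy"
      using D0[of fps_X] D0[of yy] fk(6,7) by (simp_all add: 1 D_def)
    then have "pb ?f X = pb ?g X" by (intro pb_cong) (simp_all add: pb_ring[OF v(1)] pb_ring[OF v(2)])
    then show ?thesis by (simp only: 1)
  qed
  from that[OF GH(1,2) RH GH(3) dH gen] show thesis .
qed

end

section \<open>Complex coordinates\<close>

text \<open>Homomorphisms of coefficient rings as a predicate: \<open>rhom_cmap\<close> lifts them
  through any nesting of series.\<close>

definition rhom :: "('a::comm_ring_1 \<Rightarrow> 'b::comm_ring_1) \<Rightarrow> bool" where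
  "rhom \<phi> \<longleftrightarrow> \<phi> 0 = 0 \<and> \<phi> 1 = 1 \<and> (\<forall>x y. \<phi> (x + y) = \<phi> x + \<phi> y) \<and> (\<forall>x y. \<phi> (x * y) = \<phi> x * \<phi> y)"

definition cmap :: "('a::comm_ring_1 \<Rightarrow> 'b::comm_ring_1) \<Rightarrow> 'a fps fps \<Rightarrow> 'b fps fps" where
  "cmap \<phi> T = Abs_fps (\<lambda>i. Abs_fps (\<lambda>j. \<phi> (T $ i $ j)))"

lemma cmap_nth [simp]: "cmap \<phi> T $ i $ j = \<phi> (T $ i $ j)"
  by (simp add: cmap_def)

lemma rhomD:
  assumes "rhom \<phi>"
  shows "\<phi> 0 = 0" "\<phi> 1 = 1" "\<phi> (x + y) = \<phi> x + \<phi> y" "\<phi> (x * y) = \<phi> x * \<phi> y" "\<phi> (- x) = - \<phi> x"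
    "\<phi> (x - y) = \<phi> x - \<phi> y" "\<phi> (x ^ k) = \<phi> x ^ k" "\<phi> (of_nat k) = of_nat k" "\<phi> (\<Sum>i\<in>I. f i) = (\<Sum>i\<in>I. \<phi> (f i))"
proof -
  show z: "\<phi> 0 = 0" and o: "\<phi> 1 = 1" and a: "\<phi> (x + y) = \<phi> x + \<phi> y" and m: "\<phi> (x * y) = \<phi> x * \<phi> y" for x y
    using assms by (auto simp: rhom_def)
  show n: "\<phi> (- x) = - \<phi> x" for x using a[of x "- x"] z by (simp add: eq_neg_iff_add_eq_0 add.commute)
  show "\<phi> (x - y) = \<phi> x - \<phi> y" using a[of x "- y"] n by simp
  show "\<phi> (x ^ k) = \<phi> x ^ k" by (induction k) (simp_all add: o m)
  show "\<phi> (of_nat k) = of_nat k" by (induction k) (simp_all add: z o a)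
  show "\<phi> (\<Sum>i\<in>I. f i) = (\<Sum>i\<in>I. \<phi> (f i))" by (induction I rule: infinite_finite_induct) (simp_all add: z a)
qed

lemma rhom_cmap:
  assumes "rhom \<phi>" shows "rhom (cmap \<phi>)"
  unfolding rhom_def[of "cmap \<phi>"]
  by (intro conjI allI; rule fps2_eqI; simp add: rhomD[OF assms] mult2_nth fps_one_nth)

lemma cmap_subst2:
  assumes "rhom \<phi>"
  shows "cmap \<phi> (subst2 G X Y) = subst2 (cmap \<phi> G) (cmap \<phi> X) (cmap \<phi> Y)"
proof -
  have p: "cmap \<phi> X ^ i * cmap \<phi> Y ^ j = cmap \<phi> (X ^ i * Y ^ j)" for i j by (simp add: rhomD[OF rhom_cmap[OF assms]])
  show ?thesis by (rule fps2_eqI) (simp add: subst2_nth p rhomD[OF assms])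
qed

lemma cmap_vars:
  assumes "rhom \<phi>"
  shows "cmap \<phi> fps_X = fps_X" "cmap \<phi> yy = yy" "cmap \<phi> (cc c) = cc (\<phi> c)"
  by (rule fps2_eqI; simp add: rhomD[OF assms] yy_def cc_nth fps_X_nth; simp add: rhomD[OF assms] fps_one_nth)+

lemma cmap_deriv:
  assumes "rhom \<phi>"
  shows "cmap \<phi> (fps_deriv G) = fps_deriv (cmap \<phi> G)" "cmap \<phi> (dY G) = dY (cmap \<phi> G)"
  by (rule fps2_eqI; simp add: fps_deriv_nth2 dY_nth rhomD[OF assms] del: of_nat_add of_nat_Suc)+

lemma cmap_br:
  assumes "rhom \<phi>"
  shows "cmap \<phi> (br G H) = br (cmap \<phi> G) (cmap \<phi> H)"
  by (simp add: br_def rhomD[OF rhom_cmap[OF assms]] cmap_deriv[OF assms])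

lemma cmap_dge: "rhom \<phi> \<Longrightarrow> dge k T \<Longrightarrow> dge k (cmap \<phi> T)"
  using rhomD(1)[of \<phi>] by (simp add: dge_def)

lemma fps4_eqI': "(\<And>i j m l. S $ i $ j $ m $ l = T $ i $ j $ m $ l) \<Longrightarrow> S = T"
  by (simp add: fps_eq_iff)

type_synonym cpar = "complex fps fps"
type_synonym cplane = "complex fps fps fps fps"

definition cP :: "plane_series \<Rightarrow> cplane" where "cP = cmap (cmap of_real)"
definition ck :: "complex \<Rightarrow> cplane" where "ck c = cc (cc c)"

lemma rhom_of_real: "rhom (of_real :: real \<Rightarrow> complex)" "rhom cnj"
  by (simp_all add: rhom_def)

lemma rhom_cP: "rhom cP" "rhom (cmap (of_real :: real \<Rightarrow> complex))" "rhom (cmap cnj)" "rhom (cmap (cmap cnj))"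
  unfolding cP_def by (intro rhom_cmap rhom_of_real)+

lemma cP_nth [simp]: "cP T $ i $ j $ m $ l = of_real (T $ i $ j $ m $ l)"
  by (simp add: cP_def)

lemma ck_nth [simp]: "(ck c * T) $ i $ j $ m $ l = c * T $ i $ j $ m $ l"
  by (simp add: ck_def)

lemma ck_hom: "ck (a + b) = ck a + ck b" "ck (a * b) = ck a * ck b" "ck 0 = 0" "ck 1 = 1" "ck (- a) = - ck a"
   "ck (a - b) = ck a - ck b" "ck (a ^ k) = ck a ^ k"
proof -
  show m: "ck (a * b) = ck a * ck b" for a b by (simp add: ck_def cc_mult)
  show o: "ck 1 = 1" by (simp add: ck_def)
  show "ck (a ^ k) = ck a ^ k" by (induction k) (simp_all add: o m)
qed (simp_all add: ck_def cc_add cc_diff cc_minus)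

definition lin1 :: "'a::comm_ring_1 fps fps fps fps \<Rightarrow> bool" where
  "lin1 = spt (\<lambda>i j m l. i + j = 1 \<and> m = 0 \<and> l = 0)"

lemma lin1_dge: "lin1 X \<Longrightarrow> dge 1 X"
  unfolding lin1_def dge_spt by (erule spt_mono) simp

lemma spt_one: "spt (\<lambda>i j m l. i = 0 \<and> j = 0 \<and> m = 0 \<and> l = 0) (1 :: 'a::comm_ring_1 fps fps fps fps)"
  by (auto simp: spt_def fps_one_nth split: if_splits)

lemma lin1_power: "lin1 X \<Longrightarrow> spt (\<lambda>i j m l. i + j = k \<and> m = 0 \<and> l = 0) (X ^ k)"
proof (induction k)
  case 0
  show ?case using spt_one by (simp add: spt_mono)
next
  case (Suc k)
  show ?case unfolding power_Suc
    by (rule spt_mult[OF Suc.prems[unfolded lin1_def] Suc.IH[OF Suc.prems]]) simp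
qed

text \<open>A linear substitution free of parameters preserves the degree in the plane variables,
  hence every support condition that depends only on i + j, m and l. Degree estimates thus pass
  freely between (x,y) and (z,w).\<close>

lemma hom_subst2:
  fixes G X Y :: "'a::comm_ring_1 fps fps fps fps"
  assumes X: "lin1 X" and Y: "lin1 Y" and G: "spt (\<lambda>i j m l. A (i + j) m l) G"
  shows "spt (\<lambda>i j m l. A (i + j) m l) (subst2 G X Y)"
  unfolding spt_def
proof (intro allI impI)
  fix a b m l assume "subst2 G X Y $ a $ b $ m $ l \<noteq> 0"
  then have "(\<Sum>i\<le>a+b. \<Sum>j\<le>a+b. (cc (G $ i $ j) * (X ^ i * Y ^ j)) $ a $ b $ m $ l) \<noteq> 0"
    by (simp add: subst2_nth fps_sum_nth)
  then obtain i j where nz: "(cc (G $ i $ j) * (X ^ i * Y ^ j)) $ a $ b $ m $ l \<noteq> 0"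
    by (rule sum2_nzE)
  have "spt (\<lambda>a b m l. a = 0 \<and> b = 0 \<and> A (i + j) m l) (cc (G $ i $ j))"
    unfolding spt_def
  proof (intro allI impI)
    fix a b m l assume nz: "cc (G $ i $ j) $ a $ b $ m $ l \<noteq> 0"
    then have "a = 0" "b = 0" "G $ i $ j $ m $ l \<noteq> 0" by (auto simp: cc_nth split: if_splits)
    then show "a = 0 \<and> b = 0 \<and> A (i + j) m l" using spt_nz[OF G] by blast
  qed
  moreover have "spt (\<lambda>a b m l. a + b = i + j \<and> m = 0 \<and> l = 0) (X ^ i * Y ^ j)"
    by (rule spt_mult[OF lin1_power[OF X] lin1_power[OF Y]]) simp
  ultimately have "spt (\<lambda>a b m l. a + b = i + j \<and> A (i + j) m l) (cc (G $ i $ j) * (X ^ i * Y ^ j))"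
    by (rule spt_mult) auto
  from spt_nz[OF this nz] show "A (a + b) m l" by auto
qed

lemma lin1_vars: "lin1 (fps_X :: 'a::comm_ring_1 fps fps fps fps)" "lin1 (yy :: 'a::comm_ring_1 fps fps fps fps)"
  by (auto simp: lin1_def spt_def yy_def fps_X_nth split: if_splits)

lemma lin1_comb: "lin1 X \<Longrightarrow> lin1 Y \<Longrightarrow> lin1 (X + Y)" "lin1 X \<Longrightarrow> lin1 Y \<Longrightarrow> lin1 (X - Y)" "lin1 X \<Longrightarrow> lin1 (ck c * X)"
  by (simp_all add: lin1_def spt_add spt_diff) (auto simp: spt_def)

text \<open>In the complex coordinates \<open>z = x + i y\<close>, \<open>w = x - i y\<close> one has \<open>x = (z + w)/2\<close>, \<open>y = (z - w)/(2i)\<close>.\<close>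

definition ZX :: cplane where "ZX = ck (1/2) * (fps_X + yy)"
definition ZY :: cplane where "ZY = ck (- (\<i>/2)) * (fps_X - yy)"
definition tau :: "plane_series \<Rightarrow> cplane" where "tau T = subst2 (cP T) ZX ZY"
definition XZ :: cplane where "XZ = fps_X + ck \<i> * yy"
definition XW :: cplane where "XW = fps_X - ck \<i> * yy"

lemma lin1_Z: "lin1 ZX" "lin1 ZY" "lin1 XZ" "lin1 XW"
  unfolding ZX_def ZY_def XZ_def XW_def by (intro lin1_comb lin1_vars)+

lemmas dge_Z = lin1_Z[THEN lin1_dge]

lemma Z_id: "ZX + ck \<i> * ZY = fps_X" "ZX - ck \<i> * ZY = yy" "ck (1/2) * (XZ + XW) = fps_X" "ck (- (\<i>/2)) * (XZ - XW) = yy"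
proof -
  have h: "ck (1/2) + ck (1/2) = 1" unfolding ck_hom(1)[symmetric] by (simp add: ck_hom(4))
  have i: "ck \<i> * ck (- (\<i>/2)) = ck (1/2)" unfolding ck_hom(2)[symmetric] by simp
  have "ZX + ck \<i> * ZY = ck (1/2) * (fps_X + yy) + (ck \<i> * ck (- (\<i>/2))) * (fps_X - yy)"
    by (simp add: ZX_def ZY_def mult.assoc)
  also have "\<dots> = (ck (1/2) + ck (1/2)) * fps_X" unfolding i by (simp add: algebra_simps)
  finally show "ZX + ck \<i> * ZY = fps_X" by (simp only: h mult_1)
  have "ZX - ck \<i> * ZY = ck (1/2) * (fps_X + yy) - (ck \<i> * ck (- (\<i>/2))) * (fps_X - yy)"
    by (simp add: ZX_def ZY_def mult.assoc)
  also have "\<dots> = (ck (1/2) + ck (1/2)) * yy" unfolding i by (simp add: algebra_simps)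
  finally show "ZX - ck \<i> * ZY = yy" by (simp only: h mult_1)
  have "ck (1/2) * (XZ + XW) = (ck (1/2) + ck (1/2)) * fps_X" by (simp add: XZ_def XW_def algebra_simps)
  then show "ck (1/2) * (XZ + XW) = fps_X" by (simp only: h mult_1)
  have "ck (- (\<i>/2)) * (XZ - XW) = (ck \<i> * ck (- (\<i>/2)) + ck \<i> * ck (- (\<i>/2))) * yy" by (simp add: XZ_def XW_def algebra_simps)
  then show "ck (- (\<i>/2)) * (XZ - XW) = yy" by (simp only: i h mult_1)
qed

lemma subst2_ck: "dge 1 X \<Longrightarrow> dge 1 Y \<Longrightarrow> subst2 (ck c) X Y = ck c"
  by (simp add: ck_def subst2_cc)

lemma tau_ring: "tau (F + G) = tau F + tau G" "tau (F - G) = tau F - tau G" "tau (- F) = - tau F" "tau (F * G) = tau F * tau G"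
  "tau 0 = 0" "tau 1 = 1" "tau (F ^ k) = tau F ^ k"
  by (simp_all add: tau_def rhomD[OF rhom_cP(1)] subst2_add subst2_diff subst2_uminus subst2_mult dge_Z subst2_1 subst2_power
    del: One_nat_def)

lemma tau_sum: "tau (\<Sum>i\<in>I. f i) = (\<Sum>i\<in>I. tau (f i))"
  by (rule additive_sum) (rule tau_ring)

lemma cP_cc: "cP (cc c) = cc (cmap of_real c)" "cP (real_const r) = ck (of_real r)"
proof -
  show 1: "cP (cc c) = cc (cmap of_real c)" for c unfolding cP_def by (rule cmap_vars(3)[OF rhom_cP(2)])
  have "cmap of_real (cc r) = cc (of_real r :: complex)" by (rule cmap_vars(3)[OF rhom_of_real(1)])
  then show "cP (real_const r) = ck (of_real r)" using 1[of "cc r"] by (simp add: defs_eq ck_def cc_def)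
qed

lemma tau_cc: "tau (cc c) = cc (cmap of_real c)" "tau (real_const r) = ck (of_real r)" "tau fps_X = ZX" "tau yy = ZY"
  unfolding tau_def cP_cc using rhom_cP(2) by (simp_all add: ck_def subst2_cc dge_Z cmap_vars cP_def subst2_X subst2_Y del: One_nat_def)

lemma ck_br: "br (ck c * G) H = ck c * br G H" "br G (ck c * H) = ck c * br G H"
  by (simp_all add: ck_def br_cc_left br_cc_right)

text \<open>The determinant of (x,y) with respect to (z,w) is i/2, and -2i is its inverse.\<close>

lemma tau_br: "tau (br G H) = ck (- 2 * \<i>) * br (tau G) (tau H)"
proof -
  have "br ZX ZY = ck (1/2) * (ck (- (\<i>/2)) * br (fps_X + yy) (fps_X - yy))"
    by (simp add: ZX_def ZY_def ck_br)
  also have "br (fps_X + yy) (fps_X - yy) = (ck (- 2) :: cplane)"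
    using ck_hom(1)[of "-1" "-1"] by (simp add: br_add_left br_diff_right br_vars ck_hom)
  finally have b: "br ZX ZY = ck (\<i>/2)" by (simp flip: ck_hom(2))
  have "br (tau G) (tau H) = tau (br G H) * ck (\<i>/2)"
    unfolding tau_def br_subst2[OF dge_Z(1,2)] b cP_def cmap_br[OF rhom_cP(2)] ..
  then have "ck (- 2 * \<i>) * br (tau G) (tau H) = (ck (- 2 * \<i>) * ck (\<i>/2)) * tau (br G H)" by (simp add: mult_ac)
  also have "ck (- 2 * \<i>) * ck (\<i>/2) = 1" by (simp add: ck_hom flip: ck_hom(2))
  finally show ?thesis by simp
qed

lemma cP_spt: "spt A (cP T) \<longleftrightarrow> spt A T"
  by (simp add: spt_def)

lemma sigma_tau: "subst2 (tau T) XZ XW = cP T"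
proof -
  have "subst2 ZX XZ XW = fps_X" "subst2 ZY XZ XW = yy"
    unfolding ZX_def ZY_def by (simp_all add: subst2_mult subst2_add subst2_diff dge_Z subst2_ck subst2_X subst2_Y Z_id del: One_nat_def)
  then show ?thesis unfolding tau_def by (simp add: subst2_assoc dge_Z subst2_id del: One_nat_def)
qed

lemma tau_sigma: "subst2 (subst2 Z XZ XW) ZX ZY = Z"
proof -
  have "subst2 XZ ZX ZY = fps_X" "subst2 XW ZX ZY = yy"
    unfolding XZ_def XW_def by (simp_all add: subst2_mult subst2_add subst2_diff dge_Z subst2_ck subst2_X subst2_Y Z_id del: One_nat_def)
  then show ?thesis by (simp add: subst2_assoc dge_Z subst2_id del: One_nat_def)
qed

lemma tau_spt: "spt (\<lambda>i j m l. A (i + j) m l) (tau T) \<longleftrightarrow> spt (\<lambda>i j m l. A (i + j) m l) T"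
proof
  assume "spt (\<lambda>i j m l. A (i + j) m l) (tau T)"
  from hom_subst2[OF lin1_Z(3,4) this] show "spt (\<lambda>i j m l. A (i + j) m l) T" by (simp add: sigma_tau cP_spt)
next
  assume "spt (\<lambda>i j m l. A (i + j) m l) T"
  then have "spt (\<lambda>i j m l. A (i + j) m l) (cP T)" by (simp add: cP_spt)
  from hom_subst2[OF lin1_Z(1,2) this] show "spt (\<lambda>i j m l. A (i + j) m l) (tau T)" by (simp add: tau_def)
qed

lemma tau_inj: "tau S = tau T \<Longrightarrow> S = T"
proof (rule fps4_eqI)
  fix i j m l assume "tau S = tau T"
  then have "cP S = cP T" by (metis sigma_tau)
  then have "cP S $ i $ j $ m $ l = cP T $ i $ j $ m $ l" by simp
  then show "S $ i $ j $ m $ l = T $ i $ j $ m $ l" by simp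
qed

definition sw :: "'a::comm_ring_1 fps fps \<Rightarrow> 'a fps fps" where "sw Z = subst2 Z yy fps_X"

lemma sw_nth: "sw Z $ a $ b = Z $ b $ a"
proof (rule coef_ext[where T = Z and k = "Suc (a + b)"])
  note v = dge_vars(2,1)
  show "sw (mono2 c i j) $ a $ b = mono2 c i j $ b $ a" for c :: 'a and i j
  proof -
    have "sw (mono2 c i j) = mono2 c j i" unfolding sw_def subst2_mono2[OF v] by (simp add: mono2_def mult_ac)
    then show ?thesis by (auto simp: mono2_nth)
  qed
  show "sw T $ a $ b = 0" if "dge (Suc (a + b)) T" for T :: "'a fps fps"
    using subst2_dge[OF v that] by (simp add: sw_def dge_def)
qed (auto simp: sw_def subst2_add dge_def)

text \<open>The reality condition for a series written in z and its conjugate w.\<close>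

definition herm :: "cplane \<Rightarrow> bool" where
  "herm Z \<longleftrightarrow> (\<forall>k l m j. Z $ l $ k $ m $ j = cnj (Z $ k $ l $ m $ j))"

lemma herm_iff: "herm Z \<longleftrightarrow> cmap (cmap cnj) Z = sw Z"
proof -
  have "cmap (cmap cnj) Z = sw Z \<longleftrightarrow> (\<forall>k l m j. cnj (Z $ k $ l $ m $ j) = Z $ l $ k $ m $ j)"
    by (simp add: fps_eq_iff[of "cmap _ Z"] fps_eq_iff[of "cmap _ Z $ _"]) (simp add: fps_eq_iff sw_nth)
  then show ?thesis unfolding herm_def by (metis (no_types))
qed

lemma ck_cnj: "cmap (cmap cnj) (ck c) = ck (cnj c)"
  unfolding ck_def cmap_vars(3)[OF rhom_cP(3)] cmap_vars(3)[OF rhom_of_real(2)] ..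

lemma tau_herm: "herm (tau T)"
proof -
  have c: "cmap (cmap cnj) (cP T) = cP T" by (rule fps4_eqI') simp
  have X: "cmap (cmap cnj) ZX = sw ZX"
    unfolding ZX_def sw_def rhomD[OF rhom_cP(4)] ck_cnj cmap_vars[OF rhom_cP(3)]
    by (simp add: subst2_mult subst2_add subst2_ck dge_vars subst2_X subst2_Y add.commute del: One_nat_def)
  have "ck (cnj (- (\<i>/2))) = - ck (- (\<i>/2))" by (simp flip: ck_hom(5))
  then have Y: "cmap (cmap cnj) ZY = sw ZY"
    unfolding ZY_def sw_def rhomD[OF rhom_cP(4)] ck_cnj cmap_vars[OF rhom_cP(3)]
    by (simp add: subst2_mult subst2_diff subst2_ck dge_vars subst2_X subst2_Y del: One_nat_def) (simp add: algebra_simps)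
  show ?thesis unfolding herm_iff tau_def cmap_subst2[OF rhom_cP(3)] c X Y
    by (simp add: sw_def subst2_assoc dge_Z dge_vars del: One_nat_def)
qed

text \<open>With \<open>tau_herm\<close>: Hermitian series are exactly the images of real ones, so
  generators can be built from complex coefficients and brought back.\<close>

lemma tau_surj:
  assumes "herm Z" obtains T where "tau T = Z"
proof -
  define Y where "Y = subst2 Z XZ XW"
  have X: "cmap (cmap cnj) XZ = XW" "cmap (cmap cnj) XW = XZ"
    unfolding XZ_def XW_def by (simp_all add: rhomD[OF rhom_cP(4)] ck_cnj cmap_vars[OF rhom_cP(3)] ck_hom)
  have "subst2 yy XW XZ = XZ" "subst2 fps_X XW XZ = XW" by (simp_all add: subst2_X subst2_Y dge_Z del: One_nat_def)
  then have "cmap (cmap cnj) Y = Y"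
    unfolding Y_def cmap_subst2[OF rhom_cP(3)] X assms[unfolded herm_iff] sw_def
    by (simp add: subst2_assoc dge_Z dge_vars del: One_nat_def)
  then have r: "cnj (Y $ i $ j $ m $ l) = Y $ i $ j $ m $ l" for i j m l by (metis cmap_nth)
  define T where "T = Abs_fps (\<lambda>i. Abs_fps (\<lambda>j. Abs_fps (\<lambda>m. Abs_fps (\<lambda>l. Re (Y $ i $ j $ m $ l)))))"
  have "cP T = Y"
  proof (rule fps4_eqI')
    fix i j m l show "cP T $ i $ j $ m $ l = Y $ i $ j $ m $ l"
      using r[of i j m l] by (simp add: T_def complex_eq_iff)
  qed
  then have "tau T = Z" by (simp add: tau_def Y_def tau_sigma)
  with that show thesis .
qed

lemma diag_subst2: "subst2 Z (cc u * fps_X) (cc v * yy) $ a $ b = u ^ a * v ^ b * Z $ a $ b"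
proof (rule coef_ext[where T = Z and k = "Suc (a + b)"])
  have v: "dge 1 (cc u * fps_X)" "dge 1 (cc v * yy)" using dge_mult[OF dge_0(2)] dge_vars by fastforce+
  show "subst2 (mono2 c i j) (cc u * fps_X) (cc v * yy) $ a $ b = u ^ a * v ^ b * mono2 c i j $ a $ b" for c i j
  proof -
    have p: "cc x ^ k = cc (x ^ k)" for x :: 'a and k by (induction k) (simp_all add: cc_mult)
    have "subst2 (mono2 c i j) (cc u * fps_X) (cc v * yy) = mono2 (u ^ i * v ^ j * c) i j"
      unfolding subst2_mono2[OF v] by (simp add: mono2_def power_mult_distrib p cc_mult mult_ac)
    then show ?thesis by (simp add: mono2_nth)
  qed
  show "subst2 T (cc u * fps_X) (cc v * yy) $ a $ b = 0" if "dge (Suc (a + b)) T" for T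
    using subst2_dge[OF v that] by (simp add: dge_def)
qed (auto simp: subst2_add dge_def ring_distribs)

abbreviation rot where "rot \<equiv> formal_rotation"

lemma rot_eq: "fst (rot \<theta>) = real_const (cos \<theta>) * fps_X - real_const (sin \<theta>) * yy"
   "snd (rot \<theta>) = real_const (sin \<theta>) * fps_X + real_const (cos \<theta>) * yy"
  by (simp_all add: formal_rotation_def defs_eq)

lemma rot_vanishes: "vanishes_at_origin (rot \<theta>)"
  unfolding vanishes_iff rot_eq defs_eq by (auto simp: dge_1_iff yy_def cc_def)

lemma rot_canon: "canon (rot \<theta>)"
proof -
  have "br (fst (rot \<theta>)) (snd (rot \<theta>)) = real_const (cos \<theta> * cos \<theta> + sin \<theta> * sin \<theta>)"
    unfolding rot_eq rc_hom
    by (simp add: br_add_left br_add_right br_diff_left br_diff_right br_rc_left br_rc_right br_vars)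
  also have "cos \<theta> * cos \<theta> + sin \<theta> * sin \<theta> = 1" using sin_cos_squared_add2[of \<theta>] by (simp add: power2_eq_square)
  finally show ?thesis by (simp add: canon_def rot_vanishes rc_hom)
qed

text \<open>Rotations are diagonal in z and w, so invariance becomes a condition on single
  monomials.\<close>

lemma tau_rot: "tau (pb (rot \<theta>) T) $ k $ l = cc (cis \<theta> ^ k * cis (- \<theta>) ^ l) * tau T $ k $ l"
proof -
  let ?X = "cP (fst (rot \<theta>))" and ?Y = "cP (snd (rot \<theta>))"
  have X: "?X = ck (cos \<theta>) * fps_X - ck (sin \<theta>) * yy" and Y: "?Y = ck (sin \<theta>) * fps_X + ck (cos \<theta>) * yy"
    unfolding rot_eq rhomD[OF rhom_cP(1)] cP_cc by (simp_all add: cP_def cmap_vars rhom_cP)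
  have XY: "dge 1 ?X" "dge 1 ?Y"
    using rot_vanishes[unfolded vanishes_iff] by (auto simp: cP_def intro: cmap_dge rhom_cP)
  have v: "dge 1 (ck (cis \<theta>) * fps_X)" "dge 1 (ck (cis (-\<theta>)) * yy)" using dge_mult[OF dge_0(2)] dge_vars by fastforce+
  let ?z = "ck (cis \<theta>) * fps_X" and ?w = "ck (cis (- \<theta>)) * yy"
  have e: "ck (cos \<theta>) = ck (1/2) * (ck (cis \<theta>) + ck (cis (- \<theta>)))" "ck (sin \<theta>) = ck (- (\<i>/2)) * (ck (cis \<theta>) - ck (cis (- \<theta>)))"
    unfolding ck_hom[symmetric] by (rule arg_cong[where f = ck], simp add: complex_eq_iff)+
  have q: "ck (- (\<i>/2)) * ck (- (\<i>/2)) = - (ck (1/2) * ck (1/2))" by (simp flip: ck_hom)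
  have 1: "subst2 ?X ZX ZY = subst2 ZX ?z ?w" and 2: "subst2 ?Y ZX ZY = subst2 ZY ?z ?w"
  proof -
    have h: "ck (1/2) + ck (1/2) = 1" unfolding ck_hom[symmetric] by (simp add: ck_hom)
    have "subst2 ?X ZX ZY = ck (cos \<theta>) * ZX - ck (sin \<theta>) * ZY"
      unfolding X by (simp add: subst2_diff subst2_mult subst2_ck dge_Z subst2_X subst2_Y del: One_nat_def)
    also have "\<dots> = ck (1/2) * ck (1/2) * (ck (cis \<theta>) + ck (cis (- \<theta>))) * (fps_X + yy)
        - (ck (- (\<i>/2)) * ck (- (\<i>/2))) * (ck (cis \<theta>) - ck (cis (- \<theta>))) * (fps_X - yy)"
      unfolding e ZX_def ZY_def by (simp add: mult_ac)
    also have "\<dots> = ck (1/2) * ((ck (1/2) + ck (1/2)) * (ck (cis \<theta>) * fps_X + ck (cis (- \<theta>)) * yy))"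
      unfolding q by (simp add: algebra_simps)
    also have "\<dots> = subst2 ZX ?z ?w" unfolding h ZX_def by (simp add: subst2_mult subst2_add subst2_ck v subst2_X subst2_Y del: One_nat_def)
    finally show "subst2 ?X ZX ZY = subst2 ZX ?z ?w" .
    have "subst2 ?Y ZX ZY = ck (sin \<theta>) * ZX + ck (cos \<theta>) * ZY"
      unfolding Y by (simp add: subst2_add subst2_mult subst2_ck dge_Z subst2_X subst2_Y del: One_nat_def)
    also have "\<dots> = ck (- (\<i>/2)) * ((ck (1/2) + ck (1/2)) * (ck (cis \<theta>) * fps_X - ck (cis (- \<theta>)) * yy))"
      unfolding e ZX_def ZY_def by (simp add: algebra_simps)
    also have "\<dots> = subst2 ZY ?z ?w" unfolding h ZY_def by (simp add: subst2_mult subst2_diff subst2_ck v subst2_X subst2_Y del: One_nat_def)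
    finally show "subst2 ?Y ZX ZY = subst2 ZY ?z ?w" .
  qed
  have "tau (pb (rot \<theta>) T) = subst2 (subst2 (cP T) ?X ?Y) ZX ZY"
    unfolding tau_def pb_def by (simp add: cP_def cmap_subst2 rhom_cP)
  also have "\<dots> = subst2 (cP T) (subst2 ZX ?z ?w) (subst2 ZY ?z ?w)"
    unfolding subst2_assoc[OF XY dge_Z(1,2)] 1 2 ..
  also have "\<dots> = subst2 (tau T) ?z ?w" unfolding tau_def subst2_assoc[OF dge_Z(1,2) v] ..
  finally have f: "tau (pb (rot \<theta>) T) = subst2 (tau T) ?z ?w" .
  have p: "cc x ^ k = cc (x ^ k)" for x :: complex and k by (induction k) (simp_all add: cc_mult)
  show ?thesis unfolding f ck_def diag_subst2 cc_mult p ..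
qed

lemma tau_action: "tau action = ck (1/2) * (fps_X * yy)"
proof -
  have q: "ck (- (\<i>/2)) * ck (- (\<i>/2)) = - (ck (1/2) * ck (1/2))" by (simp flip: ck_hom)
  have h: "ck (1/2) + ck (1/2) = 1" unfolding ck_hom[symmetric] by (simp add: ck_hom)
  have "tau action = ck (1/2) * (ZX ^ 2 + ZY ^ 2)"
    unfolding action_def tau_ring defs_eq(1,2) tau_cc by simp
  also have "ZX ^ 2 + ZY ^ 2 = ck (1/2) * ck (1/2) * (fps_X + yy) ^ 2 + (ck (- (\<i>/2)) * ck (- (\<i>/2))) * (fps_X - yy) ^ 2"
    unfolding ZX_def ZY_def by (simp add: power2_eq_square mult_ac)
  also have "\<dots> = (ck (1/2) + ck (1/2)) * (ck (1/2) + ck (1/2)) * (fps_X * yy)"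
    unfolding q by (simp add: power2_eq_square algebra_simps)
  finally show ?thesis unfolding h by simp
qed

lemma tau_Re_z_power: "tau (Re_z_power n) = ck (1/2) * (fps_X ^ n + yy ^ n)"
proof -
  have b: "(ZX + ck c * ZY) ^ n = (\<Sum>j\<le>n. ck (of_nat (n choose j) * c ^ j) * ZX ^ (n - j) * ZY ^ j)" for c
  proof -
    have "ck (of_nat k) = of_nat k" for k by (simp add: ck_def cc_def fps_of_nat)
    then show ?thesis unfolding add.commute[of ZX] binomial_ring
      by (intro sum.cong refl) (simp add: ck_hom power_mult_distrib mult_ac)
  qed
  have r: "of_real (of_nat (n choose j) * Re (\<i> ^ j)) = 1/2 * (of_nat (n choose j) * \<i> ^ j) + 1/2 * (of_nat (n choose j) * (- \<i>) ^ j)" for j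
  proof -
    have "(- \<i>) ^ j = cnj (\<i> ^ j)" by simp
    then have "of_real (Re (\<i> ^ j)) = 1/2 * (\<i> ^ j + (- \<i>) ^ j)" by (simp add: complex_eq_iff del: complex_cnj_power)
    then show ?thesis by (simp add: algebra_simps)
  qed
  have "tau (Re_z_power n) = (\<Sum>j\<le>n. ck (of_real (of_nat (n choose j) * Re (\<i> ^ j))) * ZX ^ (n - j) * ZY ^ j)"
    unfolding Re_z_power_def tau_sum tau_ring defs_eq(1,2) tau_cc ..
  also have "\<dots> = ck (1/2) * ((ZX + ck \<i> * ZY) ^ n + (ZX + ck (- \<i>) * ZY) ^ n)"
  proof -
    have "ck (of_real (of_nat (n choose j) * Re (\<i> ^ j))) * P * Q
      = ck (1/2) * (ck (of_nat (n choose j) * \<i> ^ j) * P * Q) + ck (1/2) * (ck (of_nat (n choose j) * (- \<i>) ^ j) * P * Q)" for j P Q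
      unfolding r ck_hom(1) ck_hom(2)[of "1/2"] by (simp only: algebra_simps)
    then show ?thesis unfolding b by (simp only: sum.distrib sum_distrib_left distrib_left)
  qed
  also have "ZX + ck (- \<i>) * ZY = yy" using Z_id(2) by (simp add: ck_hom)
  finally show ?thesis unfolding Z_id(1) .
qed

lemma tau_in_action: "tau (in_action A) $ k $ l = (if k = l then cc ((1/2) ^ k) * cmap of_real (A $ k) else 0)"
proof -
  let ?G = "Abs_fps (\<lambda>k. fps_const (A $ k)) :: plane_series"
  have "dge 1 action" by (simp add: action_def defs_eq dge_1_iff yy_def cc_def)
  then have d: "dge 1 (cP action)" "dge 1 (0 :: cplane)" by (auto simp: cP_def intro: cmap_dge rhom_cP)
  have "tau (in_action A) = subst2 (subst2 (cP ?G) (cP action) 0) ZX ZY"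
    by (simp add: tau_def in_action_def cP_def cmap_subst2 rhom_cP rhomD[OF rhom_cP(1), unfolded cP_def])
  also have "\<dots> = subst2 (cP ?G) (tau action) 0"
    unfolding subst2_assoc[OF d dge_Z(1,2)] by (simp add: tau_def)
  finally have "tau (in_action A) $ k $ l = (\<Sum>i\<le>k+l. \<Sum>j\<le>k+l. cP ?G $ i $ j * ((ck (1/2) * (fps_X * yy)) ^ i * 0 ^ j) $ k $ l)"
    by (simp add: subst2_nth tau_action)
  also have "\<dots> = (\<Sum>i\<le>k+l. \<Sum>j\<le>k+l. if i = k \<and> j = 0 then (if k = l then cc ((1/2) ^ k) * cmap of_real (A $ k) else 0) else 0)"
  proof (intro sum.cong refl)
    fix i j
    have "(ck (1/2) * (fps_X * yy)) ^ i = mono2 (cc ((1/2) ^ i)) i i"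
      by (simp add: mono2_def power_mult_distrib ck_def mult.assoc flip: ck_hom(7)[unfolded ck_def])
    then show "cP ?G $ i $ j * ((ck (1/2) * (fps_X * yy)) ^ i * 0 ^ j) $ k $ l =
      (if i = k \<and> j = 0 then (if k = l then cc ((1/2) ^ k) * cmap of_real (A $ k) else 0) else 0)"
      by (cases j) (auto simp: mono2_nth cP_def rhomD[OF rhom_cP(2)])
  qed
  also have "\<dots> = (\<Sum>i\<le>k+l. if i = k then (\<Sum>j\<le>k+l. if j = 0 then (if k = l then cc ((1/2) ^ k) * cmap of_real (A $ k) else 0) else 0) else 0)"
    by (intro sum.cong) auto
  finally show ?thesis by simp
qed

text \<open>Downward recursions of second order.\<close>

definition drec :: "nat \<Rightarrow> (nat \<Rightarrow> 'a::comm_ring_1) \<Rightarrow> (nat \<Rightarrow> 'a) \<Rightarrow> (nat \<Rightarrow> 'a) \<Rightarrow> (nat \<Rightarrow> 'a) \<Rightarrow> bool" where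
  "drec Q \<alpha> \<beta> s g \<longleftrightarrow> (\<forall>q<Q. g q = s (Suc q) + \<alpha> (Suc q) * g (Suc q) + \<beta> (Suc q) * g (Suc (Suc q)))"

lemma drec_exists: "\<exists>g. g Q = v \<and> (\<forall>q>Q. g q = 0) \<and> drec Q \<alpha> \<beta> s g"
proof -
  have "\<exists>g. g Q = v \<and> g (Suc Q) = w \<and> drec Q \<alpha> \<beta> s g" for w
  proof (induction Q arbitrary: v w)
    case 0
    show ?case by (rule exI[of _ "\<lambda>q. if q = 0 then v else w"]) (simp add: drec_def)
  next
    case (Suc Q)
    from Suc.IH[of "s (Suc Q) + \<alpha> (Suc Q) * v + \<beta> (Suc Q) * w" v] obtain g
      where g: "g Q = s (Suc Q) + \<alpha> (Suc Q) * v + \<beta> (Suc Q) * w" "g (Suc Q) = v" "drec Q \<alpha> \<beta> s g" by blast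
    let ?g = "g(Suc (Suc Q) := w)"
    have "drec (Suc Q) \<alpha> \<beta> s ?g"
      unfolding drec_def
    proof (intro allI impI)
      fix q assume "q < Suc Q"
      then show "?g q = s (Suc q) + \<alpha> (Suc q) * ?g (Suc q) + \<beta> (Suc q) * ?g (Suc (Suc q))"
        using g by (cases "q = Q") (auto simp: drec_def)
    qed
    moreover have "?g (Suc Q) = v" "?g (Suc (Suc Q)) = w" using g by simp_all
    ultimately show ?case by blast
  qed
  from this[of 0] obtain g where g: "g Q = v" "g (Suc Q) = 0" "drec Q \<alpha> \<beta> s g" by blast
  let ?g = "\<lambda>q. if q \<le> Suc Q then g q else 0"
  have "drec Q \<alpha> \<beta> s ?g" using g(3) by (auto simp: drec_def)
  moreover have "?g q = 0" if "q > Q" for q using g(2) that by (cases "q = Suc Q") auto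
  ultimately show ?thesis using g(1) by (intro exI[of _ ?g]) simp
qed

lemma drec_unique:
  assumes "drec Q \<alpha> \<beta> s g" "drec Q \<alpha> \<beta> s h" "g Q = h Q" "g (Suc Q) = h (Suc Q)"
  shows "q \<le> Q \<Longrightarrow> g q = h q"
proof -
  have "\<forall>q. q \<le> Q \<and> Q \<le> q + k \<longrightarrow> g q = h q \<and> g (Suc q) = h (Suc q)" for k
  proof (induction k)
    case 0
    show ?case using assms(3,4) by auto
  next
    case (Suc k)
    show ?case
    proof (intro allI impI)
      fix q assume q: "q \<le> Q \<and> Q \<le> q + Suc k"
      show "g q = h q \<and> g (Suc q) = h (Suc q)"
      proof (cases "q = Q")
        case False
        with q have "Suc q \<le> Q \<and> Q \<le> Suc q + k" by auto
        with Suc have "g (Suc q) = h (Suc q)" "g (Suc (Suc q)) = h (Suc (Suc q))" by blast+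
        with assms(1,2) False q show ?thesis by (simp add: drec_def)
      qed (use assms in simp)
    qed
  qed
  then show "q \<le> Q \<Longrightarrow> g q = h q" using le_add1[of Q q] by (metis add.commute)
qed

lemma drec_lincomb:
  assumes "drec Q \<alpha> \<beta> s g" "drec Q \<alpha> \<beta> s' h"
  shows "drec Q \<alpha> \<beta> (\<lambda>q. s q + c * s' q) (\<lambda>q. g q + c * h q)"
  using assms by (auto simp: drec_def algebra_simps)

text \<open>With nonnegative coefficients the homogeneous solution does not vanish; a common sign of \<open>\<alpha>\<close> is removed by twisting.\<close>

lemma drec_hom_pos:
  fixes \<alpha> \<beta> :: "nat \<Rightarrow> real"
  assumes ss: "\<sigma> * \<sigma> = 1" and \<alpha>: "\<And>q. 1 \<le> q \<Longrightarrow> q \<le> Q \<Longrightarrow> 0 < \<sigma> * \<alpha> q" and \<beta>: "\<And>q. 1 \<le> q \<Longrightarrow> q \<le> Q \<Longrightarrow> 0 \<le> \<beta> q"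
    and g: "drec Q \<alpha> \<beta> (\<lambda>_. 0) g" "g Q = 1" "g (Suc Q) = 0"
  shows "g 0 \<noteq> 0"
proof -
  have "0 < \<sigma> ^ k * g q" if "Q = q + k" for k q
    using that
  proof (induction k arbitrary: q rule: less_induct)
    case (less k)
    show ?case
    proof (cases k)
      case 0 with less g show ?thesis by simp
    next
      case (Suc k')
      then have q: "q < Q" using less.prems by simp
      have 1: "0 < \<sigma> ^ k' * g (Suc q)" using less Suc by simp
      have 2: "0 \<le> \<sigma> ^ k * g (Suc (Suc q))"
      proof (cases k')
        case 0 with Suc less.prems g(3) show ?thesis by simp
      next
        case (Suc k'')
        then have "0 < \<sigma> ^ k'' * g (Suc (Suc q))" using less \<open>k = Suc k'\<close> by simp
        moreover have "\<sigma> ^ k = \<sigma> ^ k''" using Suc \<open>k = Suc k'\<close> ss by (simp flip: mult.assoc)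
        ultimately show ?thesis by simp
      qed
      have "\<sigma> ^ k * g q = (\<sigma> * \<alpha> (Suc q)) * (\<sigma> ^ k' * g (Suc q)) + \<beta> (Suc q) * (\<sigma> ^ k * g (Suc (Suc q)))"
        using g(1) q Suc by (simp add: drec_def algebra_simps)
      moreover have "0 < (\<sigma> * \<alpha> (Suc q)) * (\<sigma> ^ k' * g (Suc q))" by (rule mult_pos_pos) (use \<alpha>[of "Suc q"] q 1 in auto)
      moreover have "0 \<le> \<beta> (Suc q) * (\<sigma> ^ k * g (Suc (Suc q)))" by (rule mult_nonneg_nonneg) (use \<beta>[of "Suc q"] q 2 in auto)
      ultimately show ?thesis by linarith
    qed
  qed
  from this[of 0 Q] show ?thesis by auto
qed

text \<open>Without the middle coefficient the recursion moves in steps of two, and positivity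
  reaches only indices of the parity of Q.\<close>

lemma drec_hom_pos2:
  fixes \<beta> :: "nat \<Rightarrow> real"
  assumes \<beta>: "\<And>q. 1 \<le> q \<Longrightarrow> q \<le> Q \<Longrightarrow> 0 < \<beta> q"
    and g: "drec Q (\<lambda>_. 0) \<beta> (\<lambda>_. 0) g" "g Q = 1"
  shows "Q = q + 2 * k \<Longrightarrow> 0 < g q"
proof (induction k arbitrary: q)
  case 0 with g show ?case by simp
next
  case (Suc k)
  then have "0 < g (Suc (Suc q))" "q < Q" by auto
  moreover have "g q = \<beta> (Suc q) * g (Suc (Suc q))" using g(1) \<open>q < Q\<close> by (simp add: drec_def)
  ultimately show ?case using \<beta>[of "Suc q"] by simp
qed

text \<open>A row consists of the resonant monomials z^(l + n q) w^l with 2 l + \<mu> q = d, indexed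
  by q; N stands for n. The number \<epsilon> is 1 if n = \<mu> and 0 if n > 6, when the bracket of
  w^n with a monomial of positive index is too heavy for the target row. The alternatives are n
  \<ge> 6 with I^3 in the leading part, and n = 5 without it.\<close>

locale rows =
  fixes d \<mu> :: nat and a b \<epsilon> N :: real
  assumes par: "(\<mu> = 6 \<and> a \<noteq> 0 \<and> \<epsilon> \<in> {0, 1}) \<or> (\<mu> = 5 \<and> a = 0 \<and> \<epsilon> = 1)"
    and b: "0 < b" and d: "1 \<le> d" and N: "0 < N"
begin

text \<open>The exponent of w at index q of the row.\<close>

definition J :: "nat \<Rightarrow> real" where "J q = (real d - real \<mu> * real q) / 2"

text \<open>The bracket of the leading part with a row, divided by n, at index q of the target row
  of weight d + \<mu> - 2. The three terms come from a (z w)^3, b z^n and b w^n.\<close>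

definition Rw :: "(nat \<Rightarrow> complex) \<Rightarrow> nat \<Rightarrow> complex" where
  "Rw g q = - (of_real (3 * a * q) * g q) + of_real (b * J (q - 1)) * g (q - 1)
     - of_real (\<epsilon> * b * (real d + real \<mu> * real (q + 1)) / 2) * g (q + 1)"

definition al :: "nat \<Rightarrow> real" where "al q = 3 * a * q / (b * J (q - 1))"
definition be :: "nat \<Rightarrow> real" where "be q = \<epsilon> * (real d + real \<mu> * real (q + 1)) / 2 / J (q - 1)"

text \<open>Index q of the target row carries a monomial: 2 l + \<mu> q = d + \<mu> - 2 is solvable
  in natural numbers l.\<close>

definition valid :: "nat \<Rightarrow> bool" where "valid q \<longleftrightarrow> \<mu> * q + 2 \<le> d + \<mu> \<and> even (d + \<mu> + \<mu> * q)"

lemma Jpos: "\<mu> * q < d \<Longrightarrow> 0 < J q"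
  unfolding J_def by (simp add: of_nat_less_iff[symmetric, where 'a = real] del: of_nat_less_iff)

text \<open>The term of z^n has the nonzero factor b J q, so row q + 1 can be solved for g q; this
  is the downward recursion.\<close>

lemma Rw_iff:
  assumes "\<mu> * q < d"
  shows "Rw g (Suc q) = r \<longleftrightarrow> g q = r / of_real (b * J q) + of_real (al (Suc q)) * g (Suc q) + of_real (be (Suc q)) * g (Suc (Suc q))"
proof -
  have p: "(of_real (b * J q) :: complex) \<noteq> 0" and J: "J q \<noteq> 0" "b \<noteq> 0" using Jpos[OF assms] b by auto
  have A1: "of_real (b * J q) * of_real (al (Suc q)) = (of_real (3 * a * Suc q) :: complex)"
    using J unfolding al_def of_real_mult[symmetric] by simp
  have A2: "of_real (b * J q) * of_real (be (Suc q)) = (of_real (\<epsilon> * b * (real d + real \<mu> * real (Suc q + 1)) / 2) :: complex)"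
    using J unfolding be_def of_real_mult[symmetric] by simp
  have "of_real (b * J q) * (r / of_real (b * J q) + of_real (al (Suc q)) * g (Suc q) + of_real (be (Suc q)) * g (Suc (Suc q)))
     = r + of_real (3 * a * Suc q) * g (Suc q) + of_real (\<epsilon> * b * (real d + real \<mu> * real (Suc q + 1)) / 2) * g (Suc (Suc q))"
  proof -
    have "P * A = A' \<Longrightarrow> P * B = B' \<Longrightarrow> P \<noteq> 0 \<Longrightarrow> P * (r / P + A * x + B * y) = r + A' * x + B' * y" for P A B A' B' x y :: complex
      by (simp add: distrib_left mult.assoc[symmetric])
    from this[OF A1 A2 p] show ?thesis .
  qed
  then have "g q = r / of_real (b * J q) + of_real (al (Suc q)) * g (Suc q) + of_real (be (Suc q)) * g (Suc (Suc q)) \<longleftrightarrow>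
     of_real (b * J q) * g q = r + of_real (3 * a * Suc q) * g (Suc q) + of_real (\<epsilon> * b * (real d + real \<mu> * real (Suc q + 1)) / 2) * g (Suc (Suc q))"
    using p by (metis mult_cancel_left)
  then show ?thesis unfolding Rw_def by (auto simp: algebra_simps)
qed

abbreviation cal where "cal \<equiv> (\<lambda>q. of_real (al q) :: complex)"
abbreviation cbe where "cbe \<equiv> (\<lambda>q. of_real (be q) :: complex)"

definition src :: "(nat \<Rightarrow> complex) \<Rightarrow> nat \<Rightarrow> complex" where
  "src t q = t q / (2 * \<i> * of_real N) / of_real (b * J (q - 1))"

lemma drec_row:
  assumes "drec Q cal cbe (src t) g" "q < Q" "\<mu> * q < d"
  shows "t (Suc q) - 2 * \<i> * of_real N * Rw g (Suc q) = 0"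
proof -
  have "Rw g (Suc q) = t (Suc q) / (2 * \<i> * of_real N)"
    unfolding Rw_iff[OF assms(3)] using assms(1,2) by (simp add: drec_def src_def)
  then show ?thesis using N by simp
qed

lemma hom_exists: "\<exists>h :: nat \<Rightarrow> real. h Q = 1 \<and> (\<forall>q>Q. h q = 0) \<and> drec Q al be (\<lambda>_. 0) h"
  by (rule drec_exists)

text \<open>If d = \<mu> Q the row ends in the monomial z^(n Q). By positivity the homogeneous
  solution started there reaches the bottom of the row. For \<mu> = 5 and odd Q only odd indices are
  reached, and the bottom is index 1.\<close>

lemma hom_nonzero:
  assumes h: "drec Q al be (\<lambda>_. 0) h" "h Q = 1" "h (Suc Q) = 0" and dQ: "d = \<mu> * Q"
  shows "if \<mu> = 5 \<and> odd Q then h 1 \<noteq> 0 else h 0 \<noteq> 0"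
proof -
  have Jp: "0 < J (q - 1)" if "1 \<le> q" "q \<le> Q" for q
  proof (rule Jpos)
    have "q - 1 < Q" "0 < \<mu>" using that par by auto
    then show "\<mu> * (q - 1) < d" unfolding dQ by (rule mult_strict_left_mono)
  qed
  from par show ?thesis
  proof
    assume p: "\<mu> = 6 \<and> a \<noteq> 0 \<and> \<epsilon> \<in> {0, 1}"
    have "h 0 \<noteq> 0"
    proof (rule drec_hom_pos[where \<sigma> = "sgn a" and \<alpha> = al and \<beta> = be])
      show "sgn a * sgn a = 1" using p by (simp add: sgn_if)
      show "0 < sgn a * al q" if "1 \<le> q" "q \<le> Q" for q
      proof -
        have "sgn a * al q = 3 * \<bar>a\<bar> * q / (b * J (q - 1))" by (simp add: al_def sgn_if abs_if)
        then show ?thesis using Jp[OF that] b p that by simp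
      qed
      show "0 \<le> be q" if "1 \<le> q" "q \<le> Q" for q unfolding be_def using Jp[OF that] p by auto
    qed (use h in auto)
    with p show ?thesis by simp
  next
    assume p: "\<mu> = 5 \<and> a = 0 \<and> \<epsilon> = 1"
    have al: "al = (\<lambda>_. 0)" unfolding al_def using p by (intro ext) simp
    have bp: "0 < be q" if "1 \<le> q" "q \<le> Q" for q
      unfolding be_def using Jp[OF that] p d by (auto intro!: divide_pos_pos add_pos_nonneg)
    have *: "Q = q + 2 * k \<Longrightarrow> 0 < h q" for q k
      by (rule drec_hom_pos2[OF _ h(1)[unfolded al] h(2)]) (use bp in auto)
    show ?thesis
    proof (cases "odd Q")
      case True
      then obtain k where "Q = 1 + 2 * k" by (metis oddE add.commute)
      from *[OF this] p True show ?thesis by simp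
    next
      case False
      then obtain k where "Q = 0 + 2 * k" by (metis evenE add_0)
      from *[OF this] False show ?thesis by simp
    qed
  qed
qed

lemma drec_cadd:
  assumes "drec Q cal cbe s g" "drec Q al be (\<lambda>_. 0) h"
  shows "drec Q cal cbe s (\<lambda>q. g q + c * of_real (h q))"
proof -
  have "drec Q cal cbe (\<lambda>_. 0) (\<lambda>q. of_real (h q))"
    using assms(2) unfolding drec_def by (metis (no_types) of_real_0 of_real_add of_real_mult)
  from drec_lincomb[OF assms(1) this, of c] show ?thesis by simp
qed

text \<open>Solve downward from the top. Hermitian symmetry requires a real value at index 0; giving
  up the imaginary part of g 0 leaves a real residue in row 1, the coefficient of B. If \<mu>
  divides d, an imaginary multiple of the homogeneous solution is available: it makes g 0 real
  without spoiling row 1, or, for \<mu> = 5 and odd quotient, solves the diagonal equation and so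
  removes a coefficient of A.\<close>

theorem row_solve:
  assumes t0: "Im (t 0) = 0"
  obtains g where "Im (g 0) = 0" "\<And>q. d < \<mu> * q \<Longrightarrow> g q = 0"
    "\<And>q. 2 \<le> q \<Longrightarrow> valid q \<Longrightarrow> t q - 2 * \<i> * of_real N * Rw g q = 0"
    "valid 1 \<Longrightarrow> Im (t 1 - 2 * \<i> * of_real N * Rw g 1) = 0"
    "valid 1 \<Longrightarrow> \<mu> dvd d \<Longrightarrow> t 1 - 2 * \<i> * of_real N * Rw g 1 = 0"
    "\<mu> = 5 \<Longrightarrow> \<mu> dvd d \<Longrightarrow> valid 0 \<Longrightarrow>
       t 0 - 2 * \<i> * of_real N * (of_real (b * (real d + real \<mu>) / 2) * (cnj (g 1) - g 1)) = 0"
proof -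
  define Q where "Q = d div \<mu>"
  have mu: "0 < \<mu>" using par by auto
  have Q1: "\<mu> * q \<le> d \<longleftrightarrow> q \<le> Q" for q unfolding Q_def using mu by (metis less_eq_div_iff_mult_less_eq mult.commute)
  show thesis
  proof (cases "\<mu> dvd d")
    case False
    then have lt: "\<mu> * q < d" if "q \<le> Q" for q using Q1[of q] that by (metis dvd_triv_left le_neq_implies_less)
    obtain g where g: "g (Suc Q) = 0" "\<And>q. Suc Q < q \<Longrightarrow> g q = 0" "drec (Suc Q) cal cbe (src t) g"
      using drec_exists[of "Suc Q" 0 cal cbe "src t"] by blast
    have row: "t (Suc q) - 2 * \<i> * of_real N * Rw g (Suc q) = 0" if "q \<le> Q" for q
      by (rule drec_row[OF g(3) _ lt[OF that]]) (use that in simp)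
    \<comment> \<open>Index 0 occurs only in row 1, and dropping i Im (g 0) changes that row by a
      real amount.\<close>
    define g' where "g' = g(0 := of_real (Re (g 0)))"
    show thesis
    proof (rule that[of g'])
      show "g' q = 0" if "d < \<mu> * q" for q
      proof -
        have "Q < q" using Q1[of q] that by auto
        then show ?thesis using g(1,2) by (cases "q = Suc Q") (auto simp: g'_def)
      qed
      show "t q - 2 * \<i> * of_real N * Rw g' q = 0" if "2 \<le> q" "valid q" for q
      proof -
        define q' where "q' = q - 1"
        have q': "q = Suc q'" "1 \<le> q'" using \<open>2 \<le> q\<close> by (auto simp: q'_def)
        have "\<mu> * q' \<le> d" using that(2) q' by (simp add: valid_def)
        then have "q' \<le> Q" using Q1 by blast
        moreover have "Rw g' q = Rw g q" using q' by (simp add: Rw_def g'_def)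
        ultimately show ?thesis using row q' by simp
      qed
      have "Rw g' 1 = Rw g 1 - of_real (b * J 0) * (\<i> * of_real (Im (g 0)))"
        by (simp add: Rw_def g'_def complex_eq_iff algebra_simps)
      note e = this
      have "t 1 - 2 * \<i> * of_real N * Rw g' 1 = (t 1 - 2 * \<i> * of_real N * Rw g 1) + 2 * \<i> * of_real N * (of_real (b * J 0) * (\<i> * of_real (Im (g 0))))"
        unfolding e by (simp only: right_diff_distrib) simp
      also have "t 1 - 2 * \<i> * of_real N * Rw g 1 = 0" using row[of 0] by simp
      finally show "Im (t 1 - 2 * \<i> * of_real N * Rw g' 1) = 0" by simp
    qed (use False in \<open>auto simp: g'_def\<close>)
  next
    case True
    then have dQ: "d = \<mu> * Q" by (simp add: Q_def)
    obtain h :: "nat \<Rightarrow> real" where h: "h Q = 1" "\<forall>q>Q. h q = 0" "drec Q al be (\<lambda>_. 0) h"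
      using hom_exists by blast
    obtain g where g: "g Q = 0" "\<And>q. Q < q \<Longrightarrow> g q = 0" "drec Q cal cbe (src t) g"
      using drec_exists[of Q 0 cal cbe "src t"] by blast
    have lt: "\<mu> * q < d" if "q < Q" for q unfolding dQ using that mu by simp
    have hz: "if \<mu> = 5 \<and> odd Q then h 1 \<noteq> 0 else h 0 \<noteq> 0"
      using hom_nonzero[OF h(3,1) _ dQ] h(2) by simp
    \<comment> \<open>Real multiples of h would not move the imaginary parts that have to be
      adjusted, so the freedom is an imaginary multiple.\<close>
    define G where "G s q = g q + (\<i> * of_real s) * of_real (h q)" for s q
    have Gr: "drec Q cal cbe (src t) (G s)" for s unfolding G_def by (rule drec_cadd[OF g(3) h(3)])
    have row: "t (Suc q) - 2 * \<i> * of_real N * Rw (G s) (Suc q) = 0" if "q < Q" for q s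
      by (rule drec_row[OF Gr that lt[OF that]])
    have vrow: "t q - 2 * \<i> * of_real N * Rw (G s) q = 0" if "1 \<le> q" "valid q" for q s
    proof -
      define q' where "q' = q - 1"
      have q': "q = Suc q'" using \<open>1 \<le> q\<close> by (simp add: q'_def)
      have "\<mu> * q' < d" using that(2) q' by (simp add: valid_def)
      then have "q' < Q" unfolding dQ using mu by simp
      with row q' show ?thesis by simp
    qed
    have out: "G s q = 0" if "d < \<mu> * q" for q s
    proof -
      have "Q < q" using Q1[of q] that by auto
      then show ?thesis using g h by (simp add: G_def)
    qed
    show thesis
    proof (cases "\<mu> = 5 \<and> odd Q")
      case False
      then have h0: "h 0 \<noteq> 0" using hz by auto
      \<comment> \<open>The freedom is spent on making the diagonal value real; all valid rows from
        1 on stay solved.\<close>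
      define s where "s = - Im (g 0) / h 0"
      show thesis
      proof (rule that[of "G s"])
        show "Im (G s 0) = 0" using h0 by (simp add: G_def s_def)
        assume m: "\<mu> = 5" "valid 0"
        then have "even Q" using False by simp
        then have "odd (d + \<mu> + \<mu> * 0)" unfolding dQ m by simp
        with m(2) show "t 0 - 2 * \<i> * of_real N * (of_real (b * (real d + real \<mu>) / 2) * (cnj (G s 1) - G s 1)) = 0"
          unfolding valid_def by blast
      qed (use vrow out in auto)
    next
      case odd: True
      then have h1: "h 1 \<noteq> 0" using hz by auto
      define C where "C = 2 * N * (b * (real d + real \<mu>) / 2)"
      have C: "C \<noteq> 0" using b N d by (simp add: C_def add_nonneg_eq_0_iff)
      \<comment> \<open>Here d is odd, so index 0 carries no monomial. The freedom goes into the
        diagonal equation, which involves g only through Im (g 1).\<close>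
      define s where "s = (Re (t 0) / (2 * C) - Im (g 1)) / h 1"
      have s: "2 * C * Im (G s 1) = Re (t 0)" using h1 C by (simp add: G_def s_def field_simps)
      \<comment> \<open>Clearing index 0 touches row 1 only, and that row is excluded by
        parity.\<close>
      define G' where "G' = (G s)(0 := 0)"
      have "odd (d + \<mu> + \<mu> * 1)" using odd unfolding dQ by auto
      then have nv: "\<not> valid 1" unfolding valid_def by blast
      show thesis
      proof (rule that[of G'])
        show "t q - 2 * \<i> * of_real N * Rw G' q = 0" if "2 \<le> q" "valid q" for q
          using vrow[of q s] that by (simp add: Rw_def G'_def)
        have "cnj (G' 1) - G' 1 = - 2 * \<i> * of_real (Im (G s 1))" by (simp add: G'_def complex_eq_iff)
        then have "2 * \<i> * of_real N * (of_real (b * (real d + real \<mu>) / 2) * (cnj (G' 1) - G' 1)) = of_real (2 * C * Im (G s 1))"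
          by (simp add: C_def complex_eq_iff)
        then show "t 0 - 2 * \<i> * of_real N * (of_real (b * (real d + real \<mu>) / 2) * (cnj (G' 1) - G' 1)) = 0"
          unfolding s using t0 by (simp add: complex_eq_iff)
        show "G' q = 0" if "d < \<mu> * q" for q using out[OF that, of s] by (simp add: G'_def)
      qed (use nv in \<open>auto simp: G'_def\<close>)
    qed
  qed
qed

text \<open>The uniqueness counterpart of \<open>row_solve\<close>. \<kappa> will be the row of a
  power of the leading part. It is matched with g at the top index, and the reality conditions at
  the bottom rule out an imaginary multiple of the homogeneous solution.\<close>

theorem row_kernel:
  assumes g0: "Im (g 0) = 0" and out: "\<And>q. d < \<mu> * q \<Longrightarrow> g q = 0" and wp: "\<And>q. odd (d + \<mu> * q) \<Longrightarrow> g q = 0"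
    and r2: "\<And>q. 2 \<le> q \<Longrightarrow> valid q \<Longrightarrow> Rw g q = 0" and r1: "valid 1 \<Longrightarrow> Im (2 * \<i> * of_real N * Rw g 1) = 0"
    and r1': "valid 1 \<Longrightarrow> \<mu> dvd d \<Longrightarrow> Rw g 1 = 0" and r0: "\<mu> = 5 \<Longrightarrow> \<mu> dvd d \<Longrightarrow> valid 0 \<Longrightarrow> Im (g 1) = 0"
    and k: "\<mu> dvd d \<Longrightarrow> (\<forall>q. Im (\<kappa> q) = 0) \<and> \<kappa> (d div \<mu>) \<noteq> 0 \<and> (\<forall>q\<ge>1. valid q \<longrightarrow> Rw \<kappa> q = 0) \<and>
      (\<forall>q. d < \<mu> * q \<longrightarrow> \<kappa> q = 0) \<and> (\<forall>q. odd (d + \<mu> * q) \<longrightarrow> \<kappa> q = 0)"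
  shows "\<exists>c :: real. (\<mu> dvd d \<or> c = 0) \<and> (\<forall>q. g q = of_real c * \<kappa> q)"
proof -
  define Q where "Q = d div \<mu>"
  have mu: "0 < \<mu>" using par by auto
  have Q1: "\<mu> * q \<le> d \<longleftrightarrow> q \<le> Q" for q unfolding Q_def using mu by (metis less_eq_div_iff_mult_less_eq mult.commute)
  \<comment> \<open>At an index without target monomial the recursion still has to hold. There the
    parity is odd, so the outer two terms vanish; the middle one vanishes too, by parity for \<mu> =
    6 and because a = 0 for \<mu> = 5.\<close>
  have auto0: "Rw u (Suc q) = 0" if u: "\<And>q. odd (d + \<mu> * q) \<Longrightarrow> u q = 0" and nv: "\<not> valid (Suc q)" and lt: "\<mu> * q < d" for u q
  proof -
    have "odd (d + \<mu> * q)"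
    proof (rule ccontr)
      assume "\<not> odd (d + \<mu> * q)"
      then have e: "even (d + \<mu> * q)" by simp
      then have "\<mu> * q + 2 \<le> d" using lt by presburger
      moreover have "d + \<mu> + \<mu> * Suc q = (d + \<mu> * q) + 2 * \<mu>" by simp
      then have "even (d + \<mu> + \<mu> * Suc q)" using e by (metis even_add even_mult_iff even_numeral)
      ultimately show False using nv by (auto simp: valid_def)
    qed
    then have "u q = 0" "u (Suc (Suc q)) = 0" using u by simp_all
    moreover have "of_real (3 * a * Suc q) * u (Suc q) = (0 :: complex)"
      using par
    proof
      assume m: "\<mu> = 6 \<and> a \<noteq> 0 \<and> \<epsilon> \<in> {0, 1}"
      then have "odd (d + \<mu> * Suc q)" using \<open>odd (d + \<mu> * q)\<close> by auto
      then have "u (Suc q) = 0" by (rule u)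
      then show ?thesis by simp
    next
      assume "\<mu> = 5 \<and> a = 0 \<and> \<epsilon> = 1"
      then show ?thesis by simp
    qed
    ultimately show ?thesis by (simp add: Rw_def)
  qed
  have rec: "drec Q' cal cbe (\<lambda>_. 0) u" if "\<And>q. q < Q' \<Longrightarrow> \<mu> * q < d" "\<And>q. q < Q' \<Longrightarrow> Rw u (Suc q) = 0" for Q' u
    unfolding drec_def using that Rw_iff[of _ u 0] by simp
  show ?thesis
  proof (cases "\<mu> dvd d")
    case False
    then have lt: "\<mu> * q < d" if "q \<le> Q" for q using Q1[of q] that by (metis dvd_triv_left le_neq_implies_less)
    have o: "g q = 0" if "Q < q" for q using out[of q] Q1[of q] that by auto
    have R2: "Rw g (Suc q) = 0" if "1 \<le> q" "q \<le> Q" for q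
    proof (cases "valid (Suc q)")
      case True
      with r2[of "Suc q"] that show ?thesis by simp
    next
      case False
      show ?thesis by (rule auto0[OF wp False lt[OF that(2)]])
    qed
    have g1: "g q = 0" if "1 \<le> q" for q
    proof -
      have "g q = 0" if "1 \<le> q" "Suc Q = q + k" for q k
        using that
      proof (induction k arbitrary: q rule: less_induct)
        case (less k)
        show ?case
        proof (cases k)
          case 0 with less o show ?thesis by simp
        next
          case (Suc k')
          then have q: "q \<le> Q" using less.prems by simp
          have "g (Suc q) = 0" by (rule less.IH[of k']) (use less.prems Suc in auto)
          moreover have "g (Suc (Suc q)) = 0"
          proof (cases k')
            case 0 then show ?thesis using o Suc less.prems by simp
          next
            case (Suc k'')
            show ?thesis by (rule less.IH[of k'']) (use less.prems Suc \<open>k = Suc k'\<close> in auto)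
          qed
          moreover have "Rw g (Suc q) = 0" using R2 less.prems q by simp
          ultimately show ?thesis using Rw_iff[OF lt[OF q], of g 0] by simp
        qed
      qed
      from this[OF that, of "Suc Q - q"] o that show ?thesis by (cases "q \<le> Q") auto
    qed
    have "g 0 = 0"
    proof (cases "even d")
      case False with wp[of 0] show ?thesis by simp
    next
      case True
      then have v: "valid 1" using d by (auto simp: valid_def)
      have R: "Rw g 1 = of_real (b * J 0) * g 0" using g1[of 1] g1[of 2] by (simp add: Rw_def numeral_2_eq_2)
      have "Im (2 * \<i> * of_real N * Rw g 1) = 2 * N * (b * J 0) * Re (g 0)"
        unfolding R by simp
      moreover have "0 < b * J 0" using Jpos[of 0] d b by simp
      ultimately have "2 * N * (b * J 0) * Re (g 0) = 0" "2 * N * (b * J 0) \<noteq> 0" using r1[OF v] by (metis, use Jpos[of 0] d b N in simp)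
      then have "Re (g 0) = 0" by (metis mult_eq_0_iff)
      with g0 show ?thesis by (simp add: complex_eq_iff)
    qed
    then have "g q = 0" for q using g1[of q] by (cases q) auto
    then show ?thesis by (intro exI[of _ 0]) simp
  next
    case True
    then have dQ: "d = \<mu> * Q" by (simp add: Q_def)
    note k = k[OF True, folded Q_def]
    have lt: "\<mu> * q < d" if "q < Q" for q unfolding dQ using that mu by simp
    \<comment> \<open>The real multiple of \<kappa> that leaves a purely imaginary value at the top;
      the difference f is then an imaginary multiple of h.\<close>
    define c where "c = Re (g Q) / Re (\<kappa> Q)"
    have kQ: "Re (\<kappa> Q) \<noteq> 0" using k by (metis complex_eq_iff zero_complex.sel)
    define f where "f q = g q - of_real c * \<kappa> q" for q
    have R1: "Rw g (Suc q) = 0" if "q < Q" for q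
    proof (cases "valid (Suc q)")
      case True
      with r2[of "Suc q"] r1' \<open>\<mu> dvd d\<close> show ?thesis by (cases q) auto
    next
      case False
      show ?thesis by (rule auto0[OF wp False lt[OF that]])
    qed
    have R2: "Rw \<kappa> (Suc q) = 0" if "q < Q" for q
    proof (cases "valid (Suc q)")
      case False
      show ?thesis by (rule auto0[OF _ False lt[OF that]]) (use k in auto)
    qed (use k in auto)
    have "drec Q cal cbe (\<lambda>q. 0 + (- of_real c) * 0) (\<lambda>q. g q + (- of_real c) * \<kappa> q)"
      by (rule drec_lincomb; rule rec; use lt R1 R2 in simp)
    moreover have "f = (\<lambda>q. g q - of_real c * \<kappa> q)" by (rule ext) (simp add: f_def)
    ultimately have fr: "drec Q cal cbe (\<lambda>_. 0) f" by simp
    have fo: "f q = 0" if "Q < q" for q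
      using out[of q] k Q1[of q] that by (auto simp: f_def)
    obtain h :: "nat \<Rightarrow> real" where h: "h Q = 1" "\<forall>q>Q. h q = 0" "drec Q al be (\<lambda>_. 0) h"
      using hom_exists by blast
    have hz: "if \<mu> = 5 \<and> odd Q then h 1 \<noteq> 0 else h 0 \<noteq> 0"
      using hom_nonzero[OF h(3,1) _ dQ] h(2) by simp
    have hr: "drec Q cal cbe (\<lambda>_. 0) (\<lambda>q. 0 + f Q * of_real (h q))"
      by (rule drec_cadd[OF _ h(3)]) (simp add: drec_def)
    have fh: "f q = f Q * of_real (h q)" for q
    proof (cases "q \<le> Q")
      case True
      from drec_unique[OF fr hr _ _ this] h fo show ?thesis by simp
    qed (use h fo in simp)
    have "Re (f Q) = 0" using kQ k by (simp add: f_def c_def)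
    then have fQ: "f Q = \<i> * of_real (Im (f Q))" by (simp add: complex_eq_iff)
    have If: "Im (f q) = Im (f Q) * h q" for q using fh[of q] by simp
    have "Im (f Q) = 0"
    proof (cases "\<mu> = 5 \<and> odd Q")
      case True
      have "even (d + \<mu> + \<mu> * 0)" "\<mu> * 0 + 2 \<le> d + \<mu>" using True unfolding dQ by auto
      then have "valid 0" unfolding valid_def by blast
      with r0 True \<open>\<mu> dvd d\<close> k have "Im (f 1) = 0" by (simp add: f_def)
      with If[of 1] hz True show ?thesis by simp
    next
      case False
      have "Im (f 0) = 0" using g0 k by (simp add: f_def)
      with If[of 0] hz False show ?thesis by simp
    qed
    with fQ have "f Q = 0" by simp
    with fh have "f q = 0" for q by simp
    then have "g q = of_real c * \<kappa> q" for q by (simp add: f_def)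
    with True show ?thesis by blast
  qed
qed

end

definition mu :: "nat \<Rightarrow> nat" where "mu n = min n 6"

text \<open>Resonant monomials \<open>z^k w^l\<close>, \<open>k - l \<in> n\<int>\<close>, of weight at least \<open>\<omega>\<close>. The weight makes
  \<open>I^3\<close> (for \<open>n \<ge> 6\<close>) and \<open>z^n\<close> equally heavy and both lighter than \<open>\<delta> I\<close> and \<open>\<nu> I^2\<close>.\<close>

section \<open>Weights and the homological operator\<close>

definition rsw :: "nat \<Rightarrow> nat \<Rightarrow> nat \<Rightarrow> nat \<Rightarrow> nat \<Rightarrow> nat \<Rightarrow> bool" where
  "rsw n \<omega> k l m j \<longleftrightarrow> 2 \<le> k + l \<and>
     (\<exists>q. (k = l + n * q \<and> \<omega> \<le> 2 * l + mu n * q + 6 * (m + j)) \<or> (l = k + n * q \<and> \<omega> \<le> 2 * k + mu n * q + 6 * (m + j)))"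

definition FW :: "nat \<Rightarrow> nat \<Rightarrow> plane_series \<Rightarrow> bool" where
  "FW n \<omega> T = spt (rsw n \<omega>) (tau T)"

lemma rsw_sym: "rsw n \<omega> k l m j \<Longrightarrow> rsw n \<omega> l k m j"
  unfolding rsw_def by (auto simp: add.commute)

lemma rsw_mono: "\<omega> \<le> \<omega>' \<Longrightarrow> rsw n \<omega>' k l m j \<Longrightarrow> rsw n \<omega> k l m j"
  unfolding rsw_def by (blast intro: le_trans)

lemma mu_le: "mu n * q \<le> n * q" "mu n \<le> n"
  by (simp_all add: mu_def)

text \<open>The bracket costs one z and one w, that is, weight 2. For monomials on opposite sides of
  the diagonal part of the excess cancels: n r of it, worth \<mu> r in each factor, turns into n r
  common powers worth 2 n r, and \<mu> \<le> n shows that nothing is lost.\<close>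

lemma rsw_add_aux:
  assumes "2 \<le> i + j" "2 \<le> i' + j'" and i: "i = j + n * q" "\<omega> \<le> 2 * j + mu n * q + 6 * (m + l)"
    and B: "(i' = j' + n * q' \<and> \<omega>' \<le> 2 * j' + mu n * q' + 6 * (m' + l')) \<or> (j' = i' + n * q' \<and> \<omega>' \<le> 2 * i' + mu n * q' + 6 * (m' + l'))"
    and s: "i + i' = Suc a" "j + j' = Suc b"
  shows "rsw n (\<omega> + \<omega>' - 2) a b (m + m') (l + l')"
proof -
  have ab: "2 \<le> a + b" using assms(1,2) s by linarith
  from B show ?thesis
  proof
    assume B: "i' = j' + n * q' \<and> \<omega>' \<le> 2 * j' + mu n * q' + 6 * (m' + l')"
    have "a = b + n * (q + q')"
      unfolding distrib_left using B i s by linarith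
    moreover have "\<omega> \<le> 2 * j + u + 6 * (m + l) \<Longrightarrow> \<omega>' \<le> 2 * j' + v + 6 * (m' + l') \<Longrightarrow> j + j' = Suc b
      \<Longrightarrow> \<omega> + \<omega>' - 2 \<le> 2 * b + (u + v) + 6 * (m + m' + (l + l'))" for u v :: nat
      by simp
    from this[OF i(2) conjunct2[OF B] s(2)]
    have "\<omega> + \<omega>' - 2 \<le> 2 * b + mu n * (q + q') + 6 * (m + m' + (l + l'))" by (simp only: distrib_left)
    ultimately show ?thesis using ab unfolding rsw_def by blast
  next
    assume B: "j' = i' + n * q' \<and> \<omega>' \<le> 2 * i' + mu n * q' + 6 * (m' + l')"
    note m = mu_le(1)[of n q] mu_le(1)[of n q']
    show ?thesis
    proof (cases "q' \<le> q")
      case True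
      then obtain r where r: "q = q' + r" by (metis le_add_diff_inverse)
      have "a = b + n * r" "\<omega> + \<omega>' - 2 \<le> 2 * b + mu n * r + 6 * (m + m' + (l + l'))"
        using B i s m unfolding r distrib_left le_diff_conv by linarith+
      with ab show ?thesis unfolding rsw_def by blast
    next
      case False
      then obtain r where r: "q' = q + r" by (metis le_add_diff_inverse nat_le_linear)
      have "b = a + n * r" "\<omega> + \<omega>' - 2 \<le> 2 * a + mu n * r + 6 * (m + m' + (l + l'))"
        using B i s m unfolding r distrib_left le_diff_conv by linarith+
      with ab show ?thesis unfolding rsw_def by blast
    qed
  qed
qed

lemma rsw_add:
  assumes A: "rsw n \<omega> i j m l" and B: "rsw n \<omega>' i' j' m' l'" and s: "i + i' = Suc a" "j + j' = Suc b"
  shows "rsw n (\<omega> + \<omega>' - 2) a b (m + m') (l + l')"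
proof -
  obtain q q' where
    q: "(i = j + n * q \<and> \<omega> \<le> 2 * j + mu n * q + 6 * (m + l)) \<or> (j = i + n * q \<and> \<omega> \<le> 2 * i + mu n * q + 6 * (m + l))" and
    q': "(i' = j' + n * q' \<and> \<omega>' \<le> 2 * j' + mu n * q' + 6 * (m' + l')) \<or> (j' = i' + n * q' \<and> \<omega>' \<le> 2 * i' + mu n * q' + 6 * (m' + l'))"
    and two: "2 \<le> i + j" "2 \<le> i' + j'"
    using A B unfolding rsw_def by blast
  from q show ?thesis
  proof
    assume "i = j + n * q \<and> \<omega> \<le> 2 * j + mu n * q + 6 * (m + l)"
    with rsw_add_aux[OF two _ _ q' s] show ?thesis by blast
  next
    assume "j = i + n * q \<and> \<omega> \<le> 2 * i + mu n * q + 6 * (m + l)"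
    moreover have "2 \<le> j + i" "2 \<le> j' + i'" using two by simp_all
    moreover have "(j' = i' + n * q' \<and> \<omega>' \<le> 2 * i' + mu n * q' + 6 * (m' + l')) \<or> (i' = j' + n * q' \<and> \<omega>' \<le> 2 * j' + mu n * q' + 6 * (m' + l'))"
      using q' by blast
    ultimately have "rsw n (\<omega> + \<omega>' - 2) b a (m + m') (l + l')"
      using rsw_add_aux[OF _ _ _ _ _ s(2,1)] by blast
    then show ?thesis by (rule rsw_sym)
  qed
qed

lemma spt_ck: "spt A T \<Longrightarrow> spt A (ck c * T)"
  by (auto simp: spt_def)

lemma FW_br: "FW n \<omega> S \<Longrightarrow> FW n \<omega>' T \<Longrightarrow> FW n (\<omega> + \<omega>' - 2) (br S T)"
  unfolding FW_def tau_br by (intro spt_ck, rule spt_br', assumption, assumption, rule rsw_add)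

lemma FW_mono: "FW n \<omega>' T \<Longrightarrow> \<omega> \<le> \<omega>' \<Longrightarrow> FW n \<omega> T"
  unfolding FW_def by (erule spt_mono) (rule rsw_mono)

lemma vge_tau: "vge k T \<longleftrightarrow> spt (\<lambda>i j m l. k \<le> (i + j) + m + l) (tau T)"
  unfolding vge_def using tau_spt[of "\<lambda>s m l. k \<le> s + m + l" T] by simp

lemma filtr_tau:
  assumes "\<And>k l a b c d. l \<ge> k \<Longrightarrow> A l a b c d \<Longrightarrow> A k a b c d"
  shows "filtr (\<lambda>k T. spt (A k) (tau T))"
  unfolding filtr_def
proof (intro conjI allI impI)
  fix k T assume *: "\<forall>N. \<exists>S. spt (A k) (tau S) \<and> vge N (T - S)"
  show "spt (A k) (tau T)" unfolding spt_def
  proof (intro allI impI)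
    fix a b c d assume nz: "tau T $ a $ b $ c $ d \<noteq> 0"
    from * obtain S where S: "spt (A k) (tau S)" "vge (Suc (a + b + c + d)) (T - S)" by blast
    have "tau (T - S) $ a $ b $ c $ d = 0"
      by (rule sptD[OF S(2)[unfolded vge_tau]]) simp
    then have "tau S $ a $ b $ c $ d \<noteq> 0" using nz by (simp add: tau_ring)
    from spt_nz[OF S(1) this] show "A k a b c d" .
  qed
next
  fix k l T assume "spt (A l) (tau T)" "k \<le> l"
  then show "spt (A k) (tau T)" using assms by (meson spt_mono)
qed (simp_all add: tau_ring tau_cc spt_add spt_ck)

lemma filtr_FW: "filtr (FW n)"
  using filtr_tau[of "rsw n"] rsw_mono unfolding FW_def by blast

lemma FW_Ham:
  assumes n: "5 \<le> n" and T: "FW n 3 T"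
  shows "Ham T"
proof -
  have m: "mu n \<ge> 5" using n by (simp add: mu_def)
  have "2 \<le> k + l \<and> 3 \<le> k + l + m + j" if r: "rsw n 3 k l m j" for k l m j
  proof -
    from r obtain q where q: "(k = l + n * q \<and> 3 \<le> 2 * l + mu n * q + 6 * (m + j)) \<or> (l = k + n * q \<and> 3 \<le> 2 * k + mu n * q + 6 * (m + j))"
      and two: "2 \<le> k + l" unfolding rsw_def by blast
    have "3 \<le> k + l + m + j"
    proof (cases q)
      case 0 with q two show ?thesis by (cases "m + j") auto
    next
      case (Suc q')
      then have "n \<le> k + l" using q by auto
      with n show ?thesis by simp
    qed
    with two show ?thesis by simp
  qed
  then have "spt (\<lambda>k l m j. 2 \<le> k + l \<and> 3 \<le> (k + l) + m + j) (tau T)"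
    using T unfolding FW_def by (auto elim: spt_mono)
  then have "spt (\<lambda>k l m j. 2 \<le> k + l \<and> 3 \<le> (k + l) + m + j) T"
    using tau_spt[of "\<lambda>s m j. 2 \<le> s \<and> 3 \<le> s + m + j" T] by simp
  then show ?thesis by (simp add: Ham_def)
qed

text \<open>One unit of total degree carries weight at most 6, so convergence in weight implies
  formal convergence.\<close>

lemma FW_vge:
  assumes T: "FW n \<omega> T" shows "vge (\<omega> div 6) T"
proof -
  have "\<omega> div 6 \<le> (k + l) + m + j" if r: "rsw n \<omega> k l m j" for k l m j
  proof -
    have ar: "\<omega> \<le> 2 * c + u + 6 * (m + j) \<Longrightarrow> u \<le> v \<Longrightarrow> \<omega> \<le> 6 * ((c + v + c) + m + j)" for c u v :: nat by simp
    from r obtain q where "(k = l + n * q \<and> \<omega> \<le> 2 * l + mu n * q + 6 * (m + j)) \<or> (l = k + n * q \<and> \<omega> \<le> 2 * k + mu n * q + 6 * (m + j))"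
      unfolding rsw_def by blast
    then have "\<omega> \<le> 6 * ((k + l) + m + j)"
    proof (elim disjE conjE)
      assume "k = l + n * q" "\<omega> \<le> 2 * l + mu n * q + 6 * (m + j)"
      with ar[OF this(2) mu_le(1)] show ?thesis by simp
    next
      assume "l = k + n * q" "\<omega> \<le> 2 * k + mu n * q + 6 * (m + j)"
      with ar[OF this(2) mu_le(1)] show ?thesis by (simp add: add.commute)
    qed
    then show ?thesis by simp
  qed
  then show ?thesis using T unfolding FW_def vge_tau by (meson spt_mono)
qed

section \<open>The leading part and its action on rows\<close>

definition hh :: "nat \<Rightarrow> real \<Rightarrow> real \<Rightarrow> cplane" where
  "hh n a b = ck (of_real a) * (fps_X * yy) ^ 3 + ck (of_real b) * (fps_X ^ n + yy ^ n)"

lemma XY_nth: "(fps_X ^ p * (yy ^ q * Z)) $ k $ l = (if p \<le> k \<and> q \<le> l then (Z::'a::comm_ring_1 fps fps) $ (k - p) $ (l - q) else 0)"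
  by (auto simp: yy_power fps_X_power_mult_nth not_less)

lemma XY_nth1: "(fps_X ^ p * Z) $ k $ l = (if p \<le> k then (Z::'a::comm_ring_1 fps fps) $ (k - p) $ l else 0)"
   "(yy ^ q * Z) $ k $ l = (if q \<le> l then (Z::'a::comm_ring_1 fps fps) $ k $ (l - q) else 0)"
  using XY_nth[of p 0 Z k l] XY_nth[of 0 q Z k l] by simp_all

lemma br_XY: "br (fps_X * yy) G $ k $ l = (of_nat l - of_nat k) * (G::'a::comm_ring_1 fps fps) $ k $ l"
proof -
  have "br (fps_X * yy) G = yy ^ 1 * dY G - fps_X ^ 1 * fps_deriv G"
    by (simp add: br_mult_left br_vars mult.commute)
  then show ?thesis
    by (cases k; cases l; simp only: fps_sub_nth XY_nth1)
       (simp_all add: dY_nth fps_deriv_nth2 algebra_simps)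
qed

lemma br_pow: "br (fps_X ^ n) G = of_nat n * (fps_X ^ (n - 1) * dY G)" "br (yy ^ n) G = - (of_nat n * (yy ^ (n - 1) * fps_deriv (G::'a::comm_ring_1 fps fps)))"
  by (simp_all add: br_def dY_power fps_deriv_power' mult_ac)

lemma of_nat_mult_nth4: "(of_nat k * P) $ a $ b $ m $ l = of_nat k * (P::'a::comm_ring_1 fps fps fps fps) $ a $ b $ m $ l"
  by (simp add: of_nat_mult_nth2)

lemma br_hh_nth:
  assumes n: "1 \<le> n"
  shows "br (hh n a b) G $ k $ l $ m $ j =
   of_real (3 * a) * (if 2 \<le> k \<and> 2 \<le> l then (of_nat l - of_nat k) * G $ (k - 2) $ (l - 2) $ m $ j else 0)
   + of_real (of_nat n * b) * ((if n - 1 \<le> k then of_nat (l + 1) * G $ (k + 1 - n) $ (l + 1) $ m $ j else 0)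
      - (if n - 1 \<le> l then of_nat (k + 1) * G $ (k + 1) $ (l + 1 - n) $ m $ j else 0))"
proof -
  have k: "k - (n - 1) = k + 1 - n" "l - (n - 1) = l + 1 - n" using n by auto
  have "br ((fps_X * yy) ^ 3) G = of_nat 3 * (fps_X ^ 2 * (yy ^ 2 * br (fps_X * yy) G))" for G :: cplane
    by (simp add: power3_eq_cube br_mult_left power2_eq_square algebra_simps)
  then have "br (hh n a b) G = ck (of_real a) * (of_nat 3 * (fps_X ^ 2 * (yy ^ 2 * br (fps_X * yy) G)))
     + ck (of_real b) * (of_nat n * (fps_X ^ (n - 1) * dY G) - of_nat n * (yy ^ (n - 1) * fps_deriv G))"
    unfolding hh_def br_add_left ck_br br_pow by simp
  moreover have "(fps_X ^ 2 * (yy ^ 2 * br (fps_X * yy) G)) $ k $ l $ m $ j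
      = (if 2 \<le> k \<and> 2 \<le> l then (of_nat l - of_nat k) * G $ (k - 2) $ (l - 2) $ m $ j else 0)"
  proof -
    have r: "((of_nat x - of_nat y) * P) $ m $ j = (of_nat x - of_nat y) * P $ m $ j" for x y and P :: cpar
      by (simp only: left_diff_distrib fps_sub_nth of_nat_mult_nth2)
    show ?thesis unfolding XY_nth br_XY by (simp add: r of_nat_diff)
  qed
  moreover have "(fps_X ^ (n - 1) * dY G) $ k $ l $ m $ j = (if n - 1 \<le> k then of_nat (l + 1) * G $ (k + 1 - n) $ (l + 1) $ m $ j else 0)"
    unfolding XY_nth1 dY_nth k by (simp add: of_nat_mult_nth2 del: of_nat_add of_nat_Suc)
  moreover have "(yy ^ (n - 1) * fps_deriv G) $ k $ l $ m $ j = (if n - 1 \<le> l then of_nat (k + 1) * G $ (k + 1) $ (l + 1 - n) $ m $ j else 0)"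
    unfolding XY_nth1 fps_deriv_nth2 k by (simp add: of_nat_mult_nth2 del: of_nat_add of_nat_Suc)
  ultimately show ?thesis
    by (simp only: fps_add_nth fps_sub_nth ck_nth of_nat_mult_nth4) (simp add: algebra_simps)
qed

definition eps :: "nat \<Rightarrow> real" where "eps n = (if n = mu n then 1 else 0)"

definition lead_ok :: "nat \<Rightarrow> real \<Rightarrow> real \<Rightarrow> bool" where
  "lead_ok n a b \<longleftrightarrow> 5 \<le> n \<and> 0 < b \<and> (6 \<le> n \<longrightarrow> a \<noteq> 0) \<and> (n = 5 \<longrightarrow> a = 0)"

lemma lead_rows: "lead_ok n a b \<Longrightarrow> 1 \<le> d \<Longrightarrow> rows d (mu n) a b (eps n) (real n)"
  unfolding lead_ok_def rows_def mu_def eps_def by auto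

text \<open>The leading part of the homological operator, restricted to one weight.\<close>

lemma row_formula:
  assumes ok: "lead_ok n a b" and d: "1 \<le> d"
    and V: "\<And>l q. 2 * l + mu n * q = d \<Longrightarrow> Z $ (l + n * q) $ l $ m $ j = g q"
    and Z0: "\<And>l q. 2 * l + mu n * q < d \<Longrightarrow> Z $ (l + n * q) $ l $ m $ j = 0"
    and out: "\<And>q. d < mu n * q \<Longrightarrow> g q = 0"
    and l: "2 * l + mu n * q + 2 = d + mu n" and q: "1 \<le> q"
  shows "br (hh n a b) Z $ (l + n * q) $ l $ m $ j = of_nat n * rows.Rw d (mu n) a b (eps n) g q"
proof -
  interpret rows d "mu n" a b "eps n" "real n" by (rule lead_rows[OF ok d])
  have n: "5 \<le> n" "mu n \<le> n" "a \<noteq> 0 \<Longrightarrow> mu n = 6" "5 \<le> mu n" using ok by (auto simp: lead_ok_def mu_def)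
  have n1: "1 \<le> n" using n by simp
  define q' where "q' = q - 1"
  have q': "q = Suc q'" using q by (simp add: q'_def)
  have t1: "of_real (3 * a) * (if 2 \<le> l + n * q \<and> 2 \<le> l then (of_nat l - of_nat (l + n * q)) * Z $ (l + n * q - 2) $ (l - 2) $ m $ j else 0)
    = - (of_nat n * (of_real (3 * a * q) * g q))"
  proof (cases "a = 0")
    case False
    then have m: "mu n = 6" using n by simp
    show ?thesis
    proof (cases "2 \<le> l")
      case True
      have "2 * (l - 2) + mu n * q = d" using l m True by simp
      from V[OF this] True show ?thesis by (simp add: algebra_simps)
    next
      case False
      have "d < mu n * q" using l m False by simp
      with out False show ?thesis by simp
    qed
  qed simp
  have t2: "(if n - 1 \<le> l + n * q then of_nat (l + 1) * Z $ (l + n * q + 1 - n) $ (l + 1) $ m $ j else 0) = of_real (J (q - 1)) * g (q - 1)"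
  proof -
    have e: "2 * (l + 1) + mu n * q' = d" using l unfolding q' by simp
    have i: "l + n * q + 1 - n = (l + 1) + n * q'" "n - 1 \<le> l + n * q" unfolding q' by auto
    have "real d = 2 * real (l + 1) + real (mu n) * real q'" using arg_cong[OF e, of real] by simp
    then have "J q' = real (l + 1)" unfolding J_def by simp
    with V[OF e] i show ?thesis by (simp add: q')
  qed
  have t3: "(if n - 1 \<le> l then of_nat (l + n * q + 1) * Z $ (l + n * q + 1) $ (l + 1 - n) $ m $ j else 0)
     = of_real (eps n * (real d + real (mu n) * real (q + 1)) / 2) * g (q + 1)"
  proof (cases "n = mu n")
    case True
    have e2: "real d + real (mu n) * real (q + 1) = 2 * real (l + n * q + 1)"
      using arg_cong[OF l, of real] True[symmetric] by (simp add: algebra_simps)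
    show ?thesis
    proof (cases "n - 1 \<le> l")
      case l1: True
      have l0: "(l + 1 - n) + n * (q + 1) = l + n * q + 1" using l1 by simp
      have "2 * (l + 1 - n) + mu n * (q + 1) = d" using l l1 True[symmetric] by simp
      from V[OF this, unfolded l0] l1 show ?thesis unfolding e2 using True by (simp add: eps_def)
    next
      case False
      have "d < mu n * (q + 1)" using l False True[symmetric] by simp
      with out False show ?thesis by simp
    qed
  next
    case False
    then have lt: "mu n < n" using n by simp
    have "Z $ (l + n * q + 1) $ (l + 1 - n) $ m $ j = 0" if l1: "n - 1 \<le> l"
    proof -
      have l0: "(l + 1 - n) + n * (q + 1) = l + n * q + 1" using l1 by simp
      have "2 * (l + 1 - n) + mu n * (q + 1) < d" using l l1 lt by simp
      from Z0[OF this, unfolded l0] show ?thesis .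
    qed
    with False show ?thesis by (simp add: eps_def)
  qed
  show ?thesis
    unfolding br_hh_nth[OF n1] t1 t2 t3 Rw_def
    by (simp add: algebra_simps)
qed

text \<open>On the diagonal the term (z w)^3 contributes nothing, and the two neighbours are
  conjugate, so only the imaginary part of one coefficient enters. With mu = n their weight fits the
  row.\<close>

lemma row_formula0:
  assumes n: "5 \<le> n" "mu n = n"
    and V: "\<And>l. 2 * l + mu n = d \<Longrightarrow> Z $ (l + n) $ l $ m $ j = g1 \<and> Z $ l $ (l + n) $ m $ j = cnj g1"
    and l: "2 * l + 2 = d + mu n" and out: "d < mu n \<Longrightarrow> g1 = 0"
  shows "br (hh n a b) Z $ l $ l $ m $ j = of_nat n * (of_real (b * (real d + real (mu n)) / 2) * (cnj g1 - g1))"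
proof -
  have n1: "1 \<le> n" using n by simp
  have e2: "real d + real (mu n) = 2 * real (l + 1)" using arg_cong[OF l, of real] by simp
  show ?thesis
  proof (cases "n - 1 \<le> l")
    case l1: True
    have "2 * (l + 1 - n) + mu n = d" using l l1 n by simp
    note v = V[OF this]
    have "(l + 1 - n) + n = l + 1" using l1 by simp
    with v have "Z $ (l + 1) $ (l + 1 - n) $ m $ j = g1" "Z $ (l + 1 - n) $ (l + 1) $ m $ j = cnj g1" by simp_all
    then show ?thesis
      unfolding br_hh_nth[OF n1] e2 using l1 by (simp add: algebra_simps)
  next
    case False
    then have "g1 = 0" using l n by (intro out) simp
    with False show ?thesis unfolding br_hh_nth[OF n1] by simp
  qed
qed

section \<open>Normal forms\<close>

text \<open>What survives: the diagonal and, with real coefficients, index 1. A coefficient at index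
  1 is hit by the row of weight d = 2 i + 2, one on the diagonal for n = 5 by d = 2 k - 3, and it
  must vanish if mu divides d. Writing the diagonal exponent as k + 3 gives residue 1 modulo 5 for
  A; index 1 gives residue 4 modulo 5, or 2 modulo 3, for B.\<close>

definition nfc :: "nat \<Rightarrow> nat \<Rightarrow> nat \<Rightarrow> complex \<Rightarrow> bool" where
  "nfc n k l c \<longleftrightarrow> (k = l \<longrightarrow> n = 5 \<and> 3 \<le> k \<and> 5 dvd (2 * k - 3) \<longrightarrow> c = 0) \<and>
     (\<forall>i. (k = i + n \<and> l = i) \<or> (k = i \<and> l = i + n) \<longrightarrow> Im c = 0 \<and> (mu n dvd 2 * i + 2 \<longrightarrow> c = 0)) \<and>
     (k \<noteq> l \<and> k \<noteq> l + n \<and> l \<noteq> k + n \<longrightarrow> c = 0)"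

definition NF :: "nat \<Rightarrow> nat \<Rightarrow> plane_series \<Rightarrow> bool" where
  "NF n \<omega> T \<longleftrightarrow> (\<forall>l q m j. 2 * l + mu n * q + 6 * (m + j) < \<omega> \<longrightarrow> nfc n (l + n * q) l (tau T $ (l + n * q) $ l $ m $ j))"

text \<open>The factors 8 and 2 undo I = z w / 2 and Re (z^n) = (z^n + w^n) / 2.\<close>

definition hr :: "nat \<Rightarrow> real \<Rightarrow> real \<Rightarrow> plane_series" where
  "hr n a b = real_const (8 * a) * action ^ 3 + real_const (2 * b) * Re_z_power n"

lemma tau_hr: "tau (hr n a b) = hh n a b"
proof -
  have "tau (hr n a b) = ck (of_real (8 * a)) * (ck (1/2) * (fps_X * yy)) ^ 3 + ck (of_real (2 * b)) * (ck (1/2) * (fps_X ^ n + yy ^ n))"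
    unfolding hr_def tau_ring tau_cc tau_action tau_Re_z_power ..
  also have "(ck (1/2) * (fps_X * yy)) ^ 3 = ck ((1/2) ^ 3) * (fps_X * yy) ^ 3" unfolding power_mult_distrib ck_hom(7) ..
  finally have f: "tau (hr n a b) = ck (of_real (8 * a) * (1/2) ^ 3) * (fps_X * yy) ^ 3 + ck (of_real (2 * b) * (1/2)) * (fps_X ^ n + yy ^ n)"
    unfolding mult.assoc[symmetric] ck_hom(2)[symmetric] .
  have "of_real (8 * a) * (1/2) ^ 3 = complex_of_real a" "of_real (2 * b) * (1/2) = complex_of_real b"
    by (simp_all add: power3_eq_cube)
  then show ?thesis using f unfolding hh_def by (simp only:)
qed

lemma rsw_iff:
  assumes "5 \<le> n"
  shows "rsw n \<omega> (l + n * q) l m j \<longleftrightarrow> 2 \<le> 2 * l + n * q \<and> \<omega> \<le> 2 * l + mu n * q + 6 * (m + j)"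
proof
  assume "rsw n \<omega> (l + n * q) l m j"
  then obtain q' where q': "(l + n * q = l + n * q' \<and> \<omega> \<le> 2 * l + mu n * q' + 6 * (m + j)) \<or>
      (l = l + n * q + n * q' \<and> \<omega> \<le> 2 * (l + n * q) + mu n * q' + 6 * (m + j))" and two: "2 \<le> l + n * q + l"
    unfolding rsw_def by (elim conjE exE)
  from q' have "\<omega> \<le> 2 * l + mu n * q + 6 * (m + j)"
  proof
    assume a: "l + n * q = l + n * q' \<and> \<omega> \<le> 2 * l + mu n * q' + 6 * (m + j)"
    then have "n * q = n * q'" by linarith
    then have "q = q'" using assms by simp
    with a show ?thesis by simp
  next
    assume a: "l = l + n * q + n * q' \<and> \<omega> \<le> 2 * (l + n * q) + mu n * q' + 6 * (m + j)"
    then have "n * q = 0" "n * q' = 0" by linarith+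
    then have "q = 0" "q' = 0" using assms by simp_all
    with a show ?thesis by simp
  qed
  moreover have "2 \<le> 2 * l + n * q" using two by linarith
  ultimately show "2 \<le> 2 * l + n * q \<and> \<omega> \<le> 2 * l + mu n * q + 6 * (m + j)" by blast
next
  assume a: "2 \<le> 2 * l + n * q \<and> \<omega> \<le> 2 * l + mu n * q + 6 * (m + j)"
  then have "2 \<le> l + n * q + l" by linarith
  moreover have "(l + n * q = l + n * q \<and> \<omega> \<le> 2 * l + mu n * q + 6 * (m + j)) \<or>
    (l = l + n * q + n * q \<and> \<omega> \<le> 2 * (l + n * q) + mu n * q + 6 * (m + j))" using a by simp
  ultimately show "rsw n \<omega> (l + n * q) l m j" unfolding rsw_def by (intro conjI exI[of _ q])
qed

lemma FW_zero:
  assumes "5 \<le> n" "FW n \<omega> T" "2 * l + mu n * q + 6 * (m + j) < \<omega>"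
  shows "tau T $ (l + n * q) $ l $ m $ j = 0"
proof (rule sptD[OF assms(2)[unfolded FW_def]])
  show "\<not> rsw n \<omega> (l + n * q) l m j"
    unfolding rsw_iff[OF assms(1)] using assms(3) by linarith
qed

lemma tau_sym: "tau T $ l $ k $ m $ j = cnj (tau T $ k $ l $ m $ j)"
  using tau_herm[of T] unfolding herm_def by blast

text \<open>By Hermitian symmetry it suffices to inspect monomials with at least as many factors z
  as w.\<close>

lemma FW_suc:
  assumes n: "5 \<le> n" and T: "FW n \<omega> T" and z: "\<And>l q m j. 2 * l + mu n * q + 6 * (m + j) = \<omega> \<Longrightarrow> tau T $ (l + n * q) $ l $ m $ j = 0"
  shows "FW n (\<omega> + 1) T"
  unfolding FW_def spt_def
proof (intro allI impI)
  fix k l m j assume nz: "tau T $ k $ l $ m $ j \<noteq> 0"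
  from spt_nz[OF T[unfolded FW_def] nz] obtain q where two: "2 \<le> k + l" and
    q: "(k = l + n * q \<and> \<omega> \<le> 2 * l + mu n * q + 6 * (m + j)) \<or> (l = k + n * q \<and> \<omega> \<le> 2 * k + mu n * q + 6 * (m + j))"
    unfolding rsw_def by blast
  from q show "rsw n (\<omega> + 1) k l m j"
  proof
    assume k: "k = l + n * q \<and> \<omega> \<le> 2 * l + mu n * q + 6 * (m + j)"
    then have "2 * l + mu n * q + 6 * (m + j) \<noteq> \<omega>" using z[of l q m j] nz by blast
    then have "\<omega> + 1 \<le> 2 * l + mu n * q + 6 * (m + j)" using k by linarith
    with k two show ?thesis unfolding rsw_def by blast
  next
    assume k: "l = k + n * q \<and> \<omega> \<le> 2 * k + mu n * q + 6 * (m + j)"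
    have "tau T $ l $ k $ m $ j \<noteq> 0" using nz tau_sym[of T k l m j] by auto
    then have "2 * k + mu n * q + 6 * (m + j) \<noteq> \<omega>" using z[of k q m j] k by blast
    then have "\<omega> + 1 \<le> 2 * k + mu n * q + 6 * (m + j)" using k by linarith
    with k two show ?thesis unfolding rsw_def by blast
  qed
qed

lemma FW_diff: "FW n \<omega> S \<Longrightarrow> FW n \<omega> T \<Longrightarrow> FW n \<omega> (S - T)" and FW_add: "FW n \<omega> S \<Longrightarrow> FW n \<omega> T \<Longrightarrow> FW n \<omega> (S + T)"
  by (rule filtrD(5)[OF filtr_FW], assumption+) (rule filtrD(1)[OF filtr_FW])

lemma NF_cong:
  assumes "5 \<le> n" "NF n \<omega> S" "FW n \<omega> (T - S)"
  shows "NF n \<omega> T"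
  unfolding NF_def
proof (intro allI impI)
  fix l q m j assume lt: "2 * l + mu n * q + 6 * (m + j) < \<omega>"
  have "tau (T - S) $ (l + n * q) $ l $ m $ j = 0" by (rule FW_zero[OF assms(1,3) lt])
  then have "tau T $ (l + n * q) $ l $ m $ j = tau S $ (l + n * q) $ l $ m $ j" by (simp add: tau_ring)
  then show "nfc n (l + n * q) l (tau T $ (l + n * q) $ l $ m $ j)" using assms(2) lt by (simp add: NF_def)
qed

lemma nfc_0 [simp]: "nfc n k l 0"
  by (simp add: nfc_def)

lemma nfc_diag: "5 \<le> n \<Longrightarrow> (n = 5 \<Longrightarrow> 3 \<le> l \<Longrightarrow> 5 dvd 2 * l - 3 \<Longrightarrow> c = 0) \<Longrightarrow> nfc n l l c"
  unfolding nfc_def by auto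

lemma nfc_one: "5 \<le> n \<Longrightarrow> Im c = 0 \<Longrightarrow> (mu n dvd 2 * l + 2 \<Longrightarrow> c = 0) \<Longrightarrow> nfc n (l + n) l c"
  unfolding nfc_def by auto

text \<open>Every monomial in the parameters poses an independent row problem, solved by
  \<open>row_solve\<close>; the solutions are assembled into one Hermitian series.\<close>

lemma normal_step:
  assumes ok: "lead_ok n a b"
  obtains g where "FW n (\<omega> + 2 - mu n) g"
    "\<And>l q m j. 2 * l + mu n * q + 6 * (m + j) = \<omega> \<Longrightarrow> nfc n (l + n * q) l (tau (T + br (hr n a b) g) $ (l + n * q) $ l $ m $ j)"
proof -
  have n: "5 \<le> n" "0 < n" "mu n \<le> n" "5 \<le> mu n" "mu n = 5 \<Longrightarrow> n = 5" "n = 5 \<Longrightarrow> mu n = 5"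
    using ok by (auto simp: lead_ok_def mu_def)
  \<comment> \<open>The weight left for the z, w part of g: the bracket with the leading part adds
    mu - 2, and each power of a parameter accounts for 6. Truncated subtraction gives 0 where the
    target weight is too low for any correction.\<close>
  define dd where "dd m j = \<omega> + 2 - (mu n + 6 * (m + j))" for m j
  \<comment> \<open>The row of T to be normalised; its weight is dd + mu - 2, from which the
    exponent of w at index q follows.\<close>
  define t where "t m j q = tau T $ ((dd m j + mu n - 2 - mu n * q) div 2 + n * q) $ ((dd m j + mu n - 2 - mu n * q) div 2) $ m $ j" for m j q
  define C where "C m j g q = t m j q - 2 * \<i> * of_real (real n) * rows.Rw (dd m j) (mu n) a b (eps n) g q" for m j g q
  define P where "P m j g \<longleftrightarrow> Im (g 0) = 0 \<and> (\<forall>q. dd m j < mu n * q \<longrightarrow> g q = 0) \<and>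
    (\<forall>q\<ge>2. rows.valid (dd m j) (mu n) q \<longrightarrow> C m j g q = 0) \<and>
    (rows.valid (dd m j) (mu n) 1 \<longrightarrow> Im (C m j g 1) = 0) \<and>
    (rows.valid (dd m j) (mu n) 1 \<longrightarrow> mu n dvd dd m j \<longrightarrow> C m j g 1 = 0) \<and>
    (mu n = 5 \<longrightarrow> mu n dvd dd m j \<longrightarrow> rows.valid (dd m j) (mu n) 0 \<longrightarrow>
       t m j 0 - 2 * \<i> * of_real (real n) * (of_real (b * (real (dd m j) + real (mu n)) / 2) * (cnj (g 1) - g 1)) = 0)" for m j g
  have ex: "\<exists>g. P m j g" if D: "1 \<le> dd m j" for m j
  proof -
    interpret rows "dd m j" "mu n" a b "eps n" "real n" by (rule lead_rows[OF ok D])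
    have "t m j 0 = cnj (t m j 0)" unfolding t_def mult_0_right add_0_right by (rule tau_sym)
    from arg_cong[OF this, of Im] have t0: "Im (t m j 0) = 0" by simp
    show ?thesis
    proof (rule row_solve[where t = "t m j", OF t0], goal_cases)
      case (1 g)
      have "P m j g" unfolding P_def C_def
        by (intro conjI allI impI)
          ((rule 1(1) | (rule 1(2), assumption) | (rule 1(3), assumption, assumption) | (rule 1(4), assumption)
            | (rule 1(5), assumption, assumption) | (rule 1(6), assumption, assumption, assumption))+)
      then show ?case by blast
    qed
  qed
  define gs where "gs m j = (SOME g. P m j g)" for m j
  have gs: "P m j (gs m j)" if "1 \<le> dd m j" for m j
    unfolding gs_def by (rule someI_ex[OF ex[OF that]])
  define Z where "Z = Abs_fps (\<lambda>k. Abs_fps (\<lambda>l. Abs_fps (\<lambda>m. Abs_fps (\<lambda>j.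
     if 1 \<le> dd m j \<and> l \<le> k \<and> n dvd k - l \<and> 2 * l + mu n * ((k - l) div n) = dd m j then gs m j ((k - l) div n)
     else if 1 \<le> dd m j \<and> k < l \<and> n dvd l - k \<and> 2 * k + mu n * ((l - k) div n) = dd m j then cnj (gs m j ((l - k) div n))
     else 0))))"
  have V: "Z $ (l + n * q) $ l $ m $ j = (if 1 \<le> dd m j \<and> 2 * l + mu n * q = dd m j then gs m j q else 0)" for l q m j
    using n by (simp add: Z_def)
  have hZ: "herm Z"
    unfolding herm_def
  proof (intro allI)
    fix k l m j
    have "cnj (gs m j 0) = gs m j 0" if "1 \<le> dd m j" using gs[OF that] by (simp add: P_def complex_eq_iff)
    note r = this
    show "Z $ l $ k $ m $ j = cnj (Z $ k $ l $ m $ j)"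
    proof (cases k l rule: linorder_cases)
      case less
      then have "\<not> l < k" "\<not> l \<le> k" "k \<le> l" by simp_all
      with less show ?thesis by (simp add: Z_def)
    next
      case equal
      then show ?thesis using r by (simp add: Z_def)
    next
      case greater
      then have "\<not> k < l" "\<not> k \<le> l" "l \<le> k" by simp_all
      with greater show ?thesis by (simp add: Z_def)
    qed
  qed
  obtain g where g: "tau g = Z" by (rule tau_surj[OF hZ])
  have FWg: "FW n (\<omega> + 2 - mu n) g"
    unfolding FW_def spt_def g
  proof (intro allI impI)
    fix k l m j assume nz: "Z $ k $ l $ m $ j \<noteq> 0"
    have main: "rsw n (\<omega> + 2 - mu n) (i + n * q) i m j" if "1 \<le> dd m j" "2 * i + mu n * q = dd m j" for i q
    proof -
      have "2 \<le> 2 * i + n * q"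
      proof (cases q)
        case 0
        then have "1 \<le> i" using that by (cases i) auto
        then show ?thesis by linarith
      next
        case (Suc q')
        then have "n \<le> n * q" by simp
        then show ?thesis using n(1) by linarith
      qed
      moreover have "\<omega> + 2 - mu n \<le> 2 * i + mu n * q + 6 * (m + j)" using that(2) unfolding dd_def by simp
      ultimately show ?thesis unfolding rsw_iff[OF n(1)] by simp
    qed
    consider "1 \<le> dd m j" "l \<le> k" "n dvd k - l" "2 * l + mu n * ((k - l) div n) = dd m j"
      | "1 \<le> dd m j" "k < l" "n dvd l - k" "2 * k + mu n * ((l - k) div n) = dd m j"
      using nz by (auto simp: Z_def split: if_splits)
    then show "rsw n (\<omega> + 2 - mu n) k l m j"
    proof cases
      case 1
      have "l + n * ((k - l) div n) = k" using 1 by simp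
      with main[OF 1(1,4)] show ?thesis by simp
    next
      case 2
      have "k + n * ((l - k) div n) = l" using 2 by simp
      with main[OF 2(1,4)] show ?thesis using rsw_sym by metis
    qed
  qed
  have fin: "nfc n (l + n * q) l (tau (T + br (hr n a b) g) $ (l + n * q) $ l $ m $ j)"
    if w: "2 * l + mu n * q + 6 * (m + j) = \<omega>" for l q m j
  proof (cases "1 \<le> dd m j")
    case False
    \<comment> \<open>The uncorrected targets are diagonal with l < 3, where the normal form imposes
      nothing.\<close>
    then have "2 * l + mu n * q + 2 \<le> mu n" using w by (simp add: dd_def)
    moreover from this have q0: "q = 0" by (cases q) auto
    ultimately have "2 * l + 2 \<le> mu n" by simp
    then have "l < 3" by (simp add: mu_def)
    have "nfc n l l (tau (T + br (hr n a b) g) $ l $ l $ m $ j)"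
      by (rule nfc_diag[OF n(1)]) (use \<open>l < 3\<close> in simp)
    then show ?thesis using q0 by simp
  next
    case D: True
    interpret rows "dd m j" "mu n" a b "eps n" "real n" by (rule lead_rows[OF ok D])
    have lq: "2 * l + mu n * q + 2 = dd m j + mu n" using w D by (simp add: dd_def)
    have ev: "dd m j + mu n + mu n * q = 2 * l + 2 * (mu n * q) + 2" "mu n * q + 2 \<le> dd m j + mu n" using lq by linarith+
    have val: "valid q" unfolding valid_def ev(1) using ev(2) by simp
    have tl: "t m j q = tau T $ (l + n * q) $ l $ m $ j"
    proof -
      have "dd m j + mu n - 2 - mu n * q = 2 * l" using lq by simp
      then show ?thesis by (simp add: t_def)
    qed
    note Pg = gs[OF D, unfolded P_def]
    have c: "tau (T + br (hr n a b) g) $ (l + n * q) $ l $ m $ j = t m j q - 2 * \<i> * br (hh n a b) Z $ (l + n * q) $ l $ m $ j"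
      by (simp add: tau_ring tau_br tau_hr g tl)
    show ?thesis
    proof (cases q)
      case 0
      show ?thesis
      proof (cases "n = 5 \<and> 3 \<le> l \<and> 5 dvd (2 * l - 3)")
        case True
        then have m5: "mu n = 5" "n = mu n" by (simp_all add: mu_def)
        have dl: "dd m j = 2 * l - 3" using lq 0 m5 True by simp
        have r: "br (hh n a b) Z $ l $ l $ m $ j = of_nat n * (of_real (b * (real (dd m j) + real (mu n)) / 2) * (cnj (gs m j 1) - gs m j 1))"
        proof (rule row_formula0[OF n(1) m5(2)[symmetric]])
          show "2 * l + 2 = dd m j + mu n" using lq 0 by simp
          show "gs m j 1 = 0" if "dd m j < mu n" using Pg that by simp
          show "Z $ (l + n) $ l $ m $ j = gs m j 1 \<and> Z $ l $ (l + n) $ m $ j = cnj (gs m j 1)" if "2 * l + mu n = dd m j" for l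
          proof -
            have "Z $ (l + n) $ l $ m $ j = gs m j 1" using V[of l 1 m j] that D by simp
            moreover have "Z $ l $ (l + n) $ m $ j = cnj (Z $ (l + n) $ l $ m $ j)" using hZ unfolding herm_def by blast
            ultimately show ?thesis by simp
          qed
        qed
        have "mu n dvd dd m j" "valid 0" using True dl m5 val 0 by auto
        then have z: "t m j 0 - 2 * \<i> * of_real (real n) * (of_real (b * (real (dd m j) + real (mu n)) / 2) * (cnj (gs m j 1) - gs m j 1)) = 0"
          using Pg m5(1) by blast
        have "tau (T + br (hr n a b) g) $ (l + n * q) $ l $ m $ j = 0"
          unfolding c unfolding 0 mult_0_right add_0_right r using z by (simp only: mult.assoc of_real_of_nat_eq)
        then show ?thesis by simp
      next
        case False
        have "nfc n l l (tau (T + br (hr n a b) g) $ l $ l $ m $ j)"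
          by (rule nfc_diag[OF n(1)]) (use False in blast)
        then show ?thesis using 0 by simp
      qed
    next
      case (Suc q')
      have "br (hh n a b) Z $ (l + n * q) $ l $ m $ j = of_nat n * Rw (gs m j) q"
      proof (rule row_formula[OF ok D _ _ _ lq])
        show "Z $ (l + n * q) $ l $ m $ j = gs m j q" if "2 * l + mu n * q = dd m j" for l q using V that D by simp
        show "Z $ (l + n * q) $ l $ m $ j = 0" if "2 * l + mu n * q < dd m j" for l q using V that by simp
        show "gs m j q = 0" if "dd m j < mu n * q" for q using Pg that by blast
        show "1 \<le> q" using Suc by simp
      qed
      then have cC: "tau (T + br (hr n a b) g) $ (l + n * q) $ l $ m $ j = C m j (gs m j) q"
        unfolding c C_def by (simp add: mult.assoc)
      show ?thesis
      proof (cases q')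
        case 0
        then have q1: "q = 1" using Suc by simp
        have "Im (C m j (gs m j) 1) = 0" using Pg val q1 by blast
        moreover have "C m j (gs m j) 1 = 0" if "mu n dvd 2 * l + 2"
        proof -
          have "dd m j = 2 * l + 2" using lq q1 by simp
          with that have "mu n dvd dd m j" by simp
          then show ?thesis using Pg val q1 by blast
        qed
        ultimately have "nfc n (l + n) l (C m j (gs m j) 1)" by (rule nfc_one[OF n(1)])
        then show ?thesis unfolding cC unfolding q1 by simp
      next
        case (Suc q'')
        then have "2 \<le> q" using \<open>q = Suc q'\<close> by simp
        with Pg val have "C m j (gs m j) q = 0" by blast
        with cC show ?thesis by simp
      qed
    qed
  qed
  from that[OF FWg fin] show thesis .
qed

lemma FW_L: "FW n 3 G \<Longrightarrow> FW n k T \<Longrightarrow> FW n (k + 1) (br T G)"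
  using FW_br[of n k T 3 G] by simp

lemma FW_l: "FW n (s + 2) g \<Longrightarrow> FW n k T \<Longrightarrow> FW n (k + s) (br T g)"
  using FW_br[of n k T "s + 2" g] by simp

lemma FW_variation:
  assumes n: "5 \<le> n" and G: "FW n 3 G" and g: "FW n (s + 2) g" and s: "1 \<le> s" and H: "FW n k H"
  shows "FW n (k + s + 1) (ex 1 (G + g) H - ex 1 G H - br H g)"
proof -
  have "FW n 3 g" by (rule FW_mono[OF g]) (use s in simp)
  then show ?thesis
    by (intro ex_variation[OF filtr_FW FW_Ham[OF n G] FW_Ham[OF n] FW_L[OF G] FW_l[OF g] s H])
qed

lemma hh_nth: "hh n a b $ k $ l $ m $ j = (if k = 3 \<and> l = 3 \<and> m = 0 \<and> j = 0 then of_real a else 0)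
   + of_real b * ((if k = n \<and> l = 0 \<and> m = 0 \<and> j = 0 then 1 else 0) + (if k = 0 \<and> l = n \<and> m = 0 \<and> j = 0 then 1 else 0))"
proof -
  have e: "hh n a b = ck (of_real a) * mono2 1 3 3 + ck (of_real b) * (mono2 1 n 0 + mono2 1 0 n)"
    by (simp add: hh_def mono2_def power_mult_distrib)
  show ?thesis unfolding e by (auto simp: mono2_nth)
qed

text \<open>Weight by weight: a generator of weight 3 + k changes H first at weight mu + 1 + k, and
  there only through its bracket with the leading part.\<close>

theorem normal_form_exists:
  assumes ok: "lead_ok n a b" and H: "FW n (mu n) H" and lead: "FW n (mu n + 1) (H - hr n a b)"
  obtains G where "FW n 3 G" "\<And>\<omega>. NF n \<omega> (ex 1 G H)"
proof -
  have n: "5 \<le> n" "mu n \<le> n" "5 \<le> mu n" "6 \<le> n \<Longrightarrow> mu n = 6" "n = 5 \<Longrightarrow> mu n = 5" using ok by (auto simp: lead_ok_def mu_def)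
  have h: "FW n (mu n) (hr n a b)" using FW_diff[OF H FW_mono[OF lead]] by simp
  \<comment> \<open>The leading weight mu is normal from the start, hence the offset mu + 1.\<close>
  define P where "P k G \<longleftrightarrow> FW n 3 G \<and> NF n (mu n + 1 + k) (ex 1 G H)" for k G
  define Q where "Q k G G' \<longleftrightarrow> FW n (3 + k) (G' - G)" for k and G G' :: plane_series
  have start: "P 0 0"
  proof -
    have "nfc n (l + n * q) l (tau H $ (l + n * q) $ l $ m $ j)" if w: "2 * l + mu n * q + 6 * (m + j) < mu n + 1" for l q m j
    proof -
      have "tau (H - hr n a b) $ (l + n * q) $ l $ m $ j = 0" by (rule FW_zero[OF n(1) lead w])
      then have e: "tau H $ (l + n * q) $ l $ m $ j = hh n a b $ (l + n * q) $ l $ m $ j" by (simp add: tau_ring tau_hr)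
      consider "q = 0" | "q = 1" | q' where "q = Suc (Suc q')" by (metis One_nat_def not0_implies_Suc)
      then show ?thesis
      proof cases
        case 1
        have "\<not> (n = 5 \<and> 3 \<le> l)" using w 1 n by auto
        then have "nfc n l l (tau H $ l $ l $ m $ j)" by (intro nfc_diag n(1)) blast
        then show ?thesis using 1 by simp
      next
        case 2
        then have l0: "l = 0" using w by simp
        then have e': "tau H $ n $ 0 $ m $ j = hh n a b $ n $ 0 $ m $ j" using e 2 by simp
        have "\<not> mu n dvd 2" using n(3) by (auto dest: dvd_imp_le)
        then have "nfc n (0 + n) 0 (tau H $ n $ 0 $ m $ j)" by (intro nfc_one n(1)) (simp_all add: e' hh_nth numeral_2_eq_2)
        then show ?thesis using l0 2 by simp
      next
        case 3
        with w n(3) show ?thesis by simp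
      qed
    qed
    moreover have "FW n 3 0" by (simp add: FW_def tau_ring)
    ultimately show ?thesis by (simp add: P_def NF_def)
  qed
  have step: "\<exists>G'. P (Suc k) G' \<and> Q k G G'" if PG: "P k G" for k G
  proof -
    define \<omega> where "\<omega> = mu n + 1 + k"
    have G: "FW n 3 G" and nf: "NF n \<omega> (ex 1 G H)" using PG by (auto simp: P_def \<omega>_def)
    obtain g where g: "FW n (\<omega> + 2 - mu n) g"
      "\<And>l q m j. 2 * l + mu n * q + 6 * (m + j) = \<omega> \<Longrightarrow> nfc n (l + n * q) l (tau (ex 1 G H + br (hr n a b) g) $ (l + n * q) $ l $ m $ j)"
      using normal_step[OF ok, of \<omega> "ex 1 G H"] by metis
    have g3: "FW n (3 + k) g" using g(1) by (simp add: \<omega>_def)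
    have e3: "(k + 1) + 2 = 3 + k" by simp
    have gs: "FW n ((k + 1) + 2) g" unfolding e3 by (rule g3)
    have v: "FW n (\<omega> + 1) (ex 1 (G + g) H - ex 1 G H - br H g)"
      using FW_variation[OF n(1) G gs _ H] by (simp add: \<omega>_def add.assoc)
    have w: "FW n (\<omega> + 1) (br (H - hr n a b) g)"
      using FW_l[OF gs lead] by (simp add: \<omega>_def add.commute add.left_commute)
    have hg: "FW n \<omega> (br (hr n a b) g)"
      using FW_l[OF gs h] by (simp add: \<omega>_def add.commute add.left_commute)
    \<comment> \<open>The first-order change is the bracket with H; replacing H by its leading part
      costs one more weight, so at weight \<omega> only the homological operator is visible.\<close>
    have e: "ex 1 (G + g) H - (ex 1 G H + br (hr n a b) g) = (ex 1 (G + g) H - ex 1 G H - br H g) + br (H - hr n a b) g"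
      by (simp add: br_diff_left)
    have d: "FW n (\<omega> + 1) (ex 1 (G + g) H - (ex 1 G H + br (hr n a b) g))" unfolding e by (rule FW_add[OF v w])
    have "NF n (\<omega> + 1) (ex 1 G H + br (hr n a b) g)"
      unfolding NF_def
    proof (intro allI impI)
      fix l q m j assume lt: "2 * l + mu n * q + 6 * (m + j) < \<omega> + 1"
      show "nfc n (l + n * q) l (tau (ex 1 G H + br (hr n a b) g) $ (l + n * q) $ l $ m $ j)"
      proof (cases "2 * l + mu n * q + 6 * (m + j) = \<omega>")
        case True then show ?thesis by (rule g(2))
      next
        case False
        with lt have "2 * l + mu n * q + 6 * (m + j) < \<omega>" by simp
        from FW_zero[OF n(1) hg this] nf this show ?thesis by (simp add: tau_ring NF_def)
      qed
    qed
    from NF_cong[OF n(1) this d] have "NF n (\<omega> + 1) (ex 1 (G + g) H)" .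
    moreover have "FW n 3 (G + g)" using FW_add[OF G FW_mono[OF g3]] by simp
    ultimately have "P (Suc k) (G + g)" by (simp add: P_def \<omega>_def)
    moreover have "Q k G (G + g)" using g3 by (simp add: Q_def)
    ultimately show ?thesis by blast
  qed
  obtain f where f: "\<And>k. P k (f k)" "\<And>k. Q k (f k) (f (Suc k))"
    using dependent_nat_choice[of P Q] start step by metis
  \<comment> \<open>The correction of stage k has weight 3 + k, hence total order at least (3 + k)
    div 6.\<close>
  have m: "mono (\<lambda>k::nat. (3 + k) div 6)" by (auto simp: mono_def intro: div_le_mono)
  have ub: "\<exists>k. M \<le> (3 + k) div 6" for M :: nat by (rule exI[of _ "6 * M"]) simp
  obtain G where G: "\<And>k. vge ((3 + k) div 6) (G - f k)"
    using vge_limit[of "\<lambda>k. (3 + k) div 6" f, OF _ m ub] f(2) FW_vge unfolding Q_def by blast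
  have cauchy: "FW n (3 + k) (f k' - f k)" if "k \<le> k'" for k k'
    using that
  proof (induction k' rule: dec_induct)
    case base
    show ?case by (simp add: FW_def tau_ring)
  next
    case (step k')
    have "FW n (3 + k) (f (Suc k') - f k')" using f(2)[of k'] step unfolding Q_def by (auto elim: FW_mono)
    from FW_add[OF this step.IH] show ?case by simp
  qed
  have d: "FW n (3 + k) (G - f k)" for k
  proof (rule filtrD(4)[OF filtr_FW])
    fix N
    let ?k = "k + 6 * N"
    have "vge N (G - f ?k)" by (rule vge_mono[OF G]) simp
    moreover have "(G - f k) - (f ?k - f k) = G - f ?k" by simp
    ultimately show "\<exists>S. FW n (3 + k) S \<and> vge N (G - f k - S)" using cauchy[of k ?k] by (metis le_add1)
  qed
  have fk: "FW n 3 (f k)" "NF n (mu n + 1 + k) (ex 1 (f k) H)" for k using f(1) by (auto simp: P_def)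
  have GF: "FW n 3 G" using FW_add[OF d[of 0, simplified] fk(1)[of 0]] by simp
  have NF: "NF n \<omega> (ex 1 G H)" for \<omega>
  proof -
    have e3: "(\<omega> + 1) + 2 = 3 + \<omega>" by simp
    have gs: "FW n ((\<omega> + 1) + 2) (G - f \<omega>)" unfolding e3 by (rule d)
    have "FW n (mu n + (\<omega> + 1) + 1) (ex 1 (f \<omega> + (G - f \<omega>)) H - ex 1 (f \<omega>) H - br H (G - f \<omega>))"
      by (rule FW_variation[OF n(1) fk(1) gs _ H]) simp
    moreover have "FW n (mu n + (\<omega> + 1)) (br H (G - f \<omega>))" by (rule FW_l[OF gs H])
    ultimately have "FW n \<omega> (ex 1 G H - ex 1 (f \<omega>) H - br H (G - f \<omega>) + br H (G - f \<omega>))"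
      by (intro FW_add) (auto elim: FW_mono)
    then have "FW n \<omega> (ex 1 G H - ex 1 (f \<omega>) H)" by simp
    moreover have "NF n \<omega> (ex 1 (f \<omega>) H)" using fk(2)[of \<omega>] by (simp add: NF_def)
    ultimately show ?thesis by (rule NF_cong[OF n(1), rotated])
  qed
  from that[OF GF NF] show thesis .
qed

section \<open>Powers of the leading part and uniqueness\<close>

lemma nfc_diff: "nfc n k l c \<Longrightarrow> nfc n k l d \<Longrightarrow> nfc n k l (c - d)"
  unfolding nfc_def by auto

lemma rsw_up: "rsw n \<omega> i j m l \<Longrightarrow> rsw n (\<omega> + 2) (Suc i) (Suc j) m l"
  unfolding rsw_def by force

lemma FW_mult: "FW n \<omega> S \<Longrightarrow> FW n \<omega>' T \<Longrightarrow> FW n (\<omega> + \<omega>') (S * T)"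
  unfolding FW_def tau_ring
proof (rule spt_mult, assumption, assumption)
  fix i j m l i' j' m' l' assume "rsw n \<omega> i j m l" "rsw n \<omega>' i' j' m' l'"
  from rsw_add[OF rsw_up[OF this(1)] this(2), of "i + i'" "j + j'"]
  show "rsw n (\<omega> + \<omega>') (i + i') (j + j') (m + m') (l + l')" by simp
qed

lemma FW_power: "FW n \<omega> S \<Longrightarrow> 1 \<le> Q \<Longrightarrow> FW n (\<omega> * Q) (S ^ Q)"
proof (induction Q)
  case (Suc Q)
  show ?case
  proof (cases Q)
    case 0 with Suc show ?thesis by simp
  next
    case (Suc Q')
    then have "FW n (\<omega> + \<omega> * Q) (S * S ^ Q)" using Suc.IH Suc.prems by (intro FW_mult) auto
    then show ?thesis by simp
  qed
qed simp

lemma FW_power_diff: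
  assumes "FW n \<omega> S" "FW n \<omega> T" "FW n (\<omega> + 1) (S - T)"
  shows "1 \<le> Q \<Longrightarrow> FW n (\<omega> * Q + 1) (S ^ Q - T ^ Q)"
proof (induction Q)
  case (Suc Q)
  show ?case
  proof (cases Q)
    case 0 with assms show ?thesis by simp
  next
    case (Suc Q')
    then have Q: "1 \<le> Q" by simp
    have e: "S ^ Suc Q - T ^ Suc Q = S * (S ^ Q - T ^ Q) + (S - T) * T ^ Q" by (simp add: algebra_simps)
    have "FW n (\<omega> + (\<omega> * Q + 1)) (S * (S ^ Q - T ^ Q))" by (rule FW_mult[OF assms(1) Suc.IH[OF Q]])
    moreover have "FW n ((\<omega> + 1) + \<omega> * Q) ((S - T) * T ^ Q)" by (rule FW_mult[OF assms(3) FW_power[OF assms(2) Q]])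
    moreover have "\<omega> + (\<omega> * Q + 1) = \<omega> * Suc Q + 1" "(\<omega> + 1) + \<omega> * Q = \<omega> * Suc Q + 1" by simp_all
    ultimately show ?thesis unfolding e by (intro FW_add) (simp_all only:)
  qed
qed simp

text \<open>Only b z^n produces pure powers of z, so the kernel element does not vanish at the top
  of its row.\<close>

lemma hh_power_top:
  assumes "5 \<le> n"
  shows "(hh n a b ^ Q) $ k $ 0 $ 0 $ 0 = (if k = n * Q then of_real b ^ Q else 0)"
proof (induction Q arbitrary: k)
  case 0
  show ?case by (simp add: fps_one_nth)
next
  case (Suc Q)
  have h: "hh n a b $ i $ 0 $ 0 $ 0 = (if i = n then of_real b else 0)" for i
    using assms by (simp add: hh_nth)
  have "(hh n a b ^ Suc Q) $ k $ 0 $ 0 $ 0 = (\<Sum>i\<le>k. (if i = n then of_real b * (if k - n = n * Q then of_real b ^ Q else 0) else 0))"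
  proof -
    have "(hh n a b ^ Suc Q) $ k $ 0 $ 0 $ 0 = (\<Sum>i\<le>k. hh n a b $ i $ 0 $ 0 $ 0 * (hh n a b ^ Q) $ (k - i) $ 0 $ 0 $ 0)"
      unfolding power_Suc mult4_nth by simp
    then show ?thesis unfolding h Suc.IH by (simp only: ) (rule sum.cong; simp)
  qed
  also have "\<dots> = (if n \<le> k then of_real b * (if k - n = n * Q then of_real b ^ Q else 0) else 0)" by simp
  also have "\<dots> = (if k = n * Suc Q then of_real b ^ Suc Q else 0)"
    using assms by (cases "n \<le> k") auto
  finally show ?case .
qed

lemma hh_power_spt: "spt (\<lambda>k l m j. m = 0 \<and> j = 0) (hh n a b ^ Q)"
proof (induction Q)
  case 0
  show ?case using spt_one by (auto elim: spt_mono)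
next
  case (Suc Q)
  have "spt (\<lambda>k l m j. m = 0 \<and> j = 0) (hh n a b)" by (auto simp: spt_def hh_nth split: if_splits)
  from spt_mult[OF this Suc.IH] show ?case by simp
qed

lemma hh_power_real: "Im ((hh n a b ^ Q) $ k $ l $ m $ j) = 0"
proof -
  have "cmap (cmap cnj) (hh n a b) = hh n a b"
    unfolding hh_def rhomD[OF rhom_cP(4)] ck_cnj cmap_vars[OF rhom_cP(3)] by simp
  then have "cmap (cmap cnj) (hh n a b ^ Q) = hh n a b ^ Q" by (simp add: rhomD[OF rhom_cP(4)])
  then have "cmap (cmap cnj) (hh n a b ^ Q) $ k $ l $ m $ j = (hh n a b ^ Q) $ k $ l $ m $ j" by (simp only:)
  then have "cnj ((hh n a b ^ Q) $ k $ l $ m $ j) = (hh n a b ^ Q) $ k $ l $ m $ j" by (simp only: cmap_nth)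
  from arg_cong[OF this, of Im] show ?thesis by simp
qed

definition pm :: "nat \<Rightarrow> nat \<Rightarrow> plane_series" where "pm m j = cc (mono2 1 m j)"

lemma tau_pm: "tau (real_const c * pm m j * K) $ k $ l $ m' $ j' =
   of_real c * (if m \<le> m' \<and> j \<le> j' then tau K $ k $ l $ (m' - m) $ (j' - j) else 0)"
proof -
  have "cmap of_real (mono2 (1::real) m j) = (mono2 1 m j :: cpar)" by (rule fps2_eqI) (simp add: mono2_nth)
  then have "tau (pm m j * K) $ k $ l = mono2 1 m j * tau K $ k $ l" by (simp add: pm_def tau_ring tau_cc)
  then have "tau (pm m j * K) $ k $ l $ m' $ j' = (if m \<le> m' \<and> j \<le> j' then tau K $ k $ l $ (m' - m) $ (j' - j) else 0)"
    using XY_nth[of m j "tau K $ k $ l" m' j'] by (simp add: mono2_def mult.assoc)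
  then show ?thesis by (simp add: mult.assoc tau_ring(4)[of "real_const c"] tau_cc)
qed

lemma FW_pm:
  assumes "FW n \<omega> K" shows "FW n (\<omega> + 6 * (m + j)) (real_const c * pm m j * K)"
  unfolding FW_def spt_def
proof (intro allI impI)
  fix k l m' j' assume "tau (real_const c * pm m j * K) $ k $ l $ m' $ j' \<noteq> 0"
  then have mj: "m \<le> m'" "j \<le> j'" "tau K $ k $ l $ (m' - m) $ (j' - j) \<noteq> 0" unfolding tau_pm by (auto split: if_splits)
  from spt_nz[OF assms[unfolded FW_def] mj(3)]
  obtain q where two: "2 \<le> k + l" and q: "(k = l + n * q \<and> \<omega> \<le> 2 * l + mu n * q + 6 * (m' - m + (j' - j))) \<or>
     (l = k + n * q \<and> \<omega> \<le> 2 * k + mu n * q + 6 * (m' - m + (j' - j)))" unfolding rsw_def by blast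
  have "\<omega> \<le> x + 6 * (m' - m + (j' - j)) \<Longrightarrow> \<omega> + 6 * (m + j) \<le> x + 6 * (m' + j')" for x
    using mj(1,2) by (simp add: distrib_left diff_mult_distrib2)
  with q two show "rsw n (\<omega> + 6 * (m + j)) k l m' j'" unfolding rsw_def by blast
qed

lemma FW_sum: "(\<And>i. i \<in> I \<Longrightarrow> FW n \<omega> (f i)) \<Longrightarrow> FW n \<omega> (\<Sum>i\<in>I. f i)"
  unfolding FW_def tau_sum by (rule spt_sum)

lemma of_nat_neq_0': "0 < n \<Longrightarrow> (of_nat n :: complex) \<noteq> 0" by simp
lemma of_real_neq_0': "r \<noteq> 0 \<Longrightarrow> (of_real r :: complex) \<noteq> 0" by simp

lemma product_nz2: "(of_nat n :: complex) * c = 0 \<Longrightarrow> 0 < n \<Longrightarrow> c = 0" by simp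

lemma product_nz: "(a::complex) * (b * c) = 0 \<Longrightarrow> a \<noteq> 0 \<Longrightarrow> b \<noteq> 0 \<Longrightarrow> c = 0" by simp

text \<open>If {N2, G} is normal in the lowest weight it can have, the lowest rows of G lie in the
  kernel of the homological operator, so for every monomial in the parameters they are real
  multiples of powers of the leading part. Powers of N2 in their place give an exact integral C, and
  subtracting C from G leaves {N2, G} unchanged.\<close>

lemma kernel_step:
  assumes ok: "lead_ok n a b" and N2: "FW n (mu n) N2" and lead: "FW n (mu n + 1) (N2 - hr n a b)"
    and G: "FW n (3 + k) G"
    and cond: "\<And>l q m j. 2 * l + mu n * q + 6 * (m + j) = mu n + 1 + k \<Longrightarrow> nfc n (l + n * q) l (tau (br N2 G) $ (l + n * q) $ l $ m $ j)"
  obtains C where "br N2 C = 0" "FW n (4 + k) (G - C)"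
proof -
  have n: "5 \<le> n" "0 < n" "mu n \<le> n" "5 \<le> mu n" "mu n = 5 \<Longrightarrow> n = 5" "0 < b"
    using ok by (auto simp: lead_ok_def mu_def)
  have h: "FW n (mu n) (hr n a b)" using FW_diff[OF N2 FW_mono[OF lead]] by simp
  define t where "t = 3 + k"
  define dd where "dd m j = t - 6 * (m + j)" for m j
  \<comment> \<open>Extraction of the row of weight d, with 0 at indices that carry no
    monomial.\<close>
  define gg where "gg d Z m j q = (if mu n * q \<le> d \<and> even (d + mu n * q)
    then Z $ ((d - mu n * q) div 2 + n * q) $ ((d - mu n * q) div 2) $ m $ j else 0)" for d :: nat and Z :: cplane and m j q
  have ggV: "gg d Z m j q = Z $ (l + n * q) $ l $ m $ j" if "2 * l + mu n * q = d" for d Z m j q l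
    using that by (auto simp: gg_def)
  have ggo: "gg d Z m j q = 0" if "d < mu n * q" for d Z m j q using that by (simp add: gg_def)
  have ggp: "gg d Z m j q = 0" if "odd (d + mu n * q)" for d Z m j q using that unfolding gg_def by (simp only: simp_thms if_False)
  have main: "\<exists>c :: real. (mu n dvd dd m j \<or> c = 0) \<and>
      (\<forall>q. gg (dd m j) (tau G) m j q = of_real c * gg (dd m j) (hh n a b ^ (dd m j div mu n)) 0 0 q)"
    if D: "1 \<le> dd m j" for m j
  proof -
    interpret rows "dd m j" "mu n" a b "eps n" "real n" by (rule lead_rows[OF ok D])
    let ?d = "dd m j" and ?g = "gg (dd m j) (tau G) m j"
    let ?Q = "?d div mu n"
    let ?k = "gg ?d (hh n a b ^ ?Q) 0 0"
    have dt: "?d + 6 * (m + j) = t" using D by (simp add: dd_def)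
    have lval: "\<exists>l. 2 * l + mu n * q + 2 = ?d + mu n" if "valid q" for q
    proof -
      have v: "mu n * q + 2 \<le> ?d + mu n" "even (?d + mu n + mu n * q)" using that by (auto simp: valid_def)
      then have "even (?d + mu n - 2 - mu n * q)" by presburger
      then obtain l where "?d + mu n - 2 - mu n * q = 2 * l" by blast
      with v(1) show ?thesis by (intro exI[of _ l]) simp
    qed
    have wt: "2 * l + mu n * q + 6 * (m + j) = mu n + 1 + k" if "2 * l + mu n * q + 2 = ?d + mu n" for l q
      using that dt by (simp add: t_def)
    have tz: "tau (br N2 G) $ (l + n * q) $ l $ m $ j = - 2 * \<i> * br (hh n a b) (tau G) $ (l + n * q) $ l $ m $ j"
      if l: "2 * l + mu n * q + 2 = ?d + mu n" for l q
    proof -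
      have "FW n (mu n + 1 + (k + 1)) (br (N2 - hr n a b) G)" by (rule FW_l[OF _ lead]) (use G in \<open>simp add: add.commute eval_nat_numeral\<close>)
      then have "tau (br (N2 - hr n a b) G) $ (l + n * q) $ l $ m $ j = 0"
        by (rule FW_zero[OF n(1)]) (use wt[OF l] in simp)
      then have "tau (br N2 G) $ (l + n * q) $ l $ m $ j = tau (br (hr n a b) G) $ (l + n * q) $ l $ m $ j"
        by (simp add: br_diff_left tau_ring)
      then show ?thesis by (simp add: tau_br tau_hr)
    qed
    have G0: "tau G $ (l + n * q) $ l $ m $ j = 0" if "2 * l + mu n * q < ?d" for l q
      by (rule FW_zero[OF n(1) G]) (use that dt in \<open>simp add: t_def\<close>)
    have row: "tau (br N2 G) $ (l + n * q) $ l $ m $ j = - 2 * \<i> * of_real (real n) * Rw ?g q"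
      if l: "2 * l + mu n * q + 2 = ?d + mu n" and q: "1 \<le> q" for l q
    proof -
      have "br (hh n a b) (tau G) $ (l + n * q) $ l $ m $ j = of_nat n * Rw ?g q"
        by (rule row_formula[OF ok D _ G0 ggo l q]) (rule ggV[symmetric])
      with tz[OF l] show ?thesis by simp
    qed
    show ?thesis
    proof (rule row_kernel)
      show "Im (?g 0) = 0"
        unfolding gg_def using arg_cong[OF tau_sym[of G "dd m j div 2" "dd m j div 2" m j], of Im] by simp
      show "?g q = 0" if "?d < mu n * q" for q by (rule ggo[OF that])
      show "?g q = 0" if "odd (?d + mu n * q)" for q by (rule ggp[OF that])
      show "Rw ?g q = 0" if q: "2 \<le> q" "valid q" for q
      proof -
        obtain l where l: "2 * l + mu n * q + 2 = ?d + mu n" using lval[OF q(2)] by blast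
        have "l + n * q \<noteq> l" "l + n * q \<noteq> l + n" "l \<noteq> l + n * q + n" using q(1) n by auto
        then have "tau (br N2 G) $ (l + n * q) $ l $ m $ j = 0" using cond[OF wt[OF l]] unfolding nfc_def by blast
        with row[OF l] q(1) n show ?thesis by simp
      qed
      have one: "Im (2 * \<i> * of_real (real n) * Rw ?g 1) = 0 \<and> (mu n dvd ?d \<longrightarrow> Rw ?g 1 = 0)" if v: "valid 1"
      proof -
        obtain l where l: "2 * l + mu n * 1 + 2 = ?d + mu n" using lval[OF v] by blast
        have "Im (tau (br N2 G) $ (l + n * 1) $ l $ m $ j) = 0 \<and> (mu n dvd 2 * l + 2 \<longrightarrow> tau (br N2 G) $ (l + n * 1) $ l $ m $ j = 0)"
          using cond[OF wt[OF l]] unfolding nfc_def by simp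
        moreover have "2 * l + 2 = ?d" using l by simp
        ultimately show ?thesis unfolding row[OF l order_refl] using n by auto
      qed
      show "Im (2 * \<i> * of_real (real n) * Rw ?g 1) = 0" if "valid 1" using one[OF that] by blast
      show "Rw ?g 1 = 0" if "valid 1" "mu n dvd ?d" using one[OF that(1)] that(2) by blast
      show "Im (?g 1) = 0" if m5: "mu n = 5" and dv: "mu n dvd ?d" and v: "valid 0"
      proof -
        obtain l where l: "2 * l + mu n * 0 + 2 = ?d + mu n" using lval[OF v] by blast
        have n5: "n = 5" "mu n = n" using m5 n(5) by auto
        have "5 \<le> ?d" using dv m5 D by (auto dest: dvd_imp_le)
        then have "3 \<le> l" "2 * l - 3 = ?d" using l m5 by auto
        then have "tau (br N2 G) $ (l + n * 0) $ l $ m $ j = 0"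
          using cond[OF wt[OF l]] n5 dv m5 unfolding nfc_def by simp
        then have z: "br (hh n a b) (tau G) $ l $ l $ m $ j = 0" using tz[OF l] by simp
        have a1: "br (hh n a b) (tau G) $ l $ l $ m $ j = of_nat n * (of_real (b * (real ?d + real (mu n)) / 2) * (cnj (?g 1) - ?g 1))"
        proof (rule row_formula0[OF n(1) n5(2)])
          show "2 * l + 2 = ?d + mu n" using l by simp
          show "?g 1 = 0" if "?d < mu n" using that ggo by simp
          show "tau G $ (l + n) $ l $ m $ j = ?g 1 \<and> tau G $ l $ (l + n) $ m $ j = cnj (?g 1)" if "2 * l + mu n = ?d" for l
            using ggV[of l 1 ?d "tau G" m j] that tau_sym[of G l "l + n" m j] by simp
        qed
        have a2: "b * (real ?d + real (mu n)) / 2 \<noteq> 0"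
        proof -
          have "0 < real ?d" using D by simp
          then have "0 < real ?d + real (mu n)" by (rule add_pos_nonneg) simp
          then have "0 < b * (real ?d + real (mu n))" by (rule mult_pos_pos[OF n(6)])
          then show ?thesis by (intro less_imp_neq[THEN not_sym] half_gt_zero)
        qed
        from trans[OF a1[symmetric] z] have "cnj (?g 1) - ?g 1 = 0"
          by (rule product_nz) (rule of_nat_neq_0', rule n(2), rule of_real_neq_0', rule a2)
        then show ?thesis by (simp add: complex_eq_iff)
      qed
      assume dv: "mu n dvd ?d"
      then have dQ: "mu n * ?Q = ?d" and Q1: "1 \<le> ?Q" using D by (auto simp: Suc_le_eq intro: Nat.gr0I)
      have K: "FW n ?d (hr n a b ^ ?Q)" using FW_power[OF h Q1] dQ by simp
      have tK: "tau (hr n a b ^ ?Q) = hh n a b ^ ?Q" by (simp add: tau_ring tau_hr)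
      have comm: "br (hh n a b) (hh n a b ^ ?Q) = 0"
        using br_power_0[OF br_self, of "hh n a b" ?Q] br_antisym[of "hh n a b" "hh n a b ^ ?Q"] by simp
      show "(\<forall>q. Im (?k q) = 0) \<and> ?k ?Q \<noteq> 0 \<and> (\<forall>q\<ge>1. valid q \<longrightarrow> Rw ?k q = 0) \<and>
         (\<forall>q. ?d < mu n * q \<longrightarrow> ?k q = 0) \<and> (\<forall>q. odd (?d + mu n * q) \<longrightarrow> ?k q = 0)"
      proof (intro conjI allI impI)
        show "Im (?k q) = 0" for q unfolding gg_def by (simp add: hh_power_real)
        have "?k ?Q = (hh n a b ^ ?Q) $ (0 + n * ?Q) $ 0 $ 0 $ 0" by (rule ggV) (use dQ in simp)
        then show "?k ?Q \<noteq> 0" using n by (simp add: hh_power_top)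
        show "?k q = 0" if "?d < mu n * q" for q by (rule ggo[OF that])
        show "?k q = 0" if "odd (?d + mu n * q)" for q by (rule ggp[OF that])
        show "Rw ?k q = 0" if q: "1 \<le> q" "valid q" for q
        proof -
          obtain l where l: "2 * l + mu n * q + 2 = ?d + mu n" using lval[OF q(2)] by blast
          have "br (hh n a b) (hh n a b ^ ?Q) $ (l + n * q) $ l $ 0 $ 0 = of_nat n * Rw ?k q"
          proof (rule row_formula[OF ok D _ _ ggo l q(1)])
            show "(hh n a b ^ ?Q) $ (l + n * q) $ l $ 0 $ 0 = ?k q" if "2 * l + mu n * q = ?d" for l q
              by (rule ggV[symmetric, OF that])
            show "(hh n a b ^ ?Q) $ (l + n * q) $ l $ 0 $ 0 = 0" if "2 * l + mu n * q < ?d" for l q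
              using FW_zero[OF n(1) K, of l q 0 0] that tK by simp
          qed
          then have "of_nat n * Rw ?k q = 0" unfolding comm by simp
          then show ?thesis by (rule product_nz2[OF _ n(2)])
        qed
      qed
    qed
  qed
  \<comment> \<open>Zero where the parameters alone exhaust the weight, so that the sums below run
    over all m and j up to t.\<close>
  define c where "c m j = (if 1 \<le> dd m j then (SOME c :: real. (mu n dvd dd m j \<or> c = 0) \<and>
      (\<forall>q. gg (dd m j) (tau G) m j q = of_real c * gg (dd m j) (hh n a b ^ (dd m j div mu n)) 0 0 q)) else 0)" for m j
  have c: "(mu n dvd dd m j \<or> c m j = 0) \<and>
      (\<forall>q. gg (dd m j) (tau G) m j q = of_real (c m j) * gg (dd m j) (hh n a b ^ (dd m j div mu n)) 0 0 q)" if "1 \<le> dd m j" for m j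
    unfolding c_def if_P[OF that] by (rule someI_ex[OF main[OF that]])
  have cz: "1 \<le> dd m j \<and> 1 \<le> dd m j div mu n \<and> mu n * (dd m j div mu n) + 6 * (m + j) = t" if "c m j \<noteq> 0" for m j
  proof -
    have D: "1 \<le> dd m j" using that unfolding c_def by presburger
    with c[OF D] that have dv: "mu n dvd dd m j" by blast
    then have "mu n * (dd m j div mu n) = dd m j" by simp
    moreover have "dd m j + 6 * (m + j) = t" using D by (simp add: dd_def)
    moreover have "1 \<le> dd m j div mu n" using dv D by (auto simp: Suc_le_eq intro: Nat.gr0I)
    ultimately show ?thesis using D by simp
  qed
  define Q where "Q m j = dd m j div mu n" for m j
  \<comment> \<open>C consists of exact integrals of N2; C0 below has the same coefficients but
    powers of the leading part. They differ only in weight above t, so C removes the same lowest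
    rows of G.\<close>
  define C where "C = (\<Sum>m\<le>t. \<Sum>j\<le>t. real_const (c m j) * pm m j * N2 ^ Q m j)"
  define C0 where "C0 = (\<Sum>m\<le>t. \<Sum>j\<le>t. real_const (c m j) * pm m j * hr n a b ^ Q m j)"
  have "br C N2 = 0"
    unfolding C_def br_sum_left by (simp add: mult.assoc br_rc_left pm_def br_cc_left br_power_0)
  then have brC: "br N2 C = 0" using br_antisym[of N2 C] by simp
  have dC: "FW n (t + 1) (C - C0)"
  proof -
    have "C - C0 = (\<Sum>m\<le>t. \<Sum>j\<le>t. real_const (c m j) * pm m j * (N2 ^ Q m j - hr n a b ^ Q m j))"
      unfolding C_def C0_def by (simp add: sum_subtractf right_diff_distrib)
    moreover have "FW n (t + 1) (real_const (c m j) * pm m j * (N2 ^ Q m j - hr n a b ^ Q m j))" for m j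
    proof (cases "c m j = 0")
      case True then show ?thesis by (simp add: rc_hom FW_def tau_ring)
    next
      case False
      have "FW n (mu n * Q m j + 1) (N2 ^ Q m j - hr n a b ^ Q m j)"
        by (rule FW_power_diff[OF N2 h lead]) (use cz[OF False] in \<open>simp add: Q_def\<close>)
      from FW_pm[OF this, of m j "c m j"] show ?thesis by (rule FW_mono) (use cz[OF False] in \<open>simp add: Q_def\<close>)
    qed
    ultimately show ?thesis by (simp add: FW_sum)
  qed
  have C0t: "FW n t C0"
    unfolding C0_def
  proof (intro FW_sum)
    fix m j
    show "FW n t (real_const (c m j) * pm m j * hr n a b ^ Q m j)"
    proof (cases "c m j = 0")
      case True then show ?thesis by (simp add: rc_hom FW_def tau_ring)
    next
      case False
      have "FW n (mu n * Q m j) (hr n a b ^ Q m j)"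
        by (rule FW_power[OF h]) (use cz[OF False] in \<open>simp add: Q_def\<close>)
      from FW_pm[OF this, of m j "c m j"] show ?thesis by (rule FW_mono) (use cz[OF False] in \<open>simp add: Q_def\<close>)
    qed
  qed
  have "FW n (t + 1) (G - C0)"
  proof (rule FW_suc[OF n(1)])
    show "FW n t (G - C0)" by (rule FW_diff[OF _ C0t]) (use G in \<open>simp add: t_def\<close>)
    fix l q m' j' assume w: "2 * l + mu n * q + 6 * (m' + j') = t"
    then have le: "m' \<le> t" "j' \<le> t" and dw: "2 * l + mu n * q = dd m' j'" by (auto simp: dd_def)
    have "tau C0 $ (l + n * q) $ l $ m' $ j' = (\<Sum>m\<le>t. \<Sum>j\<le>t. tau (real_const (c m j) * pm m j * hr n a b ^ Q m j) $ (l + n * q) $ l $ m' $ j')"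
      unfolding C0_def tau_sum fps_sum_nth ..
    also have "\<dots> = (\<Sum>m\<le>t. \<Sum>j\<le>t. if m = m' then if j = j' then of_real (c m' j') * (hh n a b ^ Q m' j') $ (l + n * q) $ l $ 0 $ 0 else 0 else 0)"
    proof (intro sum.cong refl)
      fix m j
      have "(hh n a b ^ Q m j) $ (l + n * q) $ l $ (m' - m) $ (j' - j) = 0" if "m < m' \<or> j < j'"
        by (rule sptD[OF hh_power_spt]) (use that in auto)
      then show "tau (real_const (c m j) * pm m j * hr n a b ^ Q m j) $ (l + n * q) $ l $ m' $ j' =
        (if m = m' then if j = j' then of_real (c m' j') * (hh n a b ^ Q m' j') $ (l + n * q) $ l $ 0 $ 0 else 0 else 0)"
        unfolding tau_pm by (auto simp: tau_ring tau_hr)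
    qed
    also have "\<dots> = (\<Sum>m\<le>t. if m = m' then (\<Sum>j\<le>t. if j = j' then of_real (c m' j') * (hh n a b ^ Q m' j') $ (l + n * q) $ l $ 0 $ 0 else 0) else 0)"
      by (intro sum.cong) auto
    also have "\<dots> = of_real (c m' j') * (hh n a b ^ Q m' j') $ (l + n * q) $ l $ 0 $ 0"
      using le by simp
    finally have tC: "tau C0 $ (l + n * q) $ l $ m' $ j' = of_real (c m' j') * (hh n a b ^ Q m' j') $ (l + n * q) $ l $ 0 $ 0" .
    show "tau (G - C0) $ (l + n * q) $ l $ m' $ j' = 0"
    proof (cases "1 \<le> dd m' j'")
      case True
      have "tau G $ (l + n * q) $ l $ m' $ j' = of_real (c m' j') * (hh n a b ^ Q m' j') $ (l + n * q) $ l $ 0 $ 0"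
        using c[OF True] unfolding Q_def by (metis ggV[OF dw])
      then show ?thesis by (simp add: tau_ring tC)
    next
      case False
      then have d0: "dd m' j' = 0" by simp
      then have "l = 0" "mu n * q = 0" using dw by simp_all
      then have "c m' j' = 0" "l = 0" "q = 0" using d0 n(4) by (simp_all add: c_def)
      moreover have "tau G $ 0 $ 0 $ m' $ j' = 0"
        by (rule sptD[OF G[unfolded FW_def]]) (simp add: rsw_def)
      ultimately show ?thesis using tC by (simp add: tau_ring)
    qed
  qed
  from FW_diff[OF this dC] have "FW n (4 + k) (G - C)" by (simp add: t_def)
  from that[OF brC this] show thesis .
qed

text \<open>G is not unique, but subtracting series that commute with N2 does not affect Y = {N2,
  G}. To leading order N1 - N2 equals Y, and a difference of normal forms is normal. Hence
  \<open>kernel_step\<close> keeps raising the weight of G, and with it the weight in which Y and N1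
  - N2 can start.\<close>

theorem normal_form_unique:
  assumes ok: "lead_ok n a b" and N2: "FW n (mu n) N2" and lead: "FW n (mu n + 1) (N2 - hr n a b)"
    and nf: "\<And>\<omega>. NF n \<omega> N1" "\<And>\<omega>. NF n \<omega> N2" and G: "FW n 3 G" and eq: "N1 = ex 1 G N2"
  shows "N1 = N2"
proof -
  have n: "5 \<le> n" using ok by (simp add: lead_ok_def)
  define Y where "Y = br N2 G"
  have HG: "Ham G" by (rule FW_Ham[OF n G])
  have Y1: "FW n (mu n + 1) Y" unfolding Y_def by (rule FW_L[OF G N2])
  have tail: "FW n (r + 1) (N1 - N2 - Y)" if "FW n r Y" for r
    using ex_filtr_step2[OF filtr_FW HG FW_L[OF G], of r N2] that by (simp add: Y_def eq)
  have nfD: "nfc n (l + n * q) l (tau (N1 - N2) $ (l + n * q) $ l $ m $ j)" for l q m j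
  proof -
    have "nfc n (l + n * q) l (tau N $ (l + n * q) $ l $ m $ j)" if "NF n (Suc (2 * l + mu n * q + 6 * (m + j))) N" for N
      using that unfolding NF_def by blast
    from nfc_diff[OF this[OF nf(1)] this[OF nf(2)]] show ?thesis by (simp only: tau_ring fps_sub_nth)
  qed
  have "FW n (mu n + 1 + s) (N1 - N2)" for s
  proof (induction s)
    case 0
    have "FW n (mu n + 1) (N1 - N2 - Y)" using tail[of "mu n"] FW_mono[OF Y1] by simp
    from FW_add[OF this Y1] show ?case by simp
  next
    case (Suc s)
    \<comment> \<open>Y agrees with N1 - N2 one weight further than it is known to vanish, so the
      known vanishing of N1 - N2 carries over to Y.\<close>
    have Ys: "FW n (mu n + 1 + r) Y" if "r \<le> s" for r
      using that
    proof (induction r)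
      case (Suc r)
      have x: "FW n (mu n + 1 + Suc r) (N1 - N2 - Y)" using tail[OF Suc.IH] Suc.prems by simp
      have y: "FW n (mu n + 1 + Suc r) (N1 - N2)" by (rule FW_mono[OF \<open>FW n (mu n + 1 + s) (N1 - N2)\<close>]) (use Suc.prems in simp)
      show ?case using FW_diff[OF y x] by simp
    qed (use Y1 in simp)
    have Yt: "FW n (mu n + 1 + s + 1) (N1 - N2 - Y)" by (rule tail[OF Ys[OF order_refl]])
    \<comment> \<open>Only the generator changes in this induction; its bracket with N2 remains Y.
      At the last round, r = s, normality of N1 - N2 is what feeds
      \<open>kernel_step\<close>.\<close>
    have "\<exists>G'. FW n (3 + r) G' \<and> br N2 G' = Y" if "r \<le> Suc s" for r
      using that
    proof (induction r)
      case 0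
      show ?case using G Y_def by auto
    next
      case (Suc r)
      then obtain G' where G': "FW n (3 + r) G'" "br N2 G' = Y" by auto
      have cond: "nfc n (l + n * q) l (tau (br N2 G') $ (l + n * q) $ l $ m $ j)"
        if w: "2 * l + mu n * q + 6 * (m + j) = mu n + 1 + r" for l q m j
      proof (cases "r = s")
        case True
        have "tau (N1 - N2 - Y) $ (l + n * q) $ l $ m $ j = 0" by (rule FW_zero[OF n Yt]) (use w True in simp)
        then have "tau (br N2 G') $ (l + n * q) $ l $ m $ j = tau (N1 - N2) $ (l + n * q) $ l $ m $ j"
          by (simp add: G'(2) tau_ring)
        with nfD show ?thesis by simp
      next
        case False
        then have "tau Y $ (l + n * q) $ l $ m $ j = 0" by (intro FW_zero[OF n Ys[OF order_refl]]) (use w Suc.prems in simp)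
        then show ?thesis by (simp add: G'(2))
      qed
      obtain C where C: "br N2 C = 0" "FW n (4 + r) (G' - C)"
        using kernel_step[OF ok N2 lead G'(1) cond] by blast
      then show ?case using G'(2) by (intro exI[of _ "G' - C"]) (simp add: br_diff_right)
    qed
    from this[of "Suc s"] obtain G' where "FW n (3 + Suc s) G'" "br N2 G' = Y" by blast
    then have "FW n (mu n + (Suc s + 1)) Y" using FW_l[of n "Suc s + 1" G' "mu n" N2] N2 by (simp add: numeral_eq_Suc)
    with Yt have "FW n (mu n + 1 + Suc s) (N1 - N2 - Y + Y)" by (intro FW_add) (simp_all add: add.commute add.left_commute)
    then show ?case by simp
  qed
  note F = this
  show ?thesis
  proof (rule vge_eqI)
    fix k
    from FW_vge[OF F[of "6 * k"]] show "vge k (N1 - N2)" by (rule vge_mono) simp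
  qed
qed

section \<open>Classification of formal maps\<close>

text \<open>The z-component u + i v of the map, as a series in z and w.\<close>

definition Cx :: "plane_series \<Rightarrow> plane_series \<Rightarrow> cplane" where "Cx u v = tau u + ck \<i> * tau v"

text \<open>By Hermitian symmetry the coefficients of u + i v at (k,l) and (l,k) determine those of
  u and v, and a condition on k + l treats both positions alike.\<close>

lemma Cx_spt:
  assumes "spt (\<lambda>i j m l. A (i + j) m l) (Cx u v)"
  shows "spt (\<lambda>i j m l. A (i + j) m l) u" "spt (\<lambda>i j m l. A (i + j) m l) v"
proof -
  have z: "tau u $ k $ l $ m $ j = 0 \<and> tau v $ k $ l $ m $ j = 0" if "\<not> A (k + l) m j" for k l m j
  proof -
    have 1: "Cx u v $ k $ l $ m $ j = 0" by (rule sptD[OF assms]) (rule that)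
    have 2: "Cx u v $ l $ k $ m $ j = 0" by (rule sptD[OF assms]) (use that in \<open>simp add: add.commute\<close>)
    define p q where "p = tau u $ k $ l $ m $ j" and "q = tau v $ k $ l $ m $ j"
    have "p + \<i> * q = 0" "cnj p + \<i> * cnj q = 0"
      using 1 2 unfolding Cx_def fps_add_nth ck_nth p_def q_def by (simp_all add: tau_sym[of u l k] tau_sym[of v l k])
    then have "p = 0 \<and> q = 0" by (simp add: complex_eq_iff)
    then show ?thesis by (simp add: p_def q_def)
  qed
  then have "spt (\<lambda>i j m l. A (i + j) m l) (tau u)" "spt (\<lambda>i j m l. A (i + j) m l) (tau v)"
    unfolding spt_def by blast+
  then show "spt (\<lambda>i j m l. A (i + j) m l) u" "spt (\<lambda>i j m l. A (i + j) m l) v" by (simp_all only: tau_spt)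
qed

lemma Cx_dge: assumes "dge k (Cx u v)" shows "dge k u" "dge k v"
  using Cx_spt[of "\<lambda>s m l. k \<le> s" u v] assms unfolding dge_spt by simp_all

lemma Cx_vge: assumes "spt (\<lambda>i j m l. k \<le> i + j + m + l) (Cx u v)" shows "vge k u" "vge k v"
  using Cx_spt[of "\<lambda>s m l. k \<le> s + m + l" u v] assms unfolding vge_def by simp_all

lemma dge_tau: "dge k T \<longleftrightarrow> dge k (tau T)"
  using tau_spt[of "\<lambda>s m l. k \<le> s" T] by (simp add: dge_spt)

lemma Ham_tau: "Ham T \<longleftrightarrow> spt (\<lambda>i j m l. 2 \<le> i + j \<and> 3 \<le> i + j + m + l) (tau T)"
  using tau_spt[of "\<lambda>s m l. 2 \<le> s \<and> 3 \<le> s + m + l" T] by (simp add: Ham_def)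

lemma Cx_diff: "Cx (a - b) (c - d) = Cx a c - Cx b d"
  by (simp add: Cx_def tau_ring algebra_simps)

lemma Cx_vars: "Cx fps_X yy = fps_X"
  by (simp add: Cx_def tau_cc Z_id)

lemma Cx_rot:
  "Cx (real_const (cos \<theta>) * u - real_const (sin \<theta>) * v) (real_const (sin \<theta>) * u + real_const (cos \<theta>) * v) = ck (cis \<theta>) * Cx u v"
proof -
  have i: "ck \<i> * ck \<i> = -1" by (simp flip: ck_hom(2)) (simp add: ck_hom)
  have c: "cis \<theta> = of_real (cos \<theta>) + \<i> * of_real (sin \<theta>)" by (simp add: complex_eq_iff)
  show ?thesis unfolding Cx_def tau_ring tau_cc c ck_hom
    using i by algebra
qed

lemma Cx_pb_rot: "Cx (pb (rot \<theta>) u) (pb (rot \<theta>) v) $ k $ l = cc (cis \<theta> ^ k * cis (- \<theta>) ^ l) * Cx u v $ k $ l"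
proof -
  have e: "(ck c * T) $ k $ l = cc c * T $ k $ l" for c T by (simp add: ck_def)
  show ?thesis unfolding Cx_def fps_add_nth e tau_rot by algebra
qed

lemma rot_add: "pb (rot a) (pb (rot b) X) = pb (rot (a + b)) X"
proof (rule tau_inj, rule fps2_eqI)
  fix k l
  have "cis (a + b) = cis a * cis b" "cis (- (a + b)) = cis (- a) * cis (- b)" by (simp_all add: cis_mult)
  then have "cis (a + b) ^ k = cis a ^ k * cis b ^ k" "cis (- (a + b)) ^ l = cis (- a) ^ l * cis (- b) ^ l"
    by (simp_all only: power_mult_distrib)
  then show "tau (pb (rot a) (pb (rot b) X)) $ k $ l = tau (pb (rot (a + b)) X) $ k $ l"
    by (simp add: tau_rot cc_mult mult_ac)
qed

lemma rot_trivial: assumes "cis \<theta> = 1" shows "pb (rot \<theta>) X = X"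
proof (rule tau_inj, rule fps2_eqI)
  fix k l
  have "cis (- \<theta>) = 1" using assms cis_mult[of \<theta> "- \<theta>"] by simp
  then show "tau (pb (rot \<theta>) X) $ k $ l = tau X $ k $ l" by (simp add: tau_rot assms)
qed

lemma rot_inverse: "pb (rot \<theta>) (pb (rot (- \<theta>)) X) = X" "pb (rot (- \<theta>)) (pb (rot \<theta>) X) = X"
  by (simp_all add: rot_add rot_trivial)

lemma rot_commute: "pb (rot a) (pb (rot b) X) = pb (rot b) (pb (rot a) X)"
  by (simp add: rot_add add.commute)

lemma rot_power: "(pb (rot a) ^^ q) X = pb (rot (of_nat q * a)) X"
  by (induction q) (simp_all add: rot_trivial rot_add algebra_simps)

lemma cis_minus_power: "cis (- a) ^ l = inverse (cis a ^ l)"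
  by (simp add: power_inverse flip: cis_inverse)

lemma ex_conj:
  assumes "Ham G" "Ham H"
  shows "ex 1 G (ex t H X) = ex t (ex 1 G H) (ex 1 G X)" "Ham (ex 1 G H)"
  unfolding ex_pb[OF assms(1)] using pb_ex[OF E_canon[OF assms(1)] assms(2)] pb_Ham[OF E_vanishes[OF assms(1)] assms(2)] by auto

text \<open>Averaging with the identity as R: S is the flow of H conjugated by that of G, which is
  the flow of the transported Hamiltonian.\<close>

lemma log_map:
  assumes S: "canon S" and b: "vge 2 (fst S - fps_X)" "vge 2 (snd S - yy)"
  obtains K where "Ham K" "\<And>X. pb S X = ex 1 K X"
proof -
  interpret P: periodic_map fid fid 1
    by unfold_locales (auto simp: fid_canon)
  have Sv: "vanishes_at_origin S" using S by (simp add: canon_def)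
  have d: "dge 1 (fst S)" "dge 1 (snd S)" using Sv by (simp_all only: vanishes_iff)
  obtain G H where G: "Ham G" and H: "Ham H" and eq: "\<And>X. pb S (ex 1 G X) = ex 1 G (ex 1 H (pb fid X))"
  proof (rule P.log_birkhoff[OF S, of 0 2])
    show "dge (2 - 1) (pb S fps_X - ex 1 0 (pb fid fps_X))" "dge (2 - 1) (pb S yy - ex 1 0 (pb fid yy))"
      using d dge_vars by (auto simp: pb_ring[OF Sv] intro!: dge_diff)
    show "vge 2 (pb S fps_X - pb fid fps_X)" "vge 2 (pb S yy - pb fid yy)" using b by (simp_all add: pb_ring[OF Sv])
  qed simp_all
  have "pb S X = ex 1 (ex 1 G H) X" for X
  proof -
    have "pb S X = pb S (ex 1 G (ex 1 (- G) X))" by (simp add: ex_inverse[OF G])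
    also have "\<dots> = ex 1 (ex 1 G H) X" unfolding eq pb_fid ex_conj(1)[OF G H] by (simp add: ex_inverse[OF G])
    finally show ?thesis .
  qed
  with ex_conj(2)[OF G H] show thesis by (rule that)
qed

section \<open>The flow of delta I + nu I^2\<close>

lemma Cx_ex_nth:
  assumes H: "Ham H" and N: "k + l + m + j \<le> N"
  shows "Cx (ex 1 H u) (ex 1 H v) $ k $ l $ m $ j = (\<Sum>q\<le>N. of_real (1 / fact q) * Cx (Lp q H u) (Lp q H v) $ k $ l $ m $ j)"
proof -
  have "tau (ex 1 H G) $ k $ l $ m $ j = (\<Sum>q\<le>N. of_real (1 / fact q) * tau (Lp q H G) $ k $ l $ m $ j)" for G
  proof -
    have "tau (ex 1 H G - (\<Sum>q\<le>N. real_const (1 ^ q / fact q) * Lp q H G)) $ k $ l $ m $ j = 0"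
      by (rule sptD[OF ex_partial[OF H, of N 1 G, unfolded vge_tau]]) (use N in simp)
    then show ?thesis by (simp add: tau_ring tau_sum tau_cc fps_sum_nth)
  qed
  then show ?thesis by (simp add: Cx_def sum.distrib sum_distrib_left ring_distribs mult_ac)
qed

lemma Cx_Lp: "Cx (Lp (Suc q) H u) (Lp (Suc q) H v) = ck (- 2 * \<i>) * br (Cx (Lp q H u) (Lp q H v)) (tau H)"
  by (simp add: Cx_def tau_br br_add_left ck_br algebra_simps)

lemma cc_power: "cc (c ^ k) = cc (c :: 'a::comm_ring_1) ^ k" by (induction k) (simp_all add: cc_mult)
lemma cc_of_nat: "cc (of_nat k) = (of_nat k :: 'a::comm_ring_1 fps fps)" by (induction k) (simp_all add: cc_add)
lemma dY_cc: "dY (cc c * G) = cc (c :: 'a::comm_ring_1) * dY G" by (simp add: dY_mult)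

definition H1 :: plane_series where "H1 = delta_var * action + nu_var * action ^ 2"

lemma tau_H1: "tau H1 = ck (1/2) * (cc fps_X * (fps_X * yy)) + ck (1/4) * (cc yy * (fps_X * yy) ^ 2)"
proof -
  have c: "cmap (of_real :: real \<Rightarrow> complex) fps_X = fps_X" "cmap (of_real :: real \<Rightarrow> complex) yy = yy"
    by (simp_all add: cmap_vars[OF rhom_of_real(1)])
  have q: "ck (1/4) = ck (1/2) * ck (1/2)" by (simp flip: ck_hom(2))
  have n: "delta_var = cc fps_X" "nu_var = cc yy" by (simp_all add: delta_var_def nu_var_def defs_eq yy_def)
  show ?thesis
    unfolding H1_def n tau_ring tau_cc tau_action power2_eq_square c q by (simp add: mult_ac)
qed

lemma pn: "(fps_X * yy * (Z::'a::comm_ring_1 fps fps)) $ a $ b = (if a = 0 \<or> b = 0 then 0 else Z $ (a - 1) $ (b - 1))"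
proof -
  have e: "fps_X * yy * Z = fps_X * (yy * Z)" by (simp add: mult.assoc)
  show ?thesis unfolding e by (cases a; cases b) (simp_all add: yy_def)
qed

lemma tau_H1_nth: "tau H1 $ k $ l = (if k = 1 \<and> l = 1 then cc (1/2) * fps_X else if k = 2 \<and> l = 2 then cc (1/4) * yy else 0)"
proof -
  have p: "tau H1 = ck (1/2) * (cc fps_X * (fps_X * yy * 1)) + ck (1/4) * (cc yy * (fps_X * yy * (fps_X * yy * 1)))"
    by (simp add: tau_H1 power2_eq_square)
  show ?thesis
    unfolding p fps_add_nth ck_def cc_mult_nth pn by (auto simp: fps_one_nth split: if_splits)
qed

lemma Ham_H1: "Ham H1"
  unfolding Ham_tau spt_def tau_H1_nth by (auto simp: fps_X_nth yy_def fps_one_nth split: if_splits)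

lemma pow_diag:
  fixes d e :: "'a::comm_ring_1"
  shows "((cc d + cc e * (fps_X * yy)) ^ q) $ a $ b = (if a \<noteq> b then 0 else of_nat (q choose a) * d ^ (q - a) * e ^ a)"
proof (induction q arbitrary: a b)
  case 0
  show ?case by (cases a; cases b) (simp_all add: fps_one_nth)
next
  case (Suc q)
  have e1: "(cc d + cc e * (fps_X * yy)) * Z = cc d * Z + cc e * (fps_X * yy * Z)" for Z :: "'a fps fps"
    by (simp add: ring_distribs mult_ac)
  have b: "d * (of_nat (q choose a) * d ^ (q - a) * e ^ a) = of_nat (q choose a) * d ^ (Suc q - a) * e ^ a" for a
    by (cases "a \<le> q") (simp_all add: Suc_diff_le mult_ac binomial_eq_0)
  show ?case
  proof (cases a)
    case 0
    then show ?thesis unfolding power_Suc e1 fps_add_nth cc_mult_nth pn Suc.IH by auto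
  next
    case ac: (Suc c)
    have b': "d * (of_nat (q choose Suc c) * d ^ (q - Suc c) * e ^ Suc c) = of_nat (q choose Suc c) * d ^ (q - c) * e ^ Suc c"
      using b[of "Suc c"] by simp
    have "d * (of_nat (q choose Suc c) * d ^ (q - Suc c) * e ^ Suc c) + e * (of_nat (q choose c) * d ^ (q - c) * e ^ c)
      = of_nat (Suc q choose Suc c) * d ^ (q - c) * e ^ Suc c"
      unfolding b' by (simp add: algebra_simps)
    then show ?thesis unfolding power_Suc[of _ q] e1 fps_add_nth cc_mult_nth pn Suc.IH ac
      by (cases "b = Suc c") auto
  qed
qed

text \<open>H1 depends on I only, so its flow multiplies z by the exponential of -i (delta + nu z
  w). This factor commutes with H1, the q-th Lie term is its q-th power times z, and the binomial
  theorem gives the coefficients.\<close>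

lemma Cx_H1:
  "Cx (ex 1 H1 fps_X) (ex 1 H1 yy) $ k $ l $ m $ j = (if k = Suc l then
     \<Sum>q\<le>k + l + m + j. of_real (1 / fact q) * (of_nat (q choose l) * (cc (- \<i>) * fps_X) ^ (q - l) * (cc (- \<i>) * yy) ^ l) $ m $ j else 0)"
proof -
  define w where "w = cc (cc (- \<i>) * fps_X) + cc (cc (- \<i>) * yy) * (fps_X * yy :: cplane)"
  have bp: "br (cc a + cc b * p) (ck c * (cc d * p) + ck e * (cc f * (p * p))) = 0" for a b c d e f and p :: cplane
    unfolding ck_def by (simp add: br_add_left br_add_right br_cc_left br_cc_right br_mult_right)
  have bw: "br w (tau H1) = 0"
    unfolding w_def tau_H1 power2_eq_square by (rule bp)
  have b1: "ck (- 2 * \<i>) * br fps_X (tau H1) = w * fps_X"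
  proof -
    have dp: "dY (fps_X * yy :: cplane) = fps_X" by (simp add: dY_mult)
    have e: "dY (tau H1) = ck (1/2) * (cc fps_X * fps_X) + ck (1/4) * (cc yy * (fps_X * (fps_X * yy) + (fps_X * yy) * fps_X))"
      unfolding tau_H1 power2_eq_square dY_add ck_def dY_cc dY_mult[of "fps_X * yy"] dp ..
    have c: "ck (- 2 * \<i>) * ck (1/2) = ck (- \<i>)" "ck (1/4) + ck (1/4) = ck (1/2)"
      by (simp_all flip: ck_hom)
    have w: "w = ck (- \<i>) * cc fps_X + ck (- \<i>) * cc yy * (fps_X * yy)" unfolding w_def cc_mult ck_def ..
    have "br fps_X (tau H1) = dY (tau H1)" by (simp add: br_def)
    then show ?thesis unfolding w e using c by algebra
  qed
  have T: "Cx (Lp q H1 fps_X) (Lp q H1 yy) = w ^ q * fps_X" for q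
  proof (induction q)
    case 0 show ?case by (simp add: Cx_vars)
  next
    case (Suc q)
    have "br (w ^ q * fps_X) (tau H1) = w ^ q * br fps_X (tau H1)"
      by (simp add: br_mult_left br_power_0[OF bw])
    then show ?case unfolding Cx_Lp Suc using b1 by (simp add: mult_ac)
  qed
  have X: "(w ^ q * fps_X) $ k $ l = (if k = Suc l then of_nat (q choose l) * (cc (- \<i>) * fps_X) ^ (q - l) * (cc (- \<i>) * yy) ^ l else 0)" for q
    unfolding w_def mult.commute[of _ fps_X] by (cases k) (auto simp: pow_diag)
  show ?thesis unfolding Cx_ex_nth[OF Ham_H1 order_refl] T X by auto
qed

lemma Cx_H1_values:
  "Cx (ex 1 H1 fps_X) (ex 1 H1 yy) $ 1 $ 0 $ m $ j = (if j = 0 then (- \<i>) ^ m / fact m else 0)"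
  "Cx (ex 1 H1 fps_X) (ex 1 H1 yy) $ 2 $ 1 $ m $ j = (if j = 1 then (- \<i>) ^ Suc m / fact m else 0)"
proof -
  have p: "((cc (- \<i>) * fps_X) ^ q) $ m $ j = (if m = q \<and> j = 0 then (- \<i>) ^ q else 0)" for q
  proof -
    have "(cc (- \<i>) * fps_X) ^ q = mono2 ((- \<i>) ^ q) q 0"
      by (simp add: mono2_def power_mult_distrib cc_power)
    then show ?thesis by (simp add: mono2_nth)
  qed
  have p1: "(of_nat q * (cc (- \<i>) * fps_X) ^ (q - 1) * (cc (- \<i>) * yy)) $ m $ j = (if Suc m = q \<and> j = 1 then of_nat q * (- \<i>) ^ q else 0)" for q
  proof -
    have "of_nat q * (cc c * fps_X) ^ (q - 1) * (cc c * yy) = mono2 (of_nat q * c ^ (q - 1) * c) (q - 1) 1" for c :: complex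
      by (simp add: mono2_def power_mult_distrib cc_power cc_mult cc_of_nat mult_ac)
    from this[of "- \<i>"] show ?thesis by (cases q) (auto simp: mono2_nth)
  qed
  show "Cx (ex 1 H1 fps_X) (ex 1 H1 yy) $ 1 $ 0 $ m $ j = (if j = 0 then (- \<i>) ^ m / fact m else 0)"
  proof -
    have "Cx (ex 1 H1 fps_X) (ex 1 H1 yy) $ 1 $ 0 $ m $ j = (\<Sum>q\<le>1 + m + j. of_real (1 / fact q) * (if m = q \<and> j = 0 then (- \<i>) ^ q else 0))"
      unfolding Cx_H1 by (simp add: p del: mult_minus_left)
    also have "\<dots> = (\<Sum>q\<le>1 + m + j. if q = m then (if j = 0 then of_real (1 / fact m) * (- \<i>) ^ m else 0) else 0)"
      by (intro sum.cong refl) auto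
    finally show ?thesis by simp
  qed
  have "Cx (ex 1 H1 fps_X) (ex 1 H1 yy) $ 2 $ 1 $ m $ j = (\<Sum>q\<le>3 + m + j. of_real (1 / fact q) * (if Suc m = q \<and> j = 1 then of_nat q * (- \<i>) ^ q else 0))"
    unfolding Cx_H1 by (simp add: p1[simplified])
  also have "\<dots> = (\<Sum>q\<le>3 + m + j. if q = Suc m then (if j = 1 then (- \<i>) ^ Suc m / fact m else 0) else 0)"
  proof (rule sum.cong[OF refl])
    fix q
    have "(1 / fact (Suc m)) * real (Suc m) = 1 / fact m" by (simp add: fact_Suc del: of_nat_Suc)
    then have "complex_of_real (1 / fact (Suc m) * real (Suc m)) = of_real (1 / fact m)" by (rule arg_cong)
    then have "complex_of_real (1 / fact (Suc m)) * of_nat (Suc m) = 1 / fact m"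
      by (simp only: of_real_mult of_real_of_nat_eq of_real_divide of_real_1 of_real_fact)
    then have "complex_of_real (1 / fact (Suc m)) * (of_nat (Suc m) * (- \<i>) ^ Suc m) = (- \<i>) ^ Suc m / fact m"
      by (simp only: mult.assoc[symmetric]) simp
    then show "of_real (1 / fact q) * (if Suc m = q \<and> j = 1 then of_nat q * (- \<i>) ^ q else 0) =
      (if q = Suc m then (if j = 1 then (- \<i>) ^ Suc m / fact m else 0) else (0::complex))"
      by (cases "q = Suc m"; cases "j = 1") (simp_all only: simp_thms if_True if_False mult_zero_right, auto)
  qed
  also have "\<dots> = (if j = 1 then (- \<i>) ^ Suc m / fact m else 0)"
    by (simp del: power_Suc)
  finally show "Cx (ex 1 H1 fps_X) (ex 1 H1 yy) $ 2 $ 1 $ m $ j = (if j = 1 then (- \<i>) ^ Suc m / fact m else 0)" .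
qed

lemma resonance_iff:
  assumes p: "cis \<alpha> ^ n = 1" and m: "\<And>k. 1 \<le> k \<Longrightarrow> k < n \<Longrightarrow> cis \<alpha> ^ k \<noteq> 1" and n: "0 < n"
  shows "cis \<alpha> ^ k * cis (- \<alpha>) ^ l = 1 \<longleftrightarrow> (\<exists>q. k = l + n * q \<or> l = k + n * q)"
proof
  assume "cis \<alpha> ^ k * cis (- \<alpha>) ^ l = 1"
  then have e: "cis \<alpha> ^ k = cis \<alpha> ^ l" by (simp add: cis_minus_power field_simps)
  have main: "n dvd d" if "cis \<alpha> ^ d = 1" for d
  proof -
    have "cis \<alpha> ^ d = (cis \<alpha> ^ n) ^ (d div n) * cis \<alpha> ^ (d mod n)" by (simp flip: power_mult power_add)
    then have "cis \<alpha> ^ (d mod n) = 1" using that p by simp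
    with m[of "d mod n"] n have "d mod n = 0" by (metis One_nat_def Suc_leI gr0I mod_less_divisor)
    then show ?thesis by presburger
  qed
  show "\<exists>q. k = l + n * q \<or> l = k + n * q"
  proof (cases "l \<le> k")
    case True
    then have "cis \<alpha> ^ l * cis \<alpha> ^ (k - l) = cis \<alpha> ^ l * 1" using e by (simp flip: power_add)
    then have "cis \<alpha> ^ (k - l) = 1" by simp
    from main[OF this] obtain q where "k - l = n * q" by (auto elim: dvdE)
    then show ?thesis using True by (intro exI[of _ q]) auto
  next
    case False
    then have "cis \<alpha> ^ k * cis \<alpha> ^ (l - k) = cis \<alpha> ^ l" by (simp flip: power_add)
    then have "cis \<alpha> ^ k * cis \<alpha> ^ (l - k) = cis \<alpha> ^ k * 1" by (simp only: e mult_1_right)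
    then have "cis \<alpha> ^ (l - k) = 1" by simp
    from main[OF this] obtain q where "l - k = n * q" by (auto elim: dvdE)
    then show ?thesis using False by (intro exI[of _ q]) auto
  qed
next
  assume "\<exists>q. k = l + n * q \<or> l = k + n * q"
  then obtain q where "k = l + n * q \<or> l = k + n * q" by blast
  then show "cis \<alpha> ^ k * cis (- \<alpha>) ^ l = 1"
    using p by (auto simp: cis_minus_power power_add power_mult)
qed

section \<open>Conjugacy as identities of automorphisms; the normal form in complex
  coordinates\<close>

lemma formal_canonical_iff:
  "formal_canonical f \<longleftrightarrow> canon f \<and> (\<exists>g. vanishes_at_origin g \<and> (\<forall>X. pb g (pb f X) = X) \<and> (\<forall>X. pb f (pb g X) = X))"
proof (cases "vanishes_at_origin f")
  case True
  have "(fcompose f g = fid \<and> fcompose g f = fid) \<longleftrightarrow> (\<forall>X. pb g (pb f X) = X) \<and> (\<forall>X. pb f (pb g X) = X)"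
    if "vanishes_at_origin g" for g
  proof
    assume "fcompose f g = fid \<and> fcompose g f = fid"
    then show "(\<forall>X. pb g (pb f X) = X) \<and> (\<forall>X. pb f (pb g X) = X)"
      using pb_fcompose[OF True that] pb_fcompose[OF that True] by (metis pb_fid)
  next
    assume *: "(\<forall>X. pb g (pb f X) = X) \<and> (\<forall>X. pb f (pb g X) = X)"
    show "fcompose f g = fid \<and> fcompose g f = fid"
      unfolding fcompose_eq fid_eq
      using *[THEN conjunct1, rule_format, of fps_X] *[THEN conjunct1, rule_format, of yy]
        *[THEN conjunct2, rule_format, of fps_X] *[THEN conjunct2, rule_format, of yy]
      by (simp add: pb_ring[OF True] pb_ring[OF that])
  qed
  then show ?thesis
    unfolding formal_canonical_def formal_invertible_def formal_jacobian_eq canon_def using True by blast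
qed (simp add: formal_canonical_def canon_def)

lemma formally_conjugate_iff:
  assumes S: "vanishes_at_origin S" and N: "Ham N" and \<Phi>: "formal_ham_flow N \<Phi>"
  shows "formally_conjugate S (fcompose (rot \<alpha>) (\<Phi> 1)) \<longleftrightarrow>
    (\<exists>\<psi>. formal_canonical \<psi> \<and> (\<forall>X. pb S (pb \<psi> X) = pb \<psi> (ex 1 N (pb (rot \<alpha>) X))))"
proof -
  have P: "\<Phi> 1 = E 1 N" by (rule flow_unique[OF N \<Phi>])
  note Ev = E_vanishes[OF N, of 1]
  note gv = vanishes_fcompose[OF rot_vanishes[of \<alpha>] Ev]
  have "fcompose \<psi> S = fcompose (fcompose (rot \<alpha>) (E 1 N)) \<psi> \<longleftrightarrow> (\<forall>X. pb S (pb \<psi> X) = pb \<psi> (ex 1 N (pb (rot \<alpha>) X)))"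
    if "formal_canonical \<psi>" for \<psi>
  proof -
    have v: "vanishes_at_origin \<psi>" using that by (simp add: formal_canonical_def)
    have 1: "pb (fcompose \<psi> S) X = pb S (pb \<psi> X)" for X by (rule pb_fcompose[OF v S])
    have 2: "pb (fcompose (fcompose (rot \<alpha>) (E 1 N)) \<psi>) X = pb \<psi> (ex 1 N (pb (rot \<alpha>) X))" for X
      by (simp add: pb_fcompose[OF gv v] pb_fcompose[OF rot_vanishes Ev] ex_pb[OF N])
    show ?thesis
    proof
      assume "fcompose \<psi> S = fcompose (fcompose (rot \<alpha>) (E 1 N)) \<psi>"
      then show "\<forall>X. pb S (pb \<psi> X) = pb \<psi> (ex 1 N (pb (rot \<alpha>) X))" using 1 2 by metis
    next
      assume *: "\<forall>X. pb S (pb \<psi> X) = pb \<psi> (ex 1 N (pb (rot \<alpha>) X))"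
      have "pb (fcompose \<psi> S) X = pb (fcompose (fcompose (rot \<alpha>) (E 1 N)) \<psi>) X" for X
        unfolding 1 2 using * by blast
      from this[of fps_X] this[of yy] show "fcompose \<psi> S = fcompose (fcompose (rot \<alpha>) (E 1 N)) \<psi>"
        by (simp add: prod_eq_iff pb_ring[OF vanishes_fcompose[OF v S]] pb_ring[OF vanishes_fcompose[OF gv v]])
    qed
  qed
  then show ?thesis unfolding formally_conjugate_def P by blast
qed

lemma tau_nfh:
  assumes "5 \<le> n"
  shows "tau (normal_form_ham n A B) $ k $ l =
    tau H1 $ k $ l + (if k = l \<and> 3 \<le> k then cc ((1/2) ^ k) * cmap of_real (A $ (k - 3)) else 0)
    + cc (of_real (2 powr (- real n / 2)) / 2) * (if k = l + n then cc ((1/2) ^ l) * cmap of_real (B $ l)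
       else if l = k + n then cc ((1/2) ^ k) * cmap of_real (B $ k) else 0)"
proof -
  have XYp: "((fps_X * yy) ^ q * Z) $ a $ b = (if a < q \<or> b < q then 0 else Z $ (a - q) $ (b - q))" for q a b and Z :: cplane
  proof (induction q arbitrary: a b)
    case (Suc q)
    have e: "(fps_X * yy) ^ Suc q * Z = fps_X * yy * ((fps_X * yy) ^ q * Z)" by (simp add: mult_ac)
    show ?case unfolding e pn by (auto simp: Suc.IH)
  qed simp
  have e: "(ck c * T) $ k $ l = cc c * T $ k $ l" for c T and k l :: nat by (simp add: ck_def)
  have y: "(yy ^ n * Z) $ k $ l = (if l < n then 0 else Z $ k $ (l - n))" for Z :: cplane and k l :: nat
    unfolding yy_power by (simp add: fps_X_power_mult_nth)
  have x: "(fps_X ^ n * Z) $ k $ l = (if k < n then 0 else Z $ (k - n) $ l)" for Z :: cplane and k l :: nat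
    by (simp add: fps_X_power_mult_nth)
  have A3: "tau (action ^ 3 * in_action A) $ k $ l = (if k = l \<and> 3 \<le> k then cc ((1/2) ^ k) * cmap of_real (A $ (k - 3)) else 0)"
  proof -
    have "tau (action ^ 3 * in_action A) = ck ((1/2) ^ 3) * ((fps_X * yy) ^ 3 * tau (in_action A))"
      unfolding tau_ring tau_action power_mult_distrib ck_hom(7) by (simp only: mult.assoc)
    then have t: "tau (action ^ 3 * in_action A) $ k $ l = cc ((1/2) ^ 3) * (if k < 3 \<or> l < 3 then 0 else tau (in_action A) $ (k - 3) $ (l - 3))"
      by (simp only: e XYp)
    have "cc ((1/2) ^ 3) * (cc ((1/2) ^ (k - 3)) * Z) = cc ((1/2) ^ k) * Z" if "3 \<le> k" for Z :: "complex fps fps"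
    proof -
      have "((1/2) ^ k :: complex) = (1/2) ^ 3 * (1/2) ^ (k - 3)" by (simp only: power_add[symmetric] le_add_diff_inverse[OF that])
      then show ?thesis by (simp only: cc_mult mult.assoc)
    qed
    then show ?thesis unfolding t tau_in_action by (cases "k = l"; cases "3 \<le> k"; cases "3 \<le> l") (simp_all only: simp_thms if_True if_False mult_zero_right not_less[symmetric], auto)
  qed
  have B: "tau (resonant_term n * in_action B) $ k $ l = cc (of_real (2 powr (- real n / 2)) / 2) * (if k = l + n then cc ((1/2) ^ l) * cmap of_real (B $ l)
       else if l = k + n then cc ((1/2) ^ k) * cmap of_real (B $ k) else 0)"
  proof -
    have "tau (resonant_term n * in_action B) = ck (of_real (2 powr (- real n / 2)) / 2) * (fps_X ^ n * tau (in_action B) + yy ^ n * tau (in_action B))"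
    proof -
      have h: "ck (of_real (2 powr (- real n / 2)) / 2) = ck (of_real (2 powr (- real n / 2))) * ck (1/2)"
        unfolding ck_hom(2)[symmetric] by simp
      show ?thesis unfolding resonant_term_def tau_ring tau_cc tau_Re_z_power h by (simp only: ring_distribs mult.assoc)
    qed
    then have t: "tau (resonant_term n * in_action B) $ k $ l = cc (of_real (2 powr (- real n / 2)) / 2) *
      ((if k < n then 0 else tau (in_action B) $ (k - n) $ l) + (if l < n then 0 else tau (in_action B) $ k $ (l - n)))"
      by (simp only: e y x fps_add_nth)
    have "(if k < n then 0 else tau (in_action B) $ (k - n) $ l) + (if l < n then 0 else tau (in_action B) $ k $ (l - n))
      = (if k = l + n then cc ((1/2) ^ l) * cmap of_real (B $ l) else if l = k + n then cc ((1/2) ^ k) * cmap of_real (B $ k) else 0)"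
    proof -
      consider "k = l + n" | "l = k + n" | "k \<noteq> l + n" "l \<noteq> k + n" by blast
      then show ?thesis
      proof cases
        case 1
        moreover have "l + n \<noteq> l - n" using assms by linarith
        ultimately show ?thesis unfolding tau_in_action using assms by (simp del: power_one_over)
      next
        case 2
        moreover have "k - n \<noteq> k + n" using assms by linarith
        ultimately show ?thesis unfolding tau_in_action using assms by (simp del: power_one_over)
      next
        case 3
        then have "k < n \<or> k - n \<noteq> l" "l < n \<or> k \<noteq> l - n" by linarith+
        then show ?thesis unfolding tau_in_action using 3 by auto
      qed
    qed
    then show ?thesis unfolding t by (rule arg_cong)
  qed
  have "normal_form_ham n A B = H1 + action ^ 3 * in_action A + resonant_term n * in_action B"
    by (simp add: normal_form_ham_def H1_def)
  then show ?thesis by (simp only: tau_ring(1) fps_add_nth A3 B)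
qed

lemma nfh_inj:
  assumes n: "5 \<le> n" and eq: "normal_form_ham n A B = normal_form_ham n A' B'"
  shows "A = A'" "B = B'"
proof -
  have "A $ k $ m $ j = A' $ k $ m $ j" for k m j
    using arg_cong[OF eq, of "\<lambda>T. tau T $ (k + 3) $ (k + 3) $ m $ j"] n by (simp add: tau_nfh)
  then show "A = A'" by (intro fps_ext) auto
  have "B $ k $ m $ j = B' $ k $ m $ j" for k m j
    using arg_cong[OF eq, of "\<lambda>T. tau T $ (k + n) $ k $ m $ j"] n by (simp add: tau_nfh)
  then show "B = B'" by (intro fps_ext) auto
qed

lemma nfh_props:
  assumes n: "5 \<le> n"
  shows "Ham (normal_form_ham n A B)"
    and "normal_form_coeffs n A B \<Longrightarrow> NF n \<omega> (normal_form_ham n A B)"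
    and "tau (normal_form_ham n A B) $ n $ 0 $ 0 $ 0 = of_real (2 powr (- real n / 2) / 2 * B $ 0 $ 0 $ 0)"
    and "tau (normal_form_ham n A B) $ k $ l $ m $ j \<noteq> 0 \<Longrightarrow> \<exists>q. k = l + n * q \<or> l = k + n * q"
proof -
  let ?N = "normal_form_ham n A B"
  have s: "tau ?N $ k $ l $ m $ j = 0" if "k = l \<Longrightarrow> 3 \<le> k \<Longrightarrow> False" "tau H1 $ k $ l $ m $ j = 0" "k \<noteq> l + n" "l \<noteq> k + n" for k l m j
  proof -
    have "\<not> (k = l \<and> 3 \<le> k)" using that(1) by blast
    then show ?thesis using that(2-4) by (simp only: tau_nfh[OF n] if_False fps_add_nth fps_zero_nth mult_zero_right add_0_right)
  qed
  show "Ham ?N" unfolding Ham_tau spt_def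
  proof (intro allI impI)
    fix k l m j assume nz: "tau ?N $ k $ l $ m $ j \<noteq> 0"
    have "(k = l \<and> 3 \<le> k) \<or> tau H1 $ k $ l $ m $ j \<noteq> 0 \<or> k = l + n \<or> l = k + n"
    proof (rule ccontr)
      assume c: "\<not> ?thesis"
      have "tau ?N $ k $ l $ m $ j = 0" by (rule s) (use c in blast)+
      with nz show False by contradiction
    qed
    then consider "k = l \<and> 3 \<le> k" | "tau H1 $ k $ l $ m $ j \<noteq> 0" | "k = l + n" | "l = k + n" by blast
    then show "2 \<le> k + l \<and> 3 \<le> k + l + m + j"
    proof cases
      case 2
      show ?thesis by (rule spt_nz[OF Ham_H1[unfolded Ham_tau] 2])
    qed (use n in linarith)+
  qed
  show "tau ?N $ n $ 0 $ 0 $ 0 = of_real (2 powr (- real n / 2) / 2 * B $ 0 $ 0 $ 0)"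
    using n by (simp add: tau_nfh[OF n] tau_H1_nth cc_nth)
  show "\<exists>q. k = l + n * q \<or> l = k + n * q" if "tau ?N $ k $ l $ m $ j \<noteq> 0"
  proof -
    have "k = l \<or> k = l + n \<or> l = k + n"
    proof (rule ccontr)
      assume c: "\<not> ?thesis"
      have "tau ?N $ k $ l $ m $ j = 0"
      proof (rule s)
        show "tau H1 $ k $ l $ m $ j = 0" unfolding tau_H1_nth using c by auto
      qed (use c in blast)+
      with that show False by contradiction
    qed
    then have "k = l + n * 0 \<or> k = l + n * 1 \<or> l = k + n * 1" by simp
    then show ?thesis by blast
  qed
  assume c: "normal_form_coeffs n A B"
  show "NF n \<omega> ?N" unfolding NF_def
  proof (intro allI impI)
    fix l q m j :: nat
    consider "q = 0" | "q = 1" | "2 \<le> q" by linarith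
    then show "nfc n (l + n * q) l (tau ?N $ (l + n * q) $ l $ m $ j)"
    proof cases
      case 1
      have "nfc n l l (tau ?N $ l $ l $ m $ j)"
      proof (rule nfc_diag[OF n])
        assume n5: "n = 5" and l: "3 \<le> l" "5 dvd 2 * l - 3"
        obtain k where k: "l = k + 3" using le_add_diff_inverse2[OF l(1)] by metis
        have "k mod 5 = 1" using l(2) unfolding k by presburger
        then have "A $ k $ m $ j = 0" using c n5 by (simp add: normal_form_coeffs_def)
        then show "tau ?N $ l $ l $ m $ j = 0" using n by (simp add: tau_nfh[OF n] k tau_H1_nth)
      qed
      then show ?thesis using 1 by simp
    next
      case 2
      have e: "tau ?N $ (l + n) $ l $ m $ j = of_real (2 powr (- real n / 2) / 2 * (1/2) ^ l * B $ l $ m $ j)"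
        using n by (simp add: tau_nfh[OF n] tau_H1_nth)
      have "nfc n (l + n) l (tau ?N $ (l + n) $ l $ m $ j)"
      proof (rule nfc_one[OF n])
        show "Im (tau ?N $ (l + n) $ l $ m $ j) = 0" unfolding e by (rule Im_complex_of_real)
        assume d: "mu n dvd 2 * l + 2"
        have "B $ l $ m $ j = 0"
        proof (cases "n = 5")
          case True
          with d have "l mod 5 = 4" unfolding mu_def by (simp) presburger
          with c True show ?thesis by (simp add: normal_form_coeffs_def)
        next
          case False
          then have "mu n = 6" using n by (simp add: mu_def)
          then have "6 dvd 2 * l + 2" using d by (simp only:)
          then have "l mod 3 = 2" by presburger
          with c False n show ?thesis by (simp add: normal_form_coeffs_def)
        qed
        then show "tau ?N $ (l + n) $ l $ m $ j = 0" unfolding e by simp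
      qed
      then show ?thesis using 2 by simp
    next
      case 3
      have "n * 2 \<le> n * q" using 3 by simp
      then have "tau ?N $ (l + n * q) $ l $ m $ j = 0" using n 3 by (intro s) (auto simp: tau_H1_nth)
      then show ?thesis by simp
    qed
  qed
qed

text \<open>The condition \<open>NF\<close> leaves the diagonal below (z w)^3 free; agreement with
  delta I + nu I^2 below order 5 fixes it.\<close>

lemma nfh_exists:
  assumes n: "5 \<le> n" and nf: "\<And>\<omega>. NF n \<omega> N" and d: "dge 5 (N - H1)"
    and res: "\<And>k l m j. tau N $ k $ l $ m $ j \<noteq> 0 \<Longrightarrow> \<exists>q. k = l + n * q \<or> l = k + n * q"
  obtains A B where "N = normal_form_ham n A B" "normal_form_coeffs n A B"
proof -
  define c where "c = 2 powr (- real n / 2) / 2"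
  have cp: "c > 0" by (simp add: c_def)
  \<comment> \<open>Powers of 2 come from I = z w / 2; in B the constant c collects 2^(-n/2) and the
    half from Re (z^n).\<close>
  define A where "A = Abs_fps (\<lambda>k. Abs_fps (\<lambda>m. Abs_fps (\<lambda>j. 2 ^ (k + 3) * Re (tau N $ (k + 3) $ (k + 3) $ m $ j))))"
  define B where "B = Abs_fps (\<lambda>k. Abs_fps (\<lambda>m. Abs_fps (\<lambda>j. 2 ^ k / c * Re (tau N $ (k + n) $ k $ m $ j))))"
  have nfcN: "nfc n (l + n * q) l (tau N $ (l + n * q) $ l $ m $ j)" for l q m j
    using nf[of "Suc (2 * l + mu n * q + 6 * (m + j))"] unfolding NF_def by blast
  have hc: "1 / 2 ^ l * (2 ^ l / c * x) * c = x" for l :: nat and x :: real using cp by simp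
  have reB: "tau N $ (l + n) $ l $ m $ j = of_real (c * ((1/2) ^ l * B $ l $ m $ j))" for l m j
  proof -
    have "Im (tau N $ (l + n) $ l $ m $ j) = 0" using nfcN[of l 1 m j] n unfolding nfc_def by simp
    then show ?thesis using cp by (simp add: B_def complex_eq_iff power_one_over)
  qed
  have reA: "tau N $ (k + 3) $ (k + 3) $ m $ j = of_real ((1/2) ^ (k + 3) * A $ k $ m $ j)" for k m j
  proof -
    have "Im (tau N $ (k + 3) $ (k + 3) $ m $ j) = 0" using arg_cong[OF tau_sym[of N "k + 3" "k + 3" m j], of Im] by simp
    then show ?thesis by (simp add: A_def complex_eq_iff power_one_over)
  qed
  have big: "tau N $ (l + n * q) $ l $ m $ j = 0" if "2 \<le> q" for l q m j
  proof -
    have "n * 2 \<le> n * q" using that by simp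
    then have "l + n * q \<noteq> l + n" "l + n * q \<noteq> l" "l \<noteq> l + n * q + n" using n by linarith+
    then show ?thesis using nfcN[of l q m j] unfolding nfc_def by blast
  qed
  have low: "tau N $ k $ l = tau H1 $ k $ l" if "k + l < 5" for k l
    using d that unfolding dge_tau[of 5] by (simp add: dge_def tau_ring)
  have H1z: "tau H1 $ k $ l = 0" if "5 \<le> k + l \<or> k \<noteq> l" for k l using that by (auto simp: tau_H1_nth)
  have half: "tau N $ (l + n * q) $ l $ m $ j = tau (normal_form_ham n A B) $ (l + n * q) $ l $ m $ j" for l q m j
  proof -
    have "(q = 0 \<and> l < 3) \<or> (q = 0 \<and> l = (l - 3) + 3) \<or> q = 1 \<or> 2 \<le> q" by linarith
    then consider "q = 0" "l < 3" | k where "q = 0" "l = k + 3" | "q = 1" | "2 \<le> q" by blast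
    then show ?thesis
    proof cases
      case 1
      then show ?thesis using low[of l l] n by (simp add: tau_nfh[OF n])
    next
      case 2
      then show ?thesis using reA[of k m j] n H1z[of "k + 3" "k + 3"] by (simp add: tau_nfh[OF n])
    next
      case 3
      then show ?thesis using reB[of l m j] n H1z[of "l + n" l] by (simp add: tau_nfh[OF n] c_def)
    next
      case 4
      have "n * 2 \<le> n * q" using 4 by simp
      then show ?thesis using big[OF 4] n H1z[of "l + n * q" l] 4 by (simp add: tau_nfh[OF n])
    qed
  qed
  have "tau N = tau (normal_form_ham n A B)"
  proof (rule fps4_eqI')
    fix k l m j
    consider q where "k = l + n * q" | q where "l = k + n * q" | "\<not> (\<exists>q. k = l + n * q \<or> l = k + n * q)" by blast
    then show "tau N $ k $ l $ m $ j = tau (normal_form_ham n A B) $ k $ l $ m $ j"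
    proof cases
      case 1 then show ?thesis using half by simp
    next
      case 2 then show ?thesis
        using half[of k q m j] tau_sym[of N k l m j] tau_sym[of "normal_form_ham n A B" k l m j] by simp
    next
      case 3
      have "tau N $ k $ l $ m $ j = 0" using res[of k l m j] 3 by blast
      moreover have "tau (normal_form_ham n A B) $ k $ l $ m $ j = 0" using nfh_props(4)[OF n, of A B k l m j] 3 by blast
      ultimately show ?thesis by simp
    qed
  qed
  then have N: "N = normal_form_ham n A B" by (rule tau_inj)
  have "normal_form_coeffs n A B" unfolding normal_form_coeffs_def
  proof (intro conjI impI allI)
    fix k m j :: nat assume n5: "n = 5" and k: "k mod 5 = 1"
    have "5 dvd 2 * (k + 3) - 3" using k by presburger
    then have "tau N $ (k + 3) $ (k + 3) $ m $ j = 0" using nfcN[of "k + 3" 0 m j] n5 unfolding nfc_def by simp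
    then show "A $ k $ m $ j = 0" by (simp add: A_def)
  next
    fix k m j :: nat assume n5: "n = 5" and k: "k mod 5 = 4"
    have "mu n dvd 2 * k + 2" using k n5 unfolding mu_def by simp presburger
    then have "tau N $ (k + n) $ k $ m $ j = 0" using nfcN[of k 1 m j] unfolding nfc_def by simp
    then show "B $ k $ m $ j = 0" by (simp add: B_def)
  next
    fix k m j :: nat assume n6: "6 \<le> n" and k: "k mod 3 = 2"
    have "6 dvd 2 * k + 2" using k by presburger
    then have "mu n dvd 2 * k + 2" using n6 by (simp add: mu_def min_def)
    then have "tau N $ (k + n) $ k $ m $ j = 0" using nfcN[of k 1 m j] unfolding nfc_def by simp
    then show "B $ k $ m $ j = 0" by (simp add: B_def)
  qed
  with N show thesis by (rule that)
qed

section \<open>From the averaged logarithm to the formal theorem\<close>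

lemma rot_invariant_res:
  assumes p: "cis \<alpha> ^ n = 1" and m: "\<And>k. 1 \<le> k \<Longrightarrow> k < n \<Longrightarrow> cis \<alpha> ^ k \<noteq> 1" and n: "0 < n"
    and T: "pb (rot \<alpha>) T = T" and nz: "tau T $ k $ l $ m' $ j \<noteq> 0"
  shows "\<exists>q. k = l + n * q \<or> l = k + n * q"
proof -
  have "cis \<alpha> ^ k * cis (- \<alpha>) ^ l * tau T $ k $ l $ m' $ j = tau T $ k $ l $ m' $ j"
    using tau_rot[of \<alpha> T k l] unfolding T by (metis cc_mult_nth)
  then have "cis \<alpha> ^ k * cis (- \<alpha>) ^ l = 1" using nz by simp
  with resonance_iff[OF p m n] show ?thesis by blast
qed

lemma FWI:
  assumes res: "\<And>k l m j. tau T $ k $ l $ m $ j \<noteq> 0 \<Longrightarrow> \<exists>q. k = l + n * q \<or> l = k + n * q"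
    and w: "\<And>l q m j. tau T $ (l + n * q) $ l $ m $ j \<noteq> 0 \<Longrightarrow> 2 \<le> 2 * l + n * q \<and> \<omega> \<le> 2 * l + mu n * q + 6 * (m + j)"
  shows "FW n \<omega> T"
  unfolding FW_def spt_def
proof (intro allI impI)
  fix k l m j assume nz: "tau T $ k $ l $ m $ j \<noteq> 0"
  then obtain q where "k = l + n * q \<or> l = k + n * q" using res by blast
  then show "rsw n \<omega> k l m j"
  proof
    assume k: "k = l + n * q"
    then show ?thesis using w[of l q m j] nz unfolding rsw_def by auto
  next
    assume l: "l = k + n * q"
    have "tau T $ l $ k $ m $ j \<noteq> 0" using nz tau_sym[of T k l m j] by simp
    then show ?thesis using w[of k q m j] l unfolding rsw_def by auto
  qed
qed

lemma periodic_rot: "cis \<alpha> ^ n = 1 \<Longrightarrow> 0 < n \<Longrightarrow> periodic_map (rot \<alpha>) (rot (- \<alpha>)) n"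
proof
  assume p: "cis \<alpha> ^ n = 1"
  show "canon (rot \<alpha>)" "canon (rot (- \<alpha>))" by (rule rot_canon)+
  have "cis (real n * \<alpha>) = 1" using p by (simp add: Complex.DeMoivre)
  then show "(pb (rot \<alpha>) ^^ n) X = X" for X unfolding rot_power by (rule rot_trivial)
qed (simp_all add: rot_inverse)

lemma pb_rot_vars:
  assumes "\<And>u v. P (u + v) = P u + P v" "\<And>u v. P (u - v) = P u - P v" "\<And>c u. P (real_const c * u) = real_const c * P u"
  shows "Cx (P (pb (rot \<theta>) fps_X)) (P (pb (rot \<theta>) yy)) = ck (cis \<theta>) * Cx (P fps_X) (P yy)"
  unfolding pb_ring[OF rot_vanishes] rot_eq assms Cx_rot ..

lemma of_nat_nth2: "(of_nat k * (U :: complex fps fps)) $ m $ j = of_nat k * U $ m $ j"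
  by (induction k) (simp_all add: algebra_simps)

lemma cmap_1': "cmap (of_real :: real \<Rightarrow> complex) 1 = 1"
  by (rule rhomD(2)[OF rhom_cmap[OF rhom_of_real(1)]])

lemma ex_rc: "Ham H \<Longrightarrow> ex 1 H (real_const c * u) = real_const c * ex 1 H u"
  by (simp add: ex_mult defs_eq ex_cc)

lemma rot_ex: "Ham H \<Longrightarrow> pb (rot \<alpha>) (ex t H X) = ex t (pb (rot \<alpha>) H) (pb (rot \<alpha>) X)"
  by (rule pb_ex[OF rot_canon])

text \<open>Up to degree n the map S contains only z^(l+1) w^l and w^(n-1), all compatible with the
  rotation. So the logarithm K of the map without its rotation is invariant below order n + 2.
  Truncating K gives an invariant H0, and averaging changes it from order n + 2 on only, so the
  coefficients of S up to degree n stay legible in H.\<close>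

lemma averaged_log:
  assumes n: "5 \<le> n" and p: "cis \<alpha> ^ n = 1" and S: "canon S"
    and h1: "\<And>k l. k + l \<le> n \<Longrightarrow> k \<noteq> l + 1 \<Longrightarrow> (k, l) \<noteq> (0, n - 1) \<Longrightarrow> Cx (fst S) (snd S) $ k $ l = 0"
    and h2: "Cx (fst S) (snd S) $ 1 $ 0 $ 0 $ 0 = cis \<alpha>"
  obtains G H where "Ham G" "Ham H" "pb (rot \<alpha>) H = H" "\<And>X. pb S (ex 1 G X) = ex 1 G (ex 1 H (pb (rot \<alpha>) X))"
    "\<And>k l. k + l \<le> n \<Longrightarrow> Cx (ex 1 H fps_X) (ex 1 H yy) $ k $ l = cc (cis (- \<alpha>)) * Cx (fst S) (snd S) $ k $ l"
proof -
  let ?r = "pb (rot \<alpha>)" and ?r' = "pb (rot (- \<alpha>))"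
  interpret R: periodic_map "rot \<alpha>" "rot (- \<alpha>)" n by (rule periodic_rot[OF p]) (use n in simp)
  have Sv: "vanishes_at_origin S" using S by (simp add: canon_def)
  define S' where "S' = fcompose (rot (- \<alpha>)) S"
  have S'c: "canon S'" unfolding S'_def by (rule canon_fcompose[OF rot_canon S])
  have S'v: "vanishes_at_origin S'" using S'c by (simp add: canon_def)
  have pS': "pb S' X = pb S (?r' X)" for X unfolding S'_def by (rule pb_fcompose[OF rot_vanishes Sv])
  have lin: "pb S (real_const c * u) = real_const c * pb S u" for c u by (simp add: pb_ring[OF Sv])
  have C': "Cx (pb S' fps_X) (pb S' yy) = ck (cis (- \<alpha>)) * Cx (fst S) (snd S)"
    unfolding pS' by (subst pb_rot_vars[where P = "pb S"]) (simp_all add: pb_ring[OF Sv])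
  have C'n: "Cx (fst S') (snd S') $ k $ l $ m $ j = cis (- \<alpha>) * Cx (fst S) (snd S) $ k $ l $ m $ j" for k l m j
    using C'[unfolded pb_ring[OF S'v]] by (simp only: ck_nth)
  have "spt (\<lambda>i j m l. 2 \<le> i + j + m + l) (Cx (fst S' - fps_X) (snd S' - yy))"
    unfolding spt_def
  proof (intro allI impI, rule ccontr)
    fix k l m j assume nz: "Cx (fst S' - fps_X) (snd S' - yy) $ k $ l $ m $ j \<noteq> 0" and "\<not> 2 \<le> k + l + m + j"
    then consider "k = 1" "l = 0" "m = 0" "j = 0" | "k = 0" "l = 1" "m = 0" "j = 0" | "k = 0" "l = 0" by linarith
    then have "Cx (fst S' - fps_X) (snd S' - yy) $ k $ l $ m $ j = 0"
      unfolding Cx_diff Cx_vars fps_sub_nth C'n using h1[of 0 1] h1[of 0 0] h2 n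
      by cases (auto simp: fps_X_nth cis_mult)
    with nz show False by simp
  qed
  from log_map[OF S'c Cx_vge[OF this]] obtain K where K: "Ham K" and S'K: "\<And>X. pb S' X = ex 1 K X" by blast
  have SK: "pb S X = ex 1 K (?r X)" for X using S'K[of "?r X"] unfolding pS' rot_inverse .
  define V where "V = Cx (ex 1 K fps_X) (ex 1 K yy)"
  have V: "V = ck (cis (- \<alpha>)) * Cx (fst S) (snd S)" unfolding V_def S'K[symmetric] by (rule C')
  have rK: "Ham (?r K)" by (rule pb_Ham[OF rot_vanishes K])
  have exrK: "ex 1 (?r K) X = ?r (ex 1 K (?r' X))" for X by (simp add: rot_ex[OF K] rot_inverse)
  \<comment> \<open>Conjugation by the rotation multiplies each coefficient by a root of unity,
    which is 1 at exactly the monomials allowed by h1.\<close>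
  have VV: "Cx (ex 1 (?r K) fps_X) (ex 1 (?r K) yy) $ k $ l = V $ k $ l" if kl: "k + l < n + 1" for k l
  proof -
    have "Cx (ex 1 K (?r' fps_X)) (ex 1 K (?r' yy)) = ck (cis (- \<alpha>)) * V"
      unfolding V_def by (rule pb_rot_vars) (simp_all add: ex_add ex_diff ex_rc[OF K])
    then have e: "Cx (ex 1 (?r K) fps_X) (ex 1 (?r K) yy) $ k $ l = cc (cis \<alpha> ^ k * cis (- \<alpha>) ^ l) * (cc (cis (- \<alpha>)) * V $ k $ l)"
      unfolding exrK Cx_pb_rot by (simp add: ck_def)
    show ?thesis
    proof (cases "k = l + 1 \<or> (k, l) = (0, n - 1)")
      case True
      have n1: "cis (- \<alpha>) ^ (n - 1) * cis (- \<alpha>) = cis (- \<alpha>) ^ n" using n by (cases n) auto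
      have "cis \<alpha> ^ l * cis (- \<alpha>) ^ l = 1" for l by (simp add: cis_minus_power)
      then have "cis \<alpha> ^ k * cis (- \<alpha>) ^ l * cis (- \<alpha>) = 1"
        using True n1 p by (auto simp: cis_minus_power cis_mult mult_ac)
      then have "cc (cis \<alpha> ^ k * cis (- \<alpha>) ^ l) * cc (cis (- \<alpha>)) = 1" by (simp flip: cc_mult)
      then show ?thesis unfolding e mult.assoc[symmetric] by simp
    next
      case False
      then have "V $ k $ l = 0" unfolding V using h1[of k l] kl by (simp add: ck_def)
      then show ?thesis unfolding e by simp
    qed
  qed
  have "dge (n + 1) (Cx (ex 1 (?r K) fps_X - ex 1 K fps_X) (ex 1 (?r K) yy - ex 1 K yy))"
    unfolding Cx_diff V_def[symmetric] dge_def using VV by simp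
  note d = Cx_dge[OF this]
  have dK: "dge (n + 2) (?r K - K)" by (rule ex_inj_dge[OF K rK]) (use d in simp_all)
  \<comment> \<open>The part of K below degree n + 2 is cut out in complex coordinates, where
    invariance is visible monomial by monomial.\<close>
  have "herm (Abs_fps (\<lambda>k. Abs_fps (\<lambda>l. if k + l < n + 2 then tau K $ k $ l else 0)))"
    unfolding herm_def
  proof (intro allI)
    fix k l m j
    show "Abs_fps (\<lambda>k. Abs_fps (\<lambda>l. if k + l < n + 2 then tau K $ k $ l else 0)) $ l $ k $ m $ j
      = cnj (Abs_fps (\<lambda>k. Abs_fps (\<lambda>l. if k + l < n + 2 then tau K $ k $ l else 0)) $ k $ l $ m $ j)"
      using tau_sym[of K l k m j] by (cases "k + l < n + 2") (simp_all only: fps_nth_Abs_fps add.commute[of l k] if_True if_False fps_zero_nth complex_cnj_zero)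
  qed
  then obtain H0 where "tau H0 = Abs_fps (\<lambda>k. Abs_fps (\<lambda>l. if k + l < n + 2 then tau K $ k $ l else 0))"
    by (rule tau_surj)
  then have H0: "tau H0 $ k $ l = (if k + l < n + 2 then tau K $ k $ l else 0)" for k l by simp
  have HamH0: "Ham H0" using K unfolding Ham_tau spt_def H0 by (auto split: if_splits)
  have dH0: "dge (n + 2) (K - H0)" unfolding dge_tau dge_def tau_ring fps_sub_nth H0 by simp
  have rH0: "?r H0 = H0"
  proof (rule tau_inj, rule fps2_eqI)
    fix k l
    have "tau (?r K - K) $ k $ l = 0" if "k + l < n + 2" using dK that unfolding dge_tau dge_def by blast
    then show "tau (?r H0) $ k $ l = tau H0 $ k $ l" unfolding tau_rot H0 by (simp add: tau_ring tau_rot)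
  qed
  have dr: "dge 1 (?r fps_X)" "dge 1 (?r yy)" by (rule pb_dge[OF rot_vanishes dge_vars(1)], rule pb_dge[OF rot_vanishes dge_vars(2)])
  obtain G H where G: "Ham G" and H: "Ham H" and rH: "?r H = H" and dH: "dge (n + 2) (H - H0)"
    and eq: "\<And>X. pb S (ex 1 G X) = ex 1 G (ex 1 H (?r X))"
  proof (rule R.log_birkhoff[OF S HamH0 rH0, of "n + 2"])
    show "dge (n + 2 - 1) (pb S fps_X - ex 1 H0 (?r fps_X))" "dge (n + 2 - 1) (pb S yy - ex 1 H0 (?r yy))"
      unfolding SK by (rule dge_U_diff[OF HamH0 K dH0 _ dr(1)], simp, rule dge_U_diff[OF HamH0 K dH0 _ dr(2)], simp)
    show "vge 2 (pb S fps_X - ?r fps_X)" "vge 2 (pb S yy - ?r yy)"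
      unfolding SK using vge_U[OF K dge_1_vge[OF dr(1)[unfolded One_nat_def]]] vge_U[OF K dge_1_vge[OF dr(2)[unfolded One_nat_def]]] by (simp_all add: numeral_2_eq_2)
  qed simp_all
  have dHK: "dge (n + 2) (H - K)" using dge_diff[OF dH dH0] by (simp add: algebra_simps)
  have "Cx (ex 1 H fps_X) (ex 1 H yy) $ k $ l = cc (cis (- \<alpha>)) * Cx (fst S) (snd S) $ k $ l" if kl: "k + l \<le> n" for k l
  proof -
    have d: "dge (n + 2 - 1) (ex 1 H fps_X - ex 1 K fps_X)" "dge (n + 2 - 1) (ex 1 H yy - ex 1 K yy)"
      by (rule dge_U_diff[OF K H dHK _ dge_vars(1)], simp, rule dge_U_diff[OF K H dHK _ dge_vars(2)], simp)
    have "Cx (ex 1 H fps_X - ex 1 K fps_X) (ex 1 H yy - ex 1 K yy) $ k $ l = 0"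
      unfolding Cx_def using d[unfolded dge_tau, unfolded dge_def] kl by (simp add: ck_def)
    then have "Cx (ex 1 H fps_X) (ex 1 H yy) $ k $ l = V $ k $ l" unfolding Cx_diff V_def by simp
    then show ?thesis unfolding V by (simp add: ck_def)
  qed
  with G H rH eq show thesis by (rule that)
qed

text \<open>Below degree 4 the map agrees with the flow of H1, so H and H1 agree below order 5. At
  zero parameters the coefficients of (z w)^3 and w^n in H then enter the map through the first Lie
  term alone.\<close>

lemma read_off:
  assumes n: "5 \<le> n" and p: "cis \<alpha> ^ n = 1" and pm: "\<And>k. 1 \<le> k \<Longrightarrow> k < n \<Longrightarrow> cis \<alpha> ^ k \<noteq> 1"
    and H: "Ham H" and rH: "pb (rot \<alpha>) H = H"
    and W: "\<And>k l. k + l \<le> n \<Longrightarrow> Cx (ex 1 H fps_X) (ex 1 H yy) $ k $ l = cc (cis (- \<alpha>)) * C $ k $ l"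
    and h1: "\<And>k l. k + l \<le> n \<Longrightarrow> k \<noteq> l + 1 \<Longrightarrow> (k, l) \<noteq> (0, n - 1) \<Longrightarrow> C $ k $ l = 0"
    and h2: "\<And>m j. C $ 1 $ 0 $ m $ j = (if j = 0 then cis \<alpha> * (- \<i>) ^ m / fact m else 0)"
    and h3: "\<And>m j. C $ 2 $ 1 $ m $ j = (if j = 1 then cis \<alpha> * (- \<i>) ^ Suc m / fact m else 0)"
    and h4: "6 \<le> n \<Longrightarrow> C $ 3 $ 2 $ 0 $ 0 \<noteq> 0" and h5: "C $ 0 $ (n - 1) $ 0 $ 0 \<noteq> 0"
  shows "dge 5 (H - H1)" "6 \<le> n \<Longrightarrow> tau H $ 3 $ 3 $ 0 $ 0 \<noteq> 0" "tau H $ n $ 0 $ 0 $ 0 \<noteq> 0"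
proof -
  have one: "cis (- \<alpha>) * (cis \<alpha> * c / d) = c / d" for c d by (simp add: mult.assoc[symmetric] cis_mult)
  have "Cx (ex 1 H fps_X) (ex 1 H yy) $ k $ l = Cx (ex 1 H1 fps_X) (ex 1 H1 yy) $ k $ l" if kl: "k + l < 4" for k l
  proof (rule fps2_eqI)
    fix m j
    have kn: "k + l \<le> n" using kl n by simp
    have w: "Cx (ex 1 H fps_X) (ex 1 H yy) $ k $ l $ m $ j = cis (- \<alpha>) * C $ k $ l $ m $ j"
      unfolding W[OF kn] by simp
    consider "k = 1" "l = 0" | "k = 2" "l = 1" | "k \<noteq> l + 1" using kl by linarith
    then show "Cx (ex 1 H fps_X) (ex 1 H yy) $ k $ l $ m $ j = Cx (ex 1 H1 fps_X) (ex 1 H1 yy) $ k $ l $ m $ j"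
    proof cases
      case 1
      show ?thesis unfolding w unfolding 1 h2 Cx_H1_values(1) using one[of "(- \<i>) ^ m" "fact m"] by simp
    next
      case 2
      show ?thesis unfolding w unfolding 2 h3 Cx_H1_values(2) using one[of "(- \<i>) ^ Suc m" "fact m"] by simp
    next
      case 3
      have "l \<noteq> n - 1" using kl n by linarith
      then have "C $ k $ l = 0" using h1[OF kn 3] by simp
      then show ?thesis unfolding W[OF kn] Cx_H1 using 3 by simp
    qed
  qed
  then have "dge 4 (Cx (ex 1 H fps_X - ex 1 H1 fps_X) (ex 1 H yy - ex 1 H1 yy))" unfolding Cx_diff dge_def by simp
  note d = Cx_dge[OF this]
  show d5: "dge 5 (H - H1)" by (rule ex_inj_dge[OF Ham_H1 H]) (use d in simp_all)
  \<comment> \<open>Supports of H and of the Lie terms of order 0, 1 and at least 2. Terms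
    containing a parameter are let through, as only parameter-free coefficients are read; outside B2
    and away from z itself only the first-order term remains.\<close>
  define A where "A k l m j \<longleftrightarrow> 1 \<le> m + j \<or> (k = l \<and> 3 \<le> l) \<or> n \<le> k + l" for k l m j :: nat
  define B0 where "B0 k l m j \<longleftrightarrow> k = 1 \<and> l = 0 \<and> m = 0 \<and> j = (0::nat)" for k l m j :: nat
  define B1 where "B1 k l m j \<longleftrightarrow> 1 \<le> m + j \<or> (k = l + 1 \<and> 2 \<le> l) \<or> n - 1 \<le> k + l" for k l m j :: nat
  define B2 where "B2 k l m j \<longleftrightarrow> 1 \<le> m + j \<or> (k = l + 1 \<and> 3 \<le> l) \<or> n \<le> k + l" for k l m j :: nat
  have A: "spt A (tau H)" unfolding spt_def
  proof (intro allI impI)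
    fix k l m j assume nz: "tau H $ k $ l $ m $ j \<noteq> 0"
    obtain q where q: "k = l + n * q \<or> l = k + n * q" using rot_invariant_res[OF p pm _ rH nz] n by auto
    show "A k l m j"
    proof (cases "q = 0 \<and> m + j = 0")
      case True
      have "tau H1 $ k $ l $ m $ j = 0" using True by (simp add: tau_H1_nth yy_def)
      then have "\<not> k + l < 5" using d5[unfolded dge_tau, unfolded dge_def] nz by (auto simp: tau_ring)
      then show ?thesis using q True by (auto simp: A_def)
    next
      case False
      then have "1 \<le> m + j \<or> n \<le> n * q" by (cases q) auto
      then show ?thesis unfolding A_def using q by linarith
    qed
  qed
  define T where "T q = Cx (Lp q H fps_X) (Lp q H yy)" for q
  have T0: "T 0 = fps_X" by (simp add: T_def Cx_vars)
  have TS: "T (Suc q) = ck (- 2 * \<i>) * br (T q) (tau H)" for q unfolding T_def by (rule Cx_Lp)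
  have ckspt: "spt B Z \<Longrightarrow> spt B (ck c * Z)" for B c Z by (simp add: spt_def)
  have t0: "spt B0 (T 0)" by (simp add: T0 spt_def B0_def fps_X_nth fps_one_nth)
  have t1: "spt B1 (T 1)" unfolding One_nat_def TS
    by (rule ckspt, rule spt_br'[OF t0 A]) (auto simp: A_def B0_def B1_def)
  have t2: "spt B2 (T (Suc (Suc q)))" for q
  proof (induction q)
    case 0
    show ?case unfolding TS[of "Suc 0"]
      by (rule ckspt, rule spt_br'[OF t1[unfolded One_nat_def] A]) (use n in \<open>auto simp: A_def B1_def B2_def\<close>)
  next
    case (Suc q)
    show ?case unfolding TS[of "Suc (Suc q)"]
      by (rule ckspt, rule spt_br'[OF Suc A]) (use n in \<open>auto simp: A_def B2_def\<close>)
  qed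
  have W1: "Cx (ex 1 H fps_X) (ex 1 H yy) $ k $ l $ 0 $ 0 = - 2 * \<i> * (of_nat (l + 1) * tau H $ k $ (l + 1) $ 0 $ 0)"
    if k: "k \<noteq> 1" "\<not> B2 k l 0 0" for k l
  proof -
    have "T q $ k $ l $ 0 $ 0 = (if q = 1 then - 2 * \<i> * (of_nat (l + 1) * tau H $ k $ (l + 1) $ 0 $ 0) else 0)" for q
    proof -
      consider "q = 0" | "q = 1" | q' where "q = Suc (Suc q')" by (metis One_nat_def not0_implies_Suc)
      then show ?thesis
      proof cases
        case 1 then show ?thesis using sptD[OF t0, of k l 0 0] k by (simp add: B0_def)
      next
        case 2
        have "T 1 $ k $ l $ 0 $ 0 = - 2 * \<i> * dY (tau H) $ k $ l $ 0 $ 0"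
          unfolding One_nat_def TS T0 ck_nth br_def by simp
        then show ?thesis using 2 by (simp add: dY_nth of_nat_nth2)
      next
        case 3 then show ?thesis using sptD[OF t2, of k l 0 0] k by simp
      qed
    qed
    moreover have e: "k + l + 0 + 0 \<le> k + l + 1" by simp
    ultimately have "Cx (ex 1 H fps_X) (ex 1 H yy) $ k $ l $ 0 $ 0 =
      (\<Sum>q\<le>k + l + 1. if q = 1 then - 2 * \<i> * (of_nat (l + 1) * tau H $ k $ (l + 1) $ 0 $ 0) else 0)"
      unfolding Cx_ex_nth[OF H e] T_def[symmetric] by (intro sum.cong) auto
    then show ?thesis by (simp del: of_nat_add of_nat_Suc)
  qed
  show "tau H $ 3 $ 3 $ 0 $ 0 \<noteq> 0" if n6: "6 \<le> n"
  proof
    assume z: "tau H $ 3 $ 3 $ 0 $ 0 = 0"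
    have "Cx (ex 1 H fps_X) (ex 1 H yy) $ 3 $ 2 $ 0 $ 0 = 0"
      using W1[of 3 2] n6 z by (simp add: B2_def)
    moreover have le: "3 + 2 \<le> n" using n6 by simp
    have "Cx (ex 1 H fps_X) (ex 1 H yy) $ 3 $ 2 $ 0 $ 0 = cis (- \<alpha>) * C $ 3 $ 2 $ 0 $ 0"
      unfolding W[OF le] by (simp only: cc_mult_nth)
    ultimately show False using h4[OF n6] by simp
  qed
  show "tau H $ n $ 0 $ 0 $ 0 \<noteq> 0"
  proof
    assume "tau H $ n $ 0 $ 0 $ 0 = 0"
    then have z: "tau H $ 0 $ n $ 0 $ 0 = 0" using tau_sym[of H 0 n 0 0] by simp
    have "Cx (ex 1 H fps_X) (ex 1 H yy) $ 0 $ (n - 1) $ 0 $ 0 = 0"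
      using W1[of 0 "n - 1"] n z by (simp add: B2_def)
    moreover have le: "0 + (n - 1) \<le> n" by simp
    have "Cx (ex 1 H fps_X) (ex 1 H yy) $ 0 $ (n - 1) $ 0 $ 0 = cis (- \<alpha>) * C $ 0 $ (n - 1) $ 0 $ 0"
      unfolding W[OF le] by (simp only: cc_mult_nth)
    ultimately show False using h5 by simp
  qed
qed

text \<open>The n-th iterates contain no rotation, so \<Psi> transports N2 to N1 and therefore
  commutes with the rotation. Its linear part at zero parameters is a rotation by some \<theta>; the
  rest is the flow of an invariant K of weight at least 3. Positivity of both leading coefficients
  shows that rotation by \<theta> fixes N2, and \<open>normal_form_unique\<close> applies.\<close>

lemma conjugate_normal_forms:
  assumes n: "5 \<le> n" and p: "cis \<alpha> ^ n = 1" and pm: "\<And>k. 1 \<le> k \<Longrightarrow> k < n \<Longrightarrow> cis \<alpha> ^ k \<noteq> 1"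
    and ok: "lead_ok n a b" and N: "Ham N1" "Ham N2" "pb (rot \<alpha>) N1 = N1" "pb (rot \<alpha>) N2 = N2"
    and F: "FW n (mu n) N2" "FW n (mu n + 1) (N2 - hr n a b)" and nf: "\<And>\<omega>. NF n \<omega> N1" "\<And>\<omega>. NF n \<omega> N2"
    and b1: "tau N1 $ n $ 0 $ 0 $ 0 = of_real b1" "0 < b1"
    and \<Psi>: "canon \<Psi>" "\<And>X. pb \<Psi> (P' X) = X"
    and eq: "\<And>X. ex 1 N1 (pb (rot \<alpha>) (pb \<Psi> X)) = pb \<Psi> (ex 1 N2 (pb (rot \<alpha>) X))"
  shows "N1 = N2"
proof -
  let ?r = "pb (rot \<alpha>)" and ?r' = "pb (rot (- \<alpha>))" and ?P = "pb \<Psi>"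
  have n0: "0 < n" using n by simp
  have v: "vanishes_at_origin \<Psi>" using \<Psi> by (simp add: canon_def)
  have it: "((\<lambda>X. ex 1 M (?r X)) ^^ q) X = ex (of_nat q) M ((?r ^^ q) X)" if M: "Ham M" "?r M = M" for M q X
  proof (induction q)
    case 0 show ?case by (simp add: ex_0)
  next
    case (Suc q)
    show ?case by (simp add: Suc rot_ex[OF M(1)] M(2) ex_group[OF M(1)])
  qed
  have "?P (((\<lambda>X. ex 1 N2 (?r X)) ^^ q) X) = ((\<lambda>X. ex 1 N1 (?r X)) ^^ q) (?P X)" for q X
    by (induction q) (simp_all flip: eq)
  then have pn: "?P (ex (of_nat n) N2 X) = ex (of_nat n) N1 (?P X)" for X
    using it[OF N(2,4)] it[OF N(1,3)] periodic_map.per[OF periodic_rot[OF p n0]] by metis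
  have PN: "Ham (?P N2)" by (rule pb_Ham[OF v N(2)])
  have en: "ex (of_nat n) N1 Y = ex (of_nat n) (?P N2) Y" for Y
    using pn[of "P' Y"] pb_ex[OF \<Psi>(1) N(2), of "of_nat n" "P' Y"] by (simp add: \<Psi>(2))
  \<comment> \<open>The n-th iterates are time-n maps, and a Hamiltonian is determined by its
    time-one map.\<close>
  have "real_const n * N1 = real_const n * ?P N2"
    by (rule ex_inj) (use en in \<open>simp_all add: Ham_rc N PN ex_scale\<close>)
  then have "n * N1 $ i $ j $ m $ l = n * ?P N2 $ i $ j $ m $ l" for i j m l by (metis rc_nth)
  then have NP: "N1 = ?P N2" using n0 by (intro fps4_eqI) simp
  have rP: "?r (?P X) = ?P (?r X)" for X
  proof -
    have "ex 1 N1 (?r (?P X)) = ex 1 N1 (?P (?r X))" unfolding eq pb_ex[OF \<Psi>(1) N(2)] NP[symmetric] ..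
    then have "ex 1 (- N1) (ex 1 N1 (?r (?P X))) = ex 1 (- N1) (ex 1 N1 (?P (?r X)))" by simp
    then show ?thesis by (simp add: ex_inverse[OF N(1)])
  qed
  define D where "D = Cx (?P fps_X) (?P yy)"
  have rotD: "Cx (?P (pb (rot \<theta>) fps_X)) (?P (pb (rot \<theta>) yy)) = ck (cis \<theta>) * D" for \<theta>
    unfolding D_def by (rule pb_rot_vars) (simp_all add: pb_ring[OF v])
  have "Cx (?P (?r fps_X)) (?P (?r yy)) $ 0 $ 1 $ 0 $ 0 = (cc (cis \<alpha> ^ 0 * cis (- \<alpha>) ^ 1) * D $ 0 $ 1) $ 0 $ 0"
    unfolding rP[symmetric] Cx_pb_rot D_def ..
  then have "cis (- \<alpha>) * D $ 0 $ 1 $ 0 $ 0 = cis \<alpha> * D $ 0 $ 1 $ 0 $ 0"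
    unfolding rotD ck_nth cc_mult_nth by auto
  then have "cis \<alpha> * (cis (- \<alpha>) * D $ 0 $ 1 $ 0 $ 0) = cis \<alpha> * (cis \<alpha> * D $ 0 $ 1 $ 0 $ 0)" by simp
  then have "(cis \<alpha> ^ 2 - 1) * D $ 0 $ 1 $ 0 $ 0 = 0" by (simp add: mult.assoc[symmetric] cis_mult power2_eq_square ring_distribs)
  then have D01: "D $ 0 $ 1 $ 0 $ 0 = 0" using pm[of 2] n by simp
  have D00: "D $ 0 $ 0 = 0" unfolding D_def Cx_def
    using pb_dge[OF v dge_vars(1)] pb_dge[OF v dge_vars(2)] unfolding dge_tau by (simp add: dge_def ck_def)
  define u where "u = D $ 1 $ 0 $ 0 $ 0"
  define D' where "D' = tau (?P fps_X) - ck \<i> * tau (?P yy)"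
  have "ck (- 2 * \<i>) * br (tau (?P fps_X)) (tau (?P yy)) = 1"
  proof -
    have "br (?P fps_X) (?P yy) = 1" using \<Psi>(1) by (simp add: canon_def pb_ring[OF v])
    moreover have "tau 1 = 1" using tau_cc(1)[of 1] by (simp add: cmap_1')
    ultimately show ?thesis using tau_br[of "?P fps_X" "?P yy"] by simp
  qed
  moreover have "br D D' = ck (- 2 * \<i>) * br (tau (?P fps_X)) (tau (?P yy))"
  proof -
    have "ck (- 2 * \<i>) = - ck \<i> - ck \<i>" by (simp flip: ck_hom)
    then show ?thesis unfolding D_def D'_def Cx_def
      using br_antisym[of "tau (?P yy)" "tau (?P fps_X)"]
      by (simp add: br_add_left br_add_right br_diff_right ck_br algebra_simps)
  qed
  ultimately have "br D D' $ 0 $ 0 $ 0 $ 0 = 1" by (simp add: fps_one_nth)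
  then have "u * D' $ 0 $ 1 $ 0 $ 0 = 1" using D01 by (simp add: br_def u_def fps_deriv_nth2 dY_nth)
  moreover have "D' $ 0 $ 1 $ 0 $ 0 = cnj u"
    unfolding D'_def u_def D_def Cx_def fps_add_nth fps_sub_nth ck_nth tau_sym[of _ 0 1] by simp
  \<comment> \<open>Since there is no w term, the Jacobian at the origin for zero parameters is u
    times its conjugate.\<close>
  ultimately have "norm u = 1" by (metis complex_mod_mult_cnj norm_one power2_eq_1_iff abs_norm_cancel real_sqrt_abs real_sqrt_one norm_mult complex_mod_cnj power2_eq_square)
  then have cu: "cis (Arg u) = u" using cis_Arg[of u] by (simp add: sgn_div_norm) (metis norm_zero zero_neq_one cis_Arg sgn_div_norm scaleR_one inverse_1)
  define \<theta> where "\<theta> = Arg u"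
  define Q where "Q = fcompose (rot (- \<theta>)) \<Psi>"
  have Qc: "canon Q" unfolding Q_def by (rule canon_fcompose[OF rot_canon \<Psi>(1)])
  have Qv: "vanishes_at_origin Q" using Qc by (simp add: canon_def)
  have pQ: "pb Q X = ?P (pb (rot (- \<theta>)) X)" for X unfolding Q_def by (rule pb_fcompose[OF rot_vanishes v])
  have CQ: "Cx (pb Q fps_X) (pb Q yy) = ck (cis (- \<theta>)) * D" unfolding pQ by (rule rotD)
  have CQn: "Cx (fst Q) (snd Q) $ k $ l $ m $ j = cis (- \<theta>) * D $ k $ l $ m $ j" for k l m j
    using CQ[unfolded pb_ring[OF Qv]] by (simp only: ck_nth)
  have cu': "cis (- \<theta>) * D $ 1 $ 0 $ 0 $ 0 = 1" using cu unfolding u_def[symmetric] \<theta>_def by (metis cis_mult cis_zero add.left_inverse)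
  have "spt (\<lambda>i j m l. 2 \<le> i + j + m + l) (Cx (fst Q - fps_X) (snd Q - yy))"
    unfolding spt_def
  proof (intro allI impI, rule ccontr)
    fix k l m j assume nz: "Cx (fst Q - fps_X) (snd Q - yy) $ k $ l $ m $ j \<noteq> 0" and "\<not> 2 \<le> k + l + m + j"
    then consider "k = 1" "l = 0" "m = 0" "j = 0" | "k = 0" "l = 1" "m = 0" "j = 0" | "k = 0" "l = 0" by linarith
    then have "Cx (fst Q - fps_X) (snd Q - yy) $ k $ l $ m $ j = 0"
      unfolding Cx_diff Cx_vars fps_sub_nth CQn using D01 D00 cu'
      by cases (auto simp: fps_X_nth)
    with nz show False by simp
  qed
  from log_map[OF Qc Cx_vge[OF this]] obtain K where K: "Ham K" and QK: "\<And>X. pb Q X = ex 1 K X" by blast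
  have PK: "?P X = ex 1 K (pb (rot \<theta>) X)" for X unfolding QK[symmetric] pQ rot_inverse ..
  have exrK: "ex 1 (?r K) X = ex 1 K X" for X
  proof -
    have "ex 1 (?r K) X = ?r (ex 1 K (?r' X))" by (simp add: rot_ex[OF K] rot_inverse)
    also have "\<dots> = ?P (?r (pb (rot (- \<theta>)) (?r' X)))" unfolding QK[symmetric] pQ rP ..
    also have "\<dots> = ex 1 K X" unfolding rot_commute[of \<alpha> "- \<theta>"] rot_inverse QK[symmetric] pQ ..
    finally show ?thesis .
  qed
  have rK: "?r K = K" by (rule ex_inj[OF K pb_Ham[OF rot_vanishes K] exrK exrK])
  have K3: "FW n 3 K"
  proof (rule FWI)
    show "\<exists>q. k = l + n * q \<or> l = k + n * q" if "tau K $ k $ l $ m $ j \<noteq> 0" for k l m j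
      by (rule rot_invariant_res[OF p pm n0 rK that])
    fix l q m j assume nz: "tau K $ (l + n * q) $ l $ m $ j \<noteq> 0"
    have h: "2 \<le> l + n * q + l \<and> 3 \<le> l + n * q + l + m + j" by (rule spt_nz[OF K[unfolded Ham_tau] nz])
    have m5: "5 \<le> mu n" using n by (simp add: mu_def)
    show "2 \<le> 2 * l + n * q \<and> 3 \<le> 2 * l + mu n * q + 6 * (m + j)"
    proof (cases "q = 0")
      case True
      then show ?thesis using h by auto
    next
      case False
      then have "5 * 1 \<le> mu n * q" using m5 by (intro mult_le_mono) auto
      then show ?thesis using h by auto
    qed
  qed
  define N2' where "N2' = pb (rot \<theta>) N2"
  have N1: "N1 = ex 1 K N2'" unfolding NP PK N2'_def ..
  have F2': "FW n (mu n) N2'" using F(1) unfolding N2'_def FW_def spt_def tau_rot by auto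
  have "FW n (mu n + 1) (N1 - N2')" unfolding N1 by (rule ex_filtr_step(1)[OF filtr_FW K FW_L[OF K3] F2'])
  from FW_zero[OF n this, of 0 1 0 0] have "tau N1 $ n $ 0 $ 0 $ 0 = tau N2' $ n $ 0 $ 0 $ 0" by (simp add: tau_ring)
  moreover have "tau N2 $ n $ 0 $ 0 $ 0 = of_real b"
    using FW_zero[OF n F(2), of 0 1 0 0] n by (simp add: tau_ring tau_hr hh_nth)
  \<comment> \<open>K has weight at least 3, so it does not alter the leading weight, and the
    coefficients of z^n differ only by the rotation.\<close>
  ultimately have bb: "of_real b1 = cis \<theta> ^ n * of_real b" using b1(1) by (simp add: N2'_def tau_rot cc_nth)
  have "b > 0" using ok by (simp add: lead_ok_def)
  have "b1 = b" using arg_cong[OF bb, of norm] b1(2) \<open>b > 0\<close> by (simp add: norm_mult norm_power)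
  then have ct: "cis \<theta> ^ n = 1" using bb \<open>b > 0\<close> by simp
  have "N2' = N2"
  proof (rule tau_inj, rule fps4_eqI')
    fix k l m j
    show "tau N2' $ k $ l $ m $ j = tau N2 $ k $ l $ m $ j"
    proof (cases "tau N2 $ k $ l $ m $ j = 0")
      case True
      then show ?thesis by (simp add: N2'_def tau_rot)
    next
      case False
      from rot_invariant_res[OF p pm n0 N(4) False] obtain q where "k = l + n * q \<or> l = k + n * q" by blast
      then have "cis \<theta> ^ k * cis (- \<theta>) ^ l = 1" using ct by (auto simp: cis_minus_power power_add power_mult)
      then show ?thesis by (simp add: N2'_def tau_rot)
    qed
  qed
  with N1 have "N1 = ex 1 K N2" by simp
  from normal_form_unique[OF ok F nf K3 this] show ?thesis .
qed

lemma fps2_eqI': "(\<And>m j. (U :: complex fps fps) $ m $ j = 0) \<Longrightarrow> U = 0"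
  by (rule fps2_eqI) simp

text \<open>The interface to the analytic family. In the z-component, h1 gives the shape up to
  degree n; h2 and h3 say that the coefficients of z and z^2 w are exp(i (\<alpha> - delta)) and -i
  nu times that; h4 and h5 are the nondegeneracy conditions.\<close>

theorem formal_main:
  assumes n: "5 \<le> n" and p: "cis \<alpha> ^ n = 1" and pm: "\<And>k. 1 \<le> k \<Longrightarrow> k < n \<Longrightarrow> cis \<alpha> ^ k \<noteq> 1"
    and S: "canon S"
    and h1: "\<And>k l. k + l \<le> n \<Longrightarrow> k \<noteq> l + 1 \<Longrightarrow> (k, l) \<noteq> (0, n - 1) \<Longrightarrow> Cx (fst S) (snd S) $ k $ l = 0"
    and h2: "\<And>m j. Cx (fst S) (snd S) $ 1 $ 0 $ m $ j = (if j = 0 then cis \<alpha> * (- \<i>) ^ m / fact m else 0)"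
    and h3: "\<And>m j. Cx (fst S) (snd S) $ 2 $ 1 $ m $ j = (if j = 1 then cis \<alpha> * (- \<i>) ^ Suc m / fact m else 0)"
    and h4: "6 \<le> n \<Longrightarrow> Cx (fst S) (snd S) $ 3 $ 2 $ 0 $ 0 \<noteq> 0" and h5: "Cx (fst S) (snd S) $ 0 $ (n - 1) $ 0 $ 0 \<noteq> 0"
  shows "\<exists>!(A, B). normal_form_coeffs n A B \<and> B $ 0 $ 0 $ 0 > 0 \<and>
       (\<exists>\<Phi>. formal_ham_flow (normal_form_ham n A B) \<Phi> \<and> formally_conjugate S (fcompose (rot \<alpha>) (\<Phi> 1)))"
proof -
  let ?r = "pb (rot \<alpha>)"
  have n0: "0 < n" using n by simp
  have Sv: "vanishes_at_origin S" using S by (simp add: canon_def)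
  obtain G H where G: "Ham G" and H: "Ham H" and rH: "?r H = H" and eq: "\<And>X. pb S (ex 1 G X) = ex 1 G (ex 1 H (?r X))"
    and W: "\<And>k l. k + l \<le> n \<Longrightarrow> Cx (ex 1 H fps_X) (ex 1 H yy) $ k $ l = cc (cis (- \<alpha>)) * Cx (fst S) (snd S) $ k $ l"
    by (rule averaged_log[OF n p S h1]) (use h2[of 0 0] in auto)
  note ro = read_off[OF n p pm H rH W h1 h2 h3 h4 h5]
  define b0 where "b0 = tau H $ n $ 0 $ 0 $ 0"
  have b0: "b0 \<noteq> 0" using ro(3) by (simp add: b0_def)
  \<comment> \<open>Rotation by \<theta> multiplies the coefficient of z^n by cis (n \<theta>); this
    choice makes it positive.\<close>
  define \<theta> where "\<theta> = - Arg b0 / n"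
  define b where "b = norm b0"
  have b: "0 < b" using b0 by (simp add: b_def)
  have tb: "cis \<theta> ^ n * b0 = of_real b"
  proof -
    have "real n * \<theta> = - Arg b0" using n0 by (simp add: \<theta>_def)
    then have "cis \<theta> ^ n = cis (- Arg b0)" by (simp add: Complex.DeMoivre)
    moreover have "b0 = cis (Arg b0) * of_real b" using cis_Arg[OF b0] b0 by (simp add: b_def sgn_div_norm scaleR_conv_of_real)
    ultimately have "cis \<theta> ^ n * b0 = cis (- Arg b0) * cis (Arg b0) * of_real b" by (metis mult.assoc)
    then show ?thesis by (simp add: cis_mult)
  qed
  define H2 where "H2 = pb (rot \<theta>) H"
  have tH2: "tau H2 $ k $ l $ m $ j = cis \<theta> ^ k * cis (- \<theta>) ^ l * tau H $ k $ l $ m $ j" for k l m j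
    by (simp add: H2_def tau_rot)
  have H2: "Ham H2" unfolding H2_def by (rule pb_Ham[OF rot_vanishes H])
  have rH2: "?r H2 = H2" unfolding H2_def rot_commute[of \<alpha>] rH ..
  have rotH1: "pb (rot \<theta>) H1 = H1"
  proof (rule tau_inj, rule fps2_eqI)
    fix k l show "tau (pb (rot \<theta>) H1) $ k $ l = tau H1 $ k $ l"
      by (auto simp: tau_rot tau_H1_nth cis_mult power2_eq_square mult.assoc)
  qed
  have d5: "dge 5 (H2 - H1)" using pb_dge[OF rot_vanishes ro(1), of \<theta>] by (simp add: pb_ring[OF rot_vanishes] rotH1 H2_def)
  have low: "tau H2 $ k $ l = tau H1 $ k $ l" if "k + l < 5" for k l
    using d5 that unfolding dge_tau[of 5] by (simp add: dge_def tau_ring)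
  \<comment> \<open>For n = 5 the monomial (z w)^3 has weight 6 > mu and does not belong to the
    leading part.\<close>
  define a where "a = (if n = 5 then 0 else Re (tau H2 $ 3 $ 3 $ 0 $ 0))"
  have H233: "tau H2 $ 3 $ 3 $ 0 $ 0 = tau H $ 3 $ 3 $ 0 $ 0" unfolding tH2 cis_minus_power by simp
  have im: "Im (tau H2 $ 3 $ 3 $ 0 $ 0) = 0" using arg_cong[OF tau_sym[of H2 3 3 0 0], of Im] by simp
  have ok: "lead_ok n a b" unfolding lead_ok_def
  proof (intro conjI impI)
    assume "6 \<le> n"
    then show "a \<noteq> 0" using ro(2) im H233 by (auto simp: a_def complex_eq_iff)
  qed (use n b in \<open>auto simp: a_def\<close>)
  have mu: "5 \<le> mu n" "mu n \<le> 6" "n = 5 \<Longrightarrow> mu n = 5" "n \<noteq> 5 \<Longrightarrow> mu n = 6" using n by (auto simp: mu_def)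
  have res2: "\<exists>q. k = l + n * q \<or> l = k + n * q" if "tau H2 $ k $ l $ m $ j \<noteq> 0" for k l m j
    by (rule rot_invariant_res[OF p pm n0 rH2 that])
  have zz: "tau H2 $ k $ l $ m $ j = 0" if "k = l" "k < 3" "m + j = 0" for k l m j
  proof -
    have "tau H1 $ k $ l $ m $ j = 0" using that by (simp add: tau_H1_nth yy_def)
    then show ?thesis using low[of k l] that by simp
  qed
  have key: "2 \<le> 2 * l + n * q \<and> mu n \<le> 2 * l + mu n * q + 6 * (m + j) \<and> (q = 0 \<longrightarrow> 6 \<le> 2 * l + 6 * (m + j) \<and> (m + j \<noteq> 0 \<longrightarrow> 8 \<le> 2 * l + 6 * (m + j)))"
    if nz: "tau H2 $ (l + n * q) $ l $ m $ j \<noteq> 0" for l q m j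
  proof -
    have two: "2 \<le> l + n * q + l" using spt_nz[OF H2[unfolded Ham_tau] nz] by blast
    show ?thesis
    proof (cases "q = 0")
      case True
      have "3 \<le> l \<or> m + j \<noteq> 0"
      proof (rule ccontr)
        assume "\<not> ?thesis"
        then have "tau H2 $ (l + n * q) $ l $ m $ j = 0" by (intro zz) (use True in auto)
        with nz show False by contradiction
      qed
      then show ?thesis using two True mu by auto
    next
      case False
      then have a: "mu n \<le> mu n * q" by (cases q) auto
      have a1: "2 \<le> 2 * l + n * q" using two by linarith
      have a2: "mu n \<le> 2 * l + mu n * q + 6 * (m + j)" using a by linarith
      show ?thesis using a1 a2 False by blast
    qed
  qed
  have F2: "FW n (mu n) H2" by (rule FWI[OF res2]) (use key in blast)+
  have lead: "FW n (mu n + 1) (H2 - hr n a b)"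
  proof (rule FW_suc[OF n FW_diff[OF F2]])
    show "FW n (mu n) (hr n a b)"
      unfolding FW_def tau_hr spt_def
    proof (intro allI impI)
      fix k l m j assume "hh n a b $ k $ l $ m $ j \<noteq> 0"
      then have "m = 0 \<and> j = 0 \<and> ((k = 3 \<and> l = 3) \<or> (k = n \<and> l = 0) \<or> (k = 0 \<and> l = n))"
        by (auto simp: hh_nth split: if_splits)
      then show "rsw n (mu n) k l m j" using n mu unfolding rsw_def
        by (auto intro: exI[of _ "0::nat"] exI[of _ "1::nat"])
    qed
    fix l q m j assume w: "2 * l + mu n * q + 6 * (m + j) = mu n"
    show "tau (H2 - hr n a b) $ (l + n * q) $ l $ m $ j = 0"
    proof (cases "q = 0")
      case q0: True
      show ?thesis
      proof (cases "m + j = 0 \<and> l = 3")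
        case True
        then have "n \<noteq> 5" using w q0 mu by auto
        then show ?thesis using True q0 n im by (simp add: tau_ring tau_hr hh_nth a_def complex_eq_iff)
      next
        case False
        have "tau H2 $ (l + n * q) $ l $ m $ j = 0"
        proof (rule ccontr)
          assume "tau H2 $ (l + n * q) $ l $ m $ j \<noteq> 0"
          from key[OF this] show False using q0 w mu(2) False by (cases "m + j = 0") auto
        qed
        moreover have "hh n a b $ (l + n * q) $ l $ m $ j = 0" using q0 False n by (auto simp: hh_nth)
        ultimately show ?thesis by (simp add: tau_ring tau_hr)
      qed
    next
      case False
      then have a: "mu n \<le> mu n * q" by (cases q) auto
      have "l = 0" using a w by linarith
      have "6 * (m + j) = 0" using a w by linarith
      then have "m = 0" "j = 0" by simp_all
      have "mu n * q = mu n" using a w by linarith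
      then have "q = 1" using mu(1) by simp
      with \<open>l = 0\<close> \<open>m = 0\<close> \<open>j = 0\<close> show ?thesis using n tb by (simp add: tau_ring tau_hr hh_nth tH2 b0_def)
    qed
  qed
  obtain G3 where G3: "FW n 3 G3" and nf: "\<And>\<omega>. NF n \<omega> (ex 1 G3 H2)"
    by (rule normal_form_exists[OF ok F2 lead]) (rule that)
  have HG3: "Ham G3" by (rule FW_Ham[OF n G3])
  define N where "N = ex 1 G3 H2"
  have res3: "\<exists>q. k = l + n * q \<or> l = k + n * q" if "tau G3 $ k $ l $ m $ j \<noteq> 0" for k l m j
    using spt_nz[OF G3[unfolded FW_def] that] unfolding rsw_def by blast
  have rG3: "?r G3 = G3"
  proof (rule tau_inj, rule fps4_eqI')
    fix k l m j show "tau (?r G3) $ k $ l $ m $ j = tau G3 $ k $ l $ m $ j"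
      using res3[of k l m j] resonance_iff[OF p pm n0, of k l] by (cases "tau G3 $ k $ l $ m $ j = 0") (auto simp: tau_rot)
  qed
  have NN: "Ham N" unfolding N_def by (rule ex_conj(2)[OF HG3 H2])
  have rN: "?r N = N" unfolding N_def rot_ex[OF HG3] rG3 rH2 ..
  \<comment> \<open>Normalisation must not disturb delta I + nu I^2. A function of I commutes with
    the diagonal part of G3, the other resonant monomials have degree at least n, and H2 - H1 has
    order at least 5.\<close>
  have dL: "dge 5 (br H2 G3)"
  proof -
    have "dge 5 (br (tau H1) (tau G3))" unfolding dge_def
    proof (intro allI impI)
      fix A B :: nat assume AB: "A + B < 5"
      show "br (tau H1) (tau G3) $ A $ B = 0"
        unfolding br_nth
      proof (intro sum.neutral ballI)
        fix i j assume ij: "i \<in> {..A + 1}" "j \<in> {..B + 1}"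
        show "(of_nat (i * (B + 1 - j)) - of_nat (j * (A + 1 - i))) * (tau H1 $ i $ j * tau G3 $ (A + 1 - i) $ (B + 1 - j)) = 0"
        proof (cases "i = j \<and> 1 \<le> i")
          case True
          show ?thesis
          proof (cases "A = B")
            case False
            have "tau G3 $ (A + 1 - i) $ (B + 1 - j) = 0"
            proof (rule fps2_eqI')
              fix m' j'
              show "tau G3 $ (A + 1 - i) $ (B + 1 - j) $ m' $ j' = 0"
              proof (rule ccontr)
                assume "tau G3 $ (A + 1 - i) $ (B + 1 - j) $ m' $ j' \<noteq> 0"
                from res3[OF this] obtain q where q: "A + 1 - i = B + 1 - j + n * q \<or> B + 1 - j = A + 1 - i + n * q" by blast
                have "q \<noteq> 0"
                proof
                  assume "q = 0"
                  then have "A + 1 - i = B + 1 - j" using q by auto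
                  moreover have "i \<le> A + 1" "j \<le> B + 1" "i = j" using ij True by auto
                  ultimately show False using False by linarith
                qed
                then have "5 * 1 \<le> n * q" using n by (intro mult_le_mono) auto
                then show False using q AB True ij by auto
              qed
            qed
            then show ?thesis by simp
          qed (use True in simp)
        next
          case False
          then have "tau H1 $ i $ j = 0" by (auto simp: tau_H1_nth)
          then show ?thesis by simp
        qed
      qed
    qed
    then have "dge 5 (tau (br H1 G3))" unfolding tau_br by (simp add: dge_def ck_def)
    then have 1: "dge 5 (br H1 G3)" by (simp only: dge_tau)
    have "dge 2 G3" using HG3 by (simp add: Ham_iff)
    then have 2: "dge 5 (br (H2 - H1) G3)" using dge_br[of 4 "H2 - H1" 1 G3] d5 by (simp add: numeral_eq_Suc)
    have "br H2 G3 = br H1 G3 + br (H2 - H1) G3" by (simp add: br_diff_left)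
    then show ?thesis using dge_add[OF 1 2] by simp
  qed
  have fd: "filtr dge"
  proof -
    have "(dge :: nat \<Rightarrow> plane_series \<Rightarrow> bool) = (\<lambda>k. spt (\<lambda>i j m l. k \<le> i + j))" by (intro ext) (simp add: dge_spt)
    then show ?thesis using filtr_spt[of "\<lambda>k i j m l. k \<le> i + j"] by simp
  qed
  have "dge 5 (Lp (Suc q) G3 H2)" for q by (induction q) (use dL in \<open>auto intro: dge_br_Ham[OF HG3]\<close>)
  then have "dge 5 (Lp q G3 H2)" if "1 \<le> q" for q using that by (cases q) auto
  from ex_tail[OF fd HG3 this, of 1] have dN: "dge 5 (N - H2)" by (simp add: N_def rc_hom)
  have dN1: "dge 5 (N - H1)" using dge_add[OF dN d5] by simp
  have FN: "FW n (mu n + 1) (N - H2)" "FW n (mu n) N"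
    unfolding N_def using ex_filtr_step[OF filtr_FW HG3 FW_L[OF G3] F2] by auto
  have leadN: "FW n (mu n + 1) (N - hr n a b)" using FW_add[OF FN(1) lead] by simp
  obtain A B where NAB: "N = normal_form_ham n A B" and cAB: "normal_form_coeffs n A B"
    by (rule nfh_exists[OF n nf[folded N_def] dN1 rot_invariant_res[OF p pm n0 rN]]) auto
  have "tau N $ n $ 0 $ 0 $ 0 = of_real b"
    using FW_zero[OF n leadN, of 0 1 0 0] n by (simp add: tau_ring tau_hr hh_nth)
  then have "complex_of_real (2 powr (- real n / 2) / 2 * B $ 0 $ 0 $ 0) = of_real b" unfolding NAB nfh_props(3)[OF n] .
  then have "2 powr (- real n / 2) / 2 * B $ 0 $ 0 $ 0 = b" by (simp only: of_real_eq_iff)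
  then have "0 < 2 powr (- real n / 2) / 2 * B $ 0 $ 0 $ 0" using b by simp
  then have B0: "B $ 0 $ 0 $ 0 > 0" by (rule zero_less_mult_pos) simp
  \<comment> \<open>The averaging transformation, the rotation that made the coefficient of z^n
    positive and the normalising transformation, composed; \<psi>' is the inverse composite.\<close>
  define \<psi> where "\<psi> = fcompose (E 1 (- G3)) (fcompose (rot (- \<theta>)) (E 1 G))"
  define \<psi>' where "\<psi>' = fcompose (fcompose (E 1 (- G)) (rot \<theta>)) (E 1 G3)"
  have mG: "Ham (- G3)" "Ham (- G)" using HG3 G by (simp_all add: Ham_minus)
  have v1: "vanishes_at_origin (fcompose (rot (- \<theta>)) (E 1 G))" by (intro vanishes_fcompose rot_vanishes E_vanishes G)
  have v2: "vanishes_at_origin (fcompose (E 1 (- G)) (rot \<theta>))" by (intro vanishes_fcompose rot_vanishes E_vanishes mG)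
  have pp: "pb \<psi> X = ex 1 G (pb (rot (- \<theta>)) (ex 1 (- G3) X))" for X
    unfolding \<psi>_def pb_fcompose[OF E_vanishes[OF mG(1)] v1] pb_fcompose[OF rot_vanishes E_vanishes[OF G]] ex_pb[OF G] ex_pb[OF mG(1)] ..
  have pp': "pb \<psi>' X = ex 1 G3 (pb (rot \<theta>) (ex 1 (- G) X))" for X
    unfolding \<psi>'_def pb_fcompose[OF v2 E_vanishes[OF HG3]] pb_fcompose[OF E_vanishes[OF mG(2)] rot_vanishes] ex_pb[OF HG3] ex_pb[OF mG(2)] ..
  have \<psi>: "formal_canonical \<psi>" unfolding formal_canonical_iff
  proof (intro conjI exI[of _ \<psi>'] allI)
    show "canon \<psi>" unfolding \<psi>_def by (intro canon_fcompose rot_canon E_canon G mG)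
    show "vanishes_at_origin \<psi>'" unfolding \<psi>'_def by (rule vanishes_fcompose[OF v2 E_vanishes[OF HG3]])
  qed (simp_all add: pp pp' ex_inverse[OF G] ex_inverse[OF HG3] rot_inverse)
  have conj: "pb S (pb \<psi> X) = pb \<psi> (ex 1 N (?r X))" for X
  proof -
    have rH2H: "pb (rot (- \<theta>)) H2 = H" unfolding H2_def rot_inverse ..
    have a1: "ex 1 H (pb (rot (- \<theta>)) Y) = pb (rot (- \<theta>)) (ex 1 H2 Y)" for Y
      unfolding rot_ex[OF H2] rH2H ..
    have a2: "ex 1 H2 (ex 1 (- G3) Y) = ex 1 (- G3) (ex 1 N Y)" for Y
      unfolding ex_conj(1)[OF mG(1) NN] by (simp add: N_def ex_inverse[OF HG3])
    have a3: "?r (ex 1 (- G3) Y) = ex 1 (- G3) (?r Y)" for Y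
      unfolding rot_ex[OF mG(1)] by (simp add: pb_ring[OF rot_vanishes] rG3)
    show ?thesis unfolding pp eq rot_commute[of \<alpha> "- \<theta>"] a1 a3 a2 ..
  qed
  have iff: "(\<exists>\<Phi>. formal_ham_flow (normal_form_ham n A B) \<Phi> \<and> formally_conjugate S (fcompose (rot \<alpha>) (\<Phi> 1))) \<longleftrightarrow>
     (\<exists>\<psi>. formal_canonical \<psi> \<and> (\<forall>X. pb S (pb \<psi> X) = pb \<psi> (ex 1 (normal_form_ham n A B) (?r X))))" for A B
    using formally_conjugate_iff[OF Sv nfh_props(1)[OF n]] E_flow[OF nfh_props(1)[OF n]] by blast
  show ?thesis
  proof (rule ex1I[of _ "(A, B)"])
    show "case (A, B) of (A, B) \<Rightarrow> normal_form_coeffs n A B \<and> B $ 0 $ 0 $ 0 > 0 \<and>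
       (\<exists>\<Phi>. formal_ham_flow (normal_form_ham n A B) \<Phi> \<and> formally_conjugate S (fcompose (rot \<alpha>) (\<Phi> 1)))"
      unfolding prod.case iff using cAB B0 \<psi> conj NAB by blast
  next
    fix AB assume *: "case AB of (A, B) \<Rightarrow> normal_form_coeffs n A B \<and> B $ 0 $ 0 $ 0 > 0 \<and>
       (\<exists>\<Phi>. formal_ham_flow (normal_form_ham n A B) \<Phi> \<and> formally_conjugate S (fcompose (rot \<alpha>) (\<Phi> 1)))"
    obtain A' B' where AB: "AB = (A', B')" by (cases AB)
    define M where "M = normal_form_ham n A' B'"
    obtain \<phi> where cA: "normal_form_coeffs n A' B'" and B': "B' $ 0 $ 0 $ 0 > 0" and \<phi>: "formal_canonical \<phi>"
      and c\<phi>: "\<And>X. pb S (pb \<phi> X) = pb \<phi> (ex 1 M (?r X))"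
      using * unfolding AB prod.case iff M_def by blast
    obtain \<phi>i where \<phi>i: "vanishes_at_origin \<phi>i" "\<And>X. pb \<phi>i (pb \<phi> X) = X" "\<And>X. pb \<phi> (pb \<phi>i X) = X" and \<phi>c: "canon \<phi>"
      using \<phi> unfolding formal_canonical_iff by blast
    have \<psi>v: "vanishes_at_origin \<psi>" "canon \<psi>" using \<psi> unfolding formal_canonical_iff by (auto simp: canon_def)
    have \<psi>i: "pb \<psi>' (pb \<psi> X) = X" "pb \<psi> (pb \<psi>' X) = X" for X
      by (simp_all add: pp pp' ex_inverse[OF G] ex_inverse[OF HG3] rot_inverse)
    have \<phi>ic: "canon \<phi>i"
    proof -
      have "pb \<phi> (br (fst \<phi>i) (snd \<phi>i)) = br (pb \<phi> (pb \<phi>i fps_X)) (pb \<phi> (pb \<phi>i yy))"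
        by (simp add: pb_br[OF \<phi>c] pb_ring[OF \<phi>i(1)])
      also have "\<dots> = pb \<phi> 1" using fid_canon(1) \<phi>c by (simp add: \<phi>i(3) canon_def fid_eq pb_ring)
      finally have "pb \<phi>i (pb \<phi> (br (fst \<phi>i) (snd \<phi>i))) = pb \<phi>i (pb \<phi> 1)" by simp
      then show ?thesis using \<phi>i by (simp add: canon_def)
    qed
    define \<Psi> where "\<Psi> = fcompose \<psi> \<phi>i"
    have p\<Psi>: "pb \<Psi> X = pb \<phi>i (pb \<psi> X)" for X unfolding \<Psi>_def by (rule pb_fcompose[OF \<psi>v(1) \<phi>i(1)])
    have rM: "?r M = M"
    proof (rule tau_inj, rule fps4_eqI')
      fix k l m j show "tau (?r M) $ k $ l $ m $ j = tau M $ k $ l $ m $ j"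
        using nfh_props(4)[OF n, of A' B' k l m j] resonance_iff[OF p pm n0, of k l]
        by (cases "tau M $ k $ l $ m $ j = 0") (auto simp: tau_rot M_def)
    qed
    have "M = N"
    proof (rule conjugate_normal_forms[OF n p pm ok _ NN rM rN FN(2) leadN _ nf[folded N_def]])
      show "Ham M" unfolding M_def by (rule nfh_props(1)[OF n])
      show "NF n \<omega> M" for \<omega> unfolding M_def by (rule nfh_props(2)[OF n cA])
      show "tau M $ n $ 0 $ 0 $ 0 = of_real (2 powr (- real n / 2) / 2 * B' $ 0 $ 0 $ 0)" unfolding M_def by (rule nfh_props(3)[OF n])
      show "0 < 2 powr (- real n / 2) / 2 * B' $ 0 $ 0 $ 0" using B' by simp
      show "canon \<Psi>" unfolding \<Psi>_def by (rule canon_fcompose[OF \<psi>v(2) \<phi>ic])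
      show "pb \<Psi> (pb \<psi>' (pb \<phi> X)) = X" for X unfolding p\<Psi> \<psi>i \<phi>i ..
      show "ex 1 M (?r (pb \<Psi> X)) = pb \<Psi> (ex 1 N (?r X))" for X
      proof -
        have "pb \<phi> (ex 1 M (?r (pb \<Psi> X))) = pb S (pb \<psi> X)" unfolding c\<phi>[symmetric] p\<Psi> \<phi>i ..
        also have "\<dots> = pb \<psi> (ex 1 N (?r X))" by (rule conj)
        finally have "pb \<phi>i (pb \<phi> (ex 1 M (?r (pb \<Psi> X)))) = pb \<phi>i (pb \<psi> (ex 1 N (?r X)))" by simp
        then show ?thesis unfolding \<phi>i p\<Psi> .
      qed
    qed
    then show "AB = (A, B)" using nfh_inj[OF n, of A' B' A B] unfolding AB M_def NAB by auto
  qed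
qed

section \<open>Convergent expansions\<close>

text \<open>Summability at r/2 gives summability within each degree, where s^deg is constant; the
  full sum is then regrouped by degree into a power series in s.\<close>

lemma graded_sums:
  fixes c :: "'k \<Rightarrow> complex" and deg :: "'k \<Rightarrow> nat"
  assumes r: "0 < r" and S: "\<And>s. \<bar>s\<bar> < r \<Longrightarrow> ((\<lambda>k. c k * of_real (s ^ deg k)) has_sum g s) UNIV"
  shows "c summable_on {k. deg k = d}"
    and "\<bar>s\<bar> < r \<Longrightarrow> (\<lambda>d. infsum c {k. deg k = d} * of_real s ^ d) sums g s"
proof -
  show sm: "c summable_on {k. deg k = d}" for d
  proof -
    have "(\<lambda>k. c k * of_real ((r/2) ^ deg k)) summable_on {k. deg k = d}"
    proof (rule summable_on_subset_banach)
      show "(\<lambda>k. c k * of_real ((r/2) ^ deg k)) summable_on UNIV"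
        unfolding summable_on_def by (rule exI, rule S) (use r in simp)
    qed simp
    then have "(\<lambda>k. inverse (of_real ((r/2) ^ d)) * (c k * of_real ((r/2) ^ deg k))) summable_on {k. deg k = d}"
      by (rule summable_on_cmult_right)
    also have "?this \<longleftrightarrow> c summable_on {k. deg k = d}"
      using r by (intro summable_on_cong) simp
    finally show ?thesis .
  qed
  assume s: "\<bar>s\<bar> < r"
  define f where "f = (\<lambda>k. c k * of_real (s ^ deg k))"
  have "bij_betw snd (Sigma UNIV (\<lambda>d. {k. deg k = d})) (UNIV :: 'k set)"
    by (rule bij_betwI[where g = "\<lambda>k. (deg k, k)"]) auto
  from has_sum_reindex_bij_betw[OF this, of f] S[OF s]
  have 1: "((\<lambda>x. f (snd x)) has_sum g s) (Sigma UNIV (\<lambda>d. {k. deg k = d}))" by (simp add: f_def)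
  have 2: "((\<lambda>k. f (snd (d, k))) has_sum infsum c {k. deg k = d} * of_real s ^ d) {k. deg k = d}" for d
  proof -
    have "((\<lambda>k. c k * of_real s ^ d) has_sum infsum c {k. deg k = d} * of_real s ^ d) {k. deg k = d}"
      by (intro has_sum_cmult_left has_sum_infsum sm)
    also have "?this \<longleftrightarrow> ?thesis" by (intro has_sum_cong) (simp add: f_def)
    finally show ?thesis .
  qed
  show "(\<lambda>d. infsum c {k. deg k = d} * of_real s ^ d) sums g s"
    by (rule has_sum_imp_sums, rule has_sum_SigmaD[OF 1]) (rule 2)
qed

text \<open>After division by s^d the limit at 0 is c d by continuity of power series and 0 by the
  bound.\<close>

lemma power_series_order:
  fixes c :: "nat \<Rightarrow> complex"
  assumes r: "0 < r" and S: "\<And>s. \<bar>s\<bar> < r \<Longrightarrow> (\<lambda>d. c d * of_real s ^ d) sums g s"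
    and \<rho>: "0 < \<rho>" and B: "\<And>s. s \<noteq> 0 \<Longrightarrow> \<bar>s\<bar> < \<rho> \<Longrightarrow> norm (g s) \<le> C * \<bar>s\<bar> ^ N"
  shows "d < N \<Longrightarrow> c d = 0"
proof (induction d rule: less_induct)
  case (less d)
  define f where "f s = g s / of_real s ^ d" for s
  have sums: "(\<lambda>e. c (e + d) * of_real s ^ e) sums f s" if s: "s \<noteq> 0" "\<bar>s\<bar> < r" for s
  proof -
    have "(\<Sum>e<d. c e * of_real s ^ e) = 0" using less by (intro sum.neutral) simp
    then have "(\<lambda>e. c (e + d) * of_real s ^ (e + d)) sums g s"
      using S[OF s(2)] sums_iff_shift[of "\<lambda>d. c d * of_real s ^ d" d "g s"] by simp
    from sums_divide[OF this, of "of_real s ^ d"] show ?thesis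
      using s(1) by (simp add: f_def power_add)
  qed
  have "((\<lambda>s. Re (f s)) \<longlongrightarrow> Re (c (0 + d))) (at 0)" "((\<lambda>s. Im (f s)) \<longlongrightarrow> Im (c (0 + d))) (at 0)"
    by (rule powser_limit_0_strong[OF r], use sums[THEN sums_Re] sums[THEN sums_Im] in \<open>simp flip: of_real_power\<close>)+
  then have l1: "(f \<longlongrightarrow> c d) (at 0)" by (simp add: tendsto_complex_iff)
  have "(f \<longlongrightarrow> 0) (at 0)"
  proof (rule Lim_null_comparison)
    have "norm (f s) \<le> \<bar>C\<bar> * \<bar>s\<bar>" if s: "s \<noteq> 0" "\<bar>s\<bar> < min \<rho> 1" for s
    proof -
      have "norm (f s) \<le> C * \<bar>s\<bar> ^ N / \<bar>s\<bar> ^ d"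
        using B[OF s(1)] s by (simp add: f_def norm_divide norm_power divide_right_mono)
      also have "\<dots> = C * \<bar>s\<bar> ^ (N - d)" using s(1) less.prems by (simp add: power_diff)
      also have "\<dots> \<le> \<bar>C\<bar> * \<bar>s\<bar> ^ 1"
        using power_decreasing[of 1 "N - d" "\<bar>s\<bar>"] s less.prems by (intro mult_mono) auto
      finally show ?thesis by simp
    qed
    then show "\<forall>\<^sub>F s in at 0. norm (f s) \<le> \<bar>C\<bar> * \<bar>s\<bar>"
      unfolding eventually_at using \<rho> by (intro exI[of _ "min \<rho> 1"]) (auto simp: dist_real_def)
    have "((\<lambda>s::real. \<bar>C\<bar> * \<bar>s\<bar>) \<longlongrightarrow> \<bar>C\<bar> * \<bar>0\<bar>) (at 0)" by (intro tendsto_intros)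
    then show "((\<lambda>s::real. \<bar>C\<bar> * \<bar>s\<bar>) \<longlongrightarrow> 0) (at 0)" by simp
  qed
  from tendsto_unique[OF _ l1 this] show ?case by simp
qed

section \<open>Taylor expansions on polydiscs\<close>

definition mon :: "real \<Rightarrow> real \<Rightarrow> real \<Rightarrow> real \<Rightarrow> nat \<times> nat \<times> nat \<times> nat \<Rightarrow> real" where
  "mon x y u v = (\<lambda>(i, j, m, l). x ^ i * y ^ j * u ^ m * v ^ l)"

definition cf :: "cplane \<Rightarrow> nat \<times> nat \<times> nat \<times> nat \<Rightarrow> complex" where
  "cf T = (\<lambda>(i, j, m, l). T $ i $ j $ m $ l)"

lemma mon_cf_simps [simp]: "mon x y u v (i, j, m, l) = x ^ i * y ^ j * u ^ m * v ^ l" "cf T (i, j, m, l) = T $ i $ j $ m $ l"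
  by (simp_all add: mon_def cf_def)

lemma cf_add: "cf (S + T) k = cf S k + cf T k" by (cases k) simp
lemma cf_ck: "cf (ck c * S) k = c * cf S k" by (cases k) simp

text \<open>T is the Taylor series of f on the real polydisc of radius r, with complex values, so
  that the z-component of the family can be treated as one function.\<close>

definition TS :: "(real \<Rightarrow> real \<Rightarrow> real \<Rightarrow> real \<Rightarrow> complex) \<Rightarrow> cplane \<Rightarrow> real \<Rightarrow> bool" where
  "TS f T r \<longleftrightarrow> 0 < r \<and> (\<forall>x y u v. \<bar>x\<bar> < r \<longrightarrow> \<bar>y\<bar> < r \<longrightarrow> \<bar>u\<bar> < r \<longrightarrow> \<bar>v\<bar> < r \<longrightarrow>
     ((\<lambda>k. cf T k * of_real (mon x y u v k)) has_sum f x y u v) UNIV)"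

lemma TSD: "TS f T r \<Longrightarrow> \<bar>x\<bar> < r \<Longrightarrow> \<bar>y\<bar> < r \<Longrightarrow> \<bar>u\<bar> < r \<Longrightarrow> \<bar>v\<bar> < r \<Longrightarrow>
    ((\<lambda>k. cf T k * of_real (mon x y u v k)) has_sum f x y u v) UNIV" "TS f T r \<Longrightarrow> 0 < r"
  by (auto simp: TS_def)

lemma TS_mono: "TS f T r \<Longrightarrow> 0 < s \<Longrightarrow> s \<le> r \<Longrightarrow> TS f T s"
  by (auto simp: TS_def)

lemma TS_cong: "TS f T r \<Longrightarrow> (\<And>x y u v. \<bar>x\<bar> < r \<Longrightarrow> \<bar>y\<bar> < r \<Longrightarrow> \<bar>u\<bar> < r \<Longrightarrow> \<bar>v\<bar> < r \<Longrightarrow> f x y u v = g x y u v) \<Longrightarrow> TS g T r"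
  by (simp add: TS_def)

lemma has_sum_0_first:
  fixes a :: "nat \<times> 'k \<Rightarrow> complex"
  assumes r: "0 < r" and S: "\<And>s. \<bar>s\<bar> < r \<Longrightarrow> ((\<lambda>k. a k * of_real (s ^ fst k)) has_sum 0) UNIV"
  shows "((\<lambda>k. a (i, k)) has_sum 0) UNIV"
proof -
  note g = graded_sums[of r a fst "\<lambda>_. 0", OF r S]
  have "infsum a {k. fst k = i} = 0"
    by (rule power_series_order[where c = "\<lambda>d. infsum a {k. fst k = d}" and g = "\<lambda>_. 0" and r = r and \<rho> = 1 and C = 0 and N = "Suc i"])
      (use r g(2) in auto)
  with has_sum_infsum[OF g(1)[of i]] have "(a has_sum 0) {k. fst k = i}" by simp
  moreover have "{k. fst k = i} = Pair i ` UNIV" by force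
  ultimately have "(a has_sum 0) (Pair i ` UNIV)" by metis
  then show ?thesis using has_sum_reindex[of "Pair i" UNIV a 0] by (simp add: inj_on_def o_def)
qed

text \<open>The identity theorem, one variable at a time: each application of
  \<open>has_sum_0_first\<close> fixes one exponent and leaves a vanishing sum in the remaining
  variables.\<close>

lemma TS_zero:
  assumes T: "TS f T r" and z: "\<And>x y u v. \<bar>x\<bar> < r \<Longrightarrow> \<bar>y\<bar> < r \<Longrightarrow> \<bar>u\<bar> < r \<Longrightarrow> \<bar>v\<bar> < r \<Longrightarrow> f x y u v = 0"
  shows "T = 0"
proof (rule fps4_eqI')
  fix i j m l
  note r = TSD(2)[OF T]
  have 1: "((\<lambda>k. (case k of (j, m, l) \<Rightarrow> T $ i $ j $ m $ l * of_real (y ^ j * u ^ m * v ^ l))) has_sum 0) UNIV"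
    if "\<bar>y\<bar> < r" "\<bar>u\<bar> < r" "\<bar>v\<bar> < r" for y u v i
    using has_sum_0_first[OF r, of "\<lambda>(i, j, m, l). T $ i $ j $ m $ l * of_real (y ^ j * u ^ m * v ^ l)" i]
      TSD(1)[OF T _ that] z[OF _ that] by (simp add: mon_def cf_def case_prod_unfold mult_ac)
  have 2: "((\<lambda>k. (case k of (m, l) \<Rightarrow> T $ i $ j $ m $ l * of_real (u ^ m * v ^ l))) has_sum 0) UNIV"
    if "\<bar>u\<bar> < r" "\<bar>v\<bar> < r" for u v i j
    using has_sum_0_first[OF r, of "\<lambda>(j, m, l). T $ i $ j $ m $ l * of_real (u ^ m * v ^ l)" j]
      1[OF _ that, of _ i] by (simp add: case_prod_unfold mult_ac)
  have 3: "((\<lambda>l. T $ i $ j $ m $ l * of_real (v ^ l)) has_sum 0) UNIV"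
    if "\<bar>v\<bar> < r" for v i j m
    using has_sum_0_first[OF r, of "\<lambda>(m, l). T $ i $ j $ m $ l * of_real (v ^ l)" m]
      2[OF _ that, of _ i j] by (simp add: case_prod_unfold mult_ac)
  have "T $ i $ j $ m $ l = 0"
    by (rule power_series_order[where c = "\<lambda>l. T $ i $ j $ m $ l" and g = "\<lambda>_. 0" and r = r and \<rho> = 1 and C = 0 and N = "Suc l"])
      (use r has_sum_imp_sums[OF 3[of _ i j m]] in auto)
  then show "T $ i $ j $ m $ l = (0::cplane) $ i $ j $ m $ l" by simp
qed

lemma TS_add: "TS f S r \<Longrightarrow> TS g T r \<Longrightarrow> TS (\<lambda>x y u v. f x y u v + g x y u v) (S + T) r"
  unfolding TS_def cf_add ring_distribs by (auto intro!: has_sum_add)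

lemma TS_cmult: "TS f S r \<Longrightarrow> TS (\<lambda>x y u v. c * f x y u v) (ck c * S) r"
  unfolding TS_def cf_ck mult.assoc by (auto intro!: has_sum_cmult_right)

lemma TS_minus: "TS f S r \<Longrightarrow> TS (\<lambda>x y u v. - f x y u v) (- S) r"
  using TS_cmult[of f S r "-1"] by (simp add: ck_hom)

lemma TS_diff: "TS f S r \<Longrightarrow> TS g T r \<Longrightarrow> TS (\<lambda>x y u v. f x y u v - g x y u v) (S - T) r"
  using TS_add[OF _ TS_minus, of f S r g T] by simp

lemma TS_cnj: "TS f S r \<Longrightarrow> TS (\<lambda>x y u v. cnj (f x y u v)) (cmap (cmap cnj) S) r"
proof -
  have "cf (cmap (cmap cnj) S) k * of_real t = cnj (cf S k * of_real t)" for k t by (cases k) simp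
  then show "TS f S r \<Longrightarrow> TS (\<lambda>x y u v. cnj (f x y u v)) (cmap (cmap cnj) S) r"
    unfolding TS_def by (auto simp only: has_sum_cnj_iff complex_cnj_cnj)
qed

lemma TS_single:
  assumes "0 < r" "spt (\<lambda>i j m l. i = a \<and> j = b \<and> m = 0 \<and> l = 0) T"
  shows "TS (\<lambda>x y u v. T $ a $ b $ 0 $ 0 * of_real (x ^ a * y ^ b)) T r"
  unfolding TS_def
proof (intro conjI allI impI)
  fix x y u v
  show "((\<lambda>k. cf T k * of_real (mon x y u v k)) has_sum T $ a $ b $ 0 $ 0 * of_real (x ^ a * y ^ b)) UNIV"
  proof (rule has_sum_finite_neutralI[of "{(a, b, 0, 0)}"])
    fix k :: "nat \<times> nat \<times> nat \<times> nat" assume k: "k \<in> UNIV - {(a, b, 0, 0)}"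
    obtain i j m l where e: "k = (i, j, m, l)" by (cases k) auto
    have "T $ i $ j $ m $ l = 0" by (rule sptD[OF assms(2)]) (use k e in auto)
    then show "cf T k * of_real (mon x y u v k) = 0" by (simp add: e)
  qed auto
qed (rule assms(1))

lemma TS_vars: assumes "0 < r"
  shows "TS (\<lambda>x y u v. of_real x) fps_X r" "TS (\<lambda>x y u v. of_real y) yy r" "TS (\<lambda>x y u v. c) (ck c) r"
proof -
  have "spt (\<lambda>i j m l. i = 1 \<and> j = 0 \<and> m = 0 \<and> l = 0) (fps_X :: cplane)"
    "spt (\<lambda>i j m l. i = 0 \<and> j = 1 \<and> m = 0 \<and> l = 0) (yy :: cplane)"
    "spt (\<lambda>i j m l. i = 0 \<and> j = 0 \<and> m = 0 \<and> l = 0) (ck c)"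
    by (simp_all add: spt_def fps_X_nth yy_def fps_one_nth ck_def cc_def)
  from this[THEN TS_single[OF assms]]
  show "TS (\<lambda>x y u v. of_real x) fps_X r" "TS (\<lambda>x y u v. of_real y) yy r" "TS (\<lambda>x y u v. c) (ck c) r"
    by (simp_all add: yy_def ck_def cc_def)
qed

lemma TS_sum: assumes "finite I" "0 < r" "\<And>i. i \<in> I \<Longrightarrow> TS (f i) (S i) r"
  shows "TS (\<lambda>x y u v. \<Sum>i\<in>I. f i x y u v) (\<Sum>i\<in>I. S i) r"
  using assms
proof (induction I rule: finite_induct)
  case empty
  then show ?case using TS_vars(3)[of r 0] by (simp add: ck_hom)
qed (auto intro!: TS_add)

text \<open>The finitely many ways to split an exponent into two; these sets index the Cauchy
  product.\<close>

definition spl :: "nat \<times> nat \<times> nat \<times> nat \<Rightarrow> ((nat \<times> nat \<times> nat \<times> nat) \<times> (nat \<times> nat \<times> nat \<times> nat)) set" where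
  "spl = (\<lambda>(a, b, m, l). (\<lambda>(i, j, p, q). ((i, j, p, q), (a - i, b - j, m - p, l - q))) ` ({..a} \<times> {..b} \<times> {..m} \<times> {..l}))"

text \<open>The family of all products of terms is absolutely summable, so it may be summed as a
  product of sums or regrouped by the total exponent.\<close>

lemma TS_mult:
  assumes S: "TS f S r" and T: "TS g T r"
  shows "TS (\<lambda>x y u v. f x y u v * g x y u v) (S * T) r"
  unfolding TS_def
proof (intro conjI allI impI)
  show "0 < r" by (rule TSD(2)[OF S])
  fix x y u v assume *: "\<bar>x\<bar> < r" "\<bar>y\<bar> < r" "\<bar>u\<bar> < r" "\<bar>v\<bar> < r"
  define a where "a = (\<lambda>k. cf S k * of_real (mon x y u v k))"
  define b where "b = (\<lambda>k. cf T k * of_real (mon x y u v k))"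
  let ?A = "f x y u v" and ?B = "g x y u v"
  have a: "(a has_sum ?A) UNIV" and b: "(b has_sum ?B) UNIV" using TSD(1)[OF S *] TSD(1)[OF T *] by (simp_all add: a_def b_def)
  have an: "(\<lambda>k. norm (a k)) summable_on UNIV" and bn: "(\<lambda>k. norm (b k)) summable_on UNIV"
    using a b summable_on_iff_abs_summable_on_complex by (auto simp: summable_on_def)
  define h where "h = (\<lambda>x. a (fst x) * b (snd x))"
  have "(\<lambda>x. norm (h x)) summable_on Sigma UNIV (\<lambda>_. UNIV)"
    unfolding Infinite_Sum.abs_summable_on_Sigma_iff h_def
  proof (intro conjI ballI)
    fix p show "(\<lambda>q. norm (a (fst (p, q)) * b (snd (p, q)))) summable_on UNIV"
      using summable_on_cmult_right[OF bn, of "norm (a p)"] by (simp add: norm_mult)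
  next
    have "(\<Sum>\<^sub>\<infinity>q. norm (a p) * norm (b q)) = norm (a p) * (\<Sum>\<^sub>\<infinity>q. norm (b q))" for p
      by (intro infsum_cmult_right bn)
    moreover have "0 \<le> (\<Sum>\<^sub>\<infinity>q. norm (b q))" by (rule infsum_nonneg) simp
    ultimately show "(\<lambda>p. norm (\<Sum>\<^sub>\<infinity>q. norm (a (fst (p, q)) * b (snd (p, q))))) summable_on UNIV"
      using summable_on_cmult_left[OF an, of "\<Sum>\<^sub>\<infinity>q. norm (b q)"] by (simp add: norm_mult)
  qed
  then have "h summable_on Sigma UNIV (\<lambda>_. UNIV)" by (rule Infinite_Sum.abs_summable_summable)
  then have "h summable_on UNIV" by simp
  then obtain L where L: "(h has_sum L) UNIV" by (auto simp: summable_on_def)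
  then have "(h has_sum L) (Sigma UNIV (\<lambda>_. UNIV))" by simp
  from has_sum_SigmaD[OF this, of "\<lambda>p. a p * ?B"] have "((\<lambda>p. a p * ?B) has_sum L) UNIV"
    using has_sum_cmult_right[OF b] by (simp add: h_def)
  with has_sum_cmult_left[OF a, of ?B] have L': "L = ?A * ?B" by (blast intro: has_sum_unique)
  have bij: "bij_betw snd (Sigma UNIV spl) UNIV"
  proof (rule bij_betwI[where g = "\<lambda>pq. (case pq of ((i, j, p, q), (i', j', p', q')) \<Rightarrow> (i + i', j + j', p + p', q + q'), pq)"])
    show "(\<lambda>pq. (case pq of ((i, j, p, q), (i', j', p', q')) \<Rightarrow> (i + i', j + j', p + p', q + q'), pq)) \<in> UNIV \<rightarrow> Sigma UNIV spl"
      by (auto simp: spl_def image_iff split: prod.splits)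
  qed (auto simp: spl_def)
  have H: "((\<lambda>x. h (snd x)) has_sum L) (Sigma UNIV spl)" using has_sum_reindex_bij_betw[OF bij, of h] L by simp
  have "((\<lambda>x. h (snd (k, x))) has_sum cf (S * T) k * of_real (mon x y u v k)) (spl k)" for k
  proof -
    obtain A B M L where k: "k = (A, B, M, L)" by (cases k) auto
    have "sum h (spl k) = (\<Sum>(i, j, p, q)\<in>{..A} \<times> {..B} \<times> {..M} \<times> {..L}. h ((i, j, p, q), (A - i, B - j, M - p, L - q)))"
      unfolding spl_def k by (simp only: prod.case, subst sum.reindex) (auto simp: inj_on_def case_prod_unfold)
    also have "\<dots> = (\<Sum>(i, j, p, q)\<in>{..A} \<times> {..B} \<times> {..M} \<times> {..L}. S $ i $ j $ p $ q * T $ (A - i) $ (B - j) $ (M - p) $ (L - q) * of_real (mon x y u v k))"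
    proof (rule sum.cong[OF refl])
      fix s assume s: "s \<in> {..A} \<times> {..B} \<times> {..M} \<times> {..L}"
      obtain i j p q where e: "s = (i, j, p, q)" by (cases s) auto
      have le: "i \<in> {..A}" "j \<in> {..B}" "p \<in> {..M}" "q \<in> {..L}" using s by (simp_all add: e)
      have "mon x y u v k = mon x y u v (i, j, p, q) * mon x y u v (A - i, B - j, M - p, L - q)"
      proof -
        have "x ^ A = x ^ i * x ^ (A - i)" "y ^ B = y ^ j * y ^ (B - j)" "u ^ M = u ^ p * u ^ (M - p)" "v ^ L = v ^ q * v ^ (L - q)"
          using le by (simp_all flip: power_add)
        then show ?thesis unfolding k mon_cf_simps by (simp only: mult_ac)
      qed
      then show "(case s of (i, j, p, q) \<Rightarrow> h ((i, j, p, q), (A - i, B - j, M - p, L - q))) =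
          (case s of (i, j, p, q) \<Rightarrow> S $ i $ j $ p $ q * T $ (A - i) $ (B - j) $ (M - p) $ (L - q) * of_real (mon x y u v k))"
        unfolding e h_def a_def b_def by (simp only: fst_conv snd_conv of_real_mult cf_def prod.case mult_ac)
    qed
    also have "\<dots> = cf (S * T) k * of_real (mon x y u v k)"
      unfolding k mon_cf_simps(2) mult4_nth sum.cartesian_product sum_distrib_right by (simp only: case_prod_unfold)
    finally have "sum h (spl k) = cf (S * T) k * of_real (mon x y u v k)" .
    moreover have "finite (spl k)" by (simp add: spl_def k)
    ultimately show ?thesis using has_sum_finite[of "spl k" h] by simp
  qed
  from has_sum_SigmaD[OF H this] show "((\<lambda>k. cf (S * T) k * of_real (mon x y u v k)) has_sum ?A * ?B) UNIV"
    by (simp add: L')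
qed

lemma TS_power: "TS f S r \<Longrightarrow> TS (\<lambda>x y u v. f x y u v ^ q) (S ^ q) r"
proof (induction q)
  case 0
  then show ?case using TS_vars(3)[OF TSD(2)[OF 0], of 1] by (simp add: ck_hom)
qed (auto intro: TS_mult)

lemma TS_swap:
  assumes T: "TS f T r" shows "TS (\<lambda>x y. f y x) (sw T) r"
  unfolding TS_def
proof (intro conjI allI impI)
  show "0 < r" by (rule TSD(2)[OF T])
  fix x y u v assume *: "\<bar>x\<bar> < r" "\<bar>y\<bar> < r" "\<bar>u\<bar> < r" "\<bar>v\<bar> < r"
  have "bij_betw (\<lambda>(i, j, m, l). (j, i, m, l)) (UNIV :: (nat \<times> nat \<times> nat \<times> nat) set) UNIV"
    by (rule bij_betwI[where g = "\<lambda>(i, j, m, l). (j, i, m, l)"]) auto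
  from has_sum_reindex_bij_betw[OF this, of "\<lambda>k. cf T k * of_real (mon y x u v k)"] TSD(1)[OF T *(2,1,3,4)]
  show "((\<lambda>k. cf (sw T) k * of_real (mon x y u v k)) has_sum f y x u v) UNIV"
    by (simp add: case_prod_unfold cf_def mon_def sw_nth mult_ac)
qed

text \<open>The bound need not be uniform in the parameters. On each ray s (x,y) it forces the
  homogeneous part of degree d < N to sum to 0 for fixed parameters, and \<open>TS_zero\<close> then
  kills its coefficients.\<close>

lemma TS_order:
  assumes T: "TS f T r"
    and B: "\<And>u v. \<bar>u\<bar> < r \<Longrightarrow> \<bar>v\<bar> < r \<Longrightarrow> \<exists>C. \<exists>\<rho>>0. \<forall>x y. \<bar>x\<bar> < \<rho> \<longrightarrow> \<bar>y\<bar> < \<rho> \<longrightarrow> norm (f x y u v) \<le> C * (\<bar>x\<bar> + \<bar>y\<bar>) ^ N"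
  shows "dge N T"
proof -
  note r = TSD(2)[OF T]
  have "T $ a $ b = 0" if ab: "a + b < N" for a b
  proof -
    define d where "d = a + b"
    define W :: cplane where "W = Abs_fps (\<lambda>i. Abs_fps (\<lambda>j. if i + j = d then T $ i $ j else 0))"
    have "TS (\<lambda>x y u v. 0) W r"
      unfolding TS_def
    proof (intro conjI allI impI)
      show "0 < r" by (rule r)
      fix x y u v assume *: "\<bar>x\<bar> < r" "\<bar>y\<bar> < r" "\<bar>u\<bar> < r" "\<bar>v\<bar> < r"
      define c where "c = (\<lambda>k. cf T k * of_real (mon x y u v k))"
      define deg where "deg k = (case k of (i, j, m, l) \<Rightarrow> i + j)" for k :: "nat \<times> nat \<times> nat \<times> nat"
      obtain C \<rho> where \<rho>: "\<rho> > 0" and C: "\<And>x y. \<bar>x\<bar> < \<rho> \<Longrightarrow> \<bar>y\<bar> < \<rho> \<Longrightarrow> norm (f x y u v) \<le> C * (\<bar>x\<bar> + \<bar>y\<bar>) ^ N"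
        using B[OF *(3,4)] by blast
      have S: "((\<lambda>k. c k * of_real (s ^ deg k)) has_sum f (s * x) (s * y) u v) UNIV" if s: "\<bar>s\<bar> < 1" for s
      proof -
        have le: "\<bar>s * x\<bar> < r" "\<bar>s * y\<bar> < r"
          using s *(1,2) mult_left_le_one_le[of "\<bar>x\<bar>" "\<bar>s\<bar>"] mult_left_le_one_le[of "\<bar>y\<bar>" "\<bar>s\<bar>"] by (auto simp: abs_mult)
        have "c k * of_real (s ^ deg k) = cf T k * of_real (mon (s * x) (s * y) u v k)" for k
          by (cases k) (simp add: c_def deg_def power_mult_distrib power_add)
        then show ?thesis using TSD(1)[OF T le *(3,4)] by simp
      qed
      note g = graded_sums[of 1 c deg "\<lambda>s. f (s * x) (s * y) u v", OF zero_less_one S]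
      \<comment> \<open>Since |x| and |y| are below r, this keeps s x and s y inside the region of
        the bound.\<close>
      define \<rho>' where "\<rho>' = \<rho> / r"
      have "infsum c {k. deg k = d} = 0"
      proof (rule power_series_order[where c = "\<lambda>d. infsum c {k. deg k = d}" and g = "\<lambda>s. f (s * x) (s * y) u v" and r = 1 and \<rho> = \<rho>' and C = "C * (\<bar>x\<bar> + \<bar>y\<bar>) ^ N" and N = N])
        show "0 < \<rho>'" using \<rho> r by (simp add: \<rho>'_def)
        fix s assume s: "\<bar>s\<bar> < \<rho>'"
        have "\<bar>s\<bar> * \<bar>x\<bar> \<le> \<bar>s\<bar> * r" "\<bar>s\<bar> * \<bar>y\<bar> \<le> \<bar>s\<bar> * r" using * by (auto intro!: mult_left_mono)
        moreover have "\<bar>s\<bar> * r < \<rho>" using s r by (simp add: \<rho>'_def pos_less_divide_eq)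
        ultimately have "norm (f (s * x) (s * y) u v) \<le> C * (\<bar>s * x\<bar> + \<bar>s * y\<bar>) ^ N" by (intro C) (auto simp: abs_mult)
        also have "\<dots> = C * (\<bar>x\<bar> + \<bar>y\<bar>) ^ N * \<bar>s\<bar> ^ N" by (simp add: abs_mult power_mult_distrib flip: ring_distribs)
        finally show "norm (f (s * x) (s * y) u v) \<le> C * (\<bar>x\<bar> + \<bar>y\<bar>) ^ N * \<bar>s\<bar> ^ N" .
      qed (use g(2) ab in \<open>auto simp: d_def\<close>)
      with has_sum_infsum[OF g(1)[of d]] have "(c has_sum 0) {k. deg k = d}" by simp
      also have "?this \<longleftrightarrow> ((\<lambda>k. cf W k * of_real (mon x y u v k)) has_sum 0) UNIV"
        by (rule has_sum_cong_neutral) (auto simp: c_def deg_def W_def cf_def)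
      finally show "((\<lambda>k. cf W k * of_real (mon x y u v k)) has_sum 0) UNIV" .
    qed
    from TS_zero[OF this] have "W = 0" by simp
    then have "W $ a $ b = 0" by simp
    then show ?thesis by (simp add: W_def d_def)
  qed
  then show ?thesis by (simp add: dge_def)
qed

lemma of_nat_fps_nth: "(of_nat k * (U :: 'a::comm_ring_1 fps)) $ m = of_nat k * U $ m"
  by (induction k) (simp_all add: algebra_simps)

lemma Suc_le_two_power: "real (Suc i) * (1 / 2) ^ i \<le> 1"
proof -
  have "Suc i \<le> 2 ^ i" by (induction i) auto
  then have "real (Suc i) \<le> 2 ^ i" by (metis of_nat_le_iff of_nat_numeral of_nat_power)
  then show ?thesis by (simp add: power_one_over field_simps)
qed

text \<open>The smaller radius absorbs the factor i + 1 of the differentiated series; the derivative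
  itself comes from the power series in x obtained by grading.\<close>

lemma TS_deriv:
  assumes T: "TS f T r"
  obtains g where "TS g (fps_deriv T) (r / 4)"
    "\<And>x y u v. \<bar>x\<bar> < r / 4 \<Longrightarrow> \<bar>y\<bar> < r / 4 \<Longrightarrow> \<bar>u\<bar> < r / 4 \<Longrightarrow> \<bar>v\<bar> < r / 4 \<Longrightarrow>
      ((\<lambda>s. f s y u v) has_vector_derivative g x y u v) (at x)"
proof -
  note r = TSD(2)[OF T]
  define g where "g x y u v = infsum (\<lambda>k. cf (fps_deriv T) k * of_real (mon x y u v k)) UNIV" for x y u v
  define sh where "sh k = (case k of (i, k') \<Rightarrow> (Suc i, k'))" for k :: "nat \<times> nat \<times> nat \<times> nat"
  have inj: "inj sh" by (auto simp: inj_on_def sh_def)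
  have cfd: "cf (fps_deriv T) k = of_nat (Suc (fst k)) * cf T (sh k)" for k
    by (cases k) (simp add: sh_def fps_deriv_nth2 of_nat_fps_nth del: of_nat_Suc of_nat_add)
  have TSg: "TS g (fps_deriv T) (r / 4)"
    unfolding TS_def
  proof (intro conjI allI impI)
    fix x y u v assume *: "\<bar>x\<bar> < r / 4" "\<bar>y\<bar> < r / 4" "\<bar>u\<bar> < r / 4" "\<bar>v\<bar> < r / 4"
    \<comment> \<open>The comparison series is taken at r/2, twice the bound for x, because (i + 1)
      2^(-i) \<le> 1.\<close>
    define q where "q = r / 2"
    have q: "0 < q" "\<bar>q\<bar> < r" "\<bar>x\<bar> \<le> q / 2" "\<bar>y\<bar> \<le> q" "\<bar>u\<bar> \<le> q" "\<bar>v\<bar> \<le> q" using * r by (auto simp: q_def)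
    define b where "b = (\<lambda>k. cf T k * of_real (mon q q q q k))"
    have "b summable_on UNIV" using TSD(1)[OF T, of q q q q] q(2) by (auto simp: b_def summable_on_def)
    then have "b summable_on range sh" by (rule summable_on_subset_banach) simp
    then have "(\<lambda>k. b (sh k)) summable_on UNIV" by (rule summable_on_reindex[OF inj, THEN iffD1, unfolded o_def])
    then have "(\<lambda>k. norm (b (sh k))) summable_on UNIV" by (simp add: summable_on_iff_abs_summable_on_complex)
    then have s: "(\<lambda>k. (1 / q) * norm (b (sh k))) summable_on UNIV" by (rule summable_on_cmult_right)
    have "(\<lambda>k. norm (cf (fps_deriv T) k * of_real (mon x y u v k))) summable_on UNIV"
    proof (rule Infinite_Sum.abs_summable_on_comparison_test'[OF s])
      fix k :: "nat \<times> nat \<times> nat \<times> nat"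
      obtain i j m l where k: "k = (i, j, m, l)" by (cases k) auto
      have "real (Suc i) * \<bar>x\<bar> ^ i \<le> real (Suc i) * (q / 2) ^ i" using q by (intro mult_left_mono power_mono) auto
      also have "\<dots> = (real (Suc i) * (1 / 2) ^ i) * q ^ i" by (simp add: power_divide)
      also have "\<dots> \<le> 1 * q ^ i" by (rule mult_right_mono[OF Suc_le_two_power]) (use q in simp)
      finally have 1: "real (Suc i) * \<bar>x\<bar> ^ i \<le> q ^ i" by simp
      have "real (Suc i) * \<bar>x\<bar> ^ i * \<bar>y\<bar> ^ j * \<bar>u\<bar> ^ m * \<bar>v\<bar> ^ l \<le> q ^ i * q ^ j * q ^ m * q ^ l"
      proof -
        have p: "\<bar>y\<bar> ^ j \<le> q ^ j" "\<bar>u\<bar> ^ m \<le> q ^ m" "\<bar>v\<bar> ^ l \<le> q ^ l" using q by (simp_all add: power_mono)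
        have q0: "0 \<le> q ^ e" for e using q(1) by simp
        have a1: "real (Suc i) * \<bar>x\<bar> ^ i * \<bar>y\<bar> ^ j \<le> q ^ i * q ^ j"
          by (rule mult_mono[OF 1 p(1) q0]) simp
        have a2: "real (Suc i) * \<bar>x\<bar> ^ i * \<bar>y\<bar> ^ j * \<bar>u\<bar> ^ m \<le> q ^ i * q ^ j * q ^ m"
          by (rule mult_mono[OF a1 p(2) mult_nonneg_nonneg[OF q0 q0]]) simp
        show ?thesis
          by (rule mult_mono[OF a2 p(3) mult_nonneg_nonneg[OF mult_nonneg_nonneg[OF q0 q0] q0]]) simp
      qed
      also have "\<dots> = (1 / q) * mon q q q q (sh k)" using q(1) by (simp add: k sh_def)
      finally have 2: "real (Suc i) * \<bar>x\<bar> ^ i * \<bar>y\<bar> ^ j * \<bar>u\<bar> ^ m * \<bar>v\<bar> ^ l \<le> (1 / q) * mon q q q q (sh k)" .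
      have "norm (cf (fps_deriv T) k * of_real (mon x y u v k)) = norm (cf T (sh k)) * (real (Suc i) * \<bar>x\<bar> ^ i * \<bar>y\<bar> ^ j * \<bar>u\<bar> ^ m * \<bar>v\<bar> ^ l)"
        unfolding cfd norm_mult norm_of_nat norm_of_real by (simp add: k abs_mult power_abs del: of_nat_Suc)
      also have "\<dots> \<le> norm (cf T (sh k)) * ((1 / q) * mon q q q q (sh k))" by (rule mult_left_mono[OF 2]) simp
      also have "\<dots> = (1 / q) * norm (b (sh k))" using q(1) unfolding b_def norm_mult norm_of_real by (simp add: k sh_def abs_mult)
      finally show "norm (cf (fps_deriv T) k * of_real (mon x y u v k)) \<le> (1 / q) * norm (b (sh k))" .
    qed
    then have "(\<lambda>k. cf (fps_deriv T) k * of_real (mon x y u v k)) summable_on UNIV" by (rule abs_summable_summable)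
    then show "((\<lambda>k. cf (fps_deriv T) k * of_real (mon x y u v k)) has_sum g x y u v) UNIV"
      unfolding g_def by (rule has_sum_infsum)
  qed (use r in simp)
  have "((\<lambda>s. f s y u v) has_vector_derivative g x y u v) (at x)"
    if *: "\<bar>x\<bar> < r / 4" "\<bar>y\<bar> < r / 4" "\<bar>u\<bar> < r / 4" "\<bar>v\<bar> < r / 4" for x y u v
  proof -
    define c where "c k = cf T k * of_real (mon 1 y u v k)" for k
    define c' where "c' k = cf (fps_deriv T) k * of_real (mon 1 y u v k)" for k
    define C where "C d = infsum c {k. fst k = d}" for d
    have le: "\<bar>y\<bar> < r" "\<bar>u\<bar> < r" "\<bar>v\<bar> < r" using * r by auto
    have fs: "((\<lambda>k. c k * of_real (s ^ fst k)) has_sum f s y u v) UNIV" if "\<bar>s\<bar> < r" for s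
      using TSD(1)[OF T that le] by (simp add: c_def cf_def mon_def case_prod_unfold mult_ac)
    have gs: "((\<lambda>k. c' k * of_real (s ^ fst k)) has_sum g s y u v) UNIV" if "\<bar>s\<bar> < r / 4" for s
      using TSD(1)[OF TSg that *(2-4)] by (simp add: c'_def cf_def mon_def case_prod_unfold mult_ac)
    note f = graded_sums[of r c fst "\<lambda>s. f s y u v", OF r fs]
    have g: "(\<lambda>d. infsum c' {k. fst k = d} * of_real x ^ d) sums g x y u v"
      using graded_sums(2)[of "r/4" c' fst "\<lambda>s. g s y u v" x, OF _ gs *(1)] r by simp
    have C': "infsum c' {k. fst k = d} = diffs C d" for d
    proof -
      have e: "{k. fst k = Suc d} = sh ` {k. fst k = d}" by (auto simp: sh_def image_iff)
      have "C (Suc d) = infsum (c \<circ> sh) {k. fst k = d}"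
        unfolding C_def e by (rule infsum_reindex) (use inj in \<open>auto simp: inj_on_def\<close>)
      moreover have "infsum c' {k. fst k = d} = infsum (\<lambda>k. of_nat (Suc d) * (c \<circ> sh) k) {k. fst k = d}"
        by (rule infsum_cong) (auto simp: c'_def cfd c_def sh_def)
      moreover have "\<dots> = of_nat (Suc d) * infsum (c \<circ> sh) {k. fst k = d}" by (rule infsum_cmult_right')
      ultimately show ?thesis by (simp add: diffs_def)
    qed
    have sm: "summable (\<lambda>n. C n * z ^ n)" if "norm z < r" for z :: complex
    proof -
      have zr: "norm z < r" by (rule that)
      obtain s where zs: "norm z < s" "s < r" using dense[OF zr] by blast
      then have "0 \<le> s" using norm_ge_zero[of z] by linarith
      with zs have s: "\<bar>s\<bar> < r" and s2: "norm z < \<bar>s\<bar>" by simp_all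
      have "summable (\<lambda>n. C n * of_real s ^ n)" using f(2)[OF _ s] by (auto simp: C_def sums_iff)
      then show ?thesis by (rule powser_inside) (use s2 in simp)
    qed
    have xr: "norm (complex_of_real x) < r" using * r by simp
    have "((\<lambda>z. \<Sum>n. C n * z ^ n) has_field_derivative (\<Sum>n. diffs C n * of_real x ^ n)) (at (complex_of_real x))"
      by (rule termdiffs_strong'[OF sm xr])
    from has_vector_derivative_real_field[OF this]
    have "((\<lambda>s. \<Sum>n. C n * of_real s ^ n) has_vector_derivative g x y u v) (at x)"
      using g by (simp add: C' sums_iff)
    then show ?thesis
    proof (rule has_vector_derivative_transform_within_open)
      show "open {-r<..<r}" "x \<in> {-r<..<r}" using * r by auto
      fix s assume "s \<in> {-r<..<r}"
      then show "(\<Sum>n. C n * of_real s ^ n) = f s y u v" using f(2)[of s] by (auto simp: C_def sums_iff abs_less_iff)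
    qed
  qed
  with TSg that show thesis by blast
qed

lemma dY_sw: "dY T = sw (fps_deriv (sw (T :: cplane)))"
  by (rule fps2_eqI) (simp add: dY_nth fps_deriv_nth2 sw_nth)

lemma TS_dY:
  assumes T: "TS f T r"
  obtains g where "TS g (dY T) (r / 4)"
    "\<And>x y u v. \<bar>x\<bar> < r / 4 \<Longrightarrow> \<bar>y\<bar> < r / 4 \<Longrightarrow> \<bar>u\<bar> < r / 4 \<Longrightarrow> \<bar>v\<bar> < r / 4 \<Longrightarrow>
      ((\<lambda>s. f x s u v) has_vector_derivative g x y u v) (at y)"
proof -
  obtain g where "TS g (fps_deriv (sw T)) (r / 4)" and
    "\<And>x y u v. \<bar>x\<bar> < r / 4 \<Longrightarrow> \<bar>y\<bar> < r / 4 \<Longrightarrow> \<bar>u\<bar> < r / 4 \<Longrightarrow> \<bar>v\<bar> < r / 4 \<Longrightarrow>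
      ((\<lambda>s. f y s u v) has_vector_derivative g x y u v) (at x)"
    using TS_deriv[OF TS_swap[OF T]] by metis
  with TS_swap[of g "fps_deriv (sw T)" "r / 4"] show thesis
    by (intro that[of "\<lambda>x y. g y x"]) (auto simp: dY_sw)
qed

lemma TS_at_0:
  assumes T: "TS f T r"
  shows "f 0 0 0 0 = T $ 0 $ 0 $ 0 $ 0"
proof -
  have "((\<lambda>k. cf T k * of_real (mon 0 0 0 0 k)) has_sum T $ 0 $ 0 $ 0 $ 0) UNIV"
    by (rule has_sum_finite_neutralI[of "{(0, 0, 0, 0)}"]) (auto simp: mon_def zero_power split: prod.splits)
  with TSD(1)[OF T, of 0 0 0 0] TSD(2)[OF T] show ?thesis by (auto intro: has_sum_unique)
qed

lemma has_taylor_plane_TS: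
  assumes "has_taylor_plane f T"
  obtains r where "TS (\<lambda>x y u v. of_real (f (u, v) (Complex x y))) (cP T) r"
proof -
  obtain r where r: "r > 0" and S: "\<And>p z. norm p < r \<Longrightarrow> norm z < r \<Longrightarrow>
     ((\<lambda>(i, j, m, l). T $ i $ j $ m $ l * Re z ^ i * Im z ^ j * fst p ^ m * snd p ^ l) has_sum f p z) UNIV"
    using assms unfolding has_taylor_plane_def by blast
  have "TS (\<lambda>x y u v. of_real (f (u, v) (Complex x y))) (cP T) (r / 2)"
    unfolding TS_def
  proof (intro conjI allI impI)
    fix x y u v :: real assume "\<bar>x\<bar> < r / 2" "\<bar>y\<bar> < r / 2" "\<bar>u\<bar> < r / 2" "\<bar>v\<bar> < r / 2"
    then have "norm (u, v) < r" "norm (Complex x y) < r"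
      using norm_Pair_le[of u v] cmod_le[of "Complex x y"] by auto
    from has_sum_of_real[OF S[OF this]] show "((\<lambda>k. cf (cP T) k * of_real (mon x y u v k)) has_sum of_real (f (u, v) (Complex x y))) UNIV"
      by (simp add: cf_def mon_def case_prod_unfold mult_ac)
  qed (use r in simp)
  then show thesis by (rule that)
qed

text \<open>A function of the parameters is expanded twice: in the parameter slots, as a coefficient
  of the family, and in the plane slots, where the derivative lemmas apply to it.\<close>

lemma has_taylor_par_TS:
  assumes "has_taylor_par f A"
  obtains r where "TS (\<lambda>x y u v. of_real (f (u, v))) (cc (cmap of_real A)) r" "TS (\<lambda>x y u v. of_real (f (x, y))) (cmap cc (cmap of_real A)) r"
proof -
  obtain r where r: "r > 0" and S: "\<And>p. norm p < r \<Longrightarrow> ((\<lambda>(m, l). A $ m $ l * fst p ^ m * snd p ^ l) has_sum f p) UNIV"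
    using assms unfolding has_taylor_par_def by blast
  have S': "((\<lambda>(m, l). of_real (A $ m $ l) * of_real (u ^ m * v ^ l)) has_sum complex_of_real (f (u, v))) UNIV"
    if "\<bar>u\<bar> < r / 2" "\<bar>v\<bar> < r / 2" for u v
  proof -
    have "norm (u, v) < r" using norm_Pair_le[of u v] that by auto
    from has_sum_of_real[OF S[OF this]] show ?thesis by (simp add: case_prod_unfold mult_ac)
  qed
  have 1: "TS (\<lambda>x y u v. of_real (f (u, v))) (cc (cmap of_real A)) (r / 2)"
    unfolding TS_def
  proof (intro conjI allI impI)
    fix x y u v :: real assume *: "\<bar>u\<bar> < r / 2" "\<bar>v\<bar> < r / 2"
    define h where "h = (\<lambda>k. cf (cc (cmap of_real A)) k * of_real (mon x y u v k))"
    have "((h \<circ> (\<lambda>(m, l). (0, 0, m, l))) has_sum complex_of_real (f (u, v))) UNIV"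
      using S'[OF *] by (simp add: h_def o_def case_prod_unfold cc_nth cf_def mon_def)
    then have "(h has_sum complex_of_real (f (u, v))) ((\<lambda>(m, l). (0, 0, m, l)) ` UNIV)"
      by (subst has_sum_reindex) (auto simp: inj_on_def)
    also have "?this \<longleftrightarrow> (h has_sum complex_of_real (f (u, v))) UNIV"
      by (rule has_sum_cong_neutral) (auto simp: h_def cf_def cc_nth image_iff split: prod.splits)
    finally show "(h has_sum complex_of_real (f (u, v))) UNIV" .
  qed (use r in simp)
  have 2: "TS (\<lambda>x y u v. of_real (f (x, y))) (cmap cc (cmap of_real A)) (r / 2)"
    unfolding TS_def
  proof (intro conjI allI impI)
    fix x y u v :: real assume *: "\<bar>x\<bar> < r / 2" "\<bar>y\<bar> < r / 2"
    define h where "h = (\<lambda>k. cf (cmap cc (cmap of_real A)) k * of_real (mon x y u v k))"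
    have "((h \<circ> (\<lambda>(m, l). (m, l, 0, 0))) has_sum complex_of_real (f (x, y))) UNIV"
      using S'[OF *] by (simp add: h_def o_def case_prod_unfold cc_nth cf_def mon_def)
    then have "(h has_sum complex_of_real (f (x, y))) ((\<lambda>(m, l). (m, l, 0, 0)) ` UNIV)"
      by (subst has_sum_reindex) (auto simp: inj_on_def)
    also have "?this \<longleftrightarrow> (h has_sum complex_of_real (f (x, y))) UNIV"
      by (rule has_sum_cong_neutral) (auto simp: h_def cf_def cc_nth image_iff split: prod.splits)
    finally show "(h has_sum complex_of_real (f (x, y))) UNIV" .
  qed (use r in simp)
  from that[OF 1 2] show thesis .
qed

lemma TS_has_taylor_par:
  assumes T: "TS (\<lambda>x y u v. of_real (f (u, v))) (cc (cmap of_real A)) r"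
  shows "has_taylor_par f A"
  unfolding has_taylor_par_def
proof (intro exI[of _ r] conjI allI impI)
  show "0 < r" by (rule TSD(2)[OF T])
  fix p :: "real \<times> real" assume p: "norm p < r"
  obtain u v where uv: "p = (u, v)" by (cases p)
  have "\<bar>u\<bar> < r" "\<bar>v\<bar> < r" using p norm_fst_le[of u v] norm_snd_le[of v u] by (auto simp: uv)
  define h where "h = (\<lambda>k. cf (cc (cmap of_real A)) k * of_real (mon 0 0 u v k))"
  have "(h has_sum complex_of_real (f (u, v))) UNIV"
    using TSD(1)[OF T, of 0 0 u v] \<open>0 < r\<close> \<open>\<bar>u\<bar> < r\<close> \<open>\<bar>v\<bar> < r\<close> by (simp add: h_def)
  also have "?this \<longleftrightarrow> (h has_sum complex_of_real (f (u, v))) ((\<lambda>(m, l). (0, 0, m, l)) ` UNIV)"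
    by (rule has_sum_cong_neutral) (auto simp: h_def cf_def cc_nth image_iff split: prod.splits)
  also have "\<dots> \<longleftrightarrow> ((h \<circ> (\<lambda>(m, l). (0, 0, m, l))) has_sum complex_of_real (f (u, v))) UNIV"
    by (rule has_sum_reindex) (auto simp: inj_on_def)
  finally have "((\<lambda>p. complex_of_real (A $ fst p $ snd p * u ^ fst p * v ^ snd p)) has_sum complex_of_real (f (u, v))) UNIV"
    by (simp add: h_def o_def case_prod_unfold cc_nth cf_def mon_def mult_ac)
  from this[unfolded has_sum_of_real_iff] show "((\<lambda>(m, l). A $ m $ l * fst p ^ m * snd p ^ l) has_sum f p) UNIV"
    unfolding uv by (simp add: case_prod_unfold)
qed

section \<open>Changing the parameters\<close>

text \<open>Moves a parameter series into the plane slots, so that results on plane maps serve for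
  changes of parameters.\<close>

definition lft :: "'a::comm_ring_1 fps fps \<Rightarrow> 'a fps fps fps fps" where "lft = cmap cc"

lemma rhom_cc: "rhom (cc :: 'a::comm_ring_1 \<Rightarrow> 'a fps fps)"
  by (simp add: rhom_def cc_add cc_mult)

lemma lft_subst2: "lft (subst2 G X Y) = subst2 (lft G) (lft X) (lft Y)"
  unfolding lft_def by (rule cmap_subst2[OF rhom_cc])

lemma vge_minus': "vge k T \<Longrightarrow> vge k (- T)"
  by (auto simp: vge_def spt_def)

text \<open>Pullback by a map tangent to the identity differs from the identity by an operator
  raising the total order; iterating S + (T - f*S) inverts it.\<close>

lemma pb_lin_surj:
  assumes f: "vanishes_at_origin f" and u: "vge 2 (fst f - fps_X)" "vge 2 (snd f - yy)"
  shows "\<exists>S. pb f S = T" "pb f S = pb f S' \<Longrightarrow> S = S'"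
proof -
  have fd: "vge (k + 1) (pb f Y - Y)" if "vge k Y" for k Y
  proof -
    have "vge 2 (fst f - fst fid)" "vge 2 (snd f - snd fid)" using u by (simp_all add: fid_eq)
    from pb_diff_vge[OF f fid_canon(2) this that] show ?thesis by simp
  qed
  define G where "G k = ((\<lambda>S. S + (T - pb f S)) ^^ k) T" for k
  have r: "vge (k + 1) (T - pb f (G k))" for k
  proof (induction k)
    case 0
    have "vge (0 + 1) (- (pb f T - T))" by (rule vge_minus'[OF fd]) simp
    then show ?case by (simp add: G_def)
  next
    case (Suc k)
    have e: "T - pb f (G (Suc k)) = - (pb f (T - pb f (G k)) - (T - pb f (G k)))"
      by (simp add: G_def pb_ring[OF f])
    from vge_minus'[OF fd[OF Suc]] show ?case unfolding e[symmetric] by simp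
  qed
  have "vge (k + 1) (G (Suc k) - G k)" for k using r[of k] by (simp add: G_def)
  then obtain L where L: "\<And>k. vge (k + 1) (L - G k)"
  proof (rule vge_limit[where f = "\<lambda>k. k + 1"])
    show "mono (\<lambda>k::nat. k + 1)" by (simp add: mono_def)
    show "\<exists>k. N \<le> k + 1" for N :: nat by (rule exI[of _ N]) simp
  qed auto
  have "pb f L = T"
  proof (rule vge_eqI)
    fix k
    have "vge (k + 1) (pb f (L - G k))" by (rule pb_vge[OF f L])
    from vge_diff[OF this r[of k]] have "vge (k + 1) (pb f L - T)" by (simp add: pb_ring[OF f])
    then show "vge k (pb f L - T)" by (rule vge_mono) simp
  qed
  then show "\<exists>S. pb f S = T" by blast
  assume e: "pb f S = pb f S'"
  have "vge k (S - S')" for k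
  proof (induction k)
    case (Suc k)
    from vge_minus'[OF fd[OF Suc]] show ?case by (simp add: pb_ring[OF f] e)
  qed simp
  then show "S = S'" by (rule vge_eqI)
qed

definition lcomb :: "real \<Rightarrow> real \<Rightarrow> par_series" where
  "lcomb a b = cc a * fps_X + cc b * yy"

lemma lcomb_dge: "dge 1 (lcomb a b)"
  by (simp add: dge_1_iff lcomb_def yy_def)

lemma lcomb_subst: "dge 1 X \<Longrightarrow> dge 1 Y \<Longrightarrow> subst2 (lcomb a b) X Y = cc a * X + cc b * Y"
  by (simp add: lcomb_def subst2_add subst2_mult subst2_cc subst2_X subst2_Y)

lemma lcomb_lcomb: "cc a * lcomb p q + cc b * lcomb r s = lcomb (a * p + b * r) (a * q + b * s)"
  by (simp add: lcomb_def cc_add cc_mult algebra_simps)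

lemma lcomb_01: "lcomb 1 0 = fps_X" "lcomb 0 1 = yy" by (simp_all add: lcomb_def)

lemma cc_lin: "cc a * (cc p * D + cc q * N) + cc b * (cc r * D + cc s * N) = cc (a * p + b * r) * D + cc (a * q + b * s) * (N :: par_series)"
  by (simp add: cc_add cc_mult algebra_simps)

text \<open>The formal inverse function theorem in the parameters: the linear part of (D,N) is split
  off by the inverse matrix (P,Q), and the rest (X,Y) is tangent to the identity.\<close>

lemma par_bij:
  fixes D N :: par_series
  assumes d: "D $ 0 $ 0 = 0" "N $ 0 $ 0 = 0" and det: "D $ 1 $ 0 * N $ 0 $ 1 - D $ 0 $ 1 * N $ 1 $ 0 \<noteq> 0"
  shows "\<exists>S. subst2 S D N = T" "subst2 S D N = subst2 S' D N \<Longrightarrow> S = S'"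
proof -
  define \<Delta> where "\<Delta> = D $ 1 $ 0 * N $ 0 $ 1 - D $ 0 $ 1 * N $ 1 $ 0"
  define P where "P = lcomb (N $ 0 $ 1 / \<Delta>) (- D $ 0 $ 1 / \<Delta>)"
  define Q where "Q = lcomb (- N $ 1 $ 0 / \<Delta>) (D $ 1 $ 0 / \<Delta>)"
  define P' where "P' = lcomb (D $ 1 $ 0) (D $ 0 $ 1)"
  define Q' where "Q' = lcomb (N $ 1 $ 0) (N $ 0 $ 1)"
  have DN: "dge 1 D" "dge 1 N" using d by (simp_all add: dge_1_iff)
  have \<Delta>0: "\<Delta> \<noteq> 0" using det by (simp add: \<Delta>_def)
  have s1: "N $ 0 $ 1 / \<Delta> * D $ 1 $ 0 + - D $ 0 $ 1 / \<Delta> * N $ 1 $ 0 = 1" "N $ 0 $ 1 / \<Delta> * D $ 0 $ 1 + - D $ 0 $ 1 / \<Delta> * N $ 0 $ 1 = 0"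
    "- N $ 1 $ 0 / \<Delta> * D $ 1 $ 0 + D $ 1 $ 0 / \<Delta> * N $ 1 $ 0 = 0" "- N $ 1 $ 0 / \<Delta> * D $ 0 $ 1 + D $ 1 $ 0 / \<Delta> * N $ 0 $ 1 = 1"
    using \<Delta>0 by (simp_all add: field_simps) (simp_all add: \<Delta>_def algebra_simps)
  have s2: "D $ 1 $ 0 * (N $ 0 $ 1 / \<Delta>) + D $ 0 $ 1 * (- N $ 1 $ 0 / \<Delta>) = 1" "D $ 1 $ 0 * (- D $ 0 $ 1 / \<Delta>) + D $ 0 $ 1 * (D $ 1 $ 0 / \<Delta>) = 0"
    "N $ 1 $ 0 * (N $ 0 $ 1 / \<Delta>) + N $ 0 $ 1 * (- N $ 1 $ 0 / \<Delta>) = 0" "N $ 1 $ 0 * (- D $ 0 $ 1 / \<Delta>) + N $ 0 $ 1 * (D $ 1 $ 0 / \<Delta>) = 1"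
    using \<Delta>0 by (simp_all add: field_simps) (simp_all add: \<Delta>_def algebra_simps)
  have PQ: "dge 1 P" "dge 1 Q" "dge 1 P'" "dge 1 Q'" unfolding P_def Q_def P'_def Q'_def by (rule lcomb_dge)+
  have inv: "subst2 P P' Q' = fps_X" "subst2 Q P' Q' = yy"
    unfolding P_def Q_def lcomb_subst[OF PQ(3,4)] unfolding P'_def Q'_def lcomb_lcomb s1 lcomb_01 by (rule refl)+
  define X where "X = subst2 P D N"
  define Y where "Y = subst2 Q D N"
  have XY: "X = cc (N $ 0 $ 1 / \<Delta>) * D + cc (- D $ 0 $ 1 / \<Delta>) * N" "Y = cc (- N $ 1 $ 0 / \<Delta>) * D + cc (D $ 1 $ 0 / \<Delta>) * N"
    unfolding X_def Y_def P_def Q_def by (simp_all only: lcomb_subst[OF DN])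
  have XYd: "dge 1 X" "dge 1 Y" unfolding X_def Y_def by (rule subst2_dge[OF DN PQ(1)], rule subst2_dge[OF DN PQ(2)])
  have D: "subst2 P' X Y = D" "subst2 Q' X Y = N"
    unfolding P'_def Q'_def lcomb_subst[OF XYd] unfolding XY cc_lin s2 by simp_all
  define f where "f = (lft X, lft Y)"
  have low: "X $ 0 $ 0 = 0" "X $ 1 $ 0 = 1" "X $ 0 $ 1 = 0" "Y $ 0 $ 0 = 0" "Y $ 1 $ 0 = 0" "Y $ 0 $ 1 = 1"
    unfolding XY fps_add_nth cc_mult_nth s1 d by simp_all
  have fv: "vanishes_at_origin f" using low by (simp add: f_def vanishes_at_origin_def lft_def)
  have v: "vge 2 (fst f - fps_X)" "vge 2 (snd f - yy)"
  proof -
    have "(lft X - fps_X) $ i $ j $ m $ l = 0 \<and> (lft Y - yy) $ i $ j $ m $ l = 0" if "i + j + m + l < 2" for i j m l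
    proof -
      consider "i = 0" "j = 0" | "i = 1" "j = 0" "m = 0" "l = 0" | "i = 0" "j = 1" "m = 0" "l = 0" using \<open>i + j + m + l < 2\<close> by linarith
      then show ?thesis using low by cases (auto simp: lft_def yy_def fps_X_nth cc_nth)
    qed
    then show "vge 2 (fst f - fps_X)" "vge 2 (snd f - yy)" unfolding f_def fst_conv snd_conv by (auto intro!: vgeI)
  qed
  define ul :: "plane_series \<Rightarrow> par_series" where "ul = cmap (\<lambda>c. c $ 0 $ 0)"
  have rul: "rhom (\<lambda>c :: par_series. c $ 0 $ 0)" by (simp add: rhom_def)
  have ulft: "ul (lft G) = G" for G by (rule fps2_eqI) (simp add: ul_def lft_def cc_nth)
  have sXY: "\<exists>S. subst2 S X Y = T" for T
  proof -
    obtain S where "pb f S = lft T" using pb_lin_surj(1)[OF fv v] by blast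
    then have "ul (subst2 S (lft X) (lft Y)) = T" by (simp add: pb_def f_def ulft)
    then have "subst2 (ul S) X Y = T" unfolding ul_def cmap_subst2[OF rul] by (simp add: ul_def[symmetric] ulft)
    then show ?thesis by blast
  qed
  have iXY: "S = S'" if "subst2 S X Y = subst2 S' X Y" for S S'
  proof -
    have "pb f (lft S) = pb f (lft S')" using that by (simp add: pb_def f_def flip: lft_subst2)
    from pb_lin_surj(2)[OF fv v this] show ?thesis by (metis ulft)
  qed
  have e1: "subst2 S D N = subst2 (subst2 S P' Q') X Y" for S unfolding subst2_assoc[OF PQ(3,4) XYd] D ..
  show "\<exists>S. subst2 S D N = T"
  proof -
    obtain U where U: "subst2 U X Y = T" using sXY by blast
    have "subst2 (subst2 U P Q) P' Q' = U" unfolding subst2_assoc[OF PQ(1,2,3,4)] inv by (rule subst2_id)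
    then show ?thesis unfolding e1 using U by metis
  qed
  assume "subst2 S D N = subst2 S' D N"
  then have "subst2 S P' Q' = subst2 S' P' Q'" unfolding e1 by (rule iXY)
  then have "subst2 (subst2 S P' Q') P Q = subst2 (subst2 S' P' Q') P Q" by simp
  moreover have "subst2 P' P Q = fps_X" "subst2 Q' P Q = yy"
    unfolding P'_def Q'_def lcomb_subst[OF PQ(1,2)] unfolding P_def Q_def lcomb_lcomb s2 lcomb_01 by (rule refl)+
  ultimately show "S = S'" unfolding subst2_assoc[OF PQ(3,4,1,2)] by (simp add: subst2_id)
qed

lemma cpar_inj:
  fixes D N :: par_series and S S' :: "complex fps fps"
  assumes inj: "\<And>S S'. subst2 S D N = subst2 S' D N \<Longrightarrow> S = S'" and d: "dge 1 D" "dge 1 N"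
    and eq: "subst2 S (cmap of_real D) (cmap of_real N) = subst2 S' (cmap of_real D) (cmap of_real N)"
  shows "S = S'"
proof -
  have c: "(cmap of_real D ^ i * cmap of_real N ^ j) $ a $ b = complex_of_real ((D ^ i * N ^ j) $ a $ b)" for i j a b
    by (simp flip: cmap_nth add: rhomD[OF rhom_cmap[OF rhom_of_real(1)]])
  have R: "subst2 (cmap Re S) D N = cmap Re (subst2 S (cmap of_real D) (cmap of_real N))"
    "subst2 (cmap Im S) D N = cmap Im (subst2 S (cmap of_real D) (cmap of_real N))" for S
    by (rule fps2_eqI, simp add: subst2_nth c Re_sum Im_sum)+
  have "cmap Re S = cmap Re S'" "cmap Im S = cmap Im S'" by (rule inj, simp add: R eq)+
  then have "Re (S $ i $ j) = Re (S' $ i $ j) \<and> Im (S $ i $ j) = Im (S' $ i $ j)" for i j by (metis cmap_nth)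
  then show ?thesis by (intro fps2_eqI) (simp add: complex_eq_iff)
qed

text \<open>Both partial derivatives of A are multiples of A, so if A has order k they have order k,
  and A without constant term has order k + 1.\<close>

lemma exp_ode_unique:
  fixes A D :: "complex fps fps"
  assumes 1: "fps_deriv A = cc (- \<i>) * fps_deriv D * A" and 2: "dY A = cc (- \<i>) * dY D * A" and 0: "A $ 0 $ 0 = 0"
  shows "A = 0"
proof -
  have "dge k A" for k
  proof (induction k)
    case (Suc k)
    have m: "dge k (cc (- \<i>) * U * A)" for U using dge_mult[of 0 "cc (- \<i>) * U" k A] Suc by simp
    have "A $ a $ b = 0" if "a + b < Suc k" for a b
    proof (cases a)
      case (Suc a')
      have "fps_deriv A $ a' $ b = 0" using m[of "fps_deriv D"] that Suc unfolding 1[symmetric] dge_def by simp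
      then show ?thesis using Suc by (simp add: fps_deriv_nth2 del: of_nat_add of_nat_Suc)
    next
      case a0: 0
      show ?thesis
      proof (cases b)
        case 0 with a0 assms(3) show ?thesis by simp
      next
        case (Suc b')
        have "dY A $ a $ b' = 0" using m[of "dY D"] that Suc unfolding 2[symmetric] dge_def by simp
        then show ?thesis using Suc by (simp add: dY_nth del: of_nat_add of_nat_Suc)
      qed
    qed
    then show ?case by (simp add: dge_def)
  qed simp
  then show ?thesis by (intro fps2_eqI) (metis dge_def fps_zero_nth lessI)
qed

lemma eventually_box:
  assumes "\<forall>\<^sub>F p in nhds (0::real, 0::real). P p"
  obtains \<rho> where "0 < \<rho>" "\<And>u v. \<bar>u\<bar> < \<rho> \<Longrightarrow> \<bar>v\<bar> < \<rho> \<Longrightarrow> P (u, v)"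
proof -
  obtain d where d: "0 < d" "\<And>p. dist p (0, 0) < d \<Longrightarrow> P p" using assms unfolding eventually_nhds_metric by blast
  show thesis
  proof (rule that[of "d / 2"])
    fix u v assume "\<bar>u\<bar> < d / 2" "\<bar>v\<bar> < d / 2"
    then have "norm (u, v) < d" using norm_Pair_le[of u v] by auto
    then show "P (u, v)" by (intro d(2)) (simp add: dist_norm flip: zero_prod_def)
  qed (use d in simp)
qed

lemma cc_complex: "cc (cmap of_real P + cc \<i> * cmap of_real Q) = cc (cmap of_real P) + ck \<i> * cc (cmap of_real Q)"
  by (simp add: cc_add cc_mult ck_def)

lemma analytic_par_complex_TS:
  assumes "analytic_par_complex g"
  obtains r A where "TS (\<lambda>x y u v. g (u, v)) (cc A) r" "TS (\<lambda>x y u v. g (x, y)) (lft A) r"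
proof -
  obtain P Q where P: "has_taylor_par (\<lambda>p. Re (g p)) P" and Q: "has_taylor_par (\<lambda>p. Im (g p)) Q"
    using assms by (auto simp: analytic_par_complex_def analytic_par_def)
  obtain r where r: "TS (\<lambda>x y u v. of_real (Re (g (u, v)))) (cc (cmap of_real P)) r" "TS (\<lambda>x y u v. of_real (Re (g (x, y)))) (cmap cc (cmap of_real P)) r"
    by (rule has_taylor_par_TS[OF P])
  obtain s where s: "TS (\<lambda>x y u v. of_real (Im (g (u, v)))) (cc (cmap of_real Q)) s" "TS (\<lambda>x y u v. of_real (Im (g (x, y)))) (cmap cc (cmap of_real Q)) s"
    by (rule has_taylor_par_TS[OF Q])
  let ?m = "min r s"
  have m: "0 < ?m" "?m \<le> r" "?m \<le> s" using TSD(2)[OF r(1)] TSD(2)[OF s(1)] by auto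
  have e: "g p = of_real (Re (g p)) + \<i> * of_real (Im (g p))" for p by (simp add: complex_eq_iff)
  have l: "lft (cmap of_real P + cc \<i> * cmap of_real Q) = cmap cc (cmap of_real P) + ck \<i> * cmap cc (cmap of_real Q)"
    unfolding lft_def by (simp add: rhomD[OF rhom_cmap[OF rhom_cc]] cmap_vars[OF rhom_cc] ck_def)
  have "TS (\<lambda>x y u v. g (u, v)) (cc (cmap of_real P + cc \<i> * cmap of_real Q)) ?m"
    unfolding cc_complex by (subst e, intro TS_add TS_cmult TS_mono[OF r(1) m(1,2)] TS_mono[OF s(1) m(1,3)])
  moreover have "TS (\<lambda>x y u v. g (x, y)) (lft (cmap of_real P + cc \<i> * cmap of_real Q)) ?m"
    unfolding l by (subst e, intro TS_add TS_cmult TS_mono[OF r(2) m(1,2)] TS_mono[OF s(2) m(1,3)])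
  ultimately show thesis by (rule that)
qed

section \<open>Reading the formal hypotheses off the analytic family\<close>

lemma poly_tail:
  fixes q :: "complex poly"
  shows "\<exists>C\<ge>0. \<forall>w. norm w \<le> 1 \<longrightarrow> norm (poly q w - (\<Sum>l\<le>n. coeff q l * w ^ l)) \<le> C * norm w ^ (n + 1)"
proof -
  define d where "d = degree q + n"
  have "norm (poly q w - (\<Sum>l\<le>n. coeff q l * w ^ l)) \<le> (\<Sum>l\<in>{n<..d}. norm (coeff q l)) * norm w ^ (n + 1)" if w: "norm w \<le> 1" for w
  proof -
    have "poly q w = (\<Sum>l\<le>d. coeff q l * w ^ l)"
      unfolding poly_altdef by (rule sum.mono_neutral_left) (auto simp: d_def coeff_eq_0)
    also have "{..d} = {..n} \<union> {n<..d}" by (auto simp: d_def)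
    also have "(\<Sum>l\<in>{..n} \<union> {n<..d}. coeff q l * w ^ l) = (\<Sum>l\<le>n. coeff q l * w ^ l) + (\<Sum>l\<in>{n<..d}. coeff q l * w ^ l)"
      by (rule sum.union_disjoint) auto
    finally have "norm (poly q w - (\<Sum>l\<le>n. coeff q l * w ^ l)) = norm (\<Sum>l\<in>{n<..d}. coeff q l * w ^ l)" by simp
    also have "\<dots> \<le> (\<Sum>l\<in>{n<..d}. norm (coeff q l) * norm w ^ (n + 1))"
    proof (rule sum_norm_le)
      fix l assume "l \<in> {n<..d}"
      then have "norm w ^ l \<le> norm w ^ (n + 1)" by (intro power_decreasing w) auto
      then show "norm (coeff q l * w ^ l) \<le> norm (coeff q l) * norm w ^ (n + 1)"
        unfolding norm_mult norm_power by (rule mult_left_mono) simp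
    qed
    finally show ?thesis by (simp add: sum_distrib_right)
  qed
  then show ?thesis by (intro exI[of _ "\<Sum>l\<in>{n<..d}. norm (coeff q l)"]) (auto intro: sum_nonneg)
qed

lemma subst2_sum: "finite I \<Longrightarrow> subst2 (\<Sum>i\<in>I. f i) X Y = (\<Sum>i\<in>I. subst2 (f i) X Y)"
  by (induction I rule: finite_induct) (simp_all add: subst2_add)

lemma XY_power_nth: "((fps_X * yy) ^ q * Z) $ a $ b = (if a < q \<or> b < q then 0 else Z $ (a - q) $ (b - q))" for Z :: cplane
proof (induction q arbitrary: a b)
  case (Suc q)
  have e: "(fps_X * yy) ^ Suc q * Z = fps_X * yy * ((fps_X * yy) ^ q * Z)" by (simp add: mult_ac)
  show ?case unfolding e pn by (auto simp: Suc.IH)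
qed simp

text \<open>The error bound holds for each parameter value separately, which \<open>TS_order\<close>
  turns into agreement of Taylor series up to degree n, parameters included.\<close>

lemma complex_coefficients:
  assumes n: "5 \<le> n" and Z: "TS (\<lambda>x y u v. F (u, v) (Complex x y)) Z r"
    and A: "\<And>l. l \<le> n \<Longrightarrow> TS (\<lambda>x y u v. coeff (a (u, v)) l) (cc (ac l)) r"
    and B: "\<And>l. l \<le> n \<Longrightarrow> TS (\<lambda>x y u v. coeff (b (u, v)) l) (cc (bc l)) r"
    and form: "\<And>u v. \<bar>u\<bar> < r \<Longrightarrow> \<bar>v\<bar> < r \<Longrightarrow> (\<lambda>z. F (u, v) z - (poly (a (u, v)) (z * cnj z) * z + poly (b (u, v)) (z * cnj z) * cnj z ^ (n - 1)))
            \<in> O[at 0](\<lambda>z. of_real (norm z ^ (n + 1)))"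
    and F0: "\<And>u v. \<bar>u\<bar> < r \<Longrightarrow> \<bar>v\<bar> < r \<Longrightarrow> F (u, v) 0 = 0" and kl: "k + l \<le> n"
  shows "subst2 Z ZX ZY $ k $ l = (if k = l + 1 then ac l else if k = 0 \<and> l = n - 1 then bc 0 else 0)"
proof -
  note r = TSD(2)[OF Z]
  have z: "TS (\<lambda>x y u v. Complex x y) XZ r" and w: "TS (\<lambda>x y u v. cnj (Complex x y)) XW r"
    unfolding XZ_def XW_def Complex_eq complex_cnj_add complex_cnj_mult complex_cnj_i complex_cnj_complex_of_real
    using TS_add[OF TS_vars(1)[OF r] TS_cmult[OF TS_vars(2)[OF r], of \<i>]] TS_diff[OF TS_vars(1)[OF r] TS_cmult[OF TS_vars(2)[OF r], of \<i>]]
    by simp_all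
  \<comment> \<open>The degrees of a and b may vary with the parameters, so the polynomials are cut
    at n, where finitely many coefficients share a radius; \<open>poly_tail\<close> bounds the
    rest.\<close>
  define M where "M = (\<Sum>l\<le>n. cc (ac l) * ((XZ * XW) ^ l * XZ)) + (\<Sum>l\<le>n. cc (bc l) * ((XZ * XW) ^ l * XW ^ (n - 1)))"
  define m where "m x y u v = (\<Sum>l\<le>n. coeff (a (u, v)) l * ((Complex x y * cnj (Complex x y)) ^ l * Complex x y))
     + (\<Sum>l\<le>n. coeff (b (u, v)) l * ((Complex x y * cnj (Complex x y)) ^ l * cnj (Complex x y) ^ (n - 1)))" for x y u v
  have M: "TS m M r" unfolding m_def M_def
    by (intro TS_add TS_sum TS_mult TS_power z w A B r) auto
  have "dge (n + 1) (Z - M)"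
  proof (rule TS_order[OF TS_diff[OF Z M]])
    fix u v :: real assume uv: "\<bar>u\<bar> < r" "\<bar>v\<bar> < r"
    let ?p = "(u, v)"
    let ?full = "\<lambda>z. poly (a ?p) (z * cnj z) * z + poly (b ?p) (z * cnj z) * cnj z ^ (n - 1)"
    obtain c where c: "0 < c" "\<forall>\<^sub>F z in at 0. norm (F ?p z - ?full z) \<le> c * norm (complex_of_real (norm z ^ (n + 1)))"
      using landau_o.bigE[OF form[OF uv]] by blast
    obtain d where d: "0 < d" "\<And>z. z \<noteq> 0 \<Longrightarrow> norm z < d \<Longrightarrow> norm (F ?p z - ?full z) \<le> c * norm z ^ (n + 1)"
    proof -
      have eq: "norm (complex_of_real (norm z ^ (n + 1))) = norm z ^ (n + 1)" for z :: complex
        unfolding norm_of_real by (rule abs_of_nonneg) simp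
      obtain d where "0 < d" "\<forall>z\<in>UNIV. z \<noteq> 0 \<and> dist z 0 < d \<longrightarrow> norm (F ?p z - ?full z) \<le> c * norm z ^ (n + 1)"
        using c(2) unfolding eventually_at eq by blast
      then show thesis by (intro that[of d]) (auto simp del: power_Suc)
    qed
    obtain C1 where C1: "0 \<le> C1" "\<And>w. norm w \<le> 1 \<Longrightarrow> norm (poly (a ?p) w - (\<Sum>l\<le>n. coeff (a ?p) l * w ^ l)) \<le> C1 * norm w ^ (n + 1)"
      using poly_tail[of "a ?p" n] by blast
    obtain C2 where C2: "0 \<le> C2" "\<And>w. norm w \<le> 1 \<Longrightarrow> norm (poly (b ?p) w - (\<Sum>l\<le>n. coeff (b ?p) l * w ^ l)) \<le> C2 * norm w ^ (n + 1)"
      using poly_tail[of "b ?p" n] by blast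
    define \<rho> where "\<rho> = min (d / 2) (1 / 2)"
    have "norm (F ?p (Complex x y) - m x y u v) \<le> (c + C1 + C2) * (\<bar>x\<bar> + \<bar>y\<bar>) ^ (n + 1)" if xy: "\<bar>x\<bar> < \<rho>" "\<bar>y\<bar> < \<rho>" for x y
    proof -
      define z where "z = Complex x y"
      define w where "w = z * cnj z"
      define P where "P = poly (a ?p) w - (\<Sum>l\<le>n. coeff (a ?p) l * w ^ l)"
      define Q where "Q = poly (b ?p) w - (\<Sum>l\<le>n. coeff (b ?p) l * w ^ l)"
      have s: "norm z \<le> \<bar>x\<bar> + \<bar>y\<bar>" using cmod_le[of z] by (simp add: z_def)
      have z1: "norm z < d" "norm z \<le> 1" using s xy by (auto simp: \<rho>_def min_def split: if_splits)
      have nw: "norm w = norm z ^ 2" by (simp add: w_def norm_mult power2_eq_square)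
      have w1: "norm w \<le> 1" unfolding nw using z1(2) by (simp add: power_le_one)
      have wz: "norm w ^ (n + 1) \<le> norm z ^ (n + 1)" unfolding nw power_mult[symmetric] by (rule power_decreasing) (use z1 in auto)
      have m: "m x y u v = (poly (a ?p) w - P) * z + (poly (b ?p) w - Q) * cnj z ^ (n - 1)"
        unfolding m_def P_def Q_def w_def z_def by (simp add: sum_distrib_right mult.assoc)
      have e: "F ?p z - m x y u v = (F ?p z - ?full z) + P * z + Q * cnj z ^ (n - 1)"
        unfolding m w_def by (simp add: algebra_simps)
      have 1: "norm (F ?p z - ?full z) \<le> c * norm z ^ (n + 1)"
      proof (cases "z = 0")
        case True then show ?thesis using F0[OF uv] n by (simp add: power_0_left)
      qed (use d(2) z1 in simp)
      have 2: "norm (P * z) \<le> C1 * norm z ^ (n + 1)"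
      proof -
        have "norm (P * z) \<le> norm P * 1" unfolding norm_mult using z1 by (intro mult_left_mono) auto
        also have "\<dots> \<le> C1 * norm w ^ (n + 1)" using C1(2)[OF w1] by (simp add: P_def)
        also have "\<dots> \<le> C1 * norm z ^ (n + 1)" by (rule mult_left_mono[OF wz C1(1)])
        finally show ?thesis .
      qed
      have 3: "norm (Q * cnj z ^ (n - 1)) \<le> C2 * norm z ^ (n + 1)"
      proof -
        have "norm (Q * cnj z ^ (n - 1)) \<le> norm Q * 1" unfolding norm_mult using z1 by (intro mult_left_mono) (auto simp: norm_power power_le_one)
        also have "\<dots> \<le> C2 * norm w ^ (n + 1)" using C2(2)[OF w1] by (simp add: Q_def)
        also have "\<dots> \<le> C2 * norm z ^ (n + 1)" by (rule mult_left_mono[OF wz C2(1)])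
        finally show ?thesis .
      qed
      have "norm (F ?p z - m x y u v) \<le> c * norm z ^ (n + 1) + C1 * norm z ^ (n + 1) + C2 * norm z ^ (n + 1)"
        unfolding e by (intro order_trans[OF norm_triangle_ineq] add_mono 1 2 3)
      also have "\<dots> = (c + C1 + C2) * norm z ^ (n + 1)" by (simp add: algebra_simps)
      also have "\<dots> \<le> (c + C1 + C2) * (\<bar>x\<bar> + \<bar>y\<bar>) ^ (n + 1)" using c(1) C1(1) C2(1) s by (intro mult_left_mono power_mono) auto
      finally show ?thesis by (simp add: z_def)
    qed
    then show "\<exists>C. \<exists>\<rho>>0. \<forall>x y. \<bar>x\<bar> < \<rho> \<longrightarrow> \<bar>y\<bar> < \<rho> \<longrightarrow> norm (F (u, v) (Complex x y) - m x y u v) \<le> C * (\<bar>x\<bar> + \<bar>y\<bar>) ^ (n + 1)"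
      using d(1) by (intro exI[of _ "c + C1 + C2"] exI[of _ \<rho>]) (auto simp: \<rho>_def)
  qed
  then have "dge (n + 1) (subst2 (Z - M) ZX ZY)" by (rule subst2_dge[OF dge_Z(1,2)])
  then have "subst2 Z ZX ZY $ k $ l = subst2 M ZX ZY $ k $ l" using kl by (simp add: dge_def subst2_diff)
  also have XZs: "subst2 XZ ZX ZY = fps_X" "subst2 XW ZX ZY = yy"
    unfolding XZ_def XW_def by (simp_all add: subst2_add subst2_diff subst2_mult subst2_ck subst2_X subst2_Y dge_Z Z_id del: One_nat_def)
  have "subst2 M ZX ZY = (\<Sum>l\<le>n. cc (ac l) * ((fps_X * yy) ^ l * fps_X)) + (\<Sum>l\<le>n. cc (bc l) * ((fps_X * yy) ^ l * yy ^ (n - 1)))"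
    unfolding M_def by (simp add: subst2_add subst2_sum subst2_mult subst2_power subst2_cc dge_Z XZs del: One_nat_def)
  then have "subst2 M ZX ZY $ k $ l = (\<Sum>i\<le>n. ac i * (if k < i \<or> l < i then 0 else (fps_X :: cplane) $ (k - i) $ (l - i)))
      + (\<Sum>i\<le>n. bc i * (if k < i \<or> l < i then 0 else (yy ^ (n - 1) :: cplane) $ (k - i) $ (l - i)))"
    by (simp only: fps_add_nth fps_sum_nth cc_mult_nth XY_power_nth)
  also have "(\<Sum>i\<le>n. ac i * (if k < i \<or> l < i then 0 else (fps_X :: cplane) $ (k - i) $ (l - i))) = (\<Sum>i\<le>n. if i = l then (if k = l + 1 then ac l else 0) else 0)"
    by (intro sum.cong refl) (auto simp: fps_X_nth fps_one_nth)
  also have "\<dots> = (if k = l + 1 then ac l else 0)" using kl by simp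
  also have "(\<Sum>i\<le>n. bc i * (if k < i \<or> l < i then 0 else (yy ^ (n - 1) :: cplane) $ (k - i) $ (l - i))) = (\<Sum>i\<le>n. if i = 0 then (if k = 0 \<and> l = n - 1 then bc 0 else 0) else 0)"
    using kl n by (intro sum.cong refl) (auto simp: yy_power fps_X_power_nth)
  also have "\<dots> = (if k = 0 \<and> l = n - 1 then bc 0 else 0)" by simp
  finally show ?thesis using n by auto
qed

text \<open>The termwise derivatives are the true partial derivatives near the origin, so the
  determinant identity for functions passes to series by \<open>TS_zero\<close>.\<close>

lemma jacobian_one:
  assumes U: "TS (\<lambda>x y u v. of_real (Re (F (u, v) (Complex x y)))) (cP S1) r"
    and V: "TS (\<lambda>x y u v. of_real (Im (F (u, v) (Complex x y)))) (cP S2) r"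
    and area: "\<And>x y u v. \<bar>x\<bar> < r \<Longrightarrow> \<bar>y\<bar> < r \<Longrightarrow> \<bar>u\<bar> < r \<Longrightarrow> \<bar>v\<bar> < r \<Longrightarrow>
      \<exists>L. (F (u, v) has_derivative L) (at (Complex x y)) \<and> det_complex L = 1"
  shows "br S1 S2 = 1"
proof -
  note r = TSD(2)[OF U]
  obtain ux where ux: "TS ux (fps_deriv (cP S1)) (r / 4)" "\<And>x y u v. \<bar>x\<bar> < r / 4 \<Longrightarrow> \<bar>y\<bar> < r / 4 \<Longrightarrow> \<bar>u\<bar> < r / 4 \<Longrightarrow> \<bar>v\<bar> < r / 4 \<Longrightarrow>
      ((\<lambda>s. of_real (Re (F (u, v) (Complex s y)))) has_vector_derivative ux x y u v) (at x)" using TS_deriv[OF U] by metis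
  obtain uy where uy: "TS uy (dY (cP S1)) (r / 4)" "\<And>x y u v. \<bar>x\<bar> < r / 4 \<Longrightarrow> \<bar>y\<bar> < r / 4 \<Longrightarrow> \<bar>u\<bar> < r / 4 \<Longrightarrow> \<bar>v\<bar> < r / 4 \<Longrightarrow>
      ((\<lambda>s. of_real (Re (F (u, v) (Complex x s)))) has_vector_derivative uy x y u v) (at y)" using TS_dY[OF U] by metis
  obtain vx where vx: "TS vx (fps_deriv (cP S2)) (r / 4)" "\<And>x y u v. \<bar>x\<bar> < r / 4 \<Longrightarrow> \<bar>y\<bar> < r / 4 \<Longrightarrow> \<bar>u\<bar> < r / 4 \<Longrightarrow> \<bar>v\<bar> < r / 4 \<Longrightarrow>
      ((\<lambda>s. of_real (Im (F (u, v) (Complex s y)))) has_vector_derivative vx x y u v) (at x)" using TS_deriv[OF V] by metis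
  obtain vy where vy: "TS vy (dY (cP S2)) (r / 4)" "\<And>x y u v. \<bar>x\<bar> < r / 4 \<Longrightarrow> \<bar>y\<bar> < r / 4 \<Longrightarrow> \<bar>u\<bar> < r / 4 \<Longrightarrow> \<bar>v\<bar> < r / 4 \<Longrightarrow>
      ((\<lambda>s. of_real (Im (F (u, v) (Complex x s)))) has_vector_derivative vy x y u v) (at y)" using TS_dY[OF V] by metis
  have one: "ux x y u v * vy x y u v - uy x y u v * vx x y u v - 1 = 0"
    if b: "\<bar>x\<bar> < r / 4" "\<bar>y\<bar> < r / 4" "\<bar>u\<bar> < r / 4" "\<bar>v\<bar> < r / 4" for x y u v
  proof -
    have b': "\<bar>x\<bar> < r" "\<bar>y\<bar> < r" "\<bar>u\<bar> < r" "\<bar>v\<bar> < r" using b r by auto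
    obtain L where L: "(F (u, v) has_derivative L) (at (Complex x y))" "det_complex L = 1" using area[OF b'] by blast
    have e: "Complex s t = of_real s + \<i> * of_real t" for s t by (rule Complex_eq)
    have dx: "((\<lambda>s. Complex s y) has_vector_derivative 1) (at x)" "((\<lambda>s. Complex x s) has_vector_derivative \<i>) (at y)"
      unfolding e by (auto intro!: derivative_eq_intros)
    have "((\<lambda>s. F (u, v) (Complex s y)) has_vector_derivative L 1) (at x)" "((\<lambda>s. F (u, v) (Complex x s)) has_vector_derivative L \<i>) (at y)"
      using vector_derivative_diff_chain_within[OF dx(1), of "F (u, v)" L] vector_derivative_diff_chain_within[OF dx(2), of "F (u, v)" L] L(1)
      by (auto simp: o_def intro: has_derivative_at_withinI)
    note d = this
    have R: "((\<lambda>s. complex_of_real (Re (f s))) has_vector_derivative of_real (Re D)) (at t)" "((\<lambda>s. complex_of_real (Im (f s))) has_vector_derivative of_real (Im D)) (at t)"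
      if "(f has_vector_derivative D) (at t)" for f D t
      using bounded_linear.has_vector_derivative[OF bounded_linear_compose[OF bounded_linear_of_real bounded_linear_Re] that]
        bounded_linear.has_vector_derivative[OF bounded_linear_compose[OF bounded_linear_of_real bounded_linear_Im] that] by (simp_all only:)
    have "ux x y u v = of_real (Re (L 1))" "vx x y u v = of_real (Im (L 1))" "uy x y u v = of_real (Re (L \<i>))" "vy x y u v = of_real (Im (L \<i>))"
      using vector_derivative_unique_at[OF ux(2)[OF b] R(1)[OF d(1)]] vector_derivative_unique_at[OF vx(2)[OF b] R(2)[OF d(1)]]
        vector_derivative_unique_at[OF uy(2)[OF b] R(1)[OF d(2)]] vector_derivative_unique_at[OF vy(2)[OF b] R(2)[OF d(2)]] by simp_all
    then have "ux x y u v * vy x y u v - uy x y u v * vx x y u v = of_real (det_complex L)" by (simp add: det_complex_def)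
    then show ?thesis by (simp add: L(2))
  qed
  have r4: "0 < r / 4" using r by simp
  have "TS (\<lambda>x y u v. ux x y u v * vy x y u v - uy x y u v * vx x y u v - 1)
    (fps_deriv (cP S1) * dY (cP S2) - dY (cP S1) * fps_deriv (cP S2) - ck 1) (r / 4)"
    by (intro TS_diff TS_mult ux(1) uy(1) vx(1) vy(1) TS_vars(3)[OF r4])
  from TS_zero[OF this one] have "br (cP S1) (cP S2) = 1" by (simp add: br_def ck_hom)
  then have "cP (br S1 S2) = cP 1" unfolding cP_def cmap_br[OF rhom_cP(2)] rhomD(2)[OF rhom_cmap[OF rhom_cP(2)]] .
  then show ?thesis by (intro fps4_eqI) (metis cP_nth of_real_eq_iff)
qed

lemma lft_inj: "lft A = lft B \<Longrightarrow> A = (B :: complex fps fps)"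
  by (rule fps2_eqI) (metis lft_def cmap_nth cc_nth)

lemma cis_series:
  assumes A: "TS (\<lambda>x y u v. of_real (\<alpha> (x, y))) (lft A) r" and W: "TS (\<lambda>x y u v. cis (\<alpha> (x, y))) (lft W) r"
  shows "fps_deriv W = cc \<i> * fps_deriv A * W" "dY W = cc \<i> * dY A * W"
proof -
  have r4: "0 < r / 4" using TSD(2)[OF A] by simp
  have ch: "((\<lambda>s. cis (\<phi> s)) has_vector_derivative (\<i> * D * cis (\<phi> t))) (at t)"
    if "((\<lambda>s. complex_of_real (\<phi> s)) has_vector_derivative D) (at t)" for \<phi> D t
  proof -
    have "((\<lambda>s. \<i> * complex_of_real (\<phi> s)) has_vector_derivative \<i> * D) (at t)" by (intro has_vector_derivative_mult_right that)
    from field_vector_diff_chain_at[OF this DERIV_exp] show ?thesis by (simp add: o_def cis_conv_exp mult_ac)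
  qed
  have s: "TS f (lft W) r \<Longrightarrow> TS f (lft W) (r/4)" for f by (rule TS_mono) (use r4 in auto)
  have l: "ck \<i> * fps_deriv (lft A) * lft W = lft (cc \<i> * fps_deriv A * W)" "ck \<i> * dY (lft A) * lft W = lft (cc \<i> * dY A * W)"
    "fps_deriv (lft W) = lft (fps_deriv W)" "dY (lft W) = lft (dY W)"
    unfolding lft_def by (simp_all add: rhomD[OF rhom_cmap[OF rhom_cc]] cmap_deriv[OF rhom_cc] cmap_vars[OF rhom_cc] ck_def)
  obtain ax where ax: "TS ax (fps_deriv (lft A)) (r / 4)" "\<And>x y u v. \<bar>x\<bar> < r / 4 \<Longrightarrow> \<bar>y\<bar> < r / 4 \<Longrightarrow> \<bar>u\<bar> < r / 4 \<Longrightarrow> \<bar>v\<bar> < r / 4 \<Longrightarrow>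
      ((\<lambda>s. of_real (\<alpha> (s, y))) has_vector_derivative ax x y u v) (at x)" using TS_deriv[OF A] by metis
  obtain wx where wx: "TS wx (fps_deriv (lft W)) (r / 4)" "\<And>x y u v. \<bar>x\<bar> < r / 4 \<Longrightarrow> \<bar>y\<bar> < r / 4 \<Longrightarrow> \<bar>u\<bar> < r / 4 \<Longrightarrow> \<bar>v\<bar> < r / 4 \<Longrightarrow>
      ((\<lambda>s. cis (\<alpha> (s, y))) has_vector_derivative wx x y u v) (at x)" using TS_deriv[OF W] by metis
  have "fps_deriv (lft W) - ck \<i> * fps_deriv (lft A) * lft W = 0"
  proof (rule TS_zero)
    show "TS (\<lambda>x y u v. wx x y u v - \<i> * ax x y u v * cis (\<alpha> (x, y))) (fps_deriv (lft W) - ck \<i> * fps_deriv (lft A) * lft W) (r / 4)"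
      by (intro TS_diff TS_mult TS_cmult wx(1) ax(1) s W)
    fix x y u v assume b: "\<bar>x\<bar> < r / 4" "\<bar>y\<bar> < r / 4" "\<bar>u\<bar> < r / 4" "\<bar>v\<bar> < r / 4"
    from vector_derivative_unique_at[OF wx(2)[OF b] ch[OF ax(2)[OF b]]]
    show "wx x y u v - \<i> * ax x y u v * cis (\<alpha> (x, y)) = 0" by simp
  qed
  then show "fps_deriv W = cc \<i> * fps_deriv A * W" unfolding l by (intro lft_inj) simp
  obtain ay where ay: "TS ay (dY (lft A)) (r / 4)" "\<And>x y u v. \<bar>x\<bar> < r / 4 \<Longrightarrow> \<bar>y\<bar> < r / 4 \<Longrightarrow> \<bar>u\<bar> < r / 4 \<Longrightarrow> \<bar>v\<bar> < r / 4 \<Longrightarrow>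
      ((\<lambda>s. of_real (\<alpha> (x, s))) has_vector_derivative ay x y u v) (at y)" using TS_dY[OF A] by metis
  obtain wy where wy: "TS wy (dY (lft W)) (r / 4)" "\<And>x y u v. \<bar>x\<bar> < r / 4 \<Longrightarrow> \<bar>y\<bar> < r / 4 \<Longrightarrow> \<bar>u\<bar> < r / 4 \<Longrightarrow> \<bar>v\<bar> < r / 4 \<Longrightarrow>
      ((\<lambda>s. cis (\<alpha> (x, s))) has_vector_derivative wy x y u v) (at y)" using TS_dY[OF W] by metis
  have "dY (lft W) - ck \<i> * dY (lft A) * lft W = 0"
  proof (rule TS_zero)
    show "TS (\<lambda>x y u v. wy x y u v - \<i> * ay x y u v * cis (\<alpha> (x, y))) (dY (lft W) - ck \<i> * dY (lft A) * lft W) (r / 4)"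
      by (intro TS_diff TS_mult TS_cmult wy(1) ay(1) s W)
    fix x y u v assume b: "\<bar>x\<bar> < r / 4" "\<bar>y\<bar> < r / 4" "\<bar>u\<bar> < r / 4" "\<bar>v\<bar> < r / 4"
    from vector_derivative_unique_at[OF wy(2)[OF b] ch[OF ay(2)[OF b]]]
    show "wy x y u v - \<i> * ay x y u v * cis (\<alpha> (x, y)) = 0" by simp
  qed
  then show "dY W = cc \<i> * dY A * W" unfolding l by (intro lft_inj) simp
qed

lemma partial_derivatives:
  assumes f: "has_taylor_par f A" and L: "(f has_derivative L) (at (0, 0))"
  shows "L (1, 0) = A $ 1 $ 0" "L (0, 1) = A $ 0 $ 1"
proof -
  obtain r where T: "TS (\<lambda>x y u v. of_real (f (x, y))) (cmap cc (cmap of_real A)) r" by (rule has_taylor_par_TS[OF f])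
  have r4: "0 < r / 4" using TSD(2)[OF T] by simp
  have b: "bounded_linear (\<lambda>s::real. complex_of_real s)" by (rule bounded_linear_of_real)
  have d: "((\<lambda>s. f (s, 0)) has_vector_derivative L (1, 0)) (at 0)" "((\<lambda>s. f (0, s)) has_vector_derivative L (0, 1)) (at 0)"
  proof -
    have "((\<lambda>s::real. (s, 0::real)) has_vector_derivative (1, 0)) (at 0)" "((\<lambda>s::real. (0::real, s)) has_vector_derivative (0, 1)) (at 0)"
      by (auto intro!: has_vector_derivative_Pair derivative_eq_intros)
    from vector_derivative_diff_chain_within[OF this(1), of f L] vector_derivative_diff_chain_within[OF this(2), of f L]
    show "((\<lambda>s. f (s, 0)) has_vector_derivative L (1, 0)) (at 0)" "((\<lambda>s. f (0, s)) has_vector_derivative L (0, 1)) (at 0)"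
      using L by (auto simp: o_def intro: has_derivative_at_withinI)
  qed
  obtain gx where gx: "TS gx (fps_deriv (cmap cc (cmap of_real A))) (r / 4)" "\<And>x y u v. \<bar>x\<bar> < r / 4 \<Longrightarrow> \<bar>y\<bar> < r / 4 \<Longrightarrow> \<bar>u\<bar> < r / 4 \<Longrightarrow> \<bar>v\<bar> < r / 4 \<Longrightarrow>
      ((\<lambda>s. of_real (f (s, y))) has_vector_derivative gx x y u v) (at x)" using TS_deriv[OF T] by metis
  have "gx 0 0 0 0 = of_real (L (1, 0))"
    by (rule vector_derivative_unique_at[OF gx(2) bounded_linear.has_vector_derivative[OF b d(1)]]) (use r4 in auto)
  then show "L (1, 0) = A $ 1 $ 0" using TS_at_0[OF gx(1)] by (simp add: fps_deriv_nth2 cc_nth)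
  obtain gy where gy: "TS gy (dY (cmap cc (cmap of_real A))) (r / 4)" "\<And>x y u v. \<bar>x\<bar> < r / 4 \<Longrightarrow> \<bar>y\<bar> < r / 4 \<Longrightarrow> \<bar>u\<bar> < r / 4 \<Longrightarrow> \<bar>v\<bar> < r / 4 \<Longrightarrow>
      ((\<lambda>s. of_real (f (x, s))) has_vector_derivative gy x y u v) (at y)" using TS_dY[OF T] by metis
  have "gy 0 0 0 0 = of_real (L (0, 1))"
    by (rule vector_derivative_unique_at[OF gy(2) bounded_linear.has_vector_derivative[OF b d(2)]]) (use r4 in auto)
  then show "L (0, 1) = A $ 0 $ 1" using TS_at_0[OF gy(1)] by (simp add: dY_nth cc_nth)
qed

lemma poly_pderiv_0: "poly (pderiv q) 0 = coeff q 1" "poly (pderiv (pderiv q)) 0 = 2 * coeff q 2" for q :: "complex poly"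
  by (simp_all add: poly_0_coeff_0 coeff_pderiv numeral_2_eq_2)

text \<open>The coefficient of z w in the bracket of the z-component with its conjugate, which is
  constant 1 for an area-preserving map. It makes i a'(0)/\<lambda> real.\<close>

lemma cubic_coefficient_imaginary:
  assumes br: "br f g = 1" and C: "\<And>k l. k + l \<le> 3 \<Longrightarrow> k \<noteq> l + 1 \<Longrightarrow> Cx f g $ k $ l = 0"
  shows "Cx f g $ 1 $ 0 * cmap cnj (Cx f g $ 2 $ 1) + Cx f g $ 2 $ 1 * cmap cnj (Cx f g $ 1 $ 0) = 0"
proof -
  define D' where "D' = tau f - ck \<i> * tau g"
  have D': "D' $ l $ k = cmap cnj (Cx f g $ k $ l)" for k l
    by (rule fps2_eqI) (simp only: D'_def Cx_def fps_sub_nth fps_add_nth ck_nth cmap_nth tau_sym[of _ l k], simp)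
  have "br (Cx f g) D' = ck (- 2 * \<i>) * br (tau f) (tau g)"
  proof -
    have "ck (- 2 * \<i>) = - ck \<i> - ck \<i>" by (simp flip: ck_hom)
    then show ?thesis unfolding D'_def Cx_def
      using br_antisym[of "tau g" "tau f"]
      by (simp add: br_add_left br_add_right br_diff_right ck_br algebra_simps)
  qed
  also have "\<dots> = 1" using tau_br[of f g] tau_cc(1)[of 1] by (simp add: br cmap_1')
  finally have "br (Cx f g) D' $ 1 $ 1 = 0" by (simp add: fps_one_nth)
  moreover have "br (Cx f g) D' $ 1 $ 1 = 2 * (Cx f g $ 1 $ 0 * D' $ 1 $ 2) + 2 * (Cx f g $ 2 $ 1 * D' $ 0 $ 1)"
  proof -
    have z: "Cx f g $ 0 $ 0 = 0" "Cx f g $ 0 $ 1 = 0" "Cx f g $ 0 $ 2 = 0" "Cx f g $ 1 $ 1 = 0" "Cx f g $ 1 $ 2 = 0" "Cx f g $ 2 $ 0 = 0"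
      by (rule C; simp)+
    have s: "(\<Sum>i\<le>1 + 1. F i) = F 0 + F 1 + F 2" for F :: "nat \<Rightarrow> complex fps fps"
      by (simp add: numeral_2_eq_2)
    show ?thesis unfolding br_nth s z by (simp add: numeral_2_eq_2)
  qed
  ultimately have "2 * (Cx f g $ 1 $ 0 * D' $ 1 $ 2 + Cx f g $ 2 $ 1 * D' $ 0 $ 1) = 0" by (simp only: ring_distribs)
  then have e: "Cx f g $ 1 $ 0 * D' $ 1 $ 2 + Cx f g $ 2 $ 1 * D' $ 0 $ 1 + (Cx f g $ 1 $ 0 * D' $ 1 $ 2 + Cx f g $ 2 $ 1 * D' $ 0 $ 1) = 0"
    by (simp only: mult_2)
  have "Cx f g $ 1 $ 0 * D' $ 1 $ 2 + Cx f g $ 2 $ 1 * D' $ 0 $ 1 = 0"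
  proof (rule fps2_eqI)
    fix i j
    have d: "x + x = 0 \<Longrightarrow> x = 0" for x :: complex by simp
    show "(Cx f g $ 1 $ 0 * D' $ 1 $ 2 + Cx f g $ 2 $ 1 * D' $ 0 $ 1) $ i $ j = (0 :: complex fps fps) $ i $ j"
      using d[of "(Cx f g $ 1 $ 0 * D' $ 1 $ 2 + Cx f g $ 2 $ 1 * D' $ 0 $ 1) $ i $ j"] arg_cong[OF e, of "\<lambda>U. U $ i $ j"]
      by (simp only: fps_add_nth fps_zero_nth)
  qed
  then show ?thesis unfolding D' .
qed

theorem theorem3:
  fixes n :: nat
    and F :: "real \<times> real \<Rightarrow> complex \<Rightarrow> complex"
    and \<alpha> \<delta> \<nu> :: "real \<times> real \<Rightarrow> real"
    and a b :: "real \<times> real \<Rightarrow> complex poly"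
  assumes n: "n \<ge> 5"
    and F_analytic: "analytic_family F"
    and F_area: "\<forall>\<^sub>F (p, z) in nhds ((0, 0), 0).
          \<exists>L. (F p has_derivative L) (at z) \<and> det_complex L = 1"
    and F_fix: "\<forall>\<^sub>F p in nhds (0, 0). F p 0 = 0"
    and F_linear: "\<forall>\<^sub>F p in nhds (0, 0). (F p has_derivative (\<lambda>h. cis (\<alpha> p) * h)) (at 0)"
    and \<alpha>_analytic: "analytic_par \<alpha>"
    and resonance: "cis (\<alpha> (0, 0)) ^ n = 1"
    and resonance_order: "\<forall>k. 1 \<le> k \<and> k < n \<longrightarrow> cis (\<alpha> (0, 0)) ^ k \<noteq> 1"
    and a_analytic: "\<forall>k. analytic_par_complex (\<lambda>p. coeff (a p) k)"
    and b_analytic: "\<forall>k. analytic_par_complex (\<lambda>p. coeff (b p) k)"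
    and F_form: "\<forall>\<^sub>F p in nhds (0, 0).
          (\<lambda>z. F p z - (poly (a p) (z * cnj z) * z + poly (b p) (z * cnj z) * cnj z ^ (n - 1)))
            \<in> O[at 0](\<lambda>z. of_real (norm z ^ (n + 1)))"
    and a_const: "\<forall>\<^sub>F p in nhds (0, 0). poly (a p) 0 = cis (\<alpha> p)"
    and \<delta>_def: "\<delta> = (\<lambda>p. \<alpha> (0, 0) - \<alpha> p)"
    and \<nu>_def: "\<nu> = (\<lambda>p. Re (\<i> * poly (pderiv (a p)) 0 / cis (\<alpha> p)))"
    and a'_zero: "poly (pderiv (a (0, 0))) 0 = 0"
    and a''_nonzero: "poly (pderiv (pderiv (a (0, 0)))) 0 \<noteq> 0"
    and b_nonzero: "poly (b (0, 0)) 0 \<noteq> 0"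
    and generic: "\<exists>L. ((\<lambda>p. (\<delta> p, \<nu> p)) has_derivative L) (at (0, 0)) \<and> det_pair L \<noteq> 0"
  shows "\<exists>S. taylor_in_parameters F \<delta> \<nu> S \<and>
    (\<exists>!(A, B). normal_form_coeffs n A B \<and> B $ 0 $ 0 $ 0 > 0 \<and>
       (\<exists>\<Phi>. formal_ham_flow (normal_form_ham n A B) \<Phi> \<and>
            formally_conjugate S (fcompose (formal_rotation (\<alpha> (0, 0))) (\<Phi> 1))))"
proof -
  define c0 where "c0 = \<alpha> (0, 0)"
  obtain T where T: "has_taylor_family F T" using F_analytic by (auto simp: analytic_family_def)
  obtain r1 where U0: "TS (\<lambda>x y u v. of_real (Re (F (u, v) (Complex x y)))) (cP (fst T)) r1"
    using has_taylor_plane_TS[of "\<lambda>p z. Re (F p z)" "fst T"] T by (auto simp: has_taylor_family_def)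
  obtain r2 where V0: "TS (\<lambda>x y u v. of_real (Im (F (u, v) (Complex x y)))) (cP (snd T)) r2"
    using has_taylor_plane_TS[of "\<lambda>p z. Im (F p z)" "snd T"] T by (auto simp: has_taylor_family_def)
  obtain Al where Al: "has_taylor_par \<alpha> Al" using \<alpha>_analytic by (auto simp: analytic_par_def)
  obtain r3 where Al1: "TS (\<lambda>x y u v. of_real (\<alpha> (u, v))) (cc (cmap of_real Al)) r3" and Al2: "TS (\<lambda>x y u v. of_real (\<alpha> (x, y))) (cmap cc (cmap of_real Al)) r3"
    by (rule has_taylor_par_TS[OF Al])
  have "\<forall>l. \<exists>r A. TS (\<lambda>x y u v. coeff (a (u, v)) l) (cc A) r \<and> TS (\<lambda>x y u v. coeff (a (x, y)) l) (lft A) r"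
    using analytic_par_complex_TS[OF a_analytic[rule_format]] by blast
  then obtain ra ac where ac: "\<And>l. TS (\<lambda>x y u v. coeff (a (u, v)) l) (cc (ac l)) (ra l)" "\<And>l. TS (\<lambda>x y u v. coeff (a (x, y)) l) (lft (ac l)) (ra l)"
    by metis
  have "\<forall>l. \<exists>r A. TS (\<lambda>x y u v. coeff (b (u, v)) l) (cc A) r \<and> TS (\<lambda>x y u v. coeff (b (x, y)) l) (lft A) r"
    using analytic_par_complex_TS[OF b_analytic[rule_format]] by blast
  then obtain rb bc where bc: "\<And>l. TS (\<lambda>x y u v. coeff (b (u, v)) l) (cc (bc l)) (rb l)"
    by metis
  obtain \<rho> where \<rho>: "0 < \<rho>" and ev: "\<And>u v. \<bar>u\<bar> < \<rho> \<Longrightarrow> \<bar>v\<bar> < \<rho> \<Longrightarrow> F (u, v) 0 = 0 \<and> poly (a (u, v)) 0 = cis (\<alpha> (u, v)) \<and>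
      (\<lambda>z. F (u, v) z - (poly (a (u, v)) (z * cnj z) * z + poly (b (u, v)) (z * cnj z) * cnj z ^ (n - 1))) \<in> O[at 0](\<lambda>z. of_real (norm z ^ (n + 1)))"
    by (rule eventually_box[OF eventually_conj[OF F_fix eventually_conj[OF a_const F_form]]]) auto
  obtain d where d: "0 < d" and area: "\<And>x y u v. \<bar>x\<bar> < d \<Longrightarrow> \<bar>y\<bar> < d \<Longrightarrow> \<bar>u\<bar> < d \<Longrightarrow> \<bar>v\<bar> < d \<Longrightarrow>
      \<exists>L. (F (u, v) has_derivative L) (at (Complex x y)) \<and> det_complex L = 1"
  proof -
    obtain e where e: "0 < e" "\<And>q. dist q ((0::real, 0::real), 0::complex) < e \<Longrightarrow> (case q of (p, z) \<Rightarrow> \<exists>L. (F p has_derivative L) (at z) \<and> det_complex L = 1)"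
      using F_area unfolding eventually_nhds_metric by blast
    have "\<exists>L. (F (u, v) has_derivative L) (at (Complex x y)) \<and> det_complex L = 1"
      if "\<bar>x\<bar> < e / 4" "\<bar>y\<bar> < e / 4" "\<bar>u\<bar> < e / 4" "\<bar>v\<bar> < e / 4" for x y u v
    proof -
      have "norm ((u, v), Complex x y) \<le> norm (u, v) + norm (Complex x y)" by (rule norm_Pair_le)
      also have "\<dots> \<le> (\<bar>u\<bar> + \<bar>v\<bar>) + (\<bar>x\<bar> + \<bar>y\<bar>)" using norm_Pair_le[of u v] cmod_le[of "Complex x y"] by (intro add_mono) auto
      also have "\<dots> < e" using that by linarith
      finally have "dist ((u, v), Complex x y) ((0, 0), 0) < e" by (simp add: dist_norm flip: zero_prod_def)
      from e(2)[OF this] show ?thesis by simp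
    qed
    with e(1) show thesis by (intro that[of "e / 4"]) auto
  qed
  \<comment> \<open>Finitely many expansions are involved, so they have a common radius.\<close>
  define R where "R = {r1, r2, r3, \<rho>, d} \<union> ra ` {..n} \<union> rb ` {..n}"
  define r where "r = Min R"
  have Rf: "finite R" "R \<noteq> {}" by (auto simp: R_def)
  have "x > 0" if "x \<in> R" for x
    using that TSD(2)[OF U0] TSD(2)[OF V0] TSD(2)[OF Al1] TSD(2)[OF ac(1)] TSD(2)[OF bc] \<rho> d by (auto simp: R_def)
  then have r: "0 < r" using Rf by (simp add: r_def)
  have le: "r \<le> x" if "x \<in> R" for x using that Rf by (simp add: r_def)
  have rle: "r \<le> r1" "r \<le> r2" "r \<le> r3" "r \<le> \<rho>" "r \<le> d" "\<And>l. l \<le> n \<Longrightarrow> r \<le> ra l" "\<And>l. l \<le> n \<Longrightarrow> r \<le> rb l"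
    by (auto intro!: le simp: R_def)
  note U = TS_mono[OF U0 r rle(1)] and V = TS_mono[OF V0 r rle(2)]
  have jac: "br (fst T) (snd T) = 1"
    by (rule jacobian_one[OF U V]) (use area rle(5) in auto)
  have CTdef: "subst2 (cP (fst T) + ck \<i> * cP (snd T)) ZX ZY = Cx (fst T) (snd T)"
    by (simp add: Cx_def tau_def subst2_add subst2_mult subst2_ck dge_Z del: One_nat_def)
  have Z: "TS (\<lambda>x y u v. F (u, v) (Complex x y)) (cP (fst T) + ck \<i> * cP (snd T)) r"
    by (rule TS_cong[OF TS_add[OF U TS_cmult[OF V]]]) (simp add: complex_eq_iff)
  have CT: "Cx (fst T) (snd T) $ k $ l = (if k = l + 1 then ac l else if k = 0 \<and> l = n - 1 then bc 0 else 0)" if "k + l \<le> n" for k l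
    unfolding CTdef[symmetric]
    by (rule complex_coefficients[where a = a and b = b and F = F and r = r])
      (use n Z ev rle that TS_mono[OF ac(1) r rle(6)] TS_mono[OF bc r rle(7)] in auto)
  have a0: "coeff (a (u, v)) 0 = cis (\<alpha> (u, v))" if "\<bar>u\<bar> < r" "\<bar>v\<bar> < r" for u v
    using ev[of u v] that rle(4) by (simp add: poly_0_coeff_0)
  have A0: "TS (\<lambda>x y u v. cis (\<alpha> (u, v))) (cc (ac 0)) r" "TS (\<lambda>x y u v. cis (\<alpha> (x, y))) (lft (ac 0)) r"
    using TS_cong[OF TS_mono[OF ac(1)[of 0] r rle(6)], of "\<lambda>x y u v. cis (\<alpha> (u, v))"]
      TS_cong[OF TS_mono[OF ac(2)[of 0] r rle(6)], of "\<lambda>x y u v. cis (\<alpha> (x, y))"] a0 by auto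
  define D :: par_series where "D = cc c0 - Al"
  have cD: "cmap of_real D = cc (complex_of_real c0) - cmap of_real Al"
    unfolding D_def by (simp add: rhomD[OF rhom_cmap[OF rhom_of_real(1)]] cmap_vars[OF rhom_of_real(1)])
  have DT: "has_taylor_par \<delta> D"
  proof (rule TS_has_taylor_par)
    have "cc (cmap of_real D) = ck (of_real c0) - cc (cmap of_real Al)" unfolding cD cc_diff ck_def ..
    then show "TS (\<lambda>x y u v. of_real (\<delta> (u, v))) (cc (cmap of_real D)) r"
      using TS_diff[OF TS_vars(3)[OF r, of "of_real c0"] TS_mono[OF Al1 r rle(3)]] by (simp add: \<delta>_def c0_def)
  qed
  define \<nu>c where "\<nu>c = cc \<i> * ac 1 * cmap cnj (ac 0)"
  define N :: par_series where "N = cmap Re \<nu>c"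
  have A1: "TS (\<lambda>x y u v. coeff (a (u, v)) 1) (cc (ac 1)) r" using TS_mono[OF ac(1)[of 1] r rle(6)] n by auto
  have ccnj: "cmap (cmap cnj) (cc A) = cc (cmap cnj A)" for A :: "complex fps fps" by (rule cmap_vars(3)[OF rhom_cP(3)])
  have \<nu>T: "TS (\<lambda>x y u v. \<i> * coeff (a (u, v)) 1 * cnj (cis (\<alpha> (u, v)))) (cc \<nu>c) r"
    using TS_mult[OF TS_cmult[OF A1, of \<i>] TS_cnj[OF A0(1)]] unfolding \<nu>c_def cc_mult ccnj ck_def by simp
  have cN: "cmap of_real N = cc (1/2) * (\<nu>c + cmap cnj \<nu>c)"
    by (rule fps2_eqI) (simp add: N_def complex_eq_iff)
  have NT: "has_taylor_par \<nu> N"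
  proof (rule TS_has_taylor_par)
    have "TS (\<lambda>x y u v. 1/2 * (\<i> * coeff (a (u, v)) 1 * cnj (cis (\<alpha> (u, v))) + cnj (\<i> * coeff (a (u, v)) 1 * cnj (cis (\<alpha> (u, v)))))) (cc (cmap of_real N)) r"
      using TS_cmult[OF TS_add[OF \<nu>T TS_cnj[OF \<nu>T]], of "1/2"] unfolding cN cc_mult cc_add ccnj ck_def .
    then show "TS (\<lambda>x y u v. of_real (\<nu> (u, v))) (cc (cmap of_real N)) r"
    proof (rule TS_cong)
      fix u v
      have i: "x / cis t = x * cnj (cis t)" for x t by (simp add: cis_cnj divide_inverse flip: cis_inverse)
      show "1/2 * (\<i> * coeff (a (u, v)) 1 * cnj (cis (\<alpha> (u, v))) + cnj (\<i> * coeff (a (u, v)) 1 * cnj (cis (\<alpha> (u, v))))) = complex_of_real (\<nu> (u, v))"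
        unfolding \<nu>_def poly_pderiv_0 i by (rule complex_eqI) simp_all
    qed
  qed
  have D0: "D $ 0 $ 0 = 0"
  proof -
    obtain s where "TS (\<lambda>x y u v. of_real (\<delta> (u, v))) (cc (cmap of_real D)) s" by (rule has_taylor_par_TS[OF DT])
    from TS_at_0[OF this] show ?thesis by (simp add: \<delta>_def cc_nth)
  qed
  have N0: "N $ 0 $ 0 = 0"
  proof -
    obtain s where "TS (\<lambda>x y u v. of_real (\<nu> (u, v))) (cc (cmap of_real N)) s" by (rule has_taylor_par_TS[OF NT])
    from TS_at_0[OF this] show ?thesis using a'_zero by (simp add: \<nu>_def cc_nth)
  qed
  obtain L where L: "((\<lambda>p. (\<delta> p, \<nu> p)) has_derivative L) (at (0, 0))" and detL: "det_pair L \<noteq> 0" using generic by blast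
  have det: "D $ 1 $ 0 * N $ 0 $ 1 - D $ 0 $ 1 * N $ 1 $ 0 \<noteq> 0"
    using detL partial_derivatives[OF DT, of "\<lambda>h. fst (L h)"] partial_derivatives[OF NT, of "\<lambda>h. snd (L h)"]
      has_derivative_fst[OF L] has_derivative_snd[OF L] by (simp add: det_pair_def)
  have DN: "dge 1 D" "dge 1 N" using D0 N0 by (simp_all add: dge_1_iff)
  let ?D = "cmap complex_of_real D" and ?N = "cmap complex_of_real N"
  have DNc: "dge 1 ?D" "dge 1 ?N" using DN by (simp_all add: cmap_dge[OF rhom_of_real(1)])
  note surj = par_bij(1)[OF D0 N0 det] and inj = par_bij(2)[OF D0 N0 det]
  note cinj = cpar_inj[OF inj DN]
  \<comment> \<open>\<phi> rewrites a series in (delta, nu) as a series in p; \<chi> does the same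
    for complex coefficients.\<close>
  define \<phi> where "\<phi> c = subst2 c D N" for c
  define \<chi> where "\<chi> c = subst2 c ?D ?N" for c :: "complex fps fps"
  have \<phi>h: "rhom \<phi>" unfolding rhom_def \<phi>_def by (simp add: subst2_add subst2_mult[OF DN] subst2_1[OF DN])
  have \<chi>h: "rhom \<chi>" unfolding rhom_def \<chi>_def by (simp add: subst2_add subst2_mult[OF DNc] subst2_1[OF DNc])
  have \<chi>cc: "\<chi> (cc c) = cc c" for c unfolding \<chi>_def by (rule subst2_cc[OF DNc])
  have \<chi>inj: "\<chi> x = \<chi> y \<Longrightarrow> x = y" for x y unfolding \<chi>_def by (rule cinj)
  have \<phi>inj: "\<phi> x = \<phi> y \<Longrightarrow> x = y" for x y unfolding \<phi>_def by (rule inj)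
  have "\<forall>t. \<exists>s. \<phi> s = t" using surj by (simp add: \<phi>_def)
  then obtain \<psi> where \<psi>: "\<And>t. \<phi> (\<psi> t) = t" by metis
  \<comment> \<open>By genericity \<phi> is bijective, so the expansion in the new parameters is
    found coefficient by coefficient.\<close>
  define S :: formal_map where "S = (cmap \<psi> (fst T), cmap \<psi> (snd T))"
  have ST: "cmap \<phi> (fst S) = fst T" "cmap \<phi> (snd S) = snd T" by (rule fps2_eqI; simp add: S_def \<psi>)+
  have cinjm: "cmap \<phi> X = cmap \<phi> Y \<Longrightarrow> X = Y" for X Y :: plane_series
    by (rule fps2_eqI) (metis cmap_nth \<phi>inj)
  have tp: "taylor_in_parameters F \<delta> \<nu> S"
    unfolding taylor_in_parameters_def
    using T DT NT D0 N0 by (intro exI[of _ T] exI[of _ D] exI[of _ N]) (auto simp: S_def \<psi>[unfolded \<phi>_def])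
  have "Cx (fst T) (snd T) $ 0 $ 0 = 0" using CT[of 0 0] n by simp
  then have "dge 1 (Cx (fst T) (snd T))" by (simp add: dge_1_iff)
  from Cx_dge[OF this] have T0: "fst T $ 0 $ 0 = 0" "snd T $ 0 $ 0 = 0" by (simp_all add: dge_1_iff)
  have Sc: "canon S" unfolding canon_def vanishes_at_origin_def
  proof (intro conjI)
    have "\<phi> (fst S $ 0 $ 0) = \<phi> 0" "\<phi> (snd S $ 0 $ 0) = \<phi> 0" using T0 by (simp_all add: S_def \<psi> rhomD(1)[OF \<phi>h])
    then show "fst S $ 0 $ 0 = 0" "snd S $ 0 $ 0 = 0" by (auto intro: \<phi>inj)
    show "br (fst S) (snd S) = 1"
      by (rule cinjm) (simp add: cmap_br[OF \<phi>h] ST jac rhomD(2)[OF rhom_cmap[OF \<phi>h]])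
  qed
  define CS where "CS = Cx (fst S) (snd S)"
  \<comment> \<open>The passage to z and w concerns the plane variables only and commutes with the
    change of parameters.\<close>
  have CS: "\<chi> (CS $ k $ l) = Cx (fst T) (snd T) $ k $ l" for k l
  proof -
    note hm = rhomD[OF rhom_cmap[OF \<chi>h]]
    have ckm: "cmap \<chi> (ck c) = ck c" for c unfolding ck_def cmap_vars(3)[OF \<chi>h] \<chi>cc ..
    have Zm: "cmap \<chi> ZX = ZX" "cmap \<chi> ZY = ZY"
      unfolding ZX_def ZY_def by (simp_all add: hm ckm cmap_vars(1,2)[OF \<chi>h])
    have "cmap \<chi> (cP G) = cP (cmap \<phi> G)" for G
      by (rule fps2_eqI) (simp add: cP_def \<chi>_def \<phi>_def cmap_subst2[OF rhom_of_real(1)])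
    then have tm: "cmap \<chi> (tau G) = tau (cmap \<phi> G)" for G
      unfolding tau_def cmap_subst2[OF \<chi>h] Zm by simp
    have "cmap \<chi> CS = Cx (fst T) (snd T)"
      unfolding CS_def Cx_def by (simp add: hm ckm tm ST)
    then show ?thesis by (metis cmap_nth)
  qed
  have \<chi>0: "\<chi> s $ 0 $ 0 = s $ 0 $ 0" for s by (simp add: \<chi>_def subst2_nth)
  \<comment> \<open>The series of cis (\<alpha>(0) - delta), which is the multiplier since
    \<alpha>(p) = \<alpha>(0) - delta(p).\<close>
  define E0 :: "complex fps fps" where "E0 = Abs_fps (\<lambda>m. fps_const (cis c0 * (- \<i>) ^ m / fact m))"
  have E0n: "E0 $ m $ j = (if j = 0 then cis c0 * (- \<i>) ^ m / fact m else 0)" for m j by (simp add: E0_def)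
  have E0d: "fps_deriv E0 = cc (- \<i>) * E0" "dY E0 = 0"
  proof -
    have "fps_deriv E0 $ m $ j = (cc (- \<i>) * E0) $ m $ j" for m j
    proof -
      have "of_nat (Suc m) \<noteq> (0::complex)" by (simp del: of_nat_Suc)
      then show ?thesis unfolding fps_deriv_nth2 cc_mult_nth E0n by (simp add: fact_Suc field_simps del: of_nat_Suc)
    qed
    then show "fps_deriv E0 = cc (- \<i>) * E0" by (rule fps2_eqI)
    show "dY E0 = 0" by (rule fps2_eqI) (simp add: dY_nth E0n)
  qed
  have CS10: "CS $ 1 $ 0 = E0"
  proof (rule \<chi>inj)
    have c10: "\<chi> (CS $ 1 $ 0) = ac 0" using CS[of 1 0] CT[of 1 0] n by simp
    have dd: "fps_deriv (cmap of_real Al) = - fps_deriv ?D" "dY (cmap of_real Al) = - dY ?D" unfolding cD by (simp_all add: dY_diff)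
    have ode1: "fps_deriv (ac 0) = cc (- \<i>) * fps_deriv ?D * ac 0" "dY (ac 0) = cc (- \<i>) * dY ?D * ac 0"
      using cis_series[OF TS_mono[OF Al2 r rle(3), folded lft_def] A0(2)]
      by (simp_all add: dd cc_minus)
    have ode2: "fps_deriv (\<chi> E0) = cc (- \<i>) * fps_deriv ?D * \<chi> E0" "dY (\<chi> E0) = cc (- \<i>) * dY ?D * \<chi> E0"
      unfolding \<chi>_def chain_rule[OF DNc] E0d by (simp_all add: subst2_mult[OF DNc] subst2_cc[OF DNc] mult_ac)
    \<comment> \<open>Both series solve the same linear equations driven by the derivatives of delta
      and have the same value at 0.\<close>
    have "ac 0 - \<chi> E0 = 0"
    proof (rule exp_ode_unique)
      show "fps_deriv (ac 0 - \<chi> E0) = cc (- \<i>) * fps_deriv ?D * (ac 0 - \<chi> E0)" by (simp add: ode1 ode2 algebra_simps)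
      show "dY (ac 0 - \<chi> E0) = cc (- \<i>) * dY ?D * (ac 0 - \<chi> E0)" by (simp add: dY_diff ode1 ode2 algebra_simps)
      show "(ac 0 - \<chi> E0) $ 0 $ 0 = 0" using TS_at_0[OF A0(1)] by (simp add: \<chi>0 E0n cc_nth c0_def)
    qed
    then show "\<chi> (CS $ 1 $ 0) = \<chi> E0" unfolding c10 by simp
  qed
  have mod1: "ac 0 * cmap cnj (ac 0) = 1"
  proof -
    have "TS (\<lambda>x y u v. cis (\<alpha> (u, v)) * cnj (cis (\<alpha> (u, v))) - 1) (cc (ac 0) * cmap (cmap cnj) (cc (ac 0)) - ck 1) r"
      by (intro TS_diff TS_mult TS_cnj A0(1) TS_vars(3)[OF r])
    from TS_zero[OF this] have "cc (ac 0 * cmap cnj (ac 0)) = 1" by (simp add: cis_cnj cis_mult ccnj cc_mult ck_hom)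
    then have "cc (ac 0 * cmap cnj (ac 0)) $ 0 $ 0 = 1" by (simp add: fps_one_nth)
    then show ?thesis by (simp add: cc_nth)
  qed
  have im: "ac 0 * cmap cnj (ac 1) + ac 1 * cmap cnj (ac 0) = 0"
  proof -
    have "Cx (fst T) (snd T) $ k $ l = 0" if "k + l \<le> 3" "k \<noteq> l + 1" for k l using CT[of k l] that n by auto
    from cubic_coefficient_imaginary[OF jac this] show ?thesis using CT[of 1 0] CT[of 2 1] n by simp
  qed
  \<comment> \<open>nu was defined as a real part; area preservation makes the whole expression
    real, so no information is lost and the coefficient of z^2 w is recovered from nu.\<close>
  have \<nu>N: "?N = \<nu>c"
  proof -
    have "cmap cnj \<nu>c = - cc \<i> * (cmap cnj (ac 1) * ac 0)"
    proof -
      have cn: "cmap cnj (cmap cnj A) = A" for A :: "complex fps fps" by (rule fps2_eqI) simp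
      show ?thesis unfolding \<nu>c_def by (simp add: rhomD[OF rhom_cmap[OF rhom_of_real(2)]] cn cmap_vars[OF rhom_of_real(2)] cc_minus mult.assoc)
    qed
    moreover have "cmap cnj (ac 1) * ac 0 = - (ac 1 * cmap cnj (ac 0))" using im by (simp add: eq_neg_iff_add_eq_0 mult.commute)
    ultimately have "cmap cnj \<nu>c = \<nu>c" by (simp add: \<nu>c_def mult.assoc)
    then have "?N $ i $ j = \<nu>c $ i $ j" for i j unfolding cN by simp
    then show ?thesis by (rule fps2_eqI)
  qed
  have CS21: "CS $ 2 $ 1 = cc (- \<i>) * yy * E0"
  proof (rule \<chi>inj)
    have c1: "\<chi> (CS $ 2 $ 1) = ac 1" using CS[of 2 1] CT[of 2 1] n by simp
    have c0': "\<chi> E0 = ac 0" using CS[of 1 0] CT[of 1 0] n CS10 by simp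
    have "\<chi> (cc (- \<i>) * yy * E0) = cc (- \<i>) * ?N * ac 0"
      unfolding rhomD(4)[OF \<chi>h] \<chi>cc c0' by (simp add: \<chi>_def subst2_Y[OF DNc])
    also have "\<dots> = (cc (- \<i>) * cc \<i>) * ac 1 * (ac 0 * cmap cnj (ac 0))" unfolding \<nu>N \<nu>c_def by (simp add: mult_ac)
    also have "cc (- \<i>) * cc \<i> = 1" by (simp flip: cc_mult)
    finally show "\<chi> (CS $ 2 $ 1) = \<chi> (cc (- \<i>) * yy * E0)" unfolding c1 mod1 by simp
  qed
  have z: "\<chi> s = 0 \<Longrightarrow> s = 0" for s using \<chi>inj[of s 0] rhomD(1)[OF \<chi>h] by simp
  have "\<exists>!(A, B). normal_form_coeffs n A B \<and> B $ 0 $ 0 $ 0 > 0 \<and>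
       (\<exists>\<Phi>. formal_ham_flow (normal_form_ham n A B) \<Phi> \<and> formally_conjugate S (fcompose (rot c0) (\<Phi> 1)))"
  proof (rule formal_main[OF n _ _ Sc, folded CS_def])
    show "cis c0 ^ n = 1" using resonance by (simp add: c0_def)
    show "cis c0 ^ k \<noteq> 1" if "1 \<le> k" "k < n" for k using resonance_order that by (simp add: c0_def)
    show "CS $ k $ l = 0" if "k + l \<le> n" "k \<noteq> l + 1" "(k, l) \<noteq> (0, n - 1)" for k l
      by (rule z) (use CS[of k l] CT[of k l] that in auto)
    show "CS $ 1 $ 0 $ m $ j = (if j = 0 then cis c0 * (- \<i>) ^ m / fact m else 0)" for m j unfolding CS10 E0n ..
    show "CS $ 2 $ 1 $ m $ j = (if j = 1 then cis c0 * (- \<i>) ^ Suc m / fact m else 0)" for m j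
    proof -
      have "(yy * E0) $ m $ j = (if j = 0 then 0 else E0 $ m $ (j - 1))" by (cases j) (simp_all add: yy_def)
      then show ?thesis unfolding CS21 mult.assoc cc_mult_nth by (auto simp: E0n)
    qed
    show "CS $ 3 $ 2 $ 0 $ 0 \<noteq> 0" if "6 \<le> n"
    proof -
      have "CS $ 3 $ 2 $ 0 $ 0 = coeff (a (0, 0)) 2" using \<chi>0[of "CS $ 3 $ 2"] CS[of 3 2] CT[of 3 2] that TS_at_0[OF ac(1)[of 2]] by (simp add: cc_nth)
      then show ?thesis using a''_nonzero unfolding poly_pderiv_0(2) by simp
    qed
    show "CS $ 0 $ (n - 1) $ 0 $ 0 \<noteq> 0"
    proof -
      have "CS $ 0 $ (n - 1) $ 0 $ 0 = coeff (b (0, 0)) 0" using \<chi>0[of "CS $ 0 $ (n - 1)"] CS[of 0 "n - 1"] CT[of 0 "n - 1"] TS_at_0[OF bc[of 0]] by (simp add: cc_nth)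
      then show ?thesis using b_nonzero by (simp add: poly_0_coeff_0)
    qed
  qed
  with tp show ?thesis unfolding c0_def by blast
qed

end
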